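(* Given a finite set $\mathcal{I}$ of intervals with orientations $o$ and a positive integer $k$, it is NP-hard to decide whether $\chi(\mathcal{B}[\mathcal{I},o])\le k$.
   Context: Let $\mathcal{I}$ be a finite set of intervals on the real line and $o$ a function assigning to each interval an orientation, left-going or right-going. Two intervals overlap if they intersect but neither contains the other. The bidirectional interval graph $\mathcal{B}[\mathcal{I},o]$ is the mixed graph with vertex set $\mathcal{I}$ in which, for every pair of distinct intersecting intervals $u,v$: if $u,v$ overlap and are both left-going, there is an arc directed towards the one of them lying further to the right (as in directional interval graphs, where overlapping intervals get an arc oriented towards the right interval); if $u,v$ overlap and are both right-going, there is an arc directed symmetrically, i.e. towards the one lying further to the left; in all other cases (one contains the other, or their orientations differ) there is an undirected edge $\{u,v\}$. Non-intersecting intervals are non-adjacent. A proper coloring of a mixed graph $G$ is a function $f\colon V(G)\to\mathbb{N}$ such that $f(u)\neq f(v)$ for every edge $\{u,v\}$ and $f(u)<f(v)$ for every arc $(u,v)$. $\chi(G)$ is the minimum number of colors in a proper coloring of $G$. *)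

theory Defs
  imports Complex_Main "HOL-Library.Extended_Nat" "HOL-Computational_Algebra.Polynomial"
begin

section \<open>Mixed graphs and bidirectional interval graphs\<close>

record 'a mixed_graph =
  verts :: "'a set"
  edges :: "'a set set"
  arcs :: "('a \<times> 'a) set"

definition proper_coloring :: "'a mixed_graph \<Rightarrow> ('a \<Rightarrow> nat) \<Rightarrow> bool" where
  "proper_coloring G f \<longleftrightarrow>
     (\<forall>u v. {u, v} \<in> edges G \<longrightarrow> f u \<noteq> f v) \<and> (\<forall>(u, v) \<in> arcs G. f u < f v)"

text \<open>The value is \<open>\<infinity>\<close> if there is no proper coloring, i.e. if the arcs contain a directed cycle;
  this does not happen for bidirectional interval graphs.\<close>

definition chromatic_number :: "'a mixed_graph \<Rightarrow> enat" where
  "chromatic_number G = Inf {enat (card (f ` verts G)) | f. proper_coloring G f}"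

datatype orientation = Left_going | Right_going

definition overlap :: "real set \<Rightarrow> real set \<Rightarrow> bool" where
  "overlap u v \<longleftrightarrow> u \<inter> v \<noteq> {} \<and> \<not> u \<subseteq> v \<and> \<not> v \<subseteq> u"

text \<open>For overlapping closed intervals the order of the left endpoints, which is also the order of
  the right endpoints, tells which interval lies further to the right.\<close>

definition bidirectional_interval_graph ::
    "real set set \<Rightarrow> (real set \<Rightarrow> orientation) \<Rightarrow> real set mixed_graph" where
  "bidirectional_interval_graph I ori =
    \<lparr> verts = I,
      edges = {{u, v} | u v. u \<in> I \<and> v \<in> I \<and> u \<noteq> v \<and> u \<inter> v \<noteq> {} \<and>
                 \<not> (overlap u v \<and> ori u = ori v)},
      arcs = {(u, v). u \<in> I \<and> v \<in> I \<and> overlap u v \<and>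
                ori u = Left_going \<and> ori v = Left_going \<and> Inf u < Inf v}
           \<union> {(u, v). u \<in> I \<and> v \<in> I \<and> overlap u v \<and>
                ori u = Right_going \<and> ori v = Right_going \<and> Inf v < Inf u} \<rparr>"


section \<open>Deterministic multi-tape Turing machines\<close>

text \<open>A machine has two-way infinite tapes numbered \<open>0..<ntapes\<close>; tape 0 is the input tape and
  tape 1 the output tape. Its states are \<open>0..nstates\<close>, where 0 is the initial state and
  \<open>nstates\<close> the unique halting state. Its tape symbols are \<open>0..<nsymbols\<close>, where 0 is the blank
  and 1, 2 stand for the bits \<open>False\<close>, \<open>True\<close>.\<close>

datatype move = Move_Left | Stay | Move_Right

record tm =
  ntapes :: nat
  nstates :: nat
  nsymbols :: nat
  trans :: "nat \<Rightarrow> nat list \<Rightarrow> nat \<times> (nat \<times> move) list"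

definition wf_tm :: "tm \<Rightarrow> bool" where
  "wf_tm M \<longleftrightarrow> 2 \<le> ntapes M \<and> 3 \<le> nsymbols M \<and>
     (\<forall>q < nstates M. \<forall>ss. length ss = ntapes M \<and> set ss \<subseteq> {..<nsymbols M} \<longrightarrow>
        fst (trans M q ss) \<le> nstates M \<and>
        length (snd (trans M q ss)) = ntapes M \<and>
        fst ` set (snd (trans M q ss)) \<subseteq> {..<nsymbols M})"

record config =
  state :: nat
  content :: "nat \<Rightarrow> int \<Rightarrow> nat"
  head :: "nat \<Rightarrow> int"

fun shift :: "move \<Rightarrow> int" where
  "shift Move_Left = - 1"
| "shift Stay = 0"
| "shift Move_Right = 1"

definition step :: "tm \<Rightarrow> config \<Rightarrow> config" where
  "step M c =
    (if state c = nstates M then c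
     else let (q, as) = trans M (state c) (map (\<lambda>i. content c i (head c i)) [0..<ntapes M])
       in \<lparr> state = q,
            content = (\<lambda>i. if i < ntapes M then (content c i)(head c i := fst (as ! i))
                           else content c i),
            head = (\<lambda>i. if i < ntapes M then head c i + shift (snd (as ! i)) else head c i) \<rparr>)"

definition word_tape :: "bool list \<Rightarrow> int \<Rightarrow> nat" where
  "word_tape w z = (if 0 \<le> z \<and> z < int (length w) then if w ! nat z then 2 else 1 else 0)"

definition init_config :: "bool list \<Rightarrow> config" where
  "init_config w =
    \<lparr> state = 0, content = (\<lambda>i. word_tape (if i = 0 then w else [])), head = (\<lambda>_. 0) \<rparr>"

text \<open>Halting configurations are fixed points of \<^term>\<open>step M\<close>, so running for exactly \<open>t\<close> steps
  amounts to halting within \<open>t\<close> steps.\<close>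

definition outputs_within :: "tm \<Rightarrow> bool list \<Rightarrow> nat \<Rightarrow> bool list \<Rightarrow> bool" where
  "outputs_within M w t y \<longleftrightarrow>
    (let c = (step M ^^ t) (init_config w) in state c = nstates M \<and> content c 1 = word_tape y)"


section \<open>Polynomial time, NP and NP-hardness\<close>

definition poly_time :: "(bool list \<Rightarrow> bool list) \<Rightarrow> bool" where
  "poly_time f \<longleftrightarrow>
    (\<exists>M (p :: nat poly). wf_tm M \<and> (\<forall>w. outputs_within M w (poly p (length w)) (f w)))"

definition class_P :: "bool list set set" where
  "class_P = {L. poly_time (\<lambda>w. [w \<in> L])}"

text \<open>A self-delimiting code for words, so that it can be followed by arbitrary further data.\<close>

definition enc_word :: "bool list \<Rightarrow> bool list" where
  "enc_word w = concat (map (\<lambda>b. [True, b]) w) @ [False]"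

definition class_NP :: "bool list set set" where
  "class_NP = {L. \<exists>V \<in> class_P. \<exists>p :: nat poly. \<forall>x.
     x \<in> L \<longleftrightarrow> (\<exists>w. length w \<le> poly p (length x) \<and> enc_word x @ w \<in> V)}"

definition poly_reducible :: "bool list set \<Rightarrow> bool list set \<Rightarrow> bool" where
  "poly_reducible A B \<longleftrightarrow> (\<exists>f. poly_time f \<and> (\<forall>x. x \<in> A \<longleftrightarrow> f x \<in> B))"

definition NP_hard :: "bool list set \<Rightarrow> bool" where
  "NP_hard L \<longleftrightarrow> (\<forall>A \<in> class_NP. poly_reducible A L)"


section \<open>Binary encoding of problem instances\<close>

text \<open>Binary representation, least significant bit first, without leading zeros.\<close>

fun bits_of_nat :: "nat \<Rightarrow> bool list" where
  "bits_of_nat n = (if n = 0 then [] else odd n # bits_of_nat (n div 2))"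

declare bits_of_nat.simps [simp del]

definition enc_nat :: "nat \<Rightarrow> bool list" where
  "enc_nat n = enc_word (bits_of_nat n)"

definition enc_int :: "int \<Rightarrow> bool list" where
  "enc_int i = (i < 0) # enc_nat (nat \<bar>i\<bar>)"

definition enc_rat :: "rat \<Rightarrow> bool list" where
  "enc_rat x = (case quotient_of x of (a, b) \<Rightarrow> enc_int a @ enc_int b)"

definition enc_list :: "('a \<Rightarrow> bool list) \<Rightarrow> 'a list \<Rightarrow> bool list" where
  "enc_list e xs = concat (map (\<lambda>x. True # e x) xs) @ [False]"

fun interval_of :: "rat \<times> rat \<Rightarrow> real set" where
  "interval_of (l, r) = {real_of_rat l .. real_of_rat r}"

text \<open>An instance consists of a finite set of non-degenerate closed intervals with rational
  endpoints, enumerated without repetition by a list of endpoint pairs, an orientation of these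
  intervals, and a number \<open>k\<close>.\<close>

definition valid_intervals :: "(rat \<times> rat) list \<Rightarrow> bool" where
  "valid_intervals xs \<longleftrightarrow> distinct xs \<and> (\<forall>(l, r) \<in> set xs. l < r)"

definition enc_instance ::
    "(rat \<times> rat) list \<Rightarrow> (real set \<Rightarrow> orientation) \<Rightarrow> nat \<Rightarrow> bool list" where
  "enc_instance xs ori k =
    enc_nat k @
    enc_list (\<lambda>(l, r). enc_rat l @ enc_rat r @ [ori (interval_of (l, r)) = Right_going]) xs"

lemma enc_word_append_eq: "enc_word v @ s = enc_word w @ t \<longleftrightarrow> v = w \<and> s = t"
proof (induction v arbitrary: w)
  case Nil
  show ?case by (cases w) (auto simp: enc_word_def)
next
  case (Cons b v)
  then show ?case by (cases w) (auto simp: enc_word_def)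
qed

lemma bits_of_nat_inject: "bits_of_nat m = bits_of_nat n \<longleftrightarrow> m = n"
proof (induction m arbitrary: n rule: less_induct)
  case (less m)
  show ?case
  proof (cases "m = 0 \<or> n = 0")
    case True
    then show ?thesis
      by (auto simp: bits_of_nat.simps[of m] bits_of_nat.simps[of n] bits_of_nat.simps[of 0])
  next
    case False
    then have "bits_of_nat m = bits_of_nat n \<longleftrightarrow> odd m = odd n \<and> m div 2 = n div 2"
      using less[of "m div 2" "n div 2"] by (subst (1 2) bits_of_nat.simps) simp
    also have "\<dots> \<longleftrightarrow> m = n" by presburger
    finally show ?thesis .
  qed
qed

lemma enc_nat_append_eq: "enc_nat m @ s = enc_nat n @ t \<longleftrightarrow> m = n \<and> s = t"
  by (simp add: enc_nat_def enc_word_append_eq bits_of_nat_inject)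

lemma enc_int_append_eq: "enc_int m @ s = enc_int n @ t \<longleftrightarrow> m = n \<and> s = t"
  by (auto simp: enc_int_def enc_nat_append_eq)

lemma enc_rat_append_eq: "enc_rat x @ s = enc_rat y @ t \<longleftrightarrow> x = y \<and> s = t"
  using quotient_of_inject[of x y]
  by (auto simp: enc_rat_def enc_int_append_eq split: prod.splits)

text \<open>Every code word determines the intervals, their orientations and \<open>k\<close>.\<close>

lemma enc_instance_inject:
  "enc_instance xs ori k = enc_instance ys ori' k' \<longleftrightarrow>
     k = k' \<and> xs = ys \<and> (\<forall>p \<in> set xs. ori (interval_of p) = ori' (interval_of p))"
proof -
  have flag: "(a = Right_going) = (b = Right_going) \<longleftrightarrow> a = b" for a b
    by (cases a; cases b) auto
  have "enc_list (\<lambda>(l, r). enc_rat l @ enc_rat r @ [ori (interval_of (l, r)) = Right_going]) xs =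
        enc_list (\<lambda>(l, r). enc_rat l @ enc_rat r @ [ori' (interval_of (l, r)) = Right_going]) ys \<longleftrightarrow>
        xs = ys \<and> (\<forall>p \<in> set xs. ori (interval_of p) = ori' (interval_of p))"
  proof (induction xs arbitrary: ys)
    case Nil
    show ?case by (cases ys) (auto simp: enc_list_def)
  next
    case (Cons p xs)
    show ?case
    proof (cases ys)
      case Nil
      then show ?thesis by (auto simp: enc_list_def)
    next
      case (Cons p' ys')
      then show ?thesis using Cons.IH[of ys']
        by (cases p; cases p') (auto simp: enc_list_def enc_rat_append_eq flag)
    qed
  qed
  then show ?thesis by (simp add: enc_instance_def enc_nat_append_eq)
qed

end

theory Submission
  imports Defs "HOL-Combinatorics.Transposition"
begin

text \<open>
  Colour \<open>k\<close> intervals per round, where round \<open>r\<close> is left-going for even \<open>r\<close> and right-going for odd \<open>r\<close>, such that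
  at every time exactly \<open>k\<close> intervals are alive. With \<open>k\<close> colours, an interval of round \<open>r + 1\<close> takes over the colour
  of an interval of round \<open>r\<close> that has just ended, so a colouring transports a permutation from round to round. Letting the
  intervals of two adjacent positions overlap instead of being nested forces an order of their colours, and letting them
  end simultaneously allows their colours to be exchanged. Hence a colouring with \<open>k\<close> colours is a run of a
  program of \<^emph>\<open>tests\<close> (two adjacent entries are in descending order; exchange them) and \<^emph>\<open>free\<close> steps
  (exchange two adjacent entries or not), starting from the identity permutation.

  Two adjacent entries carry a bit, which is on if they are exchanged. From tests and free steps one builds gates that
  compute AND, OR, swaps and a nondeterministic split of bits, where a run may always turn bits off. This
  one-sided error is harmless since all gates are monotone, and it suffices to guess and verify a tiling
  row by row, each tile being encoded in unary. Tilings in turn describe the computations of a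
  polynomial-time verifier. Finally, the interval endpoints are chosen such that their binary
  representations are concatenations of one-hot fields, which a Turing machine can write in polynomial time.
\<close>

section \<open>Gates from comparisons and optional swaps\<close>

text \<open>The orientations alternate because intervals of different orientation are joined by a
  plain edge even when they overlap. The overlaps between adjacent rounds then impose no order, and
  two different rounds of equal orientation never meet. The starting and the ending order of a round
  run in opposite directions, so its intervals are nested unless an operation changes that. Round 0
  is the exception: all its intervals overlap, which orders its colours completely and so fixes the
  initial permutation. That a colour stays within the pair of an operation is a counting argument:
  with as many colours as live intervals, inheritance of colours is a bijection between rounds, and
  an interval can only inherit from one that has already ended. A test accepts a bit that is on and
  switches it off in passing, so a single bit cannot be inspected in isolation. Gates are therefore
  programs on the four entries of two neighbouring bits, and their behaviour is established by
  exhaustive evaluation. Since rows may lose bits, and the soundness argument starts from arbitrary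
  bit sets, the tiles cannot be assumed to be one-hot there; a token in each window keeps the
  outputs of different rules from mixing.\<close>

datatype opk = Nop | Free | Test

definition swp :: "nat \<Rightarrow> (nat \<Rightarrow> nat) \<Rightarrow> nat \<Rightarrow> nat" where
  "swp q v = v(q := v (Suc q), Suc q := v q)"

fun ostep :: "opk \<times> nat \<Rightarrow> (nat \<Rightarrow> nat) \<Rightarrow> (nat \<Rightarrow> nat) \<Rightarrow> bool" where
  "ostep (Nop, q) v v' \<longleftrightarrow> v' = v"
| "ostep (Free, q) v v' \<longleftrightarrow> v' = v \<or> v' = swp q v"
| "ostep (Test, q) v v' \<longleftrightarrow> v (Suc q) < v q \<and> v' = swp q v"

fun run :: "(opk \<times> nat) list \<Rightarrow> (nat \<Rightarrow> nat) \<Rightarrow> (nat \<Rightarrow> nat) \<Rightarrow> bool" where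
  "run [] v v' \<longleftrightarrow> v' = v"
| "run (x # xs) v v' \<longleftrightarrow> (\<exists>u. ostep x v u \<and> run xs u v')"

lemma run_append: "run (xs @ ys) v v' \<longleftrightarrow> (\<exists>u. run xs v u \<and> run ys u v')"
  by (induction xs arbitrary: v) auto

definition enc :: "nat set \<Rightarrow> nat \<Rightarrow> nat" where
  "enc A i = (if i div 2 \<in> A then (if even i then Suc i else i - 1) else i)"

text \<open>An executable copy of \<open>ostep\<close> on the list of the four entries that carry
  two adjacent bits. Together with \<open>erun\<close>, which collects all reachable lists, it turns
  the behaviour of a gate into a finite computation.\<close>

fun estep :: "opk \<times> nat \<Rightarrow> nat list \<Rightarrow> nat list list" where
  "estep (Nop, q) l = [l]"
| "estep (Free, q) l = [l, l[q := l ! Suc q, Suc q := l ! q]]"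
| "estep (Test, q) l = (if l ! Suc q < l ! q then [l[q := l ! Suc q, Suc q := l ! q]] else [])"

fun erun :: "(opk \<times> nat) list \<Rightarrow> nat list list \<Rightarrow> nat list list" where
  "erun [] S = S"
| "erun (x # xs) S = erun xs (remdups (concat (map (estep x) S)))"

text \<open>The offset \<open>s\<close> shifts the values as well as the positions, because
  \<open>enc\<close> maps the four entries of two adjacent bits onto themselves. Comparisons do not
  notice the shift.\<close>

definition emb :: "nat \<Rightarrow> nat list \<Rightarrow> (nat \<Rightarrow> nat) \<Rightarrow> nat \<Rightarrow> nat" where
  "emb s l v i = (if s \<le> i \<and> i < s + 4 then s + l ! (i - s) else v i)"

lemma swp_emb:
  assumes "length l = 4" "q < 3"
  shows "swp (s + q) (emb s l v) = emb s (l[q := l ! Suc q, Suc q := l ! q]) v"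
proof
  fix i
  consider "i < s \<or> i \<ge> s + 4" | "i = s" | "i = s + 1" | "i = s + 2" | "i = s + 3" by linarith
  then show "swp (s + q) (emb s l v) i = emb s (l[q := l ! Suc q, Suc q := l ! q]) v i"
    using assms by cases (auto simp: swp_def emb_def nth_list_update)
qed

lemma ostep_emb:
  assumes "length l = 4" "q < 3"
  shows "ostep (k, s + q) (emb s l v) v' \<longleftrightarrow> (\<exists>l' \<in> set (estep (k, q) l). v' = emb s l' v)"
proof -
  have "emb s l v (s + q) = s + l ! q" "emb s l v (Suc (s + q)) = s + l ! Suc q"
    using assms by (auto simp: emb_def)
  then show ?thesis
    using swp_emb[OF assms] by (cases k) auto
qed

lemma length_estep: "l' \<in> set (estep x l) \<Longrightarrow> length l' = length l"
  by (cases "(x, l)" rule: estep.cases) (auto split: if_splits)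

lemma run_emb:
  assumes "\<forall>x \<in> set xs. snd x < 3" "\<forall>l \<in> set S. length l = 4"
  shows "(\<exists>l \<in> set S. run (map (\<lambda>(k, q). (k, s + q)) xs) (emb s l v) v') \<longleftrightarrow>
         (\<exists>l' \<in> set (erun xs S). v' = emb s l' v)"
  using assms
proof (induction xs arbitrary: S)
  case Nil
  then show ?case by auto
next
  case (Cons x xs)
  obtain k q where x: "x = (k, q)" by (cases x)
  let ?S = "remdups (concat (map (estep x) S))"
  have len: "\<forall>l \<in> set ?S. length l = 4"
    using Cons.prems length_estep by fastforce
  have "(\<exists>l \<in> set S. run (map (\<lambda>(k, q). (k, s + q)) (x # xs)) (emb s l v) v') \<longleftrightarrow>
     (\<exists>l \<in> set S. \<exists>l' \<in> set (estep x l). run (map (\<lambda>(k, q). (k, s + q)) xs) (emb s l' v) v')"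
    using Cons.prems x by (auto simp: ostep_emb)
  also have "\<dots> \<longleftrightarrow> (\<exists>l \<in> set ?S. run (map (\<lambda>(k, q). (k, s + q)) xs) (emb s l v) v')"
    by auto
  finally show ?case using Cons.IH[OF _ len] Cons.prems by simp
qed

definition bits4 :: "bool \<Rightarrow> bool \<Rightarrow> nat list" where
  "bits4 a b = (if a then [1, 0] else [0, 1]) @ (if b then [3, 2] else [2, 3])"

definition upd2 :: "nat set \<Rightarrow> nat \<Rightarrow> bool \<Rightarrow> bool \<Rightarrow> nat set" where
  "upd2 A i a b = {x. if x = i then a else if x = Suc i then b else x \<in> A}"

lemma emb_enc: "emb (2 * i) (bits4 a b) (enc A) = enc (upd2 A i a b)"
proof
  fix x
  consider "x < 2 * i \<or> x \<ge> 2 * i + 4" | "x = 2 * i" | "x = 2 * i + 1" | "x = 2 * i + 2" | "x = 2 * i + 3"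
    by linarith
  then show "emb (2 * i) (bits4 a b) (enc A) x = enc (upd2 A i a b) x"
  proof cases
    case 1
    then have "x div 2 \<noteq> i \<and> x div 2 \<noteq> Suc i" by linarith
    then show ?thesis using 1 by (auto simp: emb_def enc_def upd2_def)
  qed (cases a; cases b; simp add: emb_def enc_def upd2_def bits4_def nth_Cons')+
qed

lemma upd2_same: "upd2 A i (i \<in> A) (Suc i \<in> A) = A"
  by (auto simp: upd2_def)

text \<open>Lifts an evaluation on one block of four entries to every block \<open>i\<close> of
  every bit set \<open>A\<close>. The relation \<open>R\<close> gives the possible values of the two
  bits after the gate.\<close>

lemma run_gate:
  assumes "\<forall>x \<in> set xs. snd x < 3"
    and R: "\<And>a b. set (erun xs [bits4 a b]) = (\<lambda>(a, b). bits4 a b) ` R a b"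
  shows "run (map (\<lambda>(k, q). (k, 2 * i + q)) xs) (enc A) v' \<longleftrightarrow>
     (\<exists>(a, b) \<in> R (i \<in> A) (Suc i \<in> A). v' = enc (upd2 A i a b))"
proof -
  have "enc A = emb (2 * i) (bits4 (i \<in> A) (Suc i \<in> A)) (enc A)"
    by (simp add: emb_enc upd2_same)
  then have "run (map (\<lambda>(k, q). (k, 2 * i + q)) xs) (enc A) v' \<longleftrightarrow>
      (\<exists>l \<in> set [bits4 (i \<in> A) (Suc i \<in> A)].
          run (map (\<lambda>(k, q). (k, 2 * i + q)) xs) (emb (2 * i) l (enc A)) v')"
    by simp
  also have "\<dots> \<longleftrightarrow> (\<exists>l' \<in> set (erun xs [bits4 (i \<in> A) (Suc i \<in> A)]). v' = emb (2 * i) l' (enc A))"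
    by (rule run_emb) (use assms(1) in \<open>auto simp: bits4_def\<close>)
  finally show ?thesis by (simp add: R case_prod_beta emb_enc)
qed

text \<open>The gates are explicit witnesses. What is used of them is only that their positions are
  below 3 and which outputs each of the four inputs admits; the latter is computed by
  \<open>erun_and\<close>, \<open>erun_or\<close>, \<open>erun_split\<close> and
  \<open>erun_swap\<close>.\<close>

definition gate_and :: "(opk \<times> nat) list" where
  "gate_and = [(Free,1),(Free,0),(Test,1),(Free,2),(Test,2),(Free,1),(Free,0),(Test,0),(Free,1),(Test,1)]"

definition gate_or :: "(opk \<times> nat) list" where
  "gate_or = [(Free,1),(Free,0),(Free,2),(Test,1),(Free,0),(Free,1),(Test,0),(Free,2),(Free,1),
     (Test,2),(Free,1),(Test,1)]"

definition gate_split :: "(opk \<times> nat) list" where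
  "gate_split = [(Free,1),(Free,2),(Free,1),(Free,0),(Test,1),(Free,0),(Test,0),(Free,2),(Test,2),(Test,1)]"

definition gate_swap :: "(opk \<times> nat) list" where
  "gate_swap = [(Free,1),(Free,0),(Free,2),(Free,1),(Test,0),(Free,1),(Test,1),(Free,2),(Free,1),
     (Test,2),(Free,1),(Free,2),(Test,1),(Free,1),(Test,0),(Free,1),(Free,2),(Test,2),(Test,1)]"

text \<open>Closing the set of outputs downwards expresses that a run of a gate may lose
  bits.\<close>

definition below :: "bool \<times> bool \<Rightarrow> (bool \<times> bool) set" where
  "below p = {q. (fst q \<longrightarrow> fst p) \<and> (snd q \<longrightarrow> snd p)}"

lemma below_code: "below (a, b) = {(a', b') \<in> {(False,False),(False,True),(True,False),(True,True)}. (a' \<longrightarrow> a) \<and> (b' \<longrightarrow> b)}"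
  by (auto simp: below_def)

lemma erun_and: "set (erun gate_and [bits4 a b]) = (\<lambda>(a, b). bits4 a b) ` below (a, a \<and> b)"
proof -
  have *: "set (erun gate_and [bits4 False False]) = {bits4 False False}"
     "set (erun gate_and [bits4 False True]) = {bits4 False False}"
     "set (erun gate_and [bits4 True False]) = {bits4 False False, bits4 True False}"
     "set (erun gate_and [bits4 True True]) =
        {bits4 False False, bits4 False True, bits4 True False, bits4 True True}"
    by code_simp+
  show ?thesis by (cases a; cases b) (auto simp: * below_code)
qed

lemma erun_or: "set (erun gate_or [bits4 a b]) = (\<lambda>(a, b). bits4 a b) ` below (a, a \<or> b)"
proof -
  have *: "set (erun gate_or [bits4 False False]) = {bits4 False False}"
     "set (erun gate_or [bits4 False True]) = {bits4 False False, bits4 False True}"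
     "set (erun gate_or [bits4 True False]) =
        {bits4 False False, bits4 False True, bits4 True False, bits4 True True}"
     "set (erun gate_or [bits4 True True]) =
        {bits4 False False, bits4 False True, bits4 True False, bits4 True True}"
    by code_simp+
  show ?thesis by (cases a; cases b) (auto simp: * below_code)
qed

lemma erun_split: "set (erun gate_split [bits4 a b]) = (\<lambda>(a, b). bits4 a b) ` (below (a, False) \<union> below (False, a))"
proof -
  have *: "set (erun gate_split [bits4 False False]) = {bits4 False False}"
     "set (erun gate_split [bits4 False True]) = {bits4 False False}"
     "set (erun gate_split [bits4 True False]) =
        {bits4 False False, bits4 False True, bits4 True False}"
     "set (erun gate_split [bits4 True True]) =
        {bits4 False False, bits4 False True, bits4 True False}"
    by code_simp+
  show ?thesis by (cases a; cases b) (auto simp: * below_code)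
qed

lemma erun_swap: "set (erun gate_swap [bits4 a b]) = (\<lambda>(a, b). bits4 a b) ` below (b, a)"
proof -
  have *: "set (erun gate_swap [bits4 False False]) = {bits4 False False}"
     "set (erun gate_swap [bits4 False True]) = {bits4 False False, bits4 True False}"
     "set (erun gate_swap [bits4 True False]) = {bits4 False False, bits4 False True}"
     "set (erun gate_swap [bits4 True True]) =
        {bits4 False False, bits4 False True, bits4 True False, bits4 True True}"
    by code_simp+
  show ?thesis by (cases a; cases b) (auto simp: * below_code)
qed


text \<open>An asymmetric contract: completeness is exact, whereas soundness only says that the
  final bits are contained in an intended output. It also guarantees that a run never leaves the
  permutations of the form \<open>enc A'\<close>, although intermediate states of a gate do.\<close>

definition realized :: "nat \<Rightarrow> (nat set \<Rightarrow> nat set set) \<Rightarrow> (opk \<times> nat) list \<Rightarrow> bool" where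
  "realized m R \<Omega> \<longleftrightarrow> (\<forall>x \<in> set \<Omega>. Suc (snd x) < 2 * m) \<and>
     (\<forall>A v'. run \<Omega> (enc A) v' \<longrightarrow> (\<exists>A' B. v' = enc A' \<and> B \<in> R A \<and> A' \<subseteq> B)) \<and>
     (\<forall>A. \<forall>B \<in> R A. run \<Omega> (enc A) (enc B))"

definition realizable :: "nat \<Rightarrow> (nat set \<Rightarrow> nat set set) \<Rightarrow> bool" where
  "realizable m R \<longleftrightarrow> (\<exists>\<Omega>. realized m R \<Omega>)"

definition monotonic :: "(nat set \<Rightarrow> nat set set) \<Rightarrow> bool" where
  "monotonic R \<longleftrightarrow> (\<forall>A A' B. A \<subseteq> A' \<and> B \<in> R A \<longrightarrow> (\<exists>B' \<in> R A'. B \<subseteq> B'))"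

definition rcomp :: "(nat set \<Rightarrow> nat set set) \<Rightarrow> (nat set \<Rightarrow> nat set set) \<Rightarrow> nat set \<Rightarrow> nat set set" where
  "rcomp R S A = (\<Union>B \<in> R A. S B)"

lemma monotonic_rcomp: "monotonic R \<Longrightarrow> monotonic S \<Longrightarrow> monotonic (rcomp R S)"
  unfolding monotonic_def rcomp_def
proof (intro allI impI)
  fix A A' B
  assume *: "\<forall>A A' B. A \<subseteq> A' \<and> B \<in> R A \<longrightarrow> (\<exists>B' \<in> R A'. B \<subseteq> B')"
    "\<forall>A A' B. A \<subseteq> A' \<and> B \<in> S A \<longrightarrow> (\<exists>B' \<in> S A'. B \<subseteq> B')"
    and "A \<subseteq> A' \<and> B \<in> (\<Union>B \<in> R A. S B)"
  then obtain C where C: "A \<subseteq> A'" "C \<in> R A" "B \<in> S C" by auto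
  obtain C' where C': "C' \<in> R A'" "C \<subseteq> C'" using *(1) C(1,2) by meson
  obtain B' where "B' \<in> S C'" "B \<subseteq> B'" using *(2) C(3) C'(2) by meson
  then show "\<exists>B' \<in> \<Union>B \<in> R A'. S B. B \<subseteq> B'" using C'(1) by auto
qed

text \<open>The first program may hand over fewer bits than intended. Monotonicity of the second
  relation turns an output computed from the smaller set into part of an output from the intended
  one, so losses do not accumulate into wrong results.\<close>

lemma realized_rcomp:
  assumes "realized m R \<Omega>" "realized m S \<Omega>'" "monotonic S"
  shows "realized m (rcomp R S) (\<Omega> @ \<Omega>')"
  unfolding realized_def
proof (intro conjI allI impI ballI)
  fix x assume "x \<in> set (\<Omega> @ \<Omega>')"
  then show "Suc (snd x) < 2 * m" using assms unfolding realized_def by auto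
next
  fix A v' assume "run (\<Omega> @ \<Omega>') (enc A) v'"
  then obtain u where u: "run \<Omega> (enc A) u" "run \<Omega>' u v'" by (auto simp: run_append)
  obtain A' B where 1: "u = enc A'" "B \<in> R A" "A' \<subseteq> B"
    using u(1) assms(1) unfolding realized_def by meson
  obtain A'' B' where 2: "v' = enc A''" "B' \<in> S A'" "A'' \<subseteq> B'"
    using u(2) assms(2) unfolding realized_def 1(1) by meson
  obtain B'' where "B'' \<in> S B" "B' \<subseteq> B''"
    using assms(3) 1(3) 2(2) unfolding monotonic_def by meson
  then show "\<exists>A' B. v' = enc A' \<and> B \<in> rcomp R S A \<and> A' \<subseteq> B"
    using 1 2 unfolding rcomp_def by blast
next
  fix A B assume "B \<in> rcomp R S A"
  then obtain C where "C \<in> R A" "B \<in> S C" unfolding rcomp_def by auto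
  then have "run \<Omega> (enc A) (enc C)" "run \<Omega>' (enc C) (enc B)"
    using assms(1,2) unfolding realized_def by simp_all
  then show "run (\<Omega> @ \<Omega>') (enc A) (enc B)" unfolding run_append by auto
qed

lemma realizable_rcomp:
  "realizable m R \<Longrightarrow> realizable m S \<Longrightarrow> monotonic S \<Longrightarrow> realizable m (rcomp R S)"
  unfolding realizable_def using realized_rcomp by blast

definition r_and :: "nat \<Rightarrow> nat \<Rightarrow> nat set \<Rightarrow> nat set set" where
  "r_and i j A = {if i \<in> A then A else A - {j}}"
definition r_or :: "nat \<Rightarrow> nat \<Rightarrow> nat set \<Rightarrow> nat set set" where
  "r_or i j A = {if i \<in> A then insert j A else A}"
text \<open>A bit used as a token: it may be moved from \<open>i\<close> to \<open>j\<close>, or it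
  stays and \<open>j\<close> is cleared. In no case is it duplicated.\<close>

definition r_split :: "nat \<Rightarrow> nat \<Rightarrow> nat set \<Rightarrow> nat set set" where
  "r_split i j A = insert (A - {j}) (if i \<in> A then {insert j (A - {i})} else {})"
definition r_swap :: "nat \<Rightarrow> nat \<Rightarrow> nat set \<Rightarrow> nat set set" where
  "r_swap i j A = {transpose i j ` A}"
definition r_zero :: "nat \<Rightarrow> nat set \<Rightarrow> nat set set" where
  "r_zero j A = {A - {j}}"
definition r_one :: "nat \<Rightarrow> nat set \<Rightarrow> nat set set" where
  "r_one j A = {insert j A}"

lemma monotonic_gates:
  "monotonic (r_and i j)" "monotonic (r_or i j)" "monotonic (r_split i j)" "monotonic (r_swap i j)"
  "monotonic (r_zero j)" "monotonic (r_one j)"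
  unfolding monotonic_def r_and_def r_or_def r_split_def r_swap_def r_zero_def r_one_def
  by (auto split: if_splits)

lemma realized_gate:
  assumes "\<forall>x \<in> set xs. snd x < 3" "Suc i < m"
    and R: "\<And>a b. set (erun xs [bits4 a b]) = (\<lambda>(a, b). bits4 a b) ` R a b"
    and sound: "\<And>A a b. (a, b) \<in> R (i \<in> A) (Suc i \<in> A) \<Longrightarrow> \<exists>B \<in> S A. upd2 A i a b \<subseteq> B"
    and complete: "\<And>A B. B \<in> S A \<Longrightarrow> \<exists>(a, b) \<in> R (i \<in> A) (Suc i \<in> A). B = upd2 A i a b"
  shows "realizable m S"
  unfolding realizable_def realized_def
proof (rule exI[of _ "map (\<lambda>(k, q). (k, 2 * i + q)) xs"], intro conjI allI impI ballI)
  fix x assume "x \<in> set (map (\<lambda>(k, q). (k, 2 * i + q)) xs)"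
  then show "Suc (snd x) < 2 * m" using assms(1,2) by fastforce
next
  fix A v' assume "run (map (\<lambda>(k, q). (k, 2 * i + q)) xs) (enc A) v'"
  then show "\<exists>A' B. v' = enc A' \<and> B \<in> S A \<and> A' \<subseteq> B"
    unfolding run_gate[where R = R, OF assms(1) R] using sound by blast
next
  fix A B assume "B \<in> S A"
  then show "run (map (\<lambda>(k, q). (k, 2 * i + q)) xs) (enc A) (enc B)"
    unfolding run_gate[where R = R, OF assms(1) R] using complete by blast
qed

lemma realizable_and_adj: "Suc i < m \<Longrightarrow> realizable m (r_and i (Suc i))"
  by (rule realized_gate[OF _ _ erun_and])
    (auto simp: gate_and_def below_def upd2_def r_and_def split: if_splits)

lemma realizable_or_adj: "Suc i < m \<Longrightarrow> realizable m (r_or i (Suc i))"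
  by (rule realized_gate[OF _ _ erun_or])
    (auto simp: gate_or_def below_def upd2_def r_or_def split: if_splits)

lemma realizable_split_adj:
  assumes "Suc i < m" shows "realizable m (r_split i (Suc i))"
proof (rule realized_gate[OF _ assms erun_split])
  show "\<forall>x \<in> set gate_split. snd x < 3" by (simp add: gate_split_def)
next
  fix A a b assume "(a, b) \<in> below (i \<in> A, False) \<union> below (False, i \<in> A)"
  then consider "a \<longrightarrow> i \<in> A" "\<not> b" | "\<not> a" "b \<longrightarrow> i \<in> A" by (auto simp: below_def)
  then show "\<exists>B \<in> r_split i (Suc i) A. upd2 A i a b \<subseteq> B"
  proof cases
    case 1
    then have "upd2 A i a b \<subseteq> A - {Suc i}" by (auto simp: upd2_def split: if_splits)
    then show ?thesis by (auto simp: r_split_def)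
  next
    case 2
    show ?thesis
    proof (cases b)
      case True
      then have "upd2 A i a b \<subseteq> insert (Suc i) (A - {i})" using 2 by (auto simp: upd2_def split: if_splits)
      then show ?thesis using 2 True by (simp add: r_split_def)
    next
      case False
      then have "upd2 A i a b \<subseteq> A - {Suc i}" using 2 by (auto simp: upd2_def split: if_splits)
      then show ?thesis by (auto simp: r_split_def)
    qed
  qed
next
  fix A B assume "B \<in> r_split i (Suc i) A"
  then consider "B = A - {Suc i}" | "i \<in> A" "B = insert (Suc i) (A - {i})"
    by (auto simp: r_split_def split: if_splits)
  then show "\<exists>(a, b) \<in> below (i \<in> A, False) \<union> below (False, i \<in> A). B = upd2 A i a b"
  proof cases
    case 1
    then have "B = upd2 A i (i \<in> A) False" by (auto simp: upd2_def split: if_splits)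
    then show ?thesis by (intro bexI[of _ "(i \<in> A, False)"]) (auto simp: below_def)
  next
    case 2
    then have "B = upd2 A i False True" by (auto simp: upd2_def split: if_splits)
    then show ?thesis using 2 by (intro bexI[of _ "(False, True)"]) (auto simp: below_def)
  qed
qed

lemma realizable_swap_adj:
  assumes "Suc i < m" shows "realizable m (r_swap i (Suc i))"
proof -
  have *: "transpose i (Suc i) ` A = upd2 A i (Suc i \<in> A) (i \<in> A)" for A
    by (auto simp: upd2_def transpose_def split: if_splits)
  show ?thesis
    by (rule realized_gate[OF _ assms erun_swap])
      (auto simp: gate_swap_def below_def r_swap_def * upd2_def split: if_splits)
qed

lemma swp_enc: "swp (2 * j) (enc A) = enc (if j \<in> A then A - {j} else insert j A)"
proof
  fix i
  consider "i = 2 * j" | "i = Suc (2 * j)" | "i div 2 \<noteq> j" "i \<noteq> 2 * j" "i \<noteq> Suc (2 * j)"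
    by linarith
  then show "swp (2 * j) (enc A) i = enc (if j \<in> A then A - {j} else insert j A) i"
    by cases (auto simp: swp_def enc_def)
qed

lemma enc_less: "enc A (Suc (2 * j)) < enc A (2 * j) \<longleftrightarrow> j \<in> A"
  by (auto simp: enc_def)

lemma realizable_one: "j < m \<Longrightarrow> realizable m (r_one j)"
  unfolding realizable_def realized_def
  by (rule exI[of _ "[(Free, 2 * j)]"]) (auto simp: r_one_def swp_enc insert_absorb)

text \<open>The free exchange has to leave the bit on, as the test would fail otherwise, and the
  test then switches it off. Clearing is thus exact and independent of the old value.\<close>

lemma realizable_zero: "j < m \<Longrightarrow> realizable m (r_zero j)"
  unfolding realizable_def realized_def
  by (rule exI[of _ "[(Free, 2 * j), (Test, 2 * j)]"])
    (auto simp: r_zero_def swp_enc enc_less split: if_splits)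

text \<open>Conjugation by an adjacent swap renames the arguments of a gate. The swap may lose bits,
  which the monotonicity in \<open>realizable_rcomp\<close> absorbs.\<close>

lemma realizable_conj:
  assumes "Suc l < m" "realizable m (G i j)" "monotonic (G i j)"
    and equi: "\<And>A. G (transpose l (Suc l) i) (transpose l (Suc l) j) (transpose l (Suc l) ` A) =
         (`) (transpose l (Suc l)) ` G i j A"
  shows "realizable m (G (transpose l (Suc l) i) (transpose l (Suc l) j))"
proof -
  let ?t = "transpose l (Suc l)"
  have "realizable m (rcomp (rcomp (r_swap l (Suc l)) (G i j)) (r_swap l (Suc l)))"
    using assms by (intro realizable_rcomp realizable_swap_adj monotonic_gates)
  moreover have "rcomp (rcomp (r_swap l (Suc l)) (G i j)) (r_swap l (Suc l)) = G (?t i) (?t j)"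
  proof
    fix A
    have "?t ` ?t ` A = A" by (simp add: image_image)
    then have "G (?t i) (?t j) A = (`) ?t ` G i j (?t ` A)" using equi[of "?t ` A"] by simp
    also have "\<dots> = rcomp (rcomp (r_swap l (Suc l)) (G i j)) (r_swap l (Suc l)) A"
      by (auto simp: rcomp_def r_swap_def)
    finally show "rcomp (rcomp (r_swap l (Suc l)) (G i j)) (r_swap l (Suc l)) A = G (?t i) (?t j) A" ..
  qed
  ultimately show ?thesis by simp
qed

text \<open>Induction on the distance of the two bits: conjugation carries the farther argument
  outwards by one position. For the reversed order of the arguments, the base case conjugates the
  adjacent gate by the swap of its own two bits.\<close>

lemma realizable_pair:
  assumes adj: "\<And>i. Suc i < m \<Longrightarrow> realizable m (G i (Suc i))"
    and mono: "\<And>i j. monotonic (G i j)"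
    and equi: "\<And>l i j A. G (transpose l (Suc l) i) (transpose l (Suc l) j) (transpose l (Suc l) ` A) =
         (`) (transpose l (Suc l)) ` G i j A"
    and ij: "i \<noteq> j" "i < m" "j < m"
  shows "realizable m (G i j)"
proof -
  note conj = realizable_conj[where G = G, OF _ _ mono equi]
  have up: "realizable m (G i (i + Suc n))" if "i + Suc n < m" for i n
    using that
  proof (induction n)
    case 0
    then show ?case using adj by simp
  next
    case (Suc n)
    then show ?case using conj[of "i + Suc n" m i "i + Suc n"] by (simp add: transpose_def)
  qed
  have down: "realizable m (G (i + Suc n) i)" if "i + Suc n < m" for i n
    using that
  proof (induction n)
    case 0
    then show ?case using conj[of i m i "Suc i"] adj[of i] by simp
  next
    case (Suc n)
    then show ?case using conj[of "i + Suc n" m "i + Suc n" i] by (simp add: transpose_def)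
  qed
  show ?thesis
  proof (cases "i < j")
    case True
    then show ?thesis using up[of i "j - i - 1"] ij by simp
  next
    case False
    then show ?thesis using down[of j "i - j - 1"] ij by simp
  qed
qed

lemma transpose_image_mem: "transpose l k x \<in> transpose l k ` A \<longleftrightarrow> x \<in> A"
  by (metis image_eqI image_iff transpose_involutory)

lemma realizable_gates:
  assumes "i \<noteq> j" "i < m" "j < m"
  shows "realizable m (r_and i j)" "realizable m (r_or i j)" "realizable m (r_split i j)"
proof -
  have inj: "inj (transpose l (Suc l))" for l by simp
  show "realizable m (r_and i j)"
    by (rule realizable_pair[where G = r_and, OF realizable_and_adj monotonic_gates(1) _ assms])
      (auto simp: r_and_def transpose_image_mem image_set_diff[OF inj])
  show "realizable m (r_or i j)"
    by (rule realizable_pair[where G = r_or, OF realizable_or_adj monotonic_gates(2) _ assms])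
      (auto simp: r_or_def transpose_image_mem)
  show "realizable m (r_split i j)"
    by (rule realizable_pair[where G = r_split, OF realizable_split_adj monotonic_gates(3) _ assms])
      (auto simp: r_split_def transpose_image_mem image_set_diff[OF inj])
qed


section \<open>Window programs\<close>

lemma realizable_foldr:
  assumes "\<And>x. x \<in> set xs \<Longrightarrow> realizable m (f x)" "\<And>x. monotonic (f x)" "realizable m R" "monotonic R"
  shows "realizable m (foldr (\<lambda>x. rcomp (f x)) xs R) \<and> monotonic (foldr (\<lambda>x. rcomp (f x)) xs R)"
  using assms by (induction xs) (auto intro!: realizable_rcomp monotonic_rcomp)

text \<open>\<open>zeros js\<close> is used as the end of a chain of gates and thus also plays the role of the identity.\<close>

definition r_zeros :: "nat set \<Rightarrow> nat set \<Rightarrow> nat set set" where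
  "r_zeros J A = {A - J}"

lemma monotonic_zeros: "monotonic (r_zeros J)"
  by (auto simp: monotonic_def r_zeros_def)

lemma realizable_zeros:
  assumes "finite J" "J \<subseteq> {..<m}" shows "realizable m (r_zeros J)"
  using assms
proof (induction J)
  case empty
  show ?case unfolding realizable_def realized_def
    by (rule exI[of _ "[]"]) (auto simp: r_zeros_def)
next
  case (insert j J)
  then have "realizable m (rcomp (r_zero j) (r_zeros J))"
    by (intro realizable_rcomp realizable_zero monotonic_zeros) auto
  moreover have "rcomp (r_zero j) (r_zeros J) = r_zeros (insert j J)"
    by (rule ext) (auto simp: rcomp_def r_zero_def r_zeros_def)
  ultimately show ?case by simp
qed

text \<open>Each half of a window consists of \<open>h = 2 * d + 1\<close> bits: \<open>d\<close> symbol bits (one-hot), \<open>d\<close> bits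
  collecting the new symbol and one control bit. The control bit of the left half is a token which
  may be spent on one of the quadruples, via the control bit of the right half.\<close>

definition r_quad :: "nat \<Rightarrow> nat \<times> nat \<times> nat \<times> nat \<Rightarrow> nat set \<Rightarrow> nat set set" where
  "r_quad d = (\<lambda>(a, b, a', b'). let h = 2 * d + 1; c = 2 * d; s = h + 2 * d in
     rcomp (r_split c s) (rcomp (r_and a s) (rcomp (r_and (h + b) s)
       (rcomp (r_or s (d + a')) (rcomp (r_or s (h + d + b')) (r_zero s))))))"

definition r_move :: "nat \<Rightarrow> nat \<Rightarrow> nat set \<Rightarrow> nat set set" where
  "r_move d a = (let h = 2 * d + 1 in
     rcomp (r_or (d + a) a) (r_or (h + d + a) (h + a)))"

definition scratch :: "nat \<Rightarrow> nat set" where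
  "scratch d = {d..<2 * d + 1} \<union> {3 * d + 1..<4 * d + 2}"

text \<open>The scratch bits are cleared at the start because the input set is arbitrary. One token
  is issued and offered to each quadruple in turn; as at most one quadruple can spend it, the new
  symbols of both halves come from the same quadruple even if several old symbol bits are on. The
  old symbols are erased before the collected ones are moved into their place.\<close>

definition r_window :: "nat \<Rightarrow> (nat \<times> nat \<times> nat \<times> nat) list \<Rightarrow> nat set \<Rightarrow> nat set set" where
  "r_window d qs =
     rcomp (r_zeros (scratch d)) (rcomp (r_one (2 * d))
       (foldr (\<lambda>x. rcomp (r_quad d x)) qs
         (rcomp (r_zeros ({..<d} \<union> {2 * d} \<union> {2 * d + 1..<3 * d + 1}))
           (foldr (\<lambda>x. rcomp (r_move d x)) [0..<d] (r_zeros (scratch d))))))"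

lemma monotonic_quad: "monotonic (r_quad d x)"
  by (auto simp: r_quad_def Let_def split: prod.splits intro!: monotonic_rcomp monotonic_gates)

lemma monotonic_move: "monotonic (r_move d x)"
  by (auto simp: r_move_def Let_def intro!: monotonic_rcomp monotonic_gates)

lemma realizable_window:
  assumes "\<And>a b a' b'. (a, b, a', b') \<in> set qs \<Longrightarrow> a < d \<and> b < d \<and> a' < d \<and> b' < d"
  shows "realizable (4 * d + 2) (r_window d qs)"
proof -
  let ?m = "4 * d + 2"
  have sc: "realizable ?m (r_zeros (scratch d))"
    by (rule realizable_zeros) (auto simp: scratch_def)
  have q: "realizable ?m (r_quad d x)" if "x \<in> set qs" for x
    using that assms
    by (auto simp: r_quad_def Let_def split: prod.splits dest!: assms
        intro!: realizable_rcomp realizable_gates realizable_zero monotonic_rcomp monotonic_gates)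
  have mv: "realizable ?m (r_move d x)" if "x \<in> set [0..<d]" for x
    using that by (auto simp: r_move_def Let_def intro!: realizable_rcomp realizable_gates monotonic_gates)
  have 1: "realizable ?m (foldr (\<lambda>x. rcomp (r_move d x)) [0..<d] (r_zeros (scratch d)))
      \<and> monotonic (foldr (\<lambda>x. rcomp (r_move d x)) [0..<d] (r_zeros (scratch d)))"
    by (rule realizable_foldr[OF mv monotonic_move sc monotonic_zeros])
  let ?J = "{..<d} \<union> {2 * d} \<union> {2 * d + 1..<3 * d + 1}"
  have "realizable ?m (r_zeros ?J)"
    by (rule realizable_zeros) auto
  with 1 have 2: "realizable ?m (rcomp (r_zeros ?J)
       (foldr (\<lambda>x. rcomp (r_move d x)) [0..<d] (r_zeros (scratch d))))"
    "monotonic (rcomp (r_zeros ?J)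
       (foldr (\<lambda>x. rcomp (r_move d x)) [0..<d] (r_zeros (scratch d))))"
    using realizable_rcomp monotonic_rcomp monotonic_zeros by blast+
  note 3 = realizable_foldr[where xs = qs and f = "r_quad d", OF q monotonic_quad 2]
  have "realizable ?m (r_one (2 * d))" by (rule realizable_one) simp
  with 3 sc show ?thesis
    unfolding r_window_def
    by (blast intro: realizable_rcomp monotonic_rcomp monotonic_zeros monotonic_gates)
qed

lemma r_quad_spent:
  assumes "B \<in> r_quad d (a, b, a', b') A" "2 * d \<notin> A" "4 * d + 1 \<notin> A"
    "a < d" "b < d" "a' < d" "b' < d"
  shows "B = A"
  using assms
  by (auto simp: r_quad_def Let_def rcomp_def r_split_def r_and_def r_or_def r_zero_def split: if_splits)

text \<open>The token is not offered, or it is offered and lost because one of the two symbol bits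
  is missing, or it is spent.\<close>

lemma r_quad_token:
  assumes "B \<in> r_quad d (a, b, a', b') A" "2 * d \<in> A" "4 * d + 1 \<notin> A"
    "a < d" "b < d" "a' < d" "b' < d"
  shows "B = A \<or> B = A - {2 * d} \<or>
    (a \<in> A \<and> 2 * d + 1 + b \<in> A \<and> B = insert (d + a') (insert (3 * d + 1 + b') (A - {2 * d})))"
  using assms
  by (auto simp: r_quad_def Let_def rcomp_def r_split_def r_and_def r_or_def r_zero_def split: if_splits)

lemma r_quad_skip: "4 * d + 1 \<notin> A \<Longrightarrow> a < d \<Longrightarrow> b < d \<Longrightarrow> a' < d \<Longrightarrow> b' < d \<Longrightarrow> A \<in> r_quad d (a, b, a', b') A"
  by (auto simp: r_quad_def Let_def rcomp_def r_split_def r_and_def r_or_def r_zero_def)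

lemma r_quad_spend:
  assumes "2 * d \<in> A" "4 * d + 1 \<notin> A" "a < d" "b < d" "a' < d" "b' < d" "a \<in> A" "2 * d + 1 + b \<in> A"
  shows "insert (d + a') (insert (3 * d + 1 + b') (A - {2 * d})) \<in> r_quad d (a, b, a', b') A"
  using assms
  by (auto simp: r_quad_def Let_def rcomp_def r_split_def r_and_def r_or_def r_zero_def)


lemma mem_rcomp: "B \<in> rcomp R S A \<longleftrightarrow> (\<exists>C \<in> R A. B \<in> S C)"
  by (simp add: rcomp_def)

lemma quads_spent:
  assumes "\<And>a b a' b'. (a, b, a', b') \<in> set qs \<Longrightarrow> a < d \<and> b < d \<and> a' < d \<and> b' < d"
    "B \<in> foldr (\<lambda>x. rcomp (r_quad d x)) qs R A" "2 * d \<notin> A" "4 * d + 1 \<notin> A"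
  shows "B \<in> R A"
  using assms
proof (induction qs)
  case (Cons x qs)
  obtain a b a' b' where x: "x = (a, b, a', b')" by (cases x)
  obtain A' where A': "A' \<in> r_quad d x A" "B \<in> foldr (\<lambda>x. rcomp (r_quad d x)) qs R A'"
    using Cons.prems(2) by (auto simp: mem_rcomp)
  have "A' = A" using r_quad_spent[of A' d a b a' b' A] A'(1) Cons.prems x by auto
  then show ?case using Cons.IH Cons.prems A'(2) by auto
qed simp

text \<open>After the token is lost or spent, every further quadruple acts as the identity by
  \<open>quads_spent\<close>, so at most one quadruple contributes.\<close>

lemma quads_sound:
  assumes "\<And>a b a' b'. (a, b, a', b') \<in> set qs \<Longrightarrow> a < d \<and> b < d \<and> a' < d \<and> b' < d"
    "B \<in> foldr (\<lambda>x. rcomp (r_quad d x)) qs R A" "2 * d \<in> A" "4 * d + 1 \<notin> A"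
  shows "B \<in> R A \<or> B \<in> R (A - {2 * d}) \<or>
    (\<exists>(a, b, a', b') \<in> set qs. a \<in> A \<and> 2 * d + 1 + b \<in> A \<and>
        B \<in> R (insert (d + a') (insert (3 * d + 1 + b') (A - {2 * d}))))"
  using assms
proof (induction qs)
  case (Cons x qs)
  obtain a b a' b' where x: "x = (a, b, a', b')" by (cases x)
  have lt: "a < d" "b < d" "a' < d" "b' < d" using Cons.prems(1) x by auto
  have qs: "\<And>a b a' b'. (a, b, a', b') \<in> set qs \<Longrightarrow> a < d \<and> b < d \<and> a' < d \<and> b' < d"
    using Cons.prems(1) by auto
  obtain A' where A': "A' \<in> r_quad d x A" "B \<in> foldr (\<lambda>x. rcomp (r_quad d x)) qs R A'"
    using Cons.prems(2) by (auto simp: mem_rcomp)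
  consider "A' = A" | "A' = A - {2 * d}"
    | "a \<in> A" "2 * d + 1 + b \<in> A" "A' = insert (d + a') (insert (3 * d + 1 + b') (A - {2 * d}))"
    using r_quad_token[of A' d a b a' b' A] A'(1) Cons.prems lt x by auto
  then show ?case
  proof cases
    case 1
    then show ?thesis using Cons.IH[OF qs] Cons.prems A'(2) by auto
  next
    case 2
    then have "B \<in> R A'" using quads_spent[OF qs A'(2)] Cons.prems(4) by auto
    then show ?thesis using 2 by simp
  next
    case 3
    then have "B \<in> R A'" using quads_spent[OF qs A'(2)] Cons.prems(4) lt by auto
    then show ?thesis using 3 x by auto
  qed
qed simp

lemma quads_skip:
  assumes "\<And>a b a' b'. (a, b, a', b') \<in> set qs \<Longrightarrow> a < d \<and> b < d \<and> a' < d \<and> b' < d"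
    "B \<in> R A" "4 * d + 1 \<notin> A"
  shows "B \<in> foldr (\<lambda>x. rcomp (r_quad d x)) qs R A"
  using assms
proof (induction qs)
  case (Cons x qs)
  obtain a b a' b' where x: "x = (a, b, a', b')" by (cases x)
  have "A \<in> r_quad d x A" unfolding x using Cons.prems x by (intro r_quad_skip) auto
  moreover have "B \<in> foldr (\<lambda>x. rcomp (r_quad d x)) qs R A" using Cons by auto
  ultimately show ?case by (auto simp: mem_rcomp)
qed simp

lemma quads_complete:
  assumes "\<And>a b a' b'. (a, b, a', b') \<in> set qs \<Longrightarrow> a < d \<and> b < d \<and> a' < d \<and> b' < d"
    "(a, b, a', b') \<in> set qs" "a \<in> A" "2 * d + 1 + b \<in> A" "2 * d \<in> A" "4 * d + 1 \<notin> A"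
    "B \<in> R (insert (d + a') (insert (3 * d + 1 + b') (A - {2 * d})))"
  shows "B \<in> foldr (\<lambda>x. rcomp (r_quad d x)) qs R A"
  using assms
proof (induction qs)
  case (Cons x qs)
  have qs: "\<And>a b a' b'. (a, b, a', b') \<in> set qs \<Longrightarrow> a < d \<and> b < d \<and> a' < d \<and> b' < d"
    using Cons.prems(1) by auto
  show ?case
  proof (cases "x = (a, b, a', b')")
    case True
    then have lt: "a < d" "b < d" "a' < d" "b' < d" using Cons.prems(1) by auto
    let ?A = "insert (d + a') (insert (3 * d + 1 + b') (A - {2 * d}))"
    have "?A \<in> r_quad d x A" unfolding True using Cons.prems lt by (intro r_quad_spend) auto
    moreover have "B \<in> foldr (\<lambda>x. rcomp (r_quad d x)) qs R ?A"
      by (rule quads_skip[where R = R and A = ?A, OF qs Cons.prems(7)]) (use Cons.prems(6) lt in auto)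
    ultimately show ?thesis by (auto simp: mem_rcomp)
  next
    case False
    obtain u v u' v' where x: "x = (u, v, u', v')" by (cases x)
    have "A \<in> r_quad d x A" unfolding x using Cons.prems(1,6) x by (intro r_quad_skip) auto
    moreover have "B \<in> foldr (\<lambda>x. rcomp (r_quad d x)) qs R A"
      by (rule Cons.IH[OF qs]) (use Cons.prems False in auto)
    ultimately show ?thesis by (auto simp: mem_rcomp)
  qed
qed simp

lemma moves_eq:
  assumes "\<forall>x \<in> set xs. x < d"
  shows "foldr (\<lambda>x. rcomp (r_move d x)) xs R A =
    R (A \<union> {x \<in> set xs. d + x \<in> A} \<union> {2 * d + 1 + x | x. x \<in> set xs \<and> 3 * d + 1 + x \<in> A})"
  using assms
proof (induction xs arbitrary: A)
  case (Cons y xs)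
  let ?A = "A \<union> (if d + y \<in> A then {y} else {}) \<union> (if 3 * d + 1 + y \<in> A then {2 * d + 1 + y} else {})"
  have "r_move d y A = {?A}"
    using Cons.prems by (auto simp: r_move_def Let_def rcomp_def r_or_def)
  then have "foldr (\<lambda>x. rcomp (r_move d x)) (y # xs) R A = foldr (\<lambda>x. rcomp (r_move d x)) xs R ?A"
    by (simp add: rcomp_def)
  also have "\<dots> = R (?A \<union> {x \<in> set xs. d + x \<in> ?A} \<union> {2 * d + 1 + x | x. x \<in> set xs \<and> 3 * d + 1 + x \<in> ?A})"
    using Cons by simp
  also have "?A \<union> {x \<in> set xs. d + x \<in> ?A} \<union> {2 * d + 1 + x | x. x \<in> set xs \<and> 3 * d + 1 + x \<in> ?A} =
     A \<union> {x \<in> set (y # xs). d + x \<in> A} \<union> {2 * d + 1 + x | x. x \<in> set (y # xs) \<and> 3 * d + 1 + x \<in> A}"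
    using Cons.prems by auto
  finally show ?case .
qed simp

lemma r_window_sound:
  assumes qs: "\<And>a b a' b'. (a, b, a', b') \<in> set qs \<Longrightarrow> a < d \<and> b < d \<and> a' < d \<and> b' < d"
    and B: "B \<in> r_window d qs A" and x: "x \<in> B" "x < d" and y: "2 * d + 1 + y \<in> B" "y < d"
  shows "\<exists>a b. (a, b, x, y) \<in> set qs \<and> a \<in> A \<and> 2 * d + 1 + b \<in> A"
proof -
  let ?J = "{..<d} \<union> {2 * d} \<union> {2 * d + 1..<3 * d + 1}"
  let ?A1 = "insert (2 * d) (A - scratch d)"
  let ?R = "rcomp (r_zeros ?J) (foldr (\<lambda>x. rcomp (r_move d x)) [0..<d] (r_zeros (scratch d)))"
  have sc: "2 * d \<in> ?A1" "4 * d + 1 \<notin> ?A1" by (auto simp: scratch_def)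
  have B1: "B \<in> foldr (\<lambda>x. rcomp (r_quad d x)) qs ?R ?A1"
    using B by (simp add: r_window_def rcomp_def r_zeros_def r_one_def)
  have R: "d + x \<in> A' \<and> 3 * d + 1 + y \<in> A'" if "B \<in> ?R A'" for A'
    using that x y by (auto simp: rcomp_def r_zeros_def moves_eq scratch_def)
  have no: "d + x \<notin> ?A1" "d + x \<notin> ?A1 - {2 * d}" using x(2) by (auto simp: scratch_def)
  \<comment> \<open>If no quadruple spent the token, all collecting bits are off and the erased
    symbols are not replaced. This excludes the two alternatives in which the token is kept or
    lost.\<close>
  obtain a b a' b' where *: "(a, b, a', b') \<in> set qs" "a \<in> ?A1" "2 * d + 1 + b \<in> ?A1"
     "B \<in> ?R (insert (d + a') (insert (3 * d + 1 + b') (?A1 - {2 * d})))"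
    using quads_sound[OF qs B1 sc] R no by blast
  note lt = qs[OF *(1)]
  have "x = a'" "y = b'" using R[OF *(4)] x(2) y(2) lt by (auto simp: scratch_def)
  then show ?thesis using * lt by (auto simp: scratch_def)
qed

lemma r_window_complete:
  assumes qs: "\<And>a b a' b'. (a, b, a', b') \<in> set qs \<Longrightarrow> a < d \<and> b < d \<and> a' < d \<and> b' < d"
    and *: "(a, b, a', b') \<in> set qs"
  shows "{a', 2 * d + 1 + b'} \<in> r_window d qs {a, 2 * d + 1 + b}"
proof -
  let ?J = "{..<d} \<union> {2 * d} \<union> {2 * d + 1..<3 * d + 1}"
  let ?A1 = "insert (2 * d) ({a, 2 * d + 1 + b} - scratch d)"
  let ?R = "rcomp (r_zeros ?J) (foldr (\<lambda>x. rcomp (r_move d x)) [0..<d] (r_zeros (scratch d)))"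
  note lt = qs[OF *]
  have A1: "?A1 = {2 * d, a, 2 * d + 1 + b}" using lt by (auto simp: scratch_def)
  have "insert (d + a') (insert (3 * d + 1 + b') (?A1 - {2 * d})) - ?J = {d + a', 3 * d + 1 + b'}"
    using lt unfolding A1 by auto
  moreover have "{d + a', 3 * d + 1 + b'} \<union> {x \<in> {0..<d}. d + x \<in> {d + a', 3 * d + 1 + b'}} \<union>
      {2 * d + 1 + x |x. x \<in> {0..<d} \<and> 3 * d + 1 + x \<in> {d + a', 3 * d + 1 + b'}} =
      {d + a', 3 * d + 1 + b', a', 2 * d + 1 + b'}" using lt by auto
  moreover have "{d + a', 3 * d + 1 + b', a', 2 * d + 1 + b'} - scratch d = {a', 2 * d + 1 + b'}"
    using lt by (auto simp: scratch_def)
  ultimately have "{a', 2 * d + 1 + b'} \<in> ?R (insert (d + a') (insert (3 * d + 1 + b') (?A1 - {2 * d})))"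
    by (simp add: rcomp_def r_zeros_def moves_eq)
  then have "{a', 2 * d + 1 + b'} \<in> foldr (\<lambda>x. rcomp (r_quad d x)) qs ?R ?A1"
    by (intro quads_complete[OF qs *]) (use lt in \<open>auto simp: scratch_def\<close>)
  then show ?thesis by (simp add: r_window_def rcomp_def r_zeros_def r_one_def)
qed

lemma window_ops:
  assumes qs: "\<And>a b a' b'. (a, b, a', b') \<in> set qs \<Longrightarrow> a < d \<and> b < d \<and> a' < d \<and> b' < d"
  obtains \<Omega> where "\<forall>x \<in> set \<Omega>. Suc (snd x) < 8 * d + 4"
    and "\<And>A v'. run \<Omega> (enc A) v' \<Longrightarrow> \<exists>A'. v' = enc A' \<and> (\<forall>x<d. \<forall>y<d. x \<in> A' \<and> 2 * d + 1 + y \<in> A' \<longrightarrow>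
        (\<exists>a b. (a, b, x, y) \<in> set qs \<and> a \<in> A \<and> 2 * d + 1 + b \<in> A))"
    and "\<And>a b a' b'. (a, b, a', b') \<in> set qs \<Longrightarrow> run \<Omega> (enc {a, 2 * d + 1 + b}) (enc {a', 2 * d + 1 + b'})"
proof -
  obtain \<Omega> where \<Omega>: "realized (4 * d + 2) (r_window d qs) \<Omega>"
    using realizable_window[OF qs] unfolding realizable_def by blast
  show ?thesis
  proof (rule that[of \<Omega>])
    show "\<forall>x \<in> set \<Omega>. Suc (snd x) < 8 * d + 4" using \<Omega> unfolding realized_def by auto
  next
    fix A v' assume "run \<Omega> (enc A) v'"
    then obtain A' B where *: "v' = enc A'" "B \<in> r_window d qs A" "A' \<subseteq> B"
      using \<Omega> unfolding realized_def by meson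
    show "\<exists>A'. v' = enc A' \<and> (\<forall>x<d. \<forall>y<d. x \<in> A' \<and> 2 * d + 1 + y \<in> A' \<longrightarrow>
        (\<exists>a b. (a, b, x, y) \<in> set qs \<and> a \<in> A \<and> 2 * d + 1 + b \<in> A))"
      using r_window_sound[OF qs *(2)] *(1,3) by (intro exI[of _ A']) blast
  next
    fix a b a' b' assume "(a, b, a', b') \<in> set qs"
    from r_window_complete[OF qs this] show "run \<Omega> (enc {a, 2 * d + 1 + b}) (enc {a', 2 * d + 1 + b'})"
      using \<Omega> unfolding realized_def by blast
  qed
qed


section \<open>Rounds of parallel operations\<close>

text \<open>An operation at \<open>q\<close> acts on the entries \<open>q\<close> and
  \<open>q + 1\<close>. Hence an entry is idle only if no operation sits at its own position or at
  the preceding one.\<close>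

definition row :: "(nat \<Rightarrow> opk) \<Rightarrow> (nat \<Rightarrow> nat) \<Rightarrow> (nat \<Rightarrow> nat) \<Rightarrow> bool" where
  "row r v v' \<longleftrightarrow> (\<forall>q.
     (r q = Nop \<and> (q = 0 \<or> r (q - 1) = Nop) \<longrightarrow> v' q = v q) \<and>
     (r q = Free \<longrightarrow> v' q = v q \<and> v' (Suc q) = v (Suc q) \<or> v' q = v (Suc q) \<and> v' (Suc q) = v q) \<and>
     (r q = Test \<longrightarrow> v (Suc q) < v q \<and> v' q = v (Suc q) \<and> v' (Suc q) = v q))"

fun rows :: "(nat \<Rightarrow> nat \<Rightarrow> opk) \<Rightarrow> nat \<Rightarrow> nat \<Rightarrow> (nat \<Rightarrow> nat) \<Rightarrow> (nat \<Rightarrow> nat) \<Rightarrow> bool" where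
  "rows r s 0 v v' \<longleftrightarrow> v' = v"
| "rows r s (Suc l) v v' \<longleftrightarrow> (\<exists>u. row (r s) v u \<and> rows r (Suc s) l u v')"

lemma rows_add: "rows r s (l + l') v v' \<longleftrightarrow> (\<exists>u. rows r s l v u \<and> rows r (s + l) l' u v')"
  by (induction l arbitrary: s v) auto

lemma rows_path: "rows r s l v v' \<longleftrightarrow> (\<exists>w. w s = v \<and> w (s + l) = v' \<and> (\<forall>i. s \<le> i \<and> i < s + l \<longrightarrow> row (r i) (w i) (w (Suc i))))"
proof (induction l arbitrary: s v)
  case 0
  show ?case by (auto intro!: exI[of _ "\<lambda>_. v"])
next
  case (Suc l)
  show ?case
  proof
    assume "rows r s (Suc l) v v'"
    then obtain u w where u: "row (r s) v u" and w: "w (Suc s) = u" "w (Suc s + l) = v'"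
        "\<forall>i. Suc s \<le> i \<and> i < Suc s + l \<longrightarrow> row (r i) (w i) (w (Suc i))"
      using Suc by auto
    have "row (r i) ((w(s := v)) i) ((w(s := v)) (Suc i))" if "s \<le> i" "i < s + Suc l" for i
      using u w(1) w(3)[rule_format, of i] that by (cases "i = s") auto
    then show "\<exists>w. w s = v \<and> w (s + Suc l) = v' \<and> (\<forall>i. s \<le> i \<and> i < s + Suc l \<longrightarrow> row (r i) (w i) (w (Suc i)))"
      using w by (intro exI[of _ "w(s := v)"]) auto
  next
    assume "\<exists>w. w s = v \<and> w (s + Suc l) = v' \<and> (\<forall>i. s \<le> i \<and> i < s + Suc l \<longrightarrow> row (r i) (w i) (w (Suc i)))"
    then obtain w where w: "w s = v" "w (s + Suc l) = v'" "\<forall>i. s \<le> i \<and> i < s + Suc l \<longrightarrow> row (r i) (w i) (w (Suc i))"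
      by blast
    then have "rows r (Suc s) l (w (Suc s)) v'" using Suc by auto
    moreover have "row (r s) v (w (Suc s))" using w by auto
    ultimately show "rows r s (Suc l) v v'" by auto
  qed
qed

text \<open>Outside the window the value \<open>b + x\<close> is a filler. It is chosen such that a
  window of \<open>enc A\<close> is again an encoded set, shifted by \<open>b\<close>; see
  \<open>win_enc\<close>.\<close>

definition win :: "nat \<Rightarrow> nat \<Rightarrow> (nat \<Rightarrow> nat) \<Rightarrow> nat \<Rightarrow> nat" where
  "win b L v x = (if x < L then v (b + x) else b + x)"

lemma ostep_outside: "ostep x v v' \<Longrightarrow> Suc (snd x) < L \<Longrightarrow> L \<le> y \<Longrightarrow> v' y = v y"
  by (cases "(x, v, v')" rule: ostep.cases) (auto simp: swp_def)

text \<open>An operation that starts in a window also ends in it, and windows are disjoint. Thus the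
  conditions of \<open>row\<close> split into one \<open>ostep\<close> per window and immobility
  elsewhere.\<close>

lemma row_windows:
  fixes b L :: "'i \<Rightarrow> nat"
  assumes op: "\<And>i x. i \<in> I \<Longrightarrow> x < L i \<Longrightarrow> r (b i + x) = (if x = snd (p i) then fst (p i) else Nop)"
    and inside: "\<And>i. i \<in> I \<Longrightarrow> Suc (snd (p i)) < L i"
    and disj: "\<And>i j x y. i \<in> I \<Longrightarrow> j \<in> I \<Longrightarrow> x < L i \<Longrightarrow> y < L j \<Longrightarrow> b i + x = b j + y \<Longrightarrow> i = j"
    and out: "\<And>q. (\<And>i x. i \<in> I \<Longrightarrow> x < L i \<Longrightarrow> q \<noteq> b i + x) \<Longrightarrow> r q = Nop"
  shows "row r v v' \<longleftrightarrow> (\<forall>i \<in> I. ostep (p i) (win (b i) (L i) v) (win (b i) (L i) v')) \<and>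
     (\<forall>q. (\<forall>i \<in> I. \<forall>x < L i. q \<noteq> b i + x) \<longrightarrow> v' q = v q)" (is "?l \<longleftrightarrow> ?r1 \<and> ?r2")
proof
  assume l: ?l
  \<comment> \<open>An operation at \<open>q - 1\<close> would belong to some window, and by
    \<open>inside\<close> that window would also contain \<open>q\<close>. Disjointness leaves only
    the second entry of the operation of the same window, which is excluded.\<close>
  have nop: "q = 0 \<or> r (q - 1) = Nop"
    if "(\<forall>i \<in> I. \<forall>x < L i. q \<noteq> b i + x) \<or> (i \<in> I \<and> q = b i + x \<and> x < L i \<and> x \<noteq> Suc (snd (p i)))" for q i x
  proof (rule ccontr)
    assume c: "\<not> (q = 0 \<or> r (q - 1) = Nop)"
    then obtain j y where j: "j \<in> I" "y < L j" "q - 1 = b j + y" using out by blast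
    then have y: "y = snd (p j)" using c op[of j y] by (auto split: if_splits)
    then have y2: "Suc y < L j" using inside j by auto
    have q: "q = b j + Suc y" using j c by linarith
    then have "\<not> (\<forall>i \<in> I. \<forall>x < L i. q \<noteq> b i + x)" using j(1) y2 by blast
    then have "i \<in> I" "q = b i + x" "x < L i" "x \<noteq> Suc (snd (p i))" using that by auto
    then show False using disj[of i j x "Suc y"] j y2 q y by auto
  qed
  have ?r1
  proof
    fix i assume i: "i \<in> I"
    obtain k f where p: "p i = (k, f)" by (cases "p i")
    have f: "Suc f < L i" using inside[OF i] p by simp
    have rf: "r (b i + f) = k" using op[OF i, of f] f p by simp
    have other: "v' (b i + x) = v (b i + x)" if "x < L i" "x \<noteq> f" "x \<noteq> Suc f" for x
      using l[unfolded row_def, rule_format, of "b i + x"] op[OF i that(1)] nop[of "b i + x" i x] i that p by auto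
    show "ostep (p i) (win (b i) (L i) v) (win (b i) (L i) v')"
    proof (cases k)
      case Nop
      have "v' (b i + x) = v (b i + x)" if "x < L i" for x
      proof -
        have "r (b i + x) = Nop" using op[OF i that] p Nop by (simp split: if_splits)
        moreover have "b i + x = 0 \<or> r (b i + x - 1) = Nop"
        proof (cases "x = Suc f")
          case True
          then show ?thesis using rf Nop by simp
        next
          case False
          then show ?thesis using nop[of "b i + x" i x] i that p by auto
        qed
        ultimately show ?thesis using l[unfolded row_def, rule_format, of "b i + x"] by blast
      qed
      then show ?thesis using p Nop by (auto simp: win_def fun_eq_iff)
    next
      case Free
      then have "v' (b i + f) = v (b i + f) \<and> v' (b i + Suc f) = v (b i + Suc f) \<or>
          v' (b i + f) = v (b i + Suc f) \<and> v' (b i + Suc f) = v (b i + f)"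
        using l rf by (simp add: row_def)
      then show ?thesis
      proof
        assume "v' (b i + f) = v (b i + f) \<and> v' (b i + Suc f) = v (b i + Suc f)"
        then have "win (b i) (L i) v' = win (b i) (L i) v" using other by (fastforce simp: win_def)
        then show ?thesis using p Free by simp
      next
        assume "v' (b i + f) = v (b i + Suc f) \<and> v' (b i + Suc f) = v (b i + f)"
        then have "win (b i) (L i) v' = swp f (win (b i) (L i) v)" using other f by (fastforce simp: win_def swp_def)
        then show ?thesis using p Free by simp
      qed
    next
      case Test
      then have "v (b i + Suc f) < v (b i + f)" "v' (b i + f) = v (b i + Suc f) \<and> v' (b i + Suc f) = v (b i + f)"
        using l rf by (simp_all add: row_def)
      moreover from this have "win (b i) (L i) v' = swp f (win (b i) (L i) v)" using other f by (fastforce simp: win_def swp_def)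
      ultimately show ?thesis using p Test f by (simp add: win_def)
    qed
  qed
  moreover have ?r2
  proof (intro allI impI)
    fix q assume q: "\<forall>i \<in> I. \<forall>x < L i. q \<noteq> b i + x"
    then have "r q = Nop" using out by blast
    then show "v' q = v q" using l nop[of q] q unfolding row_def by blast
  qed
  ultimately show "?r1 \<and> ?r2" ..
next
  assume r: "?r1 \<and> ?r2"
  show ?l unfolding row_def
  proof
    fix q
    show "(r q = Nop \<and> (q = 0 \<or> r (q - 1) = Nop) \<longrightarrow> v' q = v q) \<and>
     (r q = Free \<longrightarrow> v' q = v q \<and> v' (Suc q) = v (Suc q) \<or> v' q = v (Suc q) \<and> v' (Suc q) = v q) \<and>
     (r q = Test \<longrightarrow> v (Suc q) < v q \<and> v' q = v (Suc q) \<and> v' (Suc q) = v q)"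
    proof (cases "\<exists>i \<in> I. \<exists>x < L i. q = b i + x")
      case False
      then have "v' q = v q" "r q = Nop" using r out by blast+
      then show ?thesis by simp
    next
      case True
      then obtain i x where i: "i \<in> I" "x < L i" "q = b i + x" by blast
      obtain k f where p: "p i = (k, f)" by (cases "p i")
      have f: "Suc f < L i" using inside[OF i(1)] p by simp
      have st: "ostep (k, f) (win (b i) (L i) v) (win (b i) (L i) v')" using r i p by auto
      have rq: "r q = (if x = f then k else Nop)" using op[OF i(1,2)] i p by simp
      have rx: "r (q - 1) = k" if "x = Suc f" using op[OF i(1), of f] f i(3) that p by simp
      have pt: "win (b i) (L i) w y = w (b i + y)" if "y < L i" for w y using that by (simp add: win_def)
      show ?thesis
      proof (cases "x = f")
        case True
        have w: "win (b i) (L i) w f = w q" "win (b i) (L i) w (Suc f) = w (Suc q)" for w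
          using True i f by (auto simp: win_def)
        have qp: "q = 0 \<or> r (q - 1) = Nop \<Longrightarrow> True" by simp
        show ?thesis
        proof (cases k)
          case Nop
          then have "win (b i) (L i) v' f = win (b i) (L i) v f" using st by simp
          then show ?thesis using w rq True Nop by simp
        next
          case Free
          then have "win (b i) (L i) v' = win (b i) (L i) v \<or> win (b i) (L i) v' = swp f (win (b i) (L i) v)"
            using st by simp
          then have "v' q = v q \<and> v' (Suc q) = v (Suc q) \<or> v' q = v (Suc q) \<and> v' (Suc q) = v q"
            by (metis w swp_def fun_upd_other fun_upd_same n_not_Suc_n)
          then show ?thesis using rq True Free by simp
        next
          case Test
          then have "win (b i) (L i) v (Suc f) < win (b i) (L i) v f" "win (b i) (L i) v' = swp f (win (b i) (L i) v)"
            using st by simp_all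
          then have "v (Suc q) < v q \<and> v' q = v (Suc q) \<and> v' (Suc q) = v q"
            by (metis w swp_def fun_upd_other fun_upd_same n_not_Suc_n)
          then show ?thesis using rq True Test by simp
        qed
      next
        case False
        have "v' q = v q" if "q = 0 \<or> r (q - 1) = Nop"
        proof (cases "x = Suc f")
          case True
          then have "k = Nop" using rx that i(3) by auto
          then show ?thesis using st pt[OF i(2)] i(3) by (metis ostep.simps(1))
        next
          case F2: False
          have "win (b i) (L i) v' x = win (b i) (L i) v x"
            using st False F2 by (cases k) (auto simp: swp_def)
          then show ?thesis using pt[OF i(2)] i(3) by simp
        qed
        then show ?thesis using rq False by simp
      qed
    qed
  qed
qed

lemma rows_windows:
  fixes b L :: "'i \<Rightarrow> nat"
  assumes op: "\<And>i x l. i \<in> I \<Longrightarrow> x < L i \<Longrightarrow> l < len \<Longrightarrow>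
      r (s + l) (b i + x) = (if x = snd (p i ! l) then fst (p i ! l) else Nop)"
    and inside: "\<And>i x. i \<in> I \<Longrightarrow> x \<in> set (p i) \<Longrightarrow> Suc (snd x) < L i"
    and len: "\<And>i. i \<in> I \<Longrightarrow> length (p i) = len"
    and disj: "\<And>i j x y. i \<in> I \<Longrightarrow> j \<in> I \<Longrightarrow> x < L i \<Longrightarrow> y < L j \<Longrightarrow> b i + x = b j + y \<Longrightarrow> i = j"
    and out: "\<And>q l. l < len \<Longrightarrow> (\<And>i x. i \<in> I \<Longrightarrow> x < L i \<Longrightarrow> q \<noteq> b i + x) \<Longrightarrow> r (s + l) q = Nop"
  shows "rows r s len v v' \<longleftrightarrow> (\<forall>i \<in> I. run (p i) (win (b i) (L i) v) (win (b i) (L i) v')) \<and>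
     (\<forall>q. (\<forall>i \<in> I. \<forall>x < L i. q \<noteq> b i + x) \<longrightarrow> v' q = v q)"
  using op inside len out
proof (induction len arbitrary: s p v)
  case 0
  have "v' = v" if "\<forall>i \<in> I. win (b i) (L i) v' = win (b i) (L i) v"
     "\<forall>q. (\<forall>i \<in> I. \<forall>x < L i. q \<noteq> b i + x) \<longrightarrow> v' q = v q"
  proof
    fix q
    show "v' q = v q"
    proof (cases "\<exists>i \<in> I. \<exists>x < L i. q = b i + x")
      case True
      then obtain i x where "i \<in> I" "x < L i" "q = b i + x" by blast
      then show ?thesis using that(1) by (metis win_def)
    qed (use that(2) in blast)
  qed
  then show ?case using 0(3) by auto
next
  case (Suc len)
  let ?p = "\<lambda>i. hd (p i)" and ?ps = "\<lambda>i. tl (p i)"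
  have pc: "p i = ?p i # ?ps i" if "i \<in> I" for i using Suc.prems(3)[OF that] by (cases "p i") auto
  have rw: "row (r s) v u \<longleftrightarrow> (\<forall>i \<in> I. ostep (?p i) (win (b i) (L i) v) (win (b i) (L i) u)) \<and>
     (\<forall>q. (\<forall>i \<in> I. \<forall>x < L i. q \<noteq> b i + x) \<longrightarrow> u q = v q)" for u
  proof (rule row_windows)
    fix i x assume i: "i \<in> I" "x < L i"
    then have "p i ! 0 = ?p i" using pc by (metis nth_Cons_0)
    then show "r s (b i + x) = (if x = snd (?p i) then fst (?p i) else Nop)" using Suc.prems(1)[of i x 0] i by simp
  next
    fix i assume "i \<in> I" then show "Suc (snd (?p i)) < L i" using Suc.prems(2) pc by (metis list.set_intros(1))
  next
    fix q assume "\<And>i x. i \<in> I \<Longrightarrow> x < L i \<Longrightarrow> q \<noteq> b i + x"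
    then show "r s q = Nop" using Suc.prems(4)[of 0 q] by simp
  qed (use disj in blast)
  have rs: "rows r (Suc s) len u v' \<longleftrightarrow> (\<forall>i \<in> I. run (?ps i) (win (b i) (L i) u) (win (b i) (L i) v')) \<and>
     (\<forall>q. (\<forall>i \<in> I. \<forall>x < L i. q \<noteq> b i + x) \<longrightarrow> v' q = u q)" for u
  proof (rule Suc.IH)
    fix i x l assume i: "i \<in> I" "x < L i" "l < len"
    then have "p i ! Suc l = ?ps i ! l" using pc by (metis nth_Cons_Suc)
    then show "r (Suc s + l) (b i + x) = (if x = snd (?ps i ! l) then fst (?ps i ! l) else Nop)"
      using Suc.prems(1)[of i x "Suc l"] i by simp
  next
    fix i x assume "i \<in> I" "x \<in> set (?ps i)" then show "Suc (snd x) < L i"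
      using Suc.prems(2) pc by (metis list.set_intros(2))
  next
    fix i assume "i \<in> I" then show "length (?ps i) = len" using Suc.prems(3) by simp
  next
    fix q l assume "l < len" "\<And>i x. i \<in> I \<Longrightarrow> x < L i \<Longrightarrow> q \<noteq> b i + x"
    then show "r (Suc s + l) q = Nop" using Suc.prems(4)[of "Suc l" q] by simp
  qed
  show ?case
  proof
    assume "rows r s (Suc len) v v'"
    then obtain u where u: "row (r s) v u" "rows r (Suc s) len u v'" by auto
    have "run (p i) (win (b i) (L i) v) (win (b i) (L i) v')" if "i \<in> I" for i
      using u rw rs that by (subst pc[OF that]) auto
    then show "(\<forall>i \<in> I. run (p i) (win (b i) (L i) v) (win (b i) (L i) v')) \<and>
     (\<forall>q. (\<forall>i \<in> I. \<forall>x < L i. q \<noteq> b i + x) \<longrightarrow> v' q = v q)" using u rw rs by auto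
  next
    assume r: "(\<forall>i \<in> I. run (p i) (win (b i) (L i) v) (win (b i) (L i) v')) \<and>
     (\<forall>q. (\<forall>i \<in> I. \<forall>x < L i. q \<noteq> b i + x) \<longrightarrow> v' q = v q)"
    have "\<forall>i \<in> I. \<exists>u. ostep (?p i) (win (b i) (L i) v) u \<and> run (?ps i) u (win (b i) (L i) v')"
    proof
      fix i assume i: "i \<in> I"
      have "run (?p i # ?ps i) (win (b i) (L i) v) (win (b i) (L i) v')" using r i pc[OF i] by metis
      then show "\<exists>u. ostep (?p i) (win (b i) (L i) v) u \<and> run (?ps i) u (win (b i) (L i) v')" by simp
    qed
    then obtain U where U: "\<And>i. i \<in> I \<Longrightarrow> ostep (?p i) (win (b i) (L i) v) (U i)"
       "\<And>i. i \<in> I \<Longrightarrow> run (?ps i) (U i) (win (b i) (L i) v')" by metis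
    \<comment> \<open>The global state after the first round is glued from the local ones. The
      chosen window is unique by disjointness.\<close>
    define u where "u q = (if \<exists>i \<in> I. \<exists>x < L i. q = b i + x
       then (let i = (SOME i. i \<in> I \<and> (\<exists>x < L i. q = b i + x)) in U i (q - b i)) else v q)" for q
    have uw: "win (b i) (L i) u = U i" if i: "i \<in> I" for i
    proof
      fix x
      show "win (b i) (L i) u x = U i x"
      proof (cases "x < L i")
        case True
        have "(SOME j. j \<in> I \<and> (\<exists>y < L j. b i + x = b j + y)) = i"
          by (rule some_equality) (use i True disj in blast)+
        moreover have "\<exists>j \<in> I. \<exists>y < L j. b i + x = b j + y" using i True by blast
        ultimately show ?thesis using True by (simp add: win_def u_def)
      next
        case False
        then have "U i x = win (b i) (L i) v x"
          using ostep_outside[OF U(1)[OF i], of "L i" x] Suc.prems(2)[OF i] pc[OF i]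
          by (metis leI list.set_intros(1))
        then show ?thesis using False by (simp add: win_def)
      qed
    qed
    have uo: "u q = v q" if "\<forall>i \<in> I. \<forall>x < L i. q \<noteq> b i + x" for q using that by (auto simp: u_def)
    have "row (r s) v u" unfolding rw using U uw uo by auto
    moreover have "rows r (Suc s) len u v'" unfolding rs using U uw uo r by auto
    ultimately show "rows r s (Suc len) v v'" by auto
  qed
qed


section \<open>Tilings as rounds of operations\<close>

text \<open>Operations only compare and exchange entries, so adding a constant to all values changes
  nothing. This carries statements about \<open>enc\<close> over to windows away from the
  origin.\<close>

lemma run_shift:
  "run \<Omega> (\<lambda>x. b + u x) w \<longleftrightarrow> (\<exists>u'. w = (\<lambda>x. b + u' x) \<and> run \<Omega> u u')"
proof (induction \<Omega> arbitrary: u)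
  case Nil
  show ?case by auto
next
  case (Cons y \<Omega>)
  have sw: "swp q (\<lambda>x. b + u x) = (\<lambda>x. b + swp q u x)" for q by (auto simp: swp_def)
  obtain k q where y: "y = (k, q)" by (cases y)
  have "ostep y (\<lambda>x. b + u x) z \<longleftrightarrow> (\<exists>u'. z = (\<lambda>x. b + u' x) \<and> ostep y u u')" for z
    unfolding y by (cases k) (auto simp: sw)
  then show ?case using Cons by auto blast+
qed

lemma run_Nops: "run (\<Omega> @ replicate l (Nop, j)) v v' \<longleftrightarrow> run \<Omega> v v'"
proof -
  have "run (replicate l (Nop, j)) v v' \<longleftrightarrow> v' = v" for v by (induction l) auto
  then show ?thesis by (auto simp: run_append)
qed

definition sub :: "nat \<Rightarrow> nat \<Rightarrow> nat set \<Rightarrow> nat set" where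
  "sub b m A = {i. i < m \<and> b + i \<in> A}"

lemma win_enc: "win (2 * b) (2 * m) (enc A) = (\<lambda>x. 2 * b + enc (sub b m A) x)"
proof
  fix x
  have "(2 * b + x) div 2 = b + x div 2" by simp
  then show "win (2 * b) (2 * m) (enc A) x = 2 * b + enc (sub b m A) x"
    by (auto simp: win_def enc_def sub_def dest: odd_pos)
qed

lemma enc_restrict: "x < 2 * m \<Longrightarrow> enc (sub 0 m A) x = enc A x"
  by (auto simp: enc_def sub_def)

lemma enc_empty: "enc {} = id"
  by (auto simp: enc_def)

text \<open>The specialization of \<open>rows_windows\<close> to windows of \<open>m\<close> whole
  bits starting at bit \<open>\<beta> i\<close>. Halving positions reduces disjointness of the
  windows to disjointness of the blocks of bits.\<close>

lemma phase_sound: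
  fixes \<beta> :: "nat \<Rightarrow> nat"
  assumes op: "\<And>i x l. i \<in> I \<Longrightarrow> x < 2 * m \<Longrightarrow> l < len \<Longrightarrow>
      r (s + l) (2 * \<beta> i + x) = (if x = snd (p i ! l) then fst (p i ! l) else Nop)"
    and inside: "\<And>i x. i \<in> I \<Longrightarrow> x \<in> set (p i) \<Longrightarrow> Suc (snd x) < 2 * m"
    and len: "\<And>i. i \<in> I \<Longrightarrow> length (p i) = len"
    and disj: "\<And>i j x y. i \<in> I \<Longrightarrow> j \<in> I \<Longrightarrow> x < m \<Longrightarrow> y < m \<Longrightarrow> \<beta> i + x = \<beta> j + y \<Longrightarrow> i = j"
    and out: "\<And>q l. l < len \<Longrightarrow> (\<And>i x. i \<in> I \<Longrightarrow> x < 2 * m \<Longrightarrow> q \<noteq> 2 * \<beta> i + x) \<Longrightarrow> r (s + l) q = Nop"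
  shows "rows r s len v v' \<longleftrightarrow>
       (\<forall>i \<in> I. run (p i) (win (2 * \<beta> i) (2 * m) v) (win (2 * \<beta> i) (2 * m) v')) \<and>
       (\<forall>q. (\<forall>i \<in> I. \<forall>x < 2 * m. q \<noteq> 2 * \<beta> i + x) \<longrightarrow> v' q = v q)"
proof (rule rows_windows[where b = "\<lambda>i. 2 * \<beta> i" and L = "\<lambda>i. 2 * m"])
  fix i j x y assume a: "i \<in> I" "j \<in> I" "x < 2 * m" "y < 2 * m" "2 * \<beta> i + x = 2 * \<beta> j + y"
  have "\<beta> i + x div 2 = (2 * \<beta> i + x) div 2" by simp
  also have "\<dots> = (2 * \<beta> j + y) div 2" using a(5) by simp
  also have "\<dots> = \<beta> j + y div 2" by simp
  finally have "\<beta> i + x div 2 = \<beta> j + y div 2" .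
  moreover have "x div 2 < m" "y div 2 < m" using a by auto
  ultimately show "i = j" using disj a by blast
qed (use op inside len out in auto)

lemma phase_enc:
  fixes \<beta> :: "nat \<Rightarrow> nat"
  assumes ph: "rows r s len (enc A) v' \<longleftrightarrow>
       (\<forall>i \<in> I. run (p i) (win (2 * \<beta> i) (2 * m) (enc A)) (win (2 * \<beta> i) (2 * m) v')) \<and>
       (\<forall>q. (\<forall>i \<in> I. \<forall>x < 2 * m. q \<noteq> 2 * \<beta> i + x) \<longrightarrow> v' q = enc A q)"
    and disj: "\<And>i j x y. i \<in> I \<Longrightarrow> j \<in> I \<Longrightarrow> x < m \<Longrightarrow> y < m \<Longrightarrow> \<beta> i + x = \<beta> j + y \<Longrightarrow> i = j"
    and spec: "\<And>i B v'. i \<in> I \<Longrightarrow> run (p i) (enc B) v' \<Longrightarrow> \<exists>B'. v' = enc B' \<and> R i B B'"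
    and rows: "rows r s len (enc A) v'"
  shows "\<exists>A'. v' = enc A' \<and> (\<forall>i \<in> I. \<exists>B'. sub (\<beta> i) m A' = sub 0 m B' \<and> R i (sub (\<beta> i) m A) B') \<and>
     (\<forall>y. (\<forall>i \<in> I. \<forall>x < m. y \<noteq> \<beta> i + x) \<longrightarrow> (y \<in> A' \<longleftrightarrow> y \<in> A))"
proof -
  have "\<forall>i \<in> I. \<exists>B'. win (2 * \<beta> i) (2 * m) v' = (\<lambda>x. 2 * \<beta> i + enc B' x) \<and> R i (sub (\<beta> i) m A) B'"
  proof
    fix i assume i: "i \<in> I"
    then have "run (p i) (\<lambda>x. 2 * \<beta> i + enc (sub (\<beta> i) m A) x) (win (2 * \<beta> i) (2 * m) v')"
      using rows ph by (simp add: win_enc)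
    then obtain u' where u': "win (2 * \<beta> i) (2 * m) v' = (\<lambda>x. 2 * \<beta> i + u' x)"
        "run (p i) (enc (sub (\<beta> i) m A)) u'"
      unfolding run_shift by blast
    from spec[OF i u'(2)] u'(1)
    show "\<exists>B'. win (2 * \<beta> i) (2 * m) v' = (\<lambda>x. 2 * \<beta> i + enc B' x) \<and> R i (sub (\<beta> i) m A) B'" by auto
  qed
  then obtain B where B: "\<And>i. i \<in> I \<Longrightarrow> win (2 * \<beta> i) (2 * m) v' = (\<lambda>x. 2 * \<beta> i + enc (B i) x)"
    "\<And>i. i \<in> I \<Longrightarrow> R i (sub (\<beta> i) m A) (B i)" by metis
  \<comment> \<open>Inside the windows the final bits are those of the local results, outside they
    are the old ones. The local set \<open>B i\<close> may contain numbers from \<open>m\<close> on,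
    which have no meaning in the window; therefore only its restriction enters.\<close>
  define A' where "A' = {y. (\<exists>i \<in> I. \<exists>x < m. y = \<beta> i + x \<and> x \<in> B i) \<or> (\<forall>i \<in> I. \<forall>x < m. y \<noteq> \<beta> i + x) \<and> y \<in> A}"
  have inA': "\<beta> i + x \<in> A' \<longleftrightarrow> x \<in> B i" if "i \<in> I" "x < m" for i x
  proof -
    have "x = x' \<and> i = j" if "j \<in> I" "x' < m" "\<beta> i + x = \<beta> j + x'" for j x'
      using disj[of i j x x'] \<open>i \<in> I\<close> \<open>x < m\<close> that by auto
    then show ?thesis using that unfolding A'_def by blast
  qed
  have sub: "sub (\<beta> i) m A' = sub 0 m (B i)" if "i \<in> I" for i using inA'[OF that] by (auto simp: sub_def)
  have outA': "y \<in> A' \<longleftrightarrow> y \<in> A" if "\<forall>i \<in> I. \<forall>x < m. y \<noteq> \<beta> i + x" for y using that unfolding A'_def by blast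
  have "v' = enc A'"
  proof
    fix q
    show "v' q = enc A' q"
    proof (cases "\<exists>i \<in> I. \<exists>x < 2 * m. q = 2 * \<beta> i + x")
      case True
      then obtain i x where i: "i \<in> I" "x < 2 * m" "q = 2 * \<beta> i + x" by blast
      then have "v' q = 2 * \<beta> i + enc (B i) x" using fun_cong[OF B(1)[OF i(1)], of x] by (simp add: win_def)
      also have "\<dots> = 2 * \<beta> i + enc (sub (\<beta> i) m A') x" using enc_restrict[OF i(2)] sub[OF i(1)] by simp
      also have "\<dots> = enc A' q" using fun_cong[OF win_enc[of "\<beta> i" m A'], of x] i by (simp add: win_def)
      finally show ?thesis .
    next
      case False
      then have "v' q = enc A q" using rows ph by blast
      moreover have "\<forall>i \<in> I. \<forall>x < m. q div 2 \<noteq> \<beta> i + x"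
      proof (intro ballI allI impI notI)
        fix i x assume ix: "i \<in> I" "x < m" "q div 2 = \<beta> i + x"
        then have "q = 2 * \<beta> i + (2 * x + q mod 2)" by presburger
        moreover have "2 * x + q mod 2 < 2 * m" using ix(2) by presburger
        ultimately show False using False ix(1) by blast
      qed
      then have "q div 2 \<in> A' \<longleftrightarrow> q div 2 \<in> A" by (rule outA')
      ultimately show ?thesis by (simp add: enc_def)
    qed
  qed
  then show ?thesis using sub B(2) outA' by blast
qed

lemma phase_complete:
  fixes \<beta> :: "nat \<Rightarrow> nat"
  assumes ph: "rows r s len (enc A) (enc A') \<longleftrightarrow>
       (\<forall>i \<in> I. run (p i) (win (2 * \<beta> i) (2 * m) (enc A)) (win (2 * \<beta> i) (2 * m) (enc A'))) \<and>
       (\<forall>q. (\<forall>i \<in> I. \<forall>x < 2 * m. q \<noteq> 2 * \<beta> i + x) \<longrightarrow> enc A' q = enc A q)"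
    and run: "\<And>i. i \<in> I \<Longrightarrow> run (p i) (enc (sub (\<beta> i) m A)) (enc (sub (\<beta> i) m A'))"
    and out: "\<And>y. (\<And>i x. i \<in> I \<Longrightarrow> x < m \<Longrightarrow> y \<noteq> \<beta> i + x) \<Longrightarrow> y \<in> A' \<longleftrightarrow> y \<in> A"
  shows "rows r s len (enc A) (enc A')"
  unfolding ph
proof (intro conjI ballI allI impI)
  fix i assume "i \<in> I"
  then show "run (p i) (win (2 * \<beta> i) (2 * m) (enc A)) (win (2 * \<beta> i) (2 * m) (enc A'))"
    unfolding win_enc run_shift using run by blast
next
  fix q assume q: "\<forall>i \<in> I. \<forall>x < 2 * m. q \<noteq> 2 * \<beta> i + x"
  have "q div 2 \<noteq> \<beta> i + x" if "i \<in> I" "x < m" for i x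
  proof
    assume "q div 2 = \<beta> i + x"
    then have "q = 2 * \<beta> i + (2 * x + q mod 2)" by presburger
    moreover have "2 * x + q mod 2 < 2 * m" using that(2) by presburger
    ultimately show False using q that(1) by blast
  qed
  then have "q div 2 \<in> A' \<longleftrightarrow> q div 2 \<in> A" using out by blast
  then show "enc A' q = enc A q" by (simp add: enc_def)
qed


section \<open>Specifications of the programs that act on a single window\<close>

definition window_ok :: "nat \<Rightarrow> (nat \<Rightarrow> nat \<Rightarrow> nat \<Rightarrow> nat \<Rightarrow> bool) \<Rightarrow> (opk \<times> nat) list \<Rightarrow> bool" where
  "window_ok d \<phi> \<Omega> \<longleftrightarrow> (\<forall>x \<in> set \<Omega>. Suc (snd x) < 8 * d + 4) \<and>
    (\<forall>A v'. run \<Omega> (enc A) v' \<longrightarrow> (\<exists>A'. v' = enc A' \<and> (\<forall>x<d. \<forall>y<d. x \<in> A' \<and> 2 * d + 1 + y \<in> A' \<longrightarrow>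
        (\<exists>a b. \<phi> a b x y \<and> a < d \<and> b < d \<and> a \<in> A \<and> 2 * d + 1 + b \<in> A)))) \<and>
    (\<forall>a b a' b'. \<phi> a b a' b' \<and> a < d \<and> b < d \<and> a' < d \<and> b' < d \<longrightarrow>
        run \<Omega> (enc {a, 2 * d + 1 + b}) (enc {a', 2 * d + 1 + b'}))"

lemma window_okD:
  "window_ok d \<phi> \<Omega> \<Longrightarrow> run \<Omega> (enc A) v' \<Longrightarrow> \<exists>A'. v' = enc A' \<and> (\<forall>x<d. \<forall>y<d. x \<in> A' \<and> 2 * d + 1 + y \<in> A' \<longrightarrow>
        (\<exists>a b. \<phi> a b x y \<and> a < d \<and> b < d \<and> a \<in> A \<and> 2 * d + 1 + b \<in> A))"
  by (simp add: window_ok_def)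

lemma window_ok_exists: "\<exists>\<Omega>. window_ok d \<phi> \<Omega>"
proof -
  have "finite {(a, b, a', b'). \<phi> a b a' b' \<and> a < d \<and> b < d \<and> a' < d \<and> b' < d}" (is "finite ?Q")
    by (rule finite_subset[of _ "{..<d} \<times> {..<d} \<times> {..<d} \<times> {..<d}"]) auto
  then obtain qs where qs: "set qs = ?Q" using finite_list by blast
  obtain \<Omega> where \<Omega>: "\<forall>x \<in> set \<Omega>. Suc (snd x) < 8 * d + 4"
    "\<And>A v'. run \<Omega> (enc A) v' \<Longrightarrow> \<exists>A'. v' = enc A' \<and> (\<forall>x<d. \<forall>y<d. x \<in> A' \<and> 2 * d + 1 + y \<in> A' \<longrightarrow>
        (\<exists>a b. (a, b, x, y) \<in> set qs \<and> a \<in> A \<and> 2 * d + 1 + b \<in> A))"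
    "\<And>a b a' b'. (a, b, a', b') \<in> set qs \<Longrightarrow> run \<Omega> (enc {a, 2 * d + 1 + b}) (enc {a', 2 * d + 1 + b'})"
    by (rule window_ops[of qs d]) (use qs in auto)
  have "window_ok d \<phi> \<Omega>" unfolding window_ok_def
  proof (intro conjI allI impI)
    fix A v' assume "run \<Omega> (enc A) v'"
    from \<Omega>(2)[OF this] obtain A' where "v' = enc A'" "\<forall>x<d. \<forall>y<d. x \<in> A' \<and> 2 * d + 1 + y \<in> A' \<longrightarrow>
        (\<exists>a b. (a, b, x, y) \<in> set qs \<and> a \<in> A \<and> 2 * d + 1 + b \<in> A)" by blast
    then show "\<exists>A'. v' = enc A' \<and> (\<forall>x<d. \<forall>y<d. x \<in> A' \<and> 2 * d + 1 + y \<in> A' \<longrightarrow>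
        (\<exists>a b. \<phi> a b x y \<and> a < d \<and> b < d \<and> a \<in> A \<and> 2 * d + 1 + b \<in> A))"
      unfolding qs by (intro exI[of _ A']) blast
  qed (use \<Omega>(1,3) qs in auto)
  then show ?thesis by blast
qed

text \<open>Soundness starts from an arbitrary \<open>A\<close> and constrains only those symbols
  that are present in both halves; this matches the way rows are read later. The bound
  \<open>8 * d + 4\<close> is two positions for each of the \<open>4 * d + 2\<close> bits of a
  window.\<close>

definition init_ok :: "nat \<Rightarrow> (nat \<Rightarrow> bool) \<Rightarrow> (opk \<times> nat) list \<Rightarrow> bool" where
  "init_ok d P \<Omega> \<longleftrightarrow> (\<forall>x \<in> set \<Omega>. Suc (snd x) < 8 * d + 4) \<and>
    (\<forall>A v'. run \<Omega> (enc A) v' \<longrightarrow> (\<exists>A'. v' = enc A' \<and>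
        (\<forall>x<d. \<forall>y<d. x \<in> A' \<and> 2 * d + 1 + y \<in> A' \<longrightarrow> x = y \<and> P x))) \<and>
    (\<forall>a<d. P a \<longrightarrow> run \<Omega> (enc {}) (enc {a, 2 * d + 1 + a}))"

lemma init_ok_exists:
  assumes "0 < d" shows "\<exists>\<Omega>. init_ok d P \<Omega>"
proof -
  \<comment> \<open>Symbol 0 is a dummy: it is written into both halves, and this window program
    replaces it by any permitted symbol. The right-hand side of every rule is a permitted symbol in
    both halves, so soundness does not depend on the dummy being present.\<close>
  obtain \<Omega> where \<Omega>: "window_ok d (\<lambda>a b x y. a = 0 \<and> b = 0 \<and> x = y \<and> P x) \<Omega>" using window_ok_exists by blast
  have r: "realized (4 * d + 2) (r_one j) [(Free, 2 * j)]" if "j < 4 * d + 2" for j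
    using that unfolding realized_def by (auto simp: r_one_def swp_enc insert_absorb)
  have r2: "realized (4 * d + 2) (rcomp (r_one 0) (r_one (2 * d + 1))) ([(Free, 2 * 0)] @ [(Free, 2 * (2 * d + 1))])"
    by (intro realized_rcomp r monotonic_gates) auto
  let ?\<Omega> = "([(Free, 2 * 0)] @ [(Free, 2 * (2 * d + 1))]) @ \<Omega>"
  have "init_ok d P ?\<Omega>" unfolding init_ok_def
  proof (intro conjI allI impI ballI)
    fix x assume "x \<in> set ?\<Omega>"
    then show "Suc (snd x) < 8 * d + 4" using \<Omega> unfolding window_ok_def by auto
  next
    fix A v' assume "run ?\<Omega> (enc A) v'"
    then obtain u where u: "run ([(Free, 2 * 0)] @ [(Free, 2 * (2 * d + 1))]) (enc A) u" "run \<Omega> u v'"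
      unfolding run_append by blast
    then obtain A1 where "u = enc A1" using r2 unfolding realized_def by blast
    then show "\<exists>A'. v' = enc A' \<and> (\<forall>x<d. \<forall>y<d. x \<in> A' \<and> 2 * d + 1 + y \<in> A' \<longrightarrow> x = y \<and> P x)"
      using u(2) \<Omega> unfolding window_ok_def by blast
  next
    fix a assume "a < d" "P a"
    then have "run \<Omega> (enc {0, 2 * d + 1 + 0}) (enc {a, 2 * d + 1 + a})"
      using \<Omega> assms unfolding window_ok_def by blast
    moreover have "{0, 2 * d + 1} \<in> rcomp (r_one 0) (r_one (2 * d + 1)) {}"
      by (auto simp: rcomp_def r_one_def)
    then have "run ([(Free, 2 * 0)] @ [(Free, 2 * (2 * d + 1))]) (enc {}) (enc {0, 2 * d + 1})"
      using r2 unfolding realized_def by blast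
    ultimately show "run ?\<Omega> (enc {}) (enc {a, 2 * d + 1 + a})" unfolding run_append by (metis add_0_right)
  qed
  then show ?thesis by blast
qed

definition final_ok :: "nat \<Rightarrow> (nat \<Rightarrow> bool) \<Rightarrow> (opk \<times> nat) list \<Rightarrow> bool" where
  "final_ok d P \<Omega> \<longleftrightarrow> (\<forall>x \<in> set \<Omega>. Suc (snd x) < 8 * d + 4) \<and>
    (\<forall>A v'. run \<Omega> (enc A) v' \<longrightarrow> (\<exists>A'. v' = enc A' \<and> (\<exists>a<d. P a \<and> a \<in> A \<and> 2 * d + 1 + a \<in> A))) \<and>
    (\<forall>a<d. P a \<longrightarrow> run \<Omega> (enc {a, 2 * d + 1 + a}) (enc {}))"

lemma final_ok_exists:
  assumes "0 < d" shows "\<exists>\<Omega>. final_ok d P \<Omega>"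
proof -
  \<comment> \<open>The counterpart of the initial program: an accepted symbol is replaced by symbol
    0 in both halves, and two tests then force that this has happened. These tests are where runs of
    bad tilings get stuck.\<close>
  obtain \<Omega> where \<Omega>: "window_ok d (\<lambda>a b x y. a = b \<and> P a \<and> x = 0 \<and> y = 0) \<Omega>" using window_ok_exists by blast
  have t: "run [(Test, 2 * j)] (enc A) v \<longleftrightarrow> j \<in> A \<and> v = enc (A - {j})" for j A v
    by (auto simp: enc_less swp_enc)
  let ?T = "[(Test, 2 * 0)] @ [(Test, 2 * (2 * d + 1))]"
  have T: "run ?T (enc A) v \<longleftrightarrow> 0 \<in> A \<and> 2 * d + 1 \<in> A \<and> v = enc (A - {0} - {2 * d + 1})" for A v
  proof -
    have "run ?T (enc A) v \<longleftrightarrow> (\<exists>u. run [(Test, 2 * 0)] (enc A) u \<and> run [(Test, 2 * (2 * d + 1))] u v)"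
      by (rule run_append)
    also have "\<dots> \<longleftrightarrow> 0 \<in> A \<and> run [(Test, 2 * (2 * d + 1))] (enc (A - {0})) v"
      unfolding t[of 0 A] by blast
    also have "\<dots> \<longleftrightarrow> 0 \<in> A \<and> 2 * d + 1 \<in> A - {0} \<and> v = enc (A - {0} - {2 * d + 1})"
      unfolding t ..
    finally show ?thesis by simp
  qed
  have "final_ok d P (\<Omega> @ ?T)" unfolding final_ok_def
  proof (intro conjI allI impI ballI)
    fix x assume "x \<in> set (\<Omega> @ ?T)"
    then show "Suc (snd x) < 8 * d + 4" using \<Omega> unfolding window_ok_def by auto
  next
    fix A v' assume "run (\<Omega> @ ?T) (enc A) v'"
    then obtain u where u: "run \<Omega> (enc A) u" "run ?T u v'" unfolding run_append by blast
    then obtain A' where A': "u = enc A'" "\<forall>x<d. \<forall>y<d. x \<in> A' \<and> 2 * d + 1 + y \<in> A' \<longrightarrow>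
        (\<exists>a b. (a = b \<and> P a \<and> x = 0 \<and> y = 0) \<and> a < d \<and> b < d \<and> a \<in> A \<and> 2 * d + 1 + b \<in> A)"
      using \<Omega> unfolding window_ok_def by blast
    from u(2)[unfolded A' T] have "0 \<in> A'" "2 * d + 1 + 0 \<in> A'" "v' = enc (A' - {0} - {2 * d + 1})" by auto
    then show "\<exists>A'. v' = enc A' \<and> (\<exists>a<d. P a \<and> a \<in> A \<and> 2 * d + 1 + a \<in> A)" using A'(2) assms by blast
  next
    fix a assume "a < d" "P a"
    then have "run \<Omega> (enc {a, 2 * d + 1 + a}) (enc {0, 2 * d + 1 + 0})"
      using \<Omega> assms unfolding window_ok_def by blast
    moreover have "run ?T (enc {0, 2 * d + 1 + 0}) (enc {})" unfolding T by auto
    ultimately show "run (\<Omega> @ ?T) (enc {a, 2 * d + 1 + a}) (enc {})" unfolding run_append[of \<Omega>] by blast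
  qed
  then show ?thesis by blast
qed


definition lookup_op :: "(opk \<times> nat) list \<Rightarrow> nat \<Rightarrow> nat \<Rightarrow> opk" where
  "lookup_op \<Omega> c j = (if c < length \<Omega> \<and> snd (\<Omega> ! c) = j then fst (\<Omega> ! c) else Nop)"

text \<open>Block 0 of \<open>C\<close> rounds chooses the first row of tiles, each of the blocks \<open>1..N\<close> checks the horizontal
  constraints and replaces the row of tiles by the next one, and block \<open>N + 1\<close> checks the last row.
  Round 0 is reserved for fixing the initial state.\<close>

definition op_table :: "nat \<Rightarrow> nat \<Rightarrow> (opk \<times> nat) list \<Rightarrow> (opk \<times> nat) list \<Rightarrow> (opk \<times> nat) list \<Rightarrow> (opk \<times> nat) list
    \<Rightarrow> nat \<Rightarrow> bool \<Rightarrow> bool \<Rightarrow> nat \<Rightarrow> nat \<Rightarrow> opk" where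
  "op_table d C wI wH wV wF ph fi la c j =
    (if ph = 0 then if c = 0 then Nop else lookup_op wI (c - 1) j
     else if ph = 1 then
       if c < length wH then
         if 4 * d + 2 \<le> j then if la then Nop else lookup_op wH c (j - (4 * d + 2))
         else if fi then Nop else lookup_op wH c (j + (4 * d + 2))
       else lookup_op wV (c - length wH) j
     else lookup_op wF c j)"

text \<open>The programs \<open>wI\<close> and \<open>wF\<close> are one round shorter than a block:
  round 0 only fixes the initial permutation, and the last round has no successor that could carry
  out an operation. A horizontal check and a vertical replacement together fill one block.\<close>

locale tiling =
  fixes d n N C :: nat and H V :: "nat \<Rightarrow> nat \<Rightarrow> bool" and Ini :: "nat \<Rightarrow> nat \<Rightarrow> bool" and Acc :: "nat \<Rightarrow> bool"
    and wI :: "nat \<Rightarrow> (opk \<times> nat) list" and wH wV wF :: "(opk \<times> nat) list"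
  assumes d: "0 < d" and n: "2 \<le> n" and C: "2 \<le> C"
    and wI: "\<And>p. p < n \<Longrightarrow> init_ok d (Ini p) (wI p) \<and> length (wI p) = C - 1"
    and wH: "window_ok d (\<lambda>a b x y. x = a \<and> y = b \<and> H a b) wH"
    and wV: "window_ok d (\<lambda>a b x y. a = b \<and> x = y \<and> V a x) wV" "length wH + length wV = C"
    and wF: "final_ok d Acc wF" "length wF = C - 1"
begin

definition J :: nat where "J = 8 * d + 4"
definition m :: nat where "m = 4 * d + 2"
definition h :: nat where "h = 2 * d + 1"

definition ops :: "nat \<Rightarrow> nat \<Rightarrow> opk" where
  "ops r q = (if q div J < n then op_table d C (wI (q div J)) wH wV wF
     (if r div C = 0 then 0 else if r div C \<le> N then 1 else 2) (q div J = 0) (q div J = n - 1) (r mod C) (q mod J)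
     else Nop)"

lemma J_m: "J = 2 * m" "m = 2 * h" "0 < J" "0 < m" by (auto simp: J_def m_def h_def)

definition is_tiling :: "nat \<Rightarrow> (nat \<Rightarrow> nat \<Rightarrow> nat) \<Rightarrow> bool" where
  "is_tiling t \<tau> \<longleftrightarrow> (\<forall>s\<le>t. \<forall>p<n. \<tau> s p < d) \<and> (\<forall>p<n. Ini p (\<tau> 0 p)) \<and>
    (\<forall>s<t. \<forall>p. Suc p < n \<longrightarrow> H (\<tau> s p) (\<tau> s (Suc p))) \<and> (\<forall>s<t. \<forall>p<n. V (\<tau> s p) (\<tau> (Suc s) p))"

text \<open>Every column stores its tile twice. The right copy of a column is next to the left copy
  of its successor, so a window shifted by half a column sees both tiles of a horizontal
  constraint.\<close>

definition full :: "(nat \<Rightarrow> nat) \<Rightarrow> nat set" where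
  "full a = {y. \<exists>p<n. y = p * m + a p \<or> y = p * m + h + a p}"

lemma col_disj: "x < m \<Longrightarrow> y < m \<Longrightarrow> i * m + x = j * m + y \<Longrightarrow> i = (j::nat)"
  by (metis J_m(4) div_mult_self3 div_less add.left_neutral mult.commute add.commute less_nat_zero_code)

lemma div_J: "x < J \<Longrightarrow> (p * J + x) div J = p" "x < J \<Longrightarrow> (p * J + x) mod J = x"
  using J_m by auto

lemma pos_eq: "2 * (p * m) + x = p * J + x"
  by (simp add: J_m)

lemma outside_cols:
  assumes "\<And>i x. i < n \<Longrightarrow> x < 2 * m \<Longrightarrow> q \<noteq> 2 * (i * m) + x" shows "\<not> q div J < n"
proof
  assume *: "q div J < n"
  have "q mod J < 2 * m" using J_m by (metis mod_less_divisor)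
  moreover have "q = 2 * (q div J * m) + q mod J" using pos_eq by (metis div_mult_mod_eq)
  ultimately show False using assms * by blast
qed

lemma phase_I: "rows ops 1 (C - 1) v v' \<longleftrightarrow>
     (\<forall>i \<in> {..<n}. run (wI i) (win (2 * (i * m)) (2 * m) v) (win (2 * (i * m)) (2 * m) v')) \<and>
       (\<forall>q. (\<forall>i \<in> {..<n}. \<forall>x < 2 * m. q \<noteq> 2 * (i * m) + x) \<longrightarrow> v' q = v q)"
proof (rule phase_sound)
  fix i x l assume a: "i \<in> {..<n}" "x < 2 * m" "l < C - 1"
  then have l: "(1 + l) div C = 0" "(1 + l) mod C = 1 + l" by auto
  have x: "x < J" using a J_m by simp
  show "ops (1 + l) (2 * (i * m) + x) = (if x = snd (wI i ! l) then fst (wI i ! l) else Nop)"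
    unfolding ops_def pos_eq div_J[OF x] l using a wI[of i] by (auto simp: op_table_def lookup_op_def)
next
  fix i x assume "i \<in> {..<n}" "x \<in> set (wI i)"
  then show "Suc (snd x) < 2 * m" using wI[of i] unfolding init_ok_def m_def by auto
next
  fix q l assume "\<And>i x. i \<in> {..<n} \<Longrightarrow> x < 2 * m \<Longrightarrow> q \<noteq> 2 * (i * m) + x"
  then show "ops (1 + l) q = Nop" using outside_cols[of q] by (simp add: ops_def)
next
  fix i assume "i \<in> {..<n}" then show "length (wI i) = C - 1" using wI[of i] by simp
next
  fix i j x y assume "x < m" "y < m" "i * m + x = j * m + y"
  then show "i = j" by (rule col_disj)
qed

lemma phase_V:
  assumes "t < N"
  shows "rows ops (Suc t * C + length wH) (length wV) v v' \<longleftrightarrow>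
     (\<forall>i \<in> {..<n}. run wV (win (2 * (i * m)) (2 * m) v) (win (2 * (i * m)) (2 * m) v')) \<and>
       (\<forall>q. (\<forall>i \<in> {..<n}. \<forall>x < 2 * m. q \<noteq> 2 * (i * m) + x) \<longrightarrow> v' q = v q)"
proof (rule phase_sound)
  fix i x l assume a: "i \<in> {..<n}" "x < 2 * m" "l < length wV"
  then have l: "(Suc t * C + length wH + l) div C = Suc t" "(Suc t * C + length wH + l) mod C = length wH + l"
    using wV(2) C by (simp_all add: add.assoc del: mult_Suc)
  have x: "x < J" using a J_m by simp
  show "ops (Suc t * C + length wH + l) (2 * (i * m) + x) = (if x = snd (wV ! l) then fst (wV ! l) else Nop)"
    unfolding ops_def pos_eq div_J[OF x] l using a assms by (auto simp: op_table_def lookup_op_def)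
next
  fix x assume "x \<in> set wV"
  then show "Suc (snd x) < 2 * m" using wV(1) unfolding window_ok_def m_def by auto
next
  fix q l assume "\<And>i x. i \<in> {..<n} \<Longrightarrow> x < 2 * m \<Longrightarrow> q \<noteq> 2 * (i * m) + x"
  then show "ops (Suc t * C + length wH + l) q = Nop" using outside_cols[of q] by (simp add: ops_def)
next
  fix i j x y assume "x < m" "y < m" "i * m + x = j * m + y"
  then show "i = j" by (rule col_disj)
qed (rule refl)

lemma phase_F:
  "rows ops (Suc N * C) (C - 1) v v' \<longleftrightarrow>
     (\<forall>i \<in> {..<n}. run wF (win (2 * (i * m)) (2 * m) v) (win (2 * (i * m)) (2 * m) v')) \<and>
       (\<forall>q. (\<forall>i \<in> {..<n}. \<forall>x < 2 * m. q \<noteq> 2 * (i * m) + x) \<longrightarrow> v' q = v q)"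
proof (rule phase_sound)
  fix i x l assume a: "i \<in> {..<n}" "x < 2 * m" "l < C - 1"
  then have l: "(Suc N * C + l) div C = Suc N" "(Suc N * C + l) mod C = l"
    using C by (simp_all del: mult_Suc)
  have x: "x < J" using a J_m by simp
  show "ops (Suc N * C + l) (2 * (i * m) + x) = (if x = snd (wF ! l) then fst (wF ! l) else Nop)"
    unfolding ops_def pos_eq div_J[OF x] l using a wF(2) by (auto simp: op_table_def lookup_op_def)
next
  fix x assume "x \<in> set wF"
  then show "Suc (snd x) < 2 * m" using wF(1) unfolding final_ok_def m_def by auto
next
  fix q l assume "\<And>i x. i \<in> {..<n} \<Longrightarrow> x < 2 * m \<Longrightarrow> q \<noteq> 2 * (i * m) + x"
  then show "ops (Suc N * C + l) q = Nop" using outside_cols[of q] by (simp add: ops_def)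
next
  fix i j x y assume "x < m" "y < m" "i * m + x = j * m + y"
  then show "i = j" by (rule col_disj)
qed (rule wF(2))

lemma pos_eq_h: "2 * (p * m + h) + x = p * J + (m + x)"
proof -
  have "2 * (p * m + h) + x = p * (2 * m) + (2 * h + x)" by (simp add: distrib_left)
  then show ?thesis using J_m(1,2) by metis
qed

text \<open>A window shifted by half a column straddles the border of columns \<open>i\<close> and
  \<open>i + 1\<close>, hence there are only \<open>n - 1\<close> of them. The left half of the
  first column and the right half of the last one stay idle, which is the purpose of the flags
  \<open>fi\<close> and \<open>la\<close> in \<open>op_table\<close>.\<close>

lemma phase_H:
  assumes "t < N"
  shows "rows ops (Suc t * C) (length wH) v v' \<longleftrightarrow>
     (\<forall>i \<in> {..<n - 1}. run wH (win (2 * (i * m + h)) (2 * m) v) (win (2 * (i * m + h)) (2 * m) v')) \<and>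
       (\<forall>q. (\<forall>i \<in> {..<n - 1}. \<forall>x < 2 * m. q \<noteq> 2 * (i * m + h) + x) \<longrightarrow> v' q = v q)"
proof (rule phase_sound)
  have l: "(Suc t * C + l) div C = Suc t" "(Suc t * C + l) mod C = l" if "l < length wH" for l
    using wV(2) C that by (simp_all del: mult_Suc)
  {
    fix i x l assume a: "i \<in> {..<n - 1}" "x < 2 * m" "l < length wH"
    have q: "2 * (i * m + h) + x = (if x < m then i * J + (m + x) else Suc i * J + (x - m))"
      unfolding pos_eq_h using a(2) J_m(1) by auto
    have "m + x < J" if "x < m" using that J_m by simp
    note 1 = div_J[OF this]
    have "x - m < J" using a J_m by simp
    note 2 = div_J[OF this]
    show "ops (Suc t * C + l) (2 * (i * m + h) + x) = (if x = snd (wH ! l) then fst (wH ! l) else Nop)"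
    proof (cases "x < m")
      case True
      then have e: "2 * (i * m + h) + x = i * J + (m + x)" using q by simp
      show ?thesis unfolding e ops_def l[OF a(3)] 1[OF True]
        using a assms by (auto simp: op_table_def lookup_op_def m_def)
    next
      case False
      then have e: "2 * (i * m + h) + x = Suc i * J + (x - m)" using q by simp
      have "\<not> 4 * d + 2 \<le> x - m" "x - m + (4 * d + 2) = x" using False a(2) by (auto simp: m_def)
      then show ?thesis unfolding e ops_def l[OF a(3)] 2
        using a assms by (auto simp: op_table_def lookup_op_def)
    qed
  next
    fix q k assume k: "k < length wH" and q: "\<And>i x. i \<in> {..<n - 1} \<Longrightarrow> x < 2 * m \<Longrightarrow> q \<noteq> 2 * (i * m + h) + x"
    show "ops (Suc t * C + k) q = Nop"
    proof (cases "q div J < n")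
      case True
      have j: "q mod J < 2 * m" using J_m by (metis mod_less_divisor)
      show ?thesis
      proof (cases "m \<le> q mod J")
        case T2: True
        have "q = 2 * (q div J * m + h) + (q mod J - m)" unfolding pos_eq_h using T2 by simp
        moreover have "q mod J - m < 2 * m" using j by linarith
        ultimately have "\<not> q div J < n - 1" using q[of "q div J" "q mod J - m"] by blast
        then have "q div J = n - 1" using True by linarith
        then show ?thesis using T2 True k l assms by (simp add: ops_def op_table_def m_def)
      next
        case F2: False
        have "q div J = 0"
        proof (rule ccontr)
          assume "q div J \<noteq> 0"
          then obtain i where i: "q div J = Suc i" by (cases "q div J") auto
          have "q = q div J * J + q mod J" by simp
          then have "q = Suc i * J + q mod J" using i by simp
          then have "q = 2 * (i * m + h) + (q mod J + m)" unfolding pos_eq_h using J_m(1) by simp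
          moreover have "i < n - 1" "q mod J + m < 2 * m" using i True F2 by linarith+
          ultimately show False using q[of i "q mod J + m"] by blast
        qed
        then show ?thesis using F2 True k l assms by (simp add: ops_def op_table_def m_def)
      qed
    qed (simp add: ops_def)
  }
next
  fix x assume "x \<in> set wH"
  then show "Suc (snd x) < 2 * m" using wH unfolding window_ok_def m_def by auto
next
  fix i j x y assume "x < m" "y < m" "i * m + h + x = j * m + h + y"
  then show "i = j" using col_disj[of x y i j] by simp
qed auto


lemma mem_sub: "sub b m A' = sub 0 m B' \<Longrightarrow> x < m \<Longrightarrow> b + x \<in> A' \<longleftrightarrow> x \<in> B'"
  by (auto simp: sub_def set_eq_iff)

lemma lt_m: "x < d \<Longrightarrow> x < m" "x < d \<Longrightarrow> h + x < m"
  by (auto simp: m_def h_def)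

text \<open>On the soundness side a bit set need not be one-hot: a column may show several tiles or
  none. The invariants therefore speak about all readings \<open>a\<close> of the set, where a tile
  counts only if both of its copies are present.\<close>

definition holds :: "nat set \<Rightarrow> (nat \<Rightarrow> nat) \<Rightarrow> bool" where
  "holds A a \<longleftrightarrow> (\<forall>p<n. a p < d \<and> p * m + a p \<in> A \<and> p * m + h + a p \<in> A)"

lemma init_sound:
  assumes "rows ops 1 (C - 1) id v"
  shows "\<exists>A. v = enc A \<and> (\<forall>a. holds A a \<longrightarrow> (\<forall>p<n. Ini p (a p)))"
proof -
  have rw: "rows ops 1 (C - 1) (enc {}) v" using assms by (simp add: enc_empty)
  have "\<exists>A'. v = enc A' \<and> (\<forall>i \<in> {..<n}. \<exists>B'. sub (i * m) m A' = sub 0 m B' \<and>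
       (\<forall>x<d. \<forall>y<d. x \<in> B' \<and> h + y \<in> B' \<longrightarrow> x = y \<and> Ini i x)) \<and>
     (\<forall>y. (\<forall>i \<in> {..<n}. \<forall>x < m. y \<noteq> i * m + x) \<longrightarrow> (y \<in> A' \<longleftrightarrow> y \<in> {}))"
  proof (rule phase_enc[OF phase_I _ _ rw])
    fix i B v' assume "i \<in> {..<n}" "run (wI i) (enc B) v'"
    then show "\<exists>B'. v' = enc B' \<and> (\<forall>x<d. \<forall>y<d. x \<in> B' \<and> h + y \<in> B' \<longrightarrow> x = y \<and> Ini i x)"
      using wI[of i] unfolding init_ok_def h_def by blast
  qed (rule col_disj)
  then obtain A where A: "v = enc A" "\<forall>i \<in> {..<n}. \<exists>B'. sub (i * m) m A = sub 0 m B' \<and>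
       (\<forall>x<d. \<forall>y<d. x \<in> B' \<and> h + y \<in> B' \<longrightarrow> x = y \<and> Ini i x)" by blast
  have "Ini p (a p)" if ho: "holds A a" and p: "p < n" for a p
  proof -
    obtain B' where B': "sub (p * m) m A = sub 0 m B'"
       "\<forall>x<d. \<forall>y<d. x \<in> B' \<and> h + y \<in> B' \<longrightarrow> x = y \<and> Ini p x" using A(2) p by blast
    have a: "a p < d" "p * m + a p \<in> A" "p * m + (h + a p) \<in> A"
      using ho p by (auto simp: holds_def add.assoc)
    have "a p \<in> B'" "h + a p \<in> B'" using mem_sub[OF B'(1)] a lt_m[OF a(1)] by auto
    then show ?thesis using B'(2) a(1) by blast
  qed
  then show ?thesis using A(1) by blast
qed

lemma H_sound:
  assumes t: "t < N" and rw: "rows ops (Suc t * C) (length wH) (enc A) v"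
  shows "\<exists>A'. v = enc A' \<and> (\<forall>a. holds A' a \<longrightarrow> holds A a \<and> (\<forall>p. Suc p < n \<longrightarrow> H (a p) (a (Suc p))))"
proof -
  have "\<exists>A'. v = enc A' \<and> (\<forall>i \<in> {..<n - 1}. \<exists>B'. sub (i * m + h) m A' = sub 0 m B' \<and>
       (\<forall>x<d. \<forall>y<d. x \<in> B' \<and> h + y \<in> B' \<longrightarrow> H x y \<and> x \<in> sub (i * m + h) m A \<and> h + y \<in> sub (i * m + h) m A)) \<and>
     (\<forall>y. (\<forall>i \<in> {..<n - 1}. \<forall>x < m. y \<noteq> i * m + h + x) \<longrightarrow> (y \<in> A' \<longleftrightarrow> y \<in> A))"
  proof (rule phase_enc[OF phase_H[OF t] _ _ rw])
    fix i B v' assume "run wH (enc B) v'"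
    from window_okD[OF wH this] obtain B' where "v' = enc B'"
      "\<forall>x<d. \<forall>y<d. x \<in> B' \<and> h + y \<in> B' \<longrightarrow>
        (\<exists>a b. (x = a \<and> y = b \<and> H a b) \<and> a < d \<and> b < d \<and> a \<in> B \<and> h + b \<in> B)"
      unfolding h_def by (elim exE conjE)
    then show "\<exists>B'. v' = enc B' \<and> (\<forall>x<d. \<forall>y<d. x \<in> B' \<and> h + y \<in> B' \<longrightarrow> H x y \<and> x \<in> B \<and> h + y \<in> B)"
      by (intro exI[of _ B']) simp
  next
    fix i j x y assume "x < m" "y < m" "i * m + h + x = j * m + h + y"
    then show "i = j" using col_disj[of x y i j] by simp
  qed
  then obtain A' where A': "v = enc A'" "\<forall>i \<in> {..<n - 1}. \<exists>B'. sub (i * m + h) m A' = sub 0 m B' \<and>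
       (\<forall>x<d. \<forall>y<d. x \<in> B' \<and> h + y \<in> B' \<longrightarrow> H x y \<and> x \<in> sub (i * m + h) m A \<and> h + y \<in> sub (i * m + h) m A)"
     "\<forall>y. (\<forall>i \<in> {..<n - 1}. \<forall>x < m. y \<noteq> i * m + h + x) \<longrightarrow> (y \<in> A' \<longleftrightarrow> y \<in> A)" by blast
  have "holds A a \<and> (\<forall>p. Suc p < n \<longrightarrow> H (a p) (a (Suc p)))" if a: "holds A' a" for a
  proof -
    have step: "p * m + h + (h + x) = Suc p * m + x" for p x using J_m(2) by simp
    have pair: "H (a p) (a (Suc p)) \<and> p * m + h + a p \<in> A \<and> Suc p * m + a (Suc p) \<in> A" if p: "Suc p < n" for p
    proof -
      obtain B' where B': "sub (p * m + h) m A' = sub 0 m B'"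
        "\<forall>x<d. \<forall>y<d. x \<in> B' \<and> h + y \<in> B' \<longrightarrow> H x y \<and> x \<in> sub (p * m + h) m A \<and> h + y \<in> sub (p * m + h) m A"
      proof -
        have "p \<in> {..<n - 1}" using p by auto
        from bspec[OF A'(2) this] show ?thesis using that by blast
      qed
      have 1: "a p < d" "p * m + h + a p \<in> A'" using a p by (auto simp: holds_def)
      have 2: "a (Suc p) < d" "p * m + h + (h + a (Suc p)) \<in> A'" using a p unfolding step by (auto simp: holds_def)
      have "a p \<in> B'" "h + a (Suc p) \<in> B'"
        using mem_sub[OF B'(1)] 1 2 lt_m(1)[OF 1(1)] lt_m(2)[OF 2(1)] by auto
      then have "H (a p) (a (Suc p))" "a p \<in> sub (p * m + h) m A" "h + a (Suc p) \<in> sub (p * m + h) m A"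
        using B'(2) 1(1) 2(1) by blast+
      then show ?thesis unfolding sub_def mem_Collect_eq step by blast
    qed
    have left: "p * m + a p \<in> A" if p: "p < n" for p
    proof (cases p)
      case 0
      have "a 0 < d" using a n by (auto simp: holds_def)
      then have "0 * m + a 0 \<noteq> i * m + h + x" for i x by (auto simp: h_def)
      then have "0 * m + a 0 \<in> A' \<longleftrightarrow> 0 * m + a 0 \<in> A" using A'(3) by blast
      then show ?thesis using a p 0 by (auto simp: holds_def)
    next
      case (Suc q)
      then show ?thesis using pair[of q] p by simp
    qed
    have right: "p * m + h + a p \<in> A" if p: "p < n" for p
    proof (cases "Suc p < n")
      case True
      then show ?thesis using pair[of p] by simp
    next
      case False
      then have pn: "p = n - 1" using p by simp
      have "p * m + h + a p \<noteq> i * m + h + x" if "i < n - 1" "x < m" for i x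
      proof
        assume "p * m + h + a p = i * m + h + x"
        then have "p * m + a p = i * m + x" by simp
        then have "p = i" using col_disj[of "a p" x p i] a p that(2) lt_m by (auto simp: holds_def)
        then show False using that pn by simp
      qed
      then have "p * m + h + a p \<in> A' \<longleftrightarrow> p * m + h + a p \<in> A" using A'(3) by blast
      then show ?thesis using a p by (auto simp: holds_def)
    qed
    show ?thesis using pair left right a by (auto simp: holds_def)
  qed
  then show ?thesis using A'(1) by blast
qed

lemma V_sound:
  assumes t: "t < N" and rw: "rows ops (Suc t * C + length wH) (length wV) (enc A) v"
  shows "\<exists>A'. v = enc A' \<and> (\<forall>a. holds A' a \<longrightarrow> (\<exists>b. holds A b \<and> (\<forall>p<n. V (b p) (a p))))"
proof -
  have "\<exists>A'. v = enc A' \<and> (\<forall>i \<in> {..<n}. \<exists>B'. sub (i * m) m A' = sub 0 m B' \<and>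
       (\<forall>x<d. \<forall>y<d. x \<in> B' \<and> h + y \<in> B' \<longrightarrow>
          (\<exists>a<d. V a x \<and> a \<in> sub (i * m) m A \<and> h + a \<in> sub (i * m) m A))) \<and>
     (\<forall>y. (\<forall>i \<in> {..<n}. \<forall>x < m. y \<noteq> i * m + x) \<longrightarrow> (y \<in> A' \<longleftrightarrow> y \<in> A))"
  proof (rule phase_enc[OF phase_V[OF t] _ _ rw])
    fix i B v' assume "run wV (enc B) v'"
    from window_okD[OF wV(1) this] obtain B' where "v' = enc B'"
      "\<forall>x<d. \<forall>y<d. x \<in> B' \<and> h + y \<in> B' \<longrightarrow>
        (\<exists>a b. (a = b \<and> x = y \<and> V a x) \<and> a < d \<and> b < d \<and> a \<in> B \<and> h + b \<in> B)"
      unfolding h_def by (elim exE conjE)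
    then show "\<exists>B'. v' = enc B' \<and> (\<forall>x<d. \<forall>y<d. x \<in> B' \<and> h + y \<in> B' \<longrightarrow> (\<exists>a<d. V a x \<and> a \<in> B \<and> h + a \<in> B))"
      by (intro exI[of _ B']) blast
  qed (rule col_disj)
  then obtain A' where A': "v = enc A'" "\<forall>i \<in> {..<n}. \<exists>B'. sub (i * m) m A' = sub 0 m B' \<and>
       (\<forall>x<d. \<forall>y<d. x \<in> B' \<and> h + y \<in> B' \<longrightarrow>
          (\<exists>a<d. V a x \<and> a \<in> sub (i * m) m A \<and> h + a \<in> sub (i * m) m A))" by blast
  have "\<exists>b. holds A b \<and> (\<forall>p<n. V (b p) (a p))" if a: "holds A' a" for a
  proof -
    have "\<exists>b. p < n \<longrightarrow> b < d \<and> V b (a p) \<and> p * m + b \<in> A \<and> p * m + h + b \<in> A" for p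
    proof (cases "p < n")
      case True
      obtain B' where B': "sub (p * m) m A' = sub 0 m B'" "\<forall>x<d. \<forall>y<d. x \<in> B' \<and> h + y \<in> B' \<longrightarrow>
          (\<exists>a<d. V a x \<and> a \<in> sub (p * m) m A \<and> h + a \<in> sub (p * m) m A)" using A'(2) True by blast
      have 1: "a p < d" "p * m + a p \<in> A'" "p * m + (h + a p) \<in> A'" using a True by (auto simp: holds_def add.assoc)
      have "a p \<in> B'" "h + a p \<in> B'" using mem_sub[OF B'(1)] 1 lt_m[OF 1(1)] by auto
      then obtain b where "b < d" "V b (a p)" "b \<in> sub (p * m) m A" "h + b \<in> sub (p * m) m A" using B'(2) 1(1) by blast
      then show ?thesis by (intro exI[of _ b]) (auto simp: sub_def add.assoc)
    qed simp
    then obtain b where "\<And>p. p < n \<Longrightarrow> b p < d \<and> V (b p) (a p) \<and> p * m + b p \<in> A \<and> p * m + h + b p \<in> A" by metis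
    then show ?thesis by (intro exI[of _ b]) (auto simp: holds_def)
  qed
  then show ?thesis using A'(1) by blast
qed

lemma rows_Suc: "rows ops 1 (C - 1 + Suc t * C) v v' \<longleftrightarrow> (\<exists>u w. rows ops 1 (C - 1 + t * C) v u \<and>
    rows ops (Suc t * C) (length wH) u w \<and> rows ops (Suc t * C + length wH) (length wV) w v')"
proof -
  have "C - 1 + Suc t * C = (C - 1 + t * C) + (length wH + length wV)" using wV(2) by simp
  moreover have "1 + (C - 1 + t * C) = Suc t * C" using C by simp
  ultimately show ?thesis by (simp only: rows_add) blast
qed

text \<open>The invariant is that every reading of the current row is the top row of a partial
  tiling. The vertical phase provides a reading of the previous row below it, and the horizontal
  phase certifies that reading.\<close>

lemma main_sound:
  assumes "rows ops 1 (C - 1 + t * C) id v" "t \<le> N"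
  shows "\<exists>A. v = enc A \<and> (\<forall>a. holds A a \<longrightarrow> (\<exists>\<tau>. is_tiling t \<tau> \<and> (\<forall>p<n. \<tau> t p = a p)))"
  using assms
proof (induction t arbitrary: v)
  case 0
  then have "rows ops 1 (C - 1) id v" by (simp only: mult_0 add_0_right)
  from init_sound[OF this] obtain A where A: "v = enc A" "\<forall>a. holds A a \<longrightarrow> (\<forall>p<n. Ini p (a p))" by blast
  have "\<exists>\<tau>. is_tiling 0 \<tau> \<and> (\<forall>p<n. \<tau> 0 p = a p)" if "holds A a" for a
    using A(2) that by (intro exI[of _ "\<lambda>_. a"]) (auto simp: is_tiling_def holds_def)
  then show ?case using A(1) by blast
next
  case (Suc t)
  then obtain u w where uw: "rows ops 1 (C - 1 + t * C) id u" "rows ops (Suc t * C) (length wH) u w"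
     "rows ops (Suc t * C + length wH) (length wV) w v" unfolding rows_Suc by blast
  have t: "t < N" using Suc.prems by simp
  obtain A where A: "u = enc A" "\<forall>a. holds A a \<longrightarrow> (\<exists>\<tau>. is_tiling t \<tau> \<and> (\<forall>p<n. \<tau> t p = a p))"
    using Suc.IH[OF uw(1)] t by auto
  obtain A1 where A1: "w = enc A1" "\<forall>a. holds A1 a \<longrightarrow> holds A a \<and> (\<forall>p. Suc p < n \<longrightarrow> H (a p) (a (Suc p)))"
    using H_sound[OF t] uw(2) A(1) by blast
  obtain A2 where A2: "v = enc A2" "\<forall>a. holds A2 a \<longrightarrow> (\<exists>b. holds A1 b \<and> (\<forall>p<n. V (b p) (a p)))"
    using V_sound[OF t] uw(3) A1(1) by blast
  have "\<exists>\<tau>. is_tiling (Suc t) \<tau> \<and> (\<forall>p<n. \<tau> (Suc t) p = a p)" if a: "holds A2 a" for a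
  proof -
    obtain b where b: "holds A1 b" "\<forall>p<n. V (b p) (a p)" using A2(2) a by blast
    obtain \<tau> where \<tau>: "is_tiling t \<tau>" "\<forall>p<n. \<tau> t p = b p" using A(2) A1(2) b(1) by blast
    have Hb: "\<forall>p. Suc p < n \<longrightarrow> H (b p) (b (Suc p))" using A1(2) b(1) by blast
    have "is_tiling (Suc t) (\<tau>(Suc t := a))"
      using \<tau> Hb b(2) a unfolding is_tiling_def by (auto simp: less_Suc_eq le_Suc_eq holds_def)
    then show ?thesis by (intro exI[of _ "\<tau>(Suc t := a)"]) auto
  qed
  then show ?case using A2(1) by blast
qed

lemma sub_full:
  assumes "\<And>p. p < n \<Longrightarrow> a p < d" "p < n" shows "sub (p * m) m (full a) = {a p, h + a p}"
proof -
  have "p * m + i \<in> full a \<longleftrightarrow> i = a p \<or> i = h + a p" if "i < m" for i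
  proof
    assume "p * m + i \<in> full a"
    then obtain q where q: "q < n" "p * m + i = q * m + a q \<or> p * m + i = q * m + (h + a q)"
      by (auto simp: full_def add.assoc)
    then have "p = q" using col_disj that lt_m assms(1) by blast
    then show "i = a p \<or> i = h + a p" using q by auto
  next
    assume "i = a p \<or> i = h + a p"
    then show "p * m + i \<in> full a" using assms(2) by (auto simp: full_def add.assoc)
  qed
  then show ?thesis using lt_m assms by (auto simp: sub_def)
qed

lemma sub_full_h:
  assumes "\<And>p. p < n \<Longrightarrow> a p < d" "Suc p < n" shows "sub (p * m + h) m (full a) = {a p, h + a (Suc p)}"
proof -
  have step: "p * m + h + (h + x) = Suc p * m + x" for p x using J_m(2) by simp
  have ap: "a p < d" using assms by simp
  have sf: "sub (p * m) m (full a) = {a p, h + a p}"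
    "sub (Suc p * m) m (full a) = {a (Suc p), h + a (Suc p)}"
    using assms by (intro sub_full; simp)+
  have "p * m + h + i \<in> full a \<longleftrightarrow> i = a p \<or> i = h + a (Suc p)" if "i < m" for i
  proof (cases "i < h")
    case True
    have "p * m + h + i \<in> full a \<longleftrightarrow> h + i \<in> sub (p * m) m (full a)"
      using True J_m(2) by (simp add: sub_def add.assoc)
    also have "\<dots> \<longleftrightarrow> i = a p" using ap unfolding sf by (auto simp: h_def)
    finally show ?thesis using True by simp
  next
    case False
    then have i: "i = h + (i - h)" by simp
    have "p * m + h + i \<in> full a \<longleftrightarrow> Suc p * m + (i - h) \<in> full a" using step[of p "i - h"] i by metis
    also have "\<dots> \<longleftrightarrow> i - h \<in> sub (Suc p * m) m (full a)" using that less_imp_diff_less[OF that] by (simp add: sub_def)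
    also have "\<dots> \<longleftrightarrow> i - h = a (Suc p) \<or> i - h = h + a (Suc p)" unfolding sf by simp
    also have "\<dots> \<longleftrightarrow> i = h + a (Suc p)" using that False J_m(2) by auto
    finally show ?thesis using False assms(1)[of p] assms(2) by (auto simp: h_def)
  qed
  then show ?thesis using lt_m assms by (auto simp: sub_def)
qed

lemma full_cols: "y \<in> full a \<Longrightarrow> (\<And>p. p < n \<Longrightarrow> a p < d) \<Longrightarrow> \<exists>i<n. \<exists>x<m. y = i * m + x"
  using lt_m unfolding full_def by (auto simp: add.assoc)

lemma main_complete:
  assumes "is_tiling t \<tau>" "t \<le> N"
  shows "rows ops 1 (C - 1 + t * C) id (enc (full (\<tau> t)))"
  using assms
proof (induction t)
  case 0
  have lt: "\<And>p. p < n \<Longrightarrow> \<tau> 0 p < d" and ini: "\<And>p. p < n \<Longrightarrow> Ini p (\<tau> 0 p)" using 0 by (auto simp: is_tiling_def)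
  have "rows ops 1 (C - 1) (enc {}) (enc (full (\<tau> 0)))"
  proof (rule phase_complete[OF phase_I])
    fix i assume i: "i \<in> {..<n}"
    have "sub (i * m) m {} = {}" by (simp add: sub_def)
    then show "run (wI i) (enc (sub (i * m) m {})) (enc (sub (i * m) m (full (\<tau> 0))))"
      using wI[of i] ini[of i] lt[of i] i sub_full[of "\<tau> 0" i] lt unfolding init_ok_def by (simp add: h_def)
  next
    fix y assume "\<And>i x. i \<in> {..<n} \<Longrightarrow> x < m \<Longrightarrow> y \<noteq> i * m + x"
    then show "y \<in> full (\<tau> 0) \<longleftrightarrow> y \<in> {}" using full_cols[of y "\<tau> 0"] lt by blast
  qed
  then show ?case unfolding enc_empty by (simp only: mult_0 add_0_right)
next
  case (Suc t)
  have lt: "\<And>p. p < n \<Longrightarrow> \<tau> t p < d" "\<And>p. p < n \<Longrightarrow> \<tau> (Suc t) p < d"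
    and Hs: "\<And>p. Suc p < n \<Longrightarrow> H (\<tau> t p) (\<tau> t (Suc p))" and Vs: "\<And>p. p < n \<Longrightarrow> V (\<tau> t p) (\<tau> (Suc t) p)"
    using Suc.prems by (auto simp: is_tiling_def)
  have t: "t < N" using Suc.prems by simp
  have "rows ops 1 (C - 1 + t * C) id (enc (full (\<tau> t)))"
  proof (rule Suc.IH)
    show "is_tiling t \<tau>" using Suc.prems by (simp add: is_tiling_def)
  qed (use t in simp)
  moreover have "rows ops (Suc t * C) (length wH) (enc (full (\<tau> t))) (enc (full (\<tau> t)))"
  proof (rule phase_complete[OF phase_H[OF t]])
    fix i assume "i \<in> {..<n - 1}"
    then have i: "Suc i < n" by auto
    show "run wH (enc (sub (i * m + h) m (full (\<tau> t)))) (enc (sub (i * m + h) m (full (\<tau> t))))"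
    proof -
      have e: "sub (i * m + h) m (full (\<tau> t)) = {\<tau> t i, 2 * d + 1 + \<tau> t (Suc i)}"
        using sub_full_h[of "\<tau> t" i] lt(1) i by (simp add: h_def)
      have "\<tau> t i < d" "\<tau> t (Suc i) < d" using lt(1) i by auto
      then show ?thesis unfolding e using wH Hs[OF i] unfolding window_ok_def by blast
    qed
  qed simp
  moreover have "rows ops (Suc t * C + length wH) (length wV) (enc (full (\<tau> t))) (enc (full (\<tau> (Suc t))))"
  proof (rule phase_complete[OF phase_V[OF t]])
    fix i assume "i \<in> {..<n}"
    then have i: "i < n" by simp
    show "run wV (enc (sub (i * m) m (full (\<tau> t)))) (enc (sub (i * m) m (full (\<tau> (Suc t)))))"
    proof -
      have e: "sub (i * m) m (full (\<tau> t)) = {\<tau> t i, 2 * d + 1 + \<tau> t i}"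
        "sub (i * m) m (full (\<tau> (Suc t))) = {\<tau> (Suc t) i, 2 * d + 1 + \<tau> (Suc t) i}"
        using sub_full[of "\<tau> t" i] sub_full[of "\<tau> (Suc t)" i] lt i by (simp_all add: h_def)
      show ?thesis unfolding e using wV(1) Vs[OF i] lt[OF i] unfolding window_ok_def by blast
    qed
  next
    fix y assume "\<And>i x. i \<in> {..<n} \<Longrightarrow> x < m \<Longrightarrow> y \<noteq> i * m + x"
    then show "y \<in> full (\<tau> (Suc t)) \<longleftrightarrow> y \<in> full (\<tau> t)" using full_cols lt by (metis lessThan_iff)
  qed
  ultimately show ?case unfolding rows_Suc by blast
qed

theorem rows_iff_tiling:
  "(\<exists>v. rows ops 1 ((N + 2) * C - 2) id v) \<longleftrightarrow> (\<exists>\<tau>. is_tiling N \<tau> \<and> (\<forall>p<n. Acc (\<tau> N p)))"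
proof -
  have len: "(N + 2) * C - 2 = (C - 1 + N * C) + (C - 1)" using C by (simp add: algebra_simps)
  have st: "1 + (C - 1 + N * C) = Suc N * C" using C by simp
  have eq: "rows ops 1 ((N + 2) * C - 2) id v \<longleftrightarrow>
     (\<exists>u. rows ops 1 (C - 1 + N * C) id u \<and> rows ops (Suc N * C) (C - 1) u v)" for v
    unfolding len rows_add st by simp
  show ?thesis
  proof
    assume "\<exists>v. rows ops 1 ((N + 2) * C - 2) id v"
    then obtain u v where uv: "rows ops 1 (C - 1 + N * C) id u" "rows ops (Suc N * C) (C - 1) u v" unfolding eq by blast
    obtain A where A: "u = enc A" "\<forall>a. holds A a \<longrightarrow> (\<exists>\<tau>. is_tiling N \<tau> \<and> (\<forall>p<n. \<tau> N p = a p))"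
      using main_sound[OF uv(1)] by auto
    \<comment> \<open>The final program succeeds only if each column holds an accepted tile in both
      halves; choosing one per column yields a reading of the last row.\<close>
    have "\<exists>a. p < n \<longrightarrow> a < d \<and> Acc a \<and> p * m + a \<in> A \<and> p * m + h + a \<in> A" for p
    proof (cases "p < n")
      case True
      have "run wF (\<lambda>x. 2 * (p * m) + enc (sub (p * m) m A) x) (win (2 * (p * m)) (2 * m) v)"
        using uv(2) True unfolding phase_F A(1) win_enc by blast
      then obtain u' where "run wF (enc (sub (p * m) m A)) u'" unfolding run_shift by blast
      then obtain a where "a < d" "Acc a" "a \<in> sub (p * m) m A" "h + a \<in> sub (p * m) m A"
        using wF(1) unfolding final_ok_def h_def by blast
      then show ?thesis by (intro exI[of _ a]) (auto simp: sub_def add.assoc)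
    qed simp
    then obtain a where a: "\<And>p. p < n \<Longrightarrow> a p < d \<and> Acc (a p) \<and> p * m + a p \<in> A \<and> p * m + h + a p \<in> A" by metis
    then have "holds A a" by (auto simp: holds_def)
    then obtain \<tau> where "is_tiling N \<tau>" "\<forall>p<n. \<tau> N p = a p" using A(2) by blast
    then show "\<exists>\<tau>. is_tiling N \<tau> \<and> (\<forall>p<n. Acc (\<tau> N p))" using a by auto
  next
    assume "\<exists>\<tau>. is_tiling N \<tau> \<and> (\<forall>p<n. Acc (\<tau> N p))"
    then obtain \<tau> where \<tau>: "is_tiling N \<tau>" "\<forall>p<n. Acc (\<tau> N p)" by blast
    have lt: "\<And>p. p < n \<Longrightarrow> \<tau> N p < d" using \<tau>(1) by (auto simp: is_tiling_def)
    have "rows ops (Suc N * C) (C - 1) (enc (full (\<tau> N))) (enc {})"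
    proof (rule phase_complete[OF phase_F])
      fix i assume "i \<in> {..<n}"
      then have i: "i < n" by simp
      have e: "sub (i * m) m {} = {}" by (simp add: sub_def)
      show "run wF (enc (sub (i * m) m (full (\<tau> N)))) (enc (sub (i * m) m {}))"
      proof -
        have e2: "sub (i * m) m (full (\<tau> N)) = {\<tau> N i, 2 * d + 1 + \<tau> N i}"
          using sub_full[of "\<tau> N" i] lt i by (simp add: h_def)
        show ?thesis unfolding e e2 using wF(1) \<tau>(2) lt[OF i] i unfolding final_ok_def by blast
      qed
    next
      fix y assume "\<And>i x. i \<in> {..<n} \<Longrightarrow> x < m \<Longrightarrow> y \<noteq> i * m + x"
      then show "y \<in> {} \<longleftrightarrow> y \<in> full (\<tau> N)" using full_cols[of y "\<tau> N"] lt by blast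
    qed
    then show "\<exists>v. rows ops 1 ((N + 2) * C - 2) id v"
      unfolding eq using main_complete[OF \<tau>(1)] by blast
  qed
qed

end


section \<open>Rounds of operations as interval colourings\<close>

lemma chromatic_number_le_iff:
  "chromatic_number G \<le> enat k \<longleftrightarrow> (\<exists>f. proper_coloring G f \<and> card (f ` verts G) \<le> k)"
proof
  let ?S = "{enat (card (f ` verts G)) | f. proper_coloring G f}"
  assume a: "chromatic_number G \<le> enat k"
  then have "?S \<noteq> {}" unfolding chromatic_number_def by (auto simp: Inf_enat_def split: if_splits)
  then obtain x where "x \<in> ?S" by blast
  \<comment> \<open>The infimum of a nonempty set of extended naturals is attained.\<close>
  from LeastI[of "\<lambda>x. x \<in> ?S", OF this] have "Inf ?S \<in> ?S"
    using \<open>?S \<noteq> {}\<close> unfolding Inf_enat_def by simp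
  then show "\<exists>f. proper_coloring G f \<and> card (f ` verts G) \<le> k"
    using a unfolding chromatic_number_def by auto
next
  assume "\<exists>f. proper_coloring G f \<and> card (f ` verts G) \<le> k"
  then obtain f where f: "proper_coloring G f" "card (f ` verts G) \<le> k" by blast
  then have "chromatic_number G \<le> enat (card (f ` verts G))"
    unfolding chromatic_number_def by (intro Inf_lower) auto
  then show "chromatic_number G \<le> enat k" using f(2) by (meson enat_ord_simps(1) order_trans)
qed

text \<open>Replacing each colour by its rank among the colours used preserves all strict
  inequalities, so the colours may be taken from \<open>0..<k\<close>.\<close>

lemma compress_coloring:
  assumes fin: "finite (verts G)" and f: "proper_coloring G f" "card (f ` verts G) \<le> k"
    and wf: "\<And>e u. e \<in> edges G \<Longrightarrow> u \<in> e \<Longrightarrow> u \<in> verts G" "\<And>u v. (u, v) \<in> arcs G \<Longrightarrow> u \<in> verts G \<and> v \<in> verts G"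
  shows "\<exists>g. proper_coloring G g \<and> (\<forall>u \<in> verts G. g u < k)"
proof -
  let ?C = "f ` verts G"
  define g where "g u = card {c \<in> ?C. c < f u}" for u
  have less: "g u < g v" if "f u < f v" "u \<in> verts G" for u v
    unfolding g_def by (rule psubset_card_mono) (use fin that in auto)
  have "g u < k" if "u \<in> verts G" for u
  proof -
    have "g u < card ?C" unfolding g_def by (rule psubset_card_mono) (use fin that in auto)
    then show ?thesis using f(2) by simp
  qed
  moreover have "proper_coloring G g"
    unfolding proper_coloring_def
  proof (intro conjI allI impI ballI)
    fix u v assume e: "{u, v} \<in> edges G"
    then have "f u \<noteq> f v" using f(1) unfolding proper_coloring_def by blast
    moreover have "u \<in> verts G" "v \<in> verts G" using wf(1)[OF e] by auto
    ultimately show "g u \<noteq> g v" using less[of u v] less[of v u] by linarith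
  next
    fix x assume "x \<in> arcs G"
    moreover obtain u v where x: "x = (u, v)" by (cases x)
    ultimately have "f u < f v" "u \<in> verts G" using f(1) wf(2)[of u v] unfolding proper_coloring_def by auto
    then show "case x of (u, v) \<Rightarrow> g u < g v" using less[of u v] x by simp
  qed
  ultimately show ?thesis by blast
qed

text \<open>The time \<open>tm r i s\<close> is lexicographic in the round, the slot and
  \<open>s\<close>, where \<open>s = 0\<close> marks ends and \<open>s = 1\<close> marks starts.
  Thus an end in a slot precedes the start that takes over its colour. The times stay abstract, so
  that endpoints with a convenient binary representation can be supplied later.\<close>

locale interval_rounds =
  fixes k M :: nat and op :: "nat \<Rightarrow> nat \<Rightarrow> opk" and tm :: "nat \<Rightarrow> nat \<Rightarrow> nat \<Rightarrow> nat"
  assumes k: "0 < k" and M: "0 < M"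
    and op_wf: "\<And>r q. op r q \<noteq> Nop \<Longrightarrow> Suc q < k \<and> op r (Suc q) = Nop"
    and op_last: "\<And>q. op M q = Nop"
    and tm_less: "\<And>r i s r' i' s'. r < r' \<or> r = r' \<and> (i < i' \<or> i = i' \<and> s < s') \<Longrightarrow>
       r' \<le> Suc M \<Longrightarrow> i < k \<Longrightarrow> i' < k \<Longrightarrow> s \<le> 1 \<Longrightarrow> s' \<le> 1 \<Longrightarrow> tm r i s < tm r' i' s'"
begin

text \<open>The intervals of even rounds are left-going and start in increasing order of their positions,
  those of odd rounds are right-going and start in decreasing order.\<close>

definition slot :: "nat \<Rightarrow> nat \<Rightarrow> nat" where
  "slot r q = (if even r then q else k - 1 - q)"

text \<open>The position of the next round in whose slot the interval ends. In round 0 the positions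
  are reversed, which makes all ends follow the order of the starts. A test exchanges the two ends.
  For a free step both intervals end in the slot of the pair that comes first in the next round:
  position \<open>q\<close> if that round is even, \<open>Suc q\<close> if it is odd.\<close>

definition endpos :: "nat \<Rightarrow> nat \<Rightarrow> nat" where
  "endpos r q = (if r = 0 then k - 1 - q
     else if op r q = Test then Suc q
     else if op r q = Free then (if odd r then q else Suc q)
     else if 0 < q \<and> op r (q - 1) = Test then q - 1
     else if 0 < q \<and> op r (q - 1) = Free then (if odd r then q - 1 else q)
     else q)"

definition st :: "nat \<Rightarrow> nat \<Rightarrow> nat" where
  "st r q = tm r (slot r q) 1"

definition en :: "nat \<Rightarrow> nat \<Rightarrow> nat" where
  "en r q = tm (Suc r) (slot (Suc r) (endpos r q)) 0"

definition piece :: "nat \<Rightarrow> nat \<Rightarrow> rat \<times> rat" where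
  "piece r q = (of_nat (st r q), of_nat (en r q))"

definition ivl :: "nat \<Rightarrow> nat \<Rightarrow> real set" where
  "ivl r q = interval_of (piece r q)"

definition ivls :: "real set set" where
  "ivls = {ivl r q | r q. r \<le> M \<and> q < k}"

definition ori :: "real set \<Rightarrow> orientation" where
  "ori S = (if \<exists>r q. r \<le> M \<and> q < k \<and> even r \<and> S = ivl r q then Left_going else Right_going)"

section \<open>Intersections, overlaps and arcs of the constructed intervals\<close>

abbreviation "G \<equiv> bidirectional_interval_graph ivls ori"

lemma slot_less: "q < k \<Longrightarrow> slot r q < k"
  by (auto simp: slot_def)

lemma slot_inj: "q < k \<Longrightarrow> q' < k \<Longrightarrow> slot r q = slot r q' \<longleftrightarrow> q = q'"
  by (auto simp: slot_def)

lemma endpos_less: "q < k \<Longrightarrow> endpos r q < k"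
  using op_wf[of r q] by (auto simp: endpos_def)

lemma tm_le_iff:
  assumes "r \<le> Suc M" "r' \<le> Suc M" "i < k" "i' < k" "s \<le> 1" "s' \<le> 1"
  shows "tm r i s \<le> tm r' i' s' \<longleftrightarrow> r < r' \<or> r = r' \<and> (i < i' \<or> i = i' \<and> s \<le> s')"
proof
  assume le: "tm r i s \<le> tm r' i' s'"
  show "r < r' \<or> r = r' \<and> (i < i' \<or> i = i' \<and> s \<le> s')"
  proof (rule ccontr)
    assume "\<not> ?thesis"
    then have "r' < r \<or> r' = r \<and> (i' < i \<or> i' = i \<and> s' < s)" by auto
    then show False using tm_less[of r' r i' i s' s] assms le by auto
  qed
next
  assume "r < r' \<or> r = r' \<and> (i < i' \<or> i = i' \<and> s \<le> s')"
  then show "tm r i s \<le> tm r' i' s'"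
  proof (cases "r = r' \<and> i = i' \<and> s = s'")
    case False
    with \<open>r < r' \<or> r = r' \<and> (i < i' \<or> i = i' \<and> s \<le> s')\<close>
    have "r < r' \<or> r = r' \<and> (i < i' \<or> i = i' \<and> s < s')" by linarith
    then show ?thesis using tm_less[of r r' i i' s s'] assms by simp
  qed simp
qed

lemma st_le_st: "r \<le> M \<Longrightarrow> q < k \<Longrightarrow> r' \<le> M \<Longrightarrow> q' < k \<Longrightarrow>
    st r q \<le> st r' q' \<longleftrightarrow> r < r' \<or> r = r' \<and> slot r q \<le> slot r' q'"
  by (auto simp: st_def tm_le_iff slot_less)

lemma en_le_en: "r \<le> M \<Longrightarrow> q < k \<Longrightarrow> r' \<le> M \<Longrightarrow> q' < k \<Longrightarrow>
    en r q \<le> en r' q' \<longleftrightarrow> r < r' \<or> r = r' \<and> slot (Suc r) (endpos r q) \<le> slot (Suc r) (endpos r' q')"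
  by (auto simp: en_def tm_le_iff slot_less endpos_less)

lemma st_le_en: "r \<le> M \<Longrightarrow> q < k \<Longrightarrow> r' \<le> M \<Longrightarrow> q' < k \<Longrightarrow>
    st r q \<le> en r' q' \<longleftrightarrow> r \<le> r' \<or> r = Suc r' \<and> slot r q < slot r (endpos r' q')"
  by (auto simp: st_def en_def tm_le_iff slot_less endpos_less)

lemma ivl_eq: "ivl r q = {real (st r q)..real (en r q)}"
  by (simp add: ivl_def piece_def)

lemma st_less_en: "r \<le> M \<Longrightarrow> q < k \<Longrightarrow> st r q < en r q"
  unfolding st_def en_def by (rule tm_less) (auto simp: slot_less endpos_less)

lemma ivl_inj:
  assumes "r \<le> M" "q < k" "r' \<le> M" "q' < k" shows "ivl r q = ivl r' q' \<longleftrightarrow> r = r' \<and> q = q'"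
proof
  assume "ivl r q = ivl r' q'"
  then have "st r q = st r' q'"
    using st_less_en[OF assms(1,2)] st_less_en[OF assms(3,4)] by (simp add: ivl_eq Icc_eq_Icc)
  then have "r = r'" "slot r q = slot r q'"
    using st_le_st[OF assms] st_le_st[OF assms(3,4,1,2)] by auto
  then show "r = r' \<and> q = q'" using slot_inj assms by auto
qed auto

lemma ivl_inter:
  assumes "r \<le> M" "q < k" "r' \<le> M" "q' < k"
  shows "ivl r q \<inter> ivl r' q' \<noteq> {} \<longleftrightarrow> st r q \<le> en r' q' \<and> st r' q' \<le> en r q"
  using st_less_en[OF assms(1,2)] st_less_en[OF assms(3,4)] by (auto simp: ivl_eq)

lemma ivl_subset:
  assumes "r \<le> M" "q < k"
  shows "ivl r q \<subseteq> ivl r' q' \<longleftrightarrow> st r' q' \<le> st r q \<and> en r q \<le> en r' q'"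
  using st_less_en[OF assms(1,2)] by (auto simp: ivl_eq)

lemma ori_ivl: "r \<le> M \<Longrightarrow> q < k \<Longrightarrow> ori (ivl r q) = (if even r then Left_going else Right_going)"
  using ivl_inj by (auto simp: ori_def)

lemma Inf_ivl: "r \<le> M \<Longrightarrow> q < k \<Longrightarrow> Inf (ivl r q) = real (st r q)"
  using st_less_en[of r q] by (simp add: ivl_eq)

text \<open>Ends move by at most one position, so only neighbours can be inverted strictly; a free
  step merely makes their ends coincide.\<close>

lemma endpos_order:
  assumes "0 < r" "q < q'" "endpos r q' < endpos r q" "q' < k"
  shows "q' = Suc q \<and> op r q = Test"
proof -
  have e: "endpos r q \<le> Suc q" "q' \<le> Suc (endpos r q')"
    using assms(1) by (auto simp: endpos_def)
  then have q': "q' = Suc q" using assms by linarith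
  then have eq: "endpos r q = Suc q" "endpos r (Suc q) = q" using assms e unfolding q' by linarith+
  have "op r q = Test"
  proof (cases "op r q")
    case Free
    then show ?thesis using eq assms(1) op_wf[of r q] by (auto simp: endpos_def split: if_splits)
  next
    case Nop
    then show ?thesis using eq assms(1) by (auto simp: endpos_def split: if_splits)
  qed simp
  then show ?thesis using q' by simp
qed

lemma endpos_Test:
  assumes "0 < r" "op r q = Test" shows "endpos r q = Suc q" "endpos r (Suc q) = q"
  using assms op_wf[of r q] by (auto simp: endpos_def)

text \<open>Adjacent rounds are traversed in opposite directions, so two intervals of one round are
  nested unless \<open>endpos\<close> inverts them. A common endpoint counts as containment, hence
  free steps create no arcs. In round 0 starts and ends have the same order and all pairs
  overlap.\<close>

lemma overlap_same:
  assumes "r \<le> M" "q < k" "q' < k"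
  shows "overlap (ivl r q) (ivl r q') \<and> Inf (ivl r q) < Inf (ivl r q') \<longleftrightarrow>
    (if r = 0 then q < q' else if even r then q' = Suc q \<and> op r q = Test else q = Suc q' \<and> op r q' = Test)"
proof -
  have "overlap (ivl r q) (ivl r q') \<and> Inf (ivl r q) < Inf (ivl r q') \<longleftrightarrow>
     slot r q < slot r q' \<and> slot (Suc r) (endpos r q) < slot (Suc r) (endpos r q')"
  proof -
    have "ivl r q \<inter> ivl r q' \<noteq> {}" using assms by (simp add: ivl_inter st_le_en)
    moreover have "ivl r q \<subseteq> ivl r q' \<longleftrightarrow> slot r q' \<le> slot r q \<and>
        slot (Suc r) (endpos r q) \<le> slot (Suc r) (endpos r q')"
      "ivl r q' \<subseteq> ivl r q \<longleftrightarrow> slot r q \<le> slot r q' \<and>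
        slot (Suc r) (endpos r q') \<le> slot (Suc r) (endpos r q)"
      using assms by (simp_all add: ivl_subset st_le_st en_le_en)
    moreover have "Inf (ivl r q) < Inf (ivl r q') \<longleftrightarrow> slot r q < slot r q'"
      using assms st_le_st[of r q' r q] by (simp add: Inf_ivl flip: not_le)
    ultimately show ?thesis unfolding overlap_def by auto
  qed
  also have "\<dots> \<longleftrightarrow> (if r = 0 then q < q' else if even r then q' = Suc q \<and> op r q = Test
      else q = Suc q' \<and> op r q' = Test)"
  proof -
    have e: "endpos r q < k" "endpos r q' < k" using assms endpos_less by auto
    have ev: "slot n x < slot n y \<longleftrightarrow> x < y" if "even n" for n x y using that by (simp add: slot_def)
    have od: "slot n x < slot n y \<longleftrightarrow> y < x" if "odd n" "x < k" "y < k" for n x y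
      using that by (auto simp: slot_def)
    consider "r = 0" | "0 < r" "even r" | "0 < r" "odd r" by (cases "r = 0") auto
    then show ?thesis
    proof cases
      case 1
      then show ?thesis using assms by (auto simp: slot_def endpos_def)
    next
      case 2
      have "q < q' \<and> endpos r q' < endpos r q \<longleftrightarrow> q' = Suc q \<and> op r q = Test"
        using endpos_order[of r q q'] endpos_Test[of r q] 2 assms by auto
      then show ?thesis using 2 ev[of r] od[of "Suc r"] e by simp
    next
      case 3
      have "q' < q \<and> endpos r q < endpos r q' \<longleftrightarrow> q = Suc q' \<and> op r q' = Test"
        using endpos_order[of r q' q] endpos_Test[of r q'] 3 assms by auto
      then show ?thesis using 3 od[of r] ev[of "Suc r"] assms by simp
    qed
  qed
  finally show ?thesis .
qed

text \<open>Proper colourings in terms of rounds and positions. The second clause concerns an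
  interval of round \<open>r\<close> that is still alive when one of round \<open>r + 1\<close>
  starts; it demands only different colours because the orientations differ.\<close>

definition proper :: "(nat \<Rightarrow> nat \<Rightarrow> nat) \<Rightarrow> bool" where
  "proper f \<longleftrightarrow> (\<forall>r q q'. r \<le> M \<and> q < k \<and> q' < k \<and> q \<noteq> q' \<longrightarrow> f r q \<noteq> f r q') \<and>
    (\<forall>r q q'. r < M \<and> q < k \<and> q' < k \<and> slot (Suc r) q' < slot (Suc r) (endpos r q) \<longrightarrow> f r q \<noteq> f (Suc r) q') \<and>
    (\<forall>r q. 0 < r \<and> r \<le> M \<and> op r q = Test \<longrightarrow> f r q < f r (Suc q)) \<and>
    (\<forall>q q'. q < q' \<and> q' < k \<longrightarrow> f 0 q < f 0 q')"

lemma verts_G: "verts G = ivls"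
  by (simp add: bidirectional_interval_graph_def)

lemma ivls_I: "r \<le> M \<Longrightarrow> q < k \<Longrightarrow> ivl r q \<in> ivls"
  by (auto simp: ivls_def)

lemma arcs_iff:
  assumes "r \<le> M" "q < k" "r' \<le> M" "q' < k"
  shows "(ivl r q, ivl r' q') \<in> arcs G \<longleftrightarrow>
    overlap (ivl r q) (ivl r' q') \<and> (even r \<longleftrightarrow> even r') \<and>
     (if even r then Inf (ivl r q) < Inf (ivl r' q') else Inf (ivl r' q') < Inf (ivl r q))"
  using assms ivls_I by (auto simp: bidirectional_interval_graph_def ori_ivl)

lemma edges_iff:
  assumes "r \<le> M" "q < k" "r' \<le> M" "q' < k"
  shows "{ivl r q, ivl r' q'} \<in> edges G \<longleftrightarrow> (r, q) \<noteq> (r', q') \<and>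
    ivl r q \<inter> ivl r' q' \<noteq> {} \<and> \<not> (overlap (ivl r q) (ivl r' q') \<and> (even r \<longleftrightarrow> even r'))"
proof -
  define P where "P u v \<longleftrightarrow> u \<noteq> v \<and> u \<inter> v \<noteq> {} \<and> \<not> (overlap u v \<and> ori u = ori v)" for u v
  have P: "P u v \<longleftrightarrow> P v u" for u v unfolding P_def overlap_def by auto
  have e: "edges G = {{u, v} | u v. u \<in> ivls \<and> v \<in> ivls \<and> P u v}"
    by (simp add: bidirectional_interval_graph_def P_def)
  have "{ivl r q, ivl r' q'} \<in> edges G \<longleftrightarrow> P (ivl r q) (ivl r' q')"
  proof
    assume "{ivl r q, ivl r' q'} \<in> edges G"
    then obtain u v where uv: "{ivl r q, ivl r' q'} = {u, v}" "P u v" unfolding e by blast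
    from uv(1) have "ivl r q = u \<and> ivl r' q' = v \<or> ivl r q = v \<and> ivl r' q' = u"
      by (simp add: doubleton_eq_iff)
    then show "P (ivl r q) (ivl r' q')" using uv(2) P[of u v] by auto
  next
    assume "P (ivl r q) (ivl r' q')"
    then show "{ivl r q, ivl r' q'} \<in> edges G" unfolding e using ivls_I[OF assms(1,2)] ivls_I[OF assms(3,4)] by blast
  qed
  then show ?thesis using assms unfolding P_def by (simp add: ivl_inj ori_ivl)
qed

lemma overlap_sym: "overlap u v \<longleftrightarrow> overlap v u"
  by (auto simp: overlap_def)

lemma overlap_Inf:
  assumes "r \<le> M" "q < k" "r' \<le> M" "q' < k" "overlap (ivl r q) (ivl r' q')"
  shows "Inf (ivl r q) < Inf (ivl r' q') \<or> Inf (ivl r' q') < Inf (ivl r q)"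
  using assms by (auto simp: overlap_def ivl_subset Inf_ivl)

lemma inter_distinct:
  assumes f: "proper_coloring G f" and "r \<le> M" "q < k" "r' \<le> M" "q' < k"
    "(r, q) \<noteq> (r', q')" "ivl r q \<inter> ivl r' q' \<noteq> {}"
  shows "f (ivl r q) \<noteq> f (ivl r' q')"
proof (cases "overlap (ivl r q) (ivl r' q') \<and> (even r \<longleftrightarrow> even r')")
  case True
  then have "(ivl r q, ivl r' q') \<in> arcs G \<or> (ivl r' q', ivl r q) \<in> arcs G"
    using overlap_Inf[of r q r' q'] overlap_sym assms by (auto simp: arcs_iff)
  then show ?thesis using f unfolding proper_coloring_def by fastforce
next
  case False
  then have "{ivl r q, ivl r' q'} \<in> edges G" using assms by (auto simp: edges_iff)
  then show ?thesis using f unfolding proper_coloring_def by blast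
qed

lemma proper_of_coloring:
  assumes "proper_coloring G f" shows "proper (\<lambda>r q. f (ivl r q))"
  unfolding proper_def
proof (intro conjI allI impI; elim conjE)
  fix r q q' assume "r \<le> M" "q < k" "q' < k" "q \<noteq> q'"
  then show "f (ivl r q) \<noteq> f (ivl r q')"
    by (intro inter_distinct[OF assms]) (auto simp: ivl_inter st_le_en)
next
  fix r q q' assume "r < M" "q < k" "q' < k" "slot (Suc r) q' < slot (Suc r) (endpos r q)"
  then show "f (ivl r q) \<noteq> f (ivl (Suc r) q')"
    by (intro inter_distinct[OF assms]) (auto simp: ivl_inter st_le_en)
next
  fix r q assume r: "0 < r" "r \<le> M" "op r q = Test"
  then have q: "Suc q < k" using op_wf[of r q] by simp
  then have "(ivl r q, ivl r (Suc q)) \<in> arcs G"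
    using r overlap_same[of r q "Suc q"] overlap_same[of r "Suc q" q] by (auto simp: arcs_iff overlap_sym)
  then show "f (ivl r q) < f (ivl r (Suc q))" using assms unfolding proper_coloring_def by fastforce
next
  fix q q' assume "q < q'" "q' < k"
  then have "(ivl 0 q, ivl 0 q') \<in> arcs G" using overlap_same[of 0 q q'] by (auto simp: arcs_iff)
  then show "f (ivl 0 q) < f (ivl 0 q')" using assms unfolding proper_coloring_def by fastforce
qed

lemma coloring_of_proper:
  assumes f: "proper f" and F: "\<And>r q. r \<le> M \<Longrightarrow> q < k \<Longrightarrow> F (ivl r q) = f r q"
  shows "proper_coloring G F"
proof -
  note f1 = f[unfolded proper_def, THEN conjunct1, rule_format]
    and f2 = f[unfolded proper_def, THEN conjunct2, THEN conjunct1, rule_format]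
    and f3 = f[unfolded proper_def, THEN conjunct2, THEN conjunct2, THEN conjunct1, rule_format]
    and f4 = f[unfolded proper_def, THEN conjunct2, THEN conjunct2, THEN conjunct2, rule_format]
  show ?thesis unfolding proper_coloring_def
proof (intro conjI allI impI ballI)
  fix u v assume e: "{u, v} \<in> edges G"
  then have "u \<in> ivls" "v \<in> ivls" by (auto simp: bidirectional_interval_graph_def doubleton_eq_iff)
  then obtain r q r' q' where *: "u = ivl r q" "v = ivl r' q'" "r \<le> M" "q < k" "r' \<le> M" "q' < k"
    by (auto simp: ivls_def)
  have i: "(r, q) \<noteq> (r', q')" "ivl r q \<inter> ivl r' q' \<noteq> {}" using e edges_iff[of r q r' q'] * by simp_all
  then have "r = r' \<or> r = Suc r' \<or> r' = Suc r" using * by (auto simp: ivl_inter st_le_en)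
  then have "f r q \<noteq> f r' q'"
  proof (elim disjE)
    assume "r = r'"
    then show ?thesis using f1[of r q q'] i(1) * by auto
  next
    assume r: "r = Suc r'"
    then have "slot (Suc r') q < slot (Suc r') (endpos r' q')" using i(2) * by (simp add: ivl_inter st_le_en)
    then show ?thesis using f2[of r' q' q] r * by auto
  next
    assume r: "r' = Suc r"
    then have "slot (Suc r) q' < slot (Suc r) (endpos r q)" using i(2) * by (simp add: ivl_inter st_le_en)
    then show ?thesis using f2[of r q q'] r * by auto
  qed
  then show "F u \<noteq> F v" using * F by simp
next
  fix x assume a: "x \<in> arcs G"
  obtain u v where x: "x = (u, v)" by (cases x)
  then have "u \<in> ivls" "v \<in> ivls" using a by (auto simp: bidirectional_interval_graph_def)
  then obtain r q r' q' where *: "u = ivl r q" "v = ivl r' q'" "r \<le> M" "q < k" "r' \<le> M" "q' < k"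
    by (auto simp: ivls_def)
  have i: "overlap (ivl r q) (ivl r' q')" "even r \<longleftrightarrow> even r'"
    "if even r then Inf (ivl r q) < Inf (ivl r' q') else Inf (ivl r' q') < Inf (ivl r q)"
    using a x arcs_iff[of r q r' q'] * by simp_all
  have "ivl r q \<inter> ivl r' q' \<noteq> {}" using i(1) by (simp add: overlap_def)
  then have "r = r' \<or> r = Suc r' \<or> r' = Suc r" using * by (auto simp: ivl_inter st_le_en)
  \<comment> \<open>Arcs join equally oriented intervals, and adjacent rounds have opposite
    orientations.\<close>
  then have r: "r' = r" using i(2) by auto
  have "f r q < f r q'"
  proof (cases "r = 0")
    case True
    then have "q < q'" using overlap_same[of r q q'] i * r by auto
    then show ?thesis using f4[of q q'] * True by simp
  next
    case False
    then have "q' = Suc q \<and> op r q = Test"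
    proof -
      have "overlap (ivl r q') (ivl r q)" using i(1) r overlap_sym by blast
      then have "if even r then overlap (ivl r q) (ivl r q') \<and> Inf (ivl r q) < Inf (ivl r q')
         else overlap (ivl r q') (ivl r q) \<and> Inf (ivl r q') < Inf (ivl r q)"
        using i(1,3) unfolding r by argo
      then show ?thesis
        unfolding overlap_same[OF *(3,4,6)] overlap_same[OF *(3,6,4)] using False by argo
    qed
    then show ?thesis using f3[of r q] * False by simp
  qed
  then show "case x of (u, v) \<Rightarrow> F u < F v" using x * r F by simp
qed
qed

text \<open>The first position, in the order of traversal of the next round, of the pair containing \<open>q\<close>.\<close>

definition fst_pos :: "nat \<Rightarrow> nat \<Rightarrow> nat" where
  "fst_pos r q = (if odd r then (if 0 < q \<and> op r (q - 1) \<noteq> Nop then q - 1 else q)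
     else (if op r q \<noteq> Nop then Suc q else q))"

lemma fst_pos_less: "q < k \<Longrightarrow> fst_pos r q < k"
  using op_wf[of r q] by (auto simp: fst_pos_def)

lemma fst_pos_idem: "fst_pos r (fst_pos r q) = fst_pos r q"
proof (cases "odd r")
  case True
  have "op r (q - 1 - 1) = Nop" if "0 < q - 1" "op r (q - 1) \<noteq> Nop"
  proof -
    have "Suc (q - 1 - 1) = q - 1" using that(1) by simp
    then show ?thesis using op_wf[of r "q - 1 - 1"] that(2) by metis
  qed
  then show ?thesis using True by (auto simp: fst_pos_def)
next
  case False
  then show ?thesis using op_wf[of r q] by (auto simp: fst_pos_def)
qed

lemma slot_fst_pos:
  assumes "q < k" "fst_pos r q \<noteq> q"
  shows "slot (Suc r) q = Suc (slot (Suc r) (fst_pos r q))"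
  using assms op_wf[of r q] by (auto simp: fst_pos_def slot_def split: if_splits)

text \<open>Tests and free steps move ends only within their pair, so an interval ends no earlier
  than in the first slot of its pair. Round 0 is excluded, as it reverses all positions.\<close>

lemma slot_endpos:
  assumes "0 < r" "q < k" shows "slot (Suc r) (fst_pos r q) \<le> slot (Suc r) (endpos r q)"
  using assms op_wf[of r q] op_wf[of r "q - 1"]
  by (cases "op r q"; cases "op r (q - 1)") (auto simp: fst_pos_def slot_def endpos_def)

lemma slot_fst_pos_mono:
  assumes "p < k" "q < k" "slot (Suc r) (fst_pos r p) \<le> slot (Suc r) q"
  shows "slot (Suc r) (fst_pos r p) \<le> slot (Suc r) (fst_pos r q)"
proof (cases "fst_pos r q = q")
  case True
  then show ?thesis using assms by simp
next
  case False
  have "fst_pos r p \<noteq> q" using fst_pos_idem[of r p] False by auto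
  then have "slot (Suc r) (fst_pos r p) \<noteq> slot (Suc r) q"
    using slot_inj[of "fst_pos r p" q "Suc r"] fst_pos_less[OF assms(1)] assms(2) by simp
  then show ?thesis using slot_fst_pos[OF assms(2) False] assms(3) by linarith
qed

text \<open>Both sides have the same sum over all positions, so no inequality can be strict. This is
  the counting argument that confines the inheritance of colours.\<close>

lemma bij_le_eq:
  fixes g b :: "nat \<Rightarrow> nat"
  assumes "bij_betw g {..<k} {..<k}" "\<And>q. q < k \<Longrightarrow> b (g q) \<le> b q" "q < k"
  shows "b (g q) = b q"
proof (rule ccontr)
  assume "b (g q) \<noteq> b q"
  then have "b (g q) < b q" using assms(2,3) by (simp add: le_neq_implies_less)
  then have "(\<Sum>q<k. b (g q)) < (\<Sum>q<k. b q)" using assms(2,3) by (intro sum_strict_mono_ex1) auto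
  moreover have "(\<Sum>q<k. b (g q)) = (\<Sum>q<k. b q)" using sum.reindex_bij_betw[OF assms(1)] .
  ultimately show False by simp
qed

text \<open>The colours are complemented. Round 1 inherits the colours of round 0 in reverse order
  of the positions, so the complement starts as the identity; moreover the arc of a test becomes the
  descent that \<open>row\<close> asks for.\<close>

definition state :: "(nat \<Rightarrow> nat \<Rightarrow> nat) \<Rightarrow> nat \<Rightarrow> nat \<Rightarrow> nat" where
  "state f r q = (if q < k then k - 1 - f r q else q)"

context
  fixes f :: "nat \<Rightarrow> nat \<Rightarrow> nat"
  assumes f: "proper f" and lt: "\<And>r q. r \<le> M \<Longrightarrow> q < k \<Longrightarrow> f r q < k"
begin

lemma f_bij: "r \<le> M \<Longrightarrow> bij_betw (f r) {..<k} {..<k}"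
proof -
  assume r: "r \<le> M"
  have inj: "inj_on (f r) {..<k}" using f r unfolding proper_def inj_on_def by (metis lessThan_iff)
  moreover have "f r ` {..<k} \<subseteq> {..<k}" using lt r by auto
  ultimately have "f r ` {..<k} = {..<k}" by (metis card_image card_subset_eq finite_lessThan)
  then show ?thesis using inj by (simp add: bij_betw_def)
qed

text \<open>Each round uses all \<open>k\<close> colours, so interval \<open>q\<close> of round
  \<open>r + 1\<close> has the colour of a unique interval \<open>g q\<close> of round
  \<open>r\<close>. That interval must have ended in the slot of \<open>q\<close> or earlier, since
  otherwise both would be alive with the same colour.\<close>

lemma transition:
  assumes "r < M"
  obtains g where "bij_betw g {..<k} {..<k}" "\<And>q. q < k \<Longrightarrow> f (Suc r) q = f r (g q)"
    "\<And>q. q < k \<Longrightarrow> slot (Suc r) (endpos r (g q)) \<le> slot (Suc r) q"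
proof -
  define g where "g = the_inv_into {..<k} (f r) \<circ> f (Suc r)"
  have b: "bij_betw (f r) {..<k} {..<k}" "bij_betw (f (Suc r)) {..<k} {..<k}" using f_bij assms by auto
  have gb: "bij_betw g {..<k} {..<k}" unfolding g_def
    using bij_betw_trans[OF b(2) bij_betw_the_inv_into[OF b(1)]] .
  have eq: "f (Suc r) q = f r (g q)" if "q < k" for q
    using f_the_inv_into_f_bij_betw[OF b(1)] lt[of "Suc r" q] assms that by (simp add: g_def)
  have "slot (Suc r) (endpos r (g q)) \<le> slot (Suc r) q" if "q < k" for q
  proof (rule ccontr)
    assume "\<not> ?thesis"
    moreover have "g q < k" using gb that bij_betwE by blast
    ultimately have "f r (g q) \<noteq> f (Suc r) q" using f assms that unfolding proper_def by (meson not_le)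
    then show False using eq that by simp
  qed
  then show ?thesis using that gb eq by blast
qed

lemma f_zero: "q < k \<Longrightarrow> f 0 q = q"
proof -
  assume q: "q < k"
  have mono: "f 0 q < f 0 q'" if "q < q'" "q' < k" for q q' using f that unfolding proper_def by blast
  have ge: "q \<le> f 0 q" if "q < k" for q
    using that
  proof (induction q)
    case (Suc q)
    then show ?case using mono[of q "Suc q"] by simp
  qed simp
  have "f 0 q + (k - q) \<le> k"
  proof -
    have "f 0 q + i < k" if "q + i < k" for i
    proof -
      have "f 0 q + i \<le> f 0 (q + i)" using that
      proof (induction i)
        case (Suc i)
        then show ?case using mono[of "q + i" "q + Suc i"] by simp
      qed simp
      then show ?thesis using lt[of 0 "q + i"] that by simp
    qed
    from this[of "k - q - 1"] show ?thesis using q by simp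
  qed
  then show ?thesis using ge[OF q] q by simp
qed

lemma state_one: "state f 1 = id"
proof
  fix q
  show "state f 1 q = id q"
  proof (cases "q < k")
    case True
    obtain g where g: "bij_betw g {..<k} {..<k}" "\<And>q. q < k \<Longrightarrow> f 1 q = f 0 (g q)"
      "\<And>q. q < k \<Longrightarrow> slot 1 (endpos 0 (g q)) \<le> slot 1 q"
      using transition[of 0] M by auto
    have gk: "g q < k" if "q < k" for q using g(1) that bij_betwE by blast
    \<comment> \<open>Round 1 is traversed in decreasing order. After reversing it, the inheritance
      map is a bijection that nowhere exceeds the identity, hence it is the identity.\<close>
    let ?h = "\<lambda>q. g (k - 1 - q)"
    have "bij_betw (\<lambda>q. k - 1 - q) {..<k} {..<k}"
      by (rule bij_betw_byWitness[where f' = "\<lambda>q. k - 1 - q"]) (use k in auto)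
    then have h: "bij_betw ?h {..<k} {..<k}"
      using bij_betw_trans[OF _ g(1), of "\<lambda>q. k - 1 - q" "{..<k}"] by (simp add: comp_def)
    have "?h q \<le> q" if "q < k" for q
      using g(3)[of "k - 1 - q"] gk[of "k - 1 - q"] that k by (auto simp: slot_def endpos_def)
    then have "?h q = q" if "q < k" for q using bij_le_eq[OF h, of "\<lambda>x. x" q] that by simp
    from this[of "k - 1 - q"] have "g q = k - 1 - q" using True by simp
    then have "f 1 q = k - 1 - q" using g(2)[OF True] f_zero[of "k - 1 - q"] k by simp
    then show ?thesis using True by (simp add: state_def)
  qed (simp add: state_def)
qed

lemma state_row:
  assumes r: "0 < r" "r < M" shows "row (op r) (state f r) (state f (Suc r))"
proof -
  obtain g where g: "bij_betw g {..<k} {..<k}" "\<And>q. q < k \<Longrightarrow> f (Suc r) q = f r (g q)"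
    "\<And>q. q < k \<Longrightarrow> slot (Suc r) (endpos r (g q)) \<le> slot (Suc r) q"
    using transition[OF r(2)] by blast
  have gk: "g q < k" if "q < k" for q using g(1) that bij_betwE by blast
  have ginj: "g q \<noteq> g q'" if "q < k" "q' < k" "q \<noteq> q'" for q q'
    using g(1) that by (metis bij_betw_def inj_on_def lessThan_iff)
  \<comment> \<open>The first slot of the pair of \<open>g q\<close> is never later than that of the
    pair of \<open>q\<close>. By counting they are equal, so \<open>g\<close> permutes every pair
    and fixes all idle positions.\<close>
  have "slot (Suc r) (fst_pos r (g q)) = slot (Suc r) (fst_pos r q)" if "q < k" for q
  proof (rule bij_le_eq[OF g(1), where b = "\<lambda>q. slot (Suc r) (fst_pos r q)"])
    fix q assume "q < k"
    then show "slot (Suc r) (fst_pos r (g q)) \<le> slot (Suc r) (fst_pos r q)"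
      using slot_endpos[OF r(1) gk] g(3)[of q] slot_fst_pos_mono[OF gk, of q q r] order_trans by blast
  qed (rule that)
  then have fi: "fst_pos r (g q) = fst_pos r q" if "q < k" for q
    using slot_inj fst_pos_less gk that by auto
  have out: "op r q = Nop" if "k \<le> Suc q" for q using op_wf[of r q] that by (cases "op r q") auto
  have single: "g q = q" if "q < k" "op r q = Nop" "q = 0 \<or> op r (q - 1) = Nop" for q
  proof -
    have "Suc (g q) = q \<Longrightarrow> q - 1 = g q" by simp
    then show ?thesis using fi[OF that(1)] that op_wf[of r "g q"] by (auto simp: fst_pos_def split: if_splits)
  qed
  have pair: "g q = q \<or> g q = Suc q" "g (Suc q) = q \<or> g (Suc q) = Suc q" "Suc q < k"
    if "op r q \<noteq> Nop" for q
  proof -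
    show 1: "Suc q < k" using op_wf[OF that] by simp
    have "op r (Suc q) = Nop" using op_wf[OF that] by simp
    moreover have "op r (q - 1) = Nop" if "0 < q" using op_wf[of r "q - 1"] \<open>op r q \<noteq> Nop\<close> that
      by (cases "op r (q - 1)") auto
    ultimately show "g q = q \<or> g q = Suc q" "g (Suc q) = q \<or> g (Suc q) = Suc q"
      using fi[of q] fi[of "Suc q"] that 1 by (auto simp: fst_pos_def split: if_splits)
  qed
  show ?thesis unfolding row_def
  proof (intro allI conjI impI)
    fix q assume "op r q = Nop \<and> (q = 0 \<or> op r (q - 1) = Nop)"
    then show "state f (Suc r) q = state f r q" using single[of q] g(2)[of q] by (cases "q < k") (auto simp: state_def)
  next
    fix q assume "op r q = Free"
    then have p: "g q = q \<or> g q = Suc q" "g (Suc q) = q \<or> g (Suc q) = Suc q" "Suc q < k" using pair[of q] by auto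
    then have "g q = q \<and> g (Suc q) = Suc q \<or> g q = Suc q \<and> g (Suc q) = q" using ginj[of q "Suc q"] by auto
    then show "state f (Suc r) q = state f r q \<and> state f (Suc r) (Suc q) = state f r (Suc q) \<or>
         state f (Suc r) q = state f r (Suc q) \<and> state f (Suc r) (Suc q) = state f r q"
      using g(2)[of q] g(2)[of "Suc q"] p(3) by (auto simp: state_def)
  next
    fix q assume T: "op r q = Test"
    then have p: "g q = q \<or> g q = Suc q" "g (Suc q) = q \<or> g (Suc q) = Suc q" "Suc q < k" using pair[of q] by auto
    \<comment> \<open>The ends of a tested pair are inverted. If both positions inherited from
      themselves, each of their two slots would have to be at or before the other.\<close>
    have "g q = Suc q \<and> g (Suc q) = q"
    proof (rule ccontr)
      assume "\<not> ?thesis"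
      then have "g q = q" "g (Suc q) = Suc q" using p ginj[of q "Suc q"] by auto
      then show False using g(3)[of q] g(3)[of "Suc q"] p(3) endpos_Test[OF r(1) T]
        by (cases "even r") (auto simp: slot_def)
    qed
    moreover have "f r q < f r (Suc q)" using f r T unfolding proper_def by auto
    ultimately show "state f r (Suc q) < state f r q" "state f (Suc r) q = state f r (Suc q)"
      "state f (Suc r) (Suc q) = state f r q"
      using g(2)[of q] g(2)[of "Suc q"] p(3) lt[of r "Suc q"] r by (auto simp: state_def)
  qed
qed

end

text \<open>The converse of the transition argument: a round of operations is a permutation
  \<open>g\<close> of positions that respects the times at which colours become available.\<close>

lemma row_perm:
  assumes "row (op r) v v'" "0 < r"
  shows "\<exists>g. (\<forall>q. v' q = v (g q)) \<and> bij_betw g {..<k} {..<k} \<and>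
    (\<forall>q<k. slot (Suc r) (endpos r (g q)) \<le> slot (Suc r) q)"
proof -
  \<comment> \<open>A free pair is taken to be exchanged only if the value at \<open>q\<close> has
    changed; if the two values coincide, not exchanging describes the same result.\<close>
  define sw where "sw q \<longleftrightarrow> op r q = Test \<or> op r q = Free \<and> v' q \<noteq> v q" for q
  define g where "g q = (if sw q then Suc q else if 0 < q \<and> sw (q - 1) then q - 1 else q)" for q
  have nxt: "op r (Suc q) = Nop" "Suc q < k" if "op r q \<noteq> Nop" for q using op_wf[OF that] by auto
  have prv: "op r (q - 1) = Nop" if "op r q \<noteq> Nop" "0 < q" for q
    using nxt[of "q - 1"] that by (cases "op r (q - 1)") auto
  have sw: "op r q \<noteq> Nop" if "sw q" for q using that by (auto simp: sw_def)
  have sw1: "\<not> sw (Suc q)" if "sw q" for q using nxt[OF sw[OF that]] sw[of "Suc q"] by auto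
  have 1: "v' q = v (g q)" for q
  proof -
    have rw: "op r q = Nop \<and> (q = 0 \<or> op r (q - 1) = Nop) \<longrightarrow> v' q = v q"
      "op r q = Free \<longrightarrow> v' q = v q \<and> v' (Suc q) = v (Suc q) \<or> v' q = v (Suc q) \<and> v' (Suc q) = v q"
      "op r q = Test \<longrightarrow> v' q = v (Suc q) \<and> v' (Suc q) = v q" for q
      using assms(1) unfolding row_def by blast+
    show ?thesis
    proof (cases "op r q")
      case Nop
      show ?thesis
      proof (cases "0 < q \<and> op r (q - 1) \<noteq> Nop")
        case True
        then have "\<not> sw q" "Suc (q - 1) = q" using Nop sw by auto
        then show ?thesis using rw(2,3)[of "q - 1"] True sw1[of "q - 1"]
          by (cases "op r (q - 1)") (auto simp: g_def sw_def)
      next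
        case False
        then have "\<not> sw q" "\<not> (0 < q \<and> sw (q - 1))" using Nop sw by auto
        then show ?thesis using rw(1)[of q] False Nop by (auto simp: g_def)
      qed
    next
      case Free
      then have "\<not> (0 < q \<and> sw (q - 1))" using prv[of q] sw by auto
      then show ?thesis using rw(2)[of q] Free by (auto simp: g_def sw_def)
    next
      case Test
      then show ?thesis using rw(3)[of q] by (auto simp: g_def sw_def)
    qed
  qed
  have gg: "g (g q) = q" for q
    using sw1[of q] sw1[of "q - 1"] by (auto simp: g_def)
  have gk: "g q < k" if "q < k" for q
    using nxt(2)[OF sw] that by (auto simp: g_def)
  have 2: "bij_betw g {..<k} {..<k}"
    by (rule bij_betw_byWitness[where f' = g]) (use gg gk in auto)
  have 3: "slot (Suc r) (endpos r (g q)) \<le> slot (Suc r) q" if q: "q < k" for q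
  proof (cases "sw q")
    case True
    then have "g q = Suc q" "op r q \<noteq> Nop" using sw by (auto simp: g_def)
    then show ?thesis using nxt[of q] assms(2) by (cases "op r q") (auto simp: endpos_def slot_def)
  next
    case F: False
    show ?thesis
    proof (cases "0 < q \<and> sw (q - 1)")
      case True
      then have "g q = q - 1" "op r (q - 1) \<noteq> Nop" using sw F by (auto simp: g_def)
      then show ?thesis using nxt[of "q - 1"] assms(2) True by (cases "op r (q - 1)") (auto simp: endpos_def slot_def)
    next
      case False
      then have "g q = q" using F by (auto simp: g_def)
      moreover have "op r q \<noteq> Test" using F by (auto simp: sw_def)
      moreover have "0 < q \<longrightarrow> op r (q - 1) \<noteq> Test" using False by (auto simp: sw_def)
      ultimately show ?thesis using nxt[of q] assms(2) q by (auto simp: endpos_def slot_def)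
    qed
  qed
  show ?thesis using 1 2 3 by blast
qed

lemma proper_of_rows:
  assumes w: "w 1 = id" "\<And>r. 0 < r \<Longrightarrow> r < M \<Longrightarrow> row (op r) (w r) (w (Suc r))"
  defines "f \<equiv> \<lambda>r q. if r = 0 then q else k - 1 - w r q"
  shows "proper f" "\<And>r q. r \<le> M \<Longrightarrow> q < k \<Longrightarrow> f r q < k"
proof -
  have perm: "bij_betw (w r) {..<k} {..<k}" if "0 < r" "r \<le> M" for r
    using that
  proof (induction r)
    case (Suc r)
    show ?case
    proof (cases "r = 0")
      case True
      then show ?thesis using w(1) bij_betw_id[of "{..<k}"] by (metis One_nat_def id_def)
    next
      case False
      then have r: "0 < r" "r < M" using Suc.prems by auto
      have b: "bij_betw (w r) {..<k} {..<k}" using Suc.IH r by simp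
      from row_perm[OF w(2)[OF r] r(1)] obtain g where g: "\<forall>q. w (Suc r) q = w r (g q)" "bij_betw g {..<k} {..<k}"
        by (elim exE conjE)
      have "w (Suc r) = w r \<circ> g" by (rule ext) (simp add: g(1))
      from bij_betw_trans[OF g(2) b, folded this] show ?thesis .
    qed
  qed simp
  have wlt: "w r q < k" if "0 < r" "r \<le> M" "q < k" for r q using perm[of r] that bij_betwE by blast
  have winj: "w r q \<noteq> w r q'" if "0 < r" "r \<le> M" "q < k" "q' < k" "q \<noteq> q'" for r q q'
    using perm[of r] that by (metis bij_betw_def inj_on_def lessThan_iff)
  show "f r q < k" if "r \<le> M" "q < k" for r q using that k by (auto simp: f_def)
  have inj: "k - 1 - a \<noteq> k - 1 - b" if "a < k" "b < k" "a \<noteq> b" for a b :: nat using that by linarith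
  show "proper f" unfolding proper_def
  proof (intro conjI allI impI; elim conjE)
    fix r q q' assume a: "r \<le> M" "q < k" "q' < k" "q \<noteq> q'"
    show "f r q \<noteq> f r q'"
    proof (cases "r = 0")
      case True
      then show ?thesis using a(4) by (simp add: f_def)
    next
      case False
      then have r: "0 < r" by simp
      show ?thesis
        using inj[OF wlt[OF r a(1,2)] wlt[OF r a(1,3)] winj[OF r a]] r by (simp add: f_def)
    qed
  next
    fix r q q' assume a: "r < M" "q < k" "q' < k" "slot (Suc r) q' < slot (Suc r) (endpos r q)"
    show "f r q \<noteq> f (Suc r) q'"
    proof (cases "r = 0")
      case True
      then have "f (Suc r) q' = k - 1 - q'" "f r q = q" using w(1) by (auto simp: f_def)
      then show ?thesis using a True k by (auto simp: slot_def endpos_def)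
    next
      case False
      then have r: "0 < r" by simp
      from row_perm[OF w(2)[OF r a(1)] r] obtain g where g: "\<forall>q. w (Suc r) q = w r (g q)"
         "bij_betw g {..<k} {..<k}" "\<forall>q<k. slot (Suc r) (endpos r (g q)) \<le> slot (Suc r) q"
        by (elim exE conjE)
      have "g q' \<noteq> q" using g(3) a(3,4) by auto
      moreover have "g q' < k" using g(2) a(3) bij_betwE by blast
      moreover have "r \<le> M" using a(1) by simp
      ultimately have "k - 1 - w r q \<noteq> k - 1 - w r (g q')"
        using inj wlt[OF r] winj[OF r, of q "g q'"] a(2) by metis
      then show ?thesis using r g(1) by (simp add: f_def)
    qed
  next
    fix r q assume a: "0 < r" "r \<le> M" "op r q = Test"
    \<comment> \<open>The last round is idle, so a test belongs to a round for which
      \<open>row\<close> is available.\<close>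
    then have r: "r < M" using op_last[of q] by (cases "r = M") simp_all
    have "w r (Suc q) < w r q" using w(2)[OF a(1) r, unfolded row_def, rule_format, of q] a(3) by simp
    moreover have "Suc q < k" using op_wf[of r q] a by simp
    then have "w r q < k" using wlt[OF a(1,2), of q] by simp
    ultimately show "f r q < f r (Suc q)" using a(1) by (simp add: f_def)
  next
    fix q q' assume "q < q'" "q' < k"
    then show "f 0 q < f 0 q'" by (simp add: f_def)
  qed
qed

theorem chromatic_iff_rows:
  "chromatic_number G \<le> enat k \<longleftrightarrow> (\<exists>v. rows op 1 (M - 1) id v)"
proof
  assume "chromatic_number G \<le> enat k"
  then obtain F where F: "proper_coloring G F" "card (F ` verts G) \<le> k"
    by (auto simp: chromatic_number_le_iff)
  have fin: "finite (verts G)"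
  proof -
    have "ivls = (\<lambda>(r, q). ivl r q) ` ({..M} \<times> {..<k})" by (auto simp: ivls_def)
    then have "finite ivls" by simp
    then show ?thesis unfolding verts_G .
  qed
  have wf: "\<And>e u. e \<in> edges G \<Longrightarrow> u \<in> e \<Longrightarrow> u \<in> verts G" "\<And>u v. (u, v) \<in> arcs G \<Longrightarrow> u \<in> verts G \<and> v \<in> verts G"
    by (auto simp: bidirectional_interval_graph_def)
  have "\<exists>g. proper_coloring G g \<and> (\<forall>u \<in> verts G. g u < k)"
    by (rule compress_coloring[OF fin F]) (use wf in blast)+
  then obtain F' where F': "proper_coloring G F'" "\<forall>u \<in> verts G. F' u < k"
    by (elim exE conjE)
  define f where "f r q = F' (ivl r q)" for r q
  have f: "proper f" "\<And>r q. r \<le> M \<Longrightarrow> q < k \<Longrightarrow> f r q < k"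
    using proper_of_coloring[OF F'(1)] F'(2)[unfolded verts_G, rule_format, OF ivls_I] unfolding f_def .
  have "rows op 1 (M - 1) id (state f (1 + (M - 1)))"
    unfolding rows_path
    by (intro exI[of _ "state f"] conjI state_one[OF f] allI impI state_row[OF f] refl) auto
  then show "\<exists>v. rows op 1 (M - 1) id v" by blast
next
  assume "\<exists>v. rows op 1 (M - 1) id v"
  then obtain w where w1: "w 1 = id" and w2: "\<forall>i. 1 \<le> i \<and> i < 1 + (M - 1) \<longrightarrow> row (op i) (w i) (w (Suc i))"
    unfolding rows_path by (elim exE conjE)
  have w: "w 1 = id" "\<And>r. 0 < r \<Longrightarrow> r < M \<Longrightarrow> row (op r) (w r) (w (Suc r))"
    using w1 w2 by simp_all
  define f where "f = (\<lambda>r q. if r = 0 then q else k - 1 - w r q)"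
  note f = proper_of_rows[OF w, folded f_def]
  define F where "F S = (case SOME p. S = ivl (fst p) (snd p) \<and> fst p \<le> M \<and> snd p < k of (r, q) \<Rightarrow> f r q)" for S
  have F: "F (ivl r q) = f r q" if "r \<le> M" "q < k" for r q
  proof -
    have "(SOME p. ivl r q = ivl (fst p) (snd p) \<and> fst p \<le> M \<and> snd p < k) = (r, q)"
      using that by (intro some_equality) (auto simp: ivl_inj)
    then show ?thesis by (simp add: F_def)
  qed
  have "proper_coloring G F" by (rule coloring_of_proper[OF f(1) F])
  moreover have "F u < k" if u: "u \<in> ivls" for u
  proof -
    obtain r q where "u = ivl r q" "r \<le> M" "q < k" using u unfolding ivls_def by blast
    then show ?thesis using F[of r q] f(2)[of r q] by (simp add: f_def)
  qed
  then have "F ` verts G \<subseteq> {..<k}" unfolding verts_G by blast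
  then have "card (F ` verts G) \<le> k" using card_mono[of "{..<k}" "F ` verts G"] by simp
  ultimately show "chromatic_number G \<le> enat k" using chromatic_number_le_iff by blast
qed

end


section \<open>Structured programs for Turing machines\<close>

datatype cmd = CSkip | CMv nat move | CWr nat nat move | CSeq cmd cmd
  | CIf nat "nat set" cmd cmd | CWh nat "nat set" cmd

type_synonym tapes = "(nat \<Rightarrow> int \<Rightarrow> nat) \<times> (nat \<Rightarrow> int)"

abbreviation scan :: "tapes \<Rightarrow> nat \<Rightarrow> nat" where
  "scan s i \<equiv> fst s i (snd s i)"

fun cstep :: "cmd list \<times> tapes \<Rightarrow> cmd list \<times> tapes" where
  "cstep ([], s) = ([], s)"
| "cstep (CSkip # k, s) = (k, s)"
| "cstep (CMv i m # k, s) = (k, (fst s, (snd s)(i := snd s i + shift m)))"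
| "cstep (CWr i a m # k, s) = (k, ((fst s)(i := (fst s i)(snd s i := a)), (snd s)(i := snd s i + shift m)))"
| "cstep (CSeq c d # k, s) = (c # d # k, s)"
| "cstep (CIf i A c d # k, s) = ((if scan s i \<in> A then c else d) # k, s)"
| "cstep (CWh i A c # k, s) = (if scan s i \<in> A then c # CWh i A c # k else k, s)"

text \<open>The stacks of commands that can occur while \<open>c\<close> runs on top of
  \<open>k\<close>. There are finitely many of them even for loops, and they become the states of
  the Turing machine.\<close>

fun conts :: "cmd \<Rightarrow> cmd list \<Rightarrow> cmd list set" where
  "conts (CSeq c d) k = insert (CSeq c d # k) (conts c (d # k) \<union> conts d k)"
| "conts (CIf i A c d) k = insert (CIf i A c d # k) (conts c k \<union> conts d k)"
| "conts (CWh i A c) k = insert (CWh i A c # k) (conts c (CWh i A c # k))"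
| "conts c k = {c # k}"

fun okc :: "nat \<Rightarrow> nat \<Rightarrow> cmd \<Rightarrow> bool" where
  "okc n G CSkip \<longleftrightarrow> True"
| "okc n G (CMv i m) \<longleftrightarrow> i < n"
| "okc n G (CWr i a m) \<longleftrightarrow> i < n \<and> a < G"
| "okc n G (CSeq c d) \<longleftrightarrow> okc n G c \<and> okc n G d"
| "okc n G (CIf i A c d) \<longleftrightarrow> i < n \<and> okc n G c \<and> okc n G d"
| "okc n G (CWh i A c) \<longleftrightarrow> i < n \<and> okc n G c"

lemma conts_self: "c # k \<in> conts c k"
  by (cases c) auto

lemma finite_conts: "finite (conts c k)"
  by (induction c k rule: conts.induct) auto

lemma conts_step: "k \<in> conts c k0 \<Longrightarrow> fst (cstep (k, s)) \<in> insert k0 (conts c k0)"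
proof (induction c k0 rule: conts.induct)
  case (1 c d k0)
  then show ?case using conts_self by auto
next
  case (2 i A c d k0)
  then show ?case using conts_self by auto
next
  case (3 i A c k0)
  then show ?case using conts_self by (auto split: if_splits)
qed auto

lemma conts_ok: "k \<in> conts c k0 \<Longrightarrow> okc n G c \<Longrightarrow> \<forall>x \<in> set k0. okc n G x \<Longrightarrow> k \<noteq> [] \<and> (\<forall>x \<in> set k. okc n G x)"
  by (induction c k0 rule: conts.induct) auto

fun tstep :: "cmd list \<Rightarrow> nat list \<Rightarrow> cmd list \<times> (nat \<times> move) list" where
  "tstep [] ss = ([], map (\<lambda>x. (x, Stay)) ss)"
| "tstep (CSkip # k) ss = (k, map (\<lambda>x. (x, Stay)) ss)"
| "tstep (CMv i m # k) ss = (k, (map (\<lambda>x. (x, Stay)) ss)[i := (ss ! i, m)])"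
| "tstep (CWr i a m # k) ss = (k, (map (\<lambda>x. (x, Stay)) ss)[i := (a, m)])"
| "tstep (CSeq c d # k) ss = (c # d # k, map (\<lambda>x. (x, Stay)) ss)"
| "tstep (CIf i A c d # k) ss = ((if ss ! i \<in> A then c else d) # k, map (\<lambda>x. (x, Stay)) ss)"
| "tstep (CWh i A c # k) ss = (if ss ! i \<in> A then c # CWh i A c # k else k, map (\<lambda>x. (x, Stay)) ss)"

text \<open>A small step depends only on the stack and the scanned symbols, and it is exactly one
  machine step. Step counts of commands are therefore running times of the machine.\<close>

lemma tstep_cstep:
  fixes s :: tapes
  assumes "k \<noteq> [] \<Longrightarrow> okc n G (hd k)"
  defines "t \<equiv> tstep k (map (\<lambda>i. scan s i) [0..<n])"
  shows "fst t = fst (cstep (k, s))"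
    "(\<lambda>i. if i < n then (fst s i)(snd s i := fst (snd t ! i)) else fst s i) = fst (snd (cstep (k, s)))"
    "(\<lambda>i. if i < n then snd s i + shift (snd (snd t ! i)) else snd s i) = snd (snd (cstep (k, s)))"
  using assms by (cases "(k, s)" rule: cstep.cases; auto simp: t_def nth_list_update fun_eq_iff)+

lemma tstep_wf:
  assumes "k \<noteq> [] \<Longrightarrow> okc n G (hd k)" "length ss = n" "set ss \<subseteq> {..<G}"
  shows "length (snd (tstep k ss)) = n" "fst ` set (snd (tstep k ss)) \<subseteq> {..<G}"
proof -
  have *: "fst ` set (map (\<lambda>x. (x, Stay)) ss) \<subseteq> {..<G}" using assms(3) by force
  show "length (snd (tstep k ss)) = n" using assms by (cases "(k, ss)" rule: tstep.cases) auto
  show "fst ` set (snd (tstep k ss)) \<subseteq> {..<G}"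
  proof (cases "(k, ss)" rule: tstep.cases)
    case (3 i m k ss')
    have "ss ! i < G" using 3 assms by (metis lessThan_iff list.sel(1) list.distinct(1) nth_mem okc.simps(2) prod.inject subsetD)
    then show ?thesis using 3 * set_update_subset_insert[of "map (\<lambda>x. (x, Stay)) ss" i "(ss ! i, m)"] by fastforce
  next
    case (4 i a m k ss')
    then have "a < G" using assms(1) by auto
    then show ?thesis using 4 * set_update_subset_insert[of "map (\<lambda>x. (x, Stay)) ss" i "(a, m)"] by fastforce
  qed (use * in auto)
qed

text \<open>Machine states are numbered with the initial state first and the halting state last, so
  the full program must get number 0 and the empty stack the largest number.\<close>

lemma index_exists:
  assumes "finite Q" "x \<in> Q" "y \<in> Q" "x \<noteq> y"
  obtains f :: "'a \<Rightarrow> nat" where "inj_on f Q" "f x = 0" "f y = card Q - 1" "\<And>z. z \<in> Q \<Longrightarrow> f z < card Q"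
proof -
  obtain g :: "'a \<Rightarrow> nat" where g: "bij_betw g (Q - {x, y}) {0..<card (Q - {x, y})}"
    using ex_bij_betw_finite_nat[of "Q - {x, y}"] assms(1) by auto
  have c: "card (Q - {x, y}) = card Q - 2" "2 \<le> card Q"
  proof -
    have "card {x, y} = 2" "{x, y} \<subseteq> Q" using assms by auto
    then show "card (Q - {x, y}) = card Q - 2" "2 \<le> card Q"
      using card_Diff_subset[of "{x, y}" Q] card_mono[of Q "{x, y}"] assms(1) by auto
  qed
  define f where "f z = (if z = x then 0 else if z = y then card Q - 1 else Suc (g z))" for z
  have gl: "g z < card Q - 2" if "z \<in> Q" "z \<noteq> x" "z \<noteq> y" for z
    using g that c unfolding bij_betw_def by auto
  have "inj_on f Q"
  proof (rule inj_onI)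
    fix a b assume ab: "a \<in> Q" "b \<in> Q" "f a = f b"
    have gi: "g a = g b \<Longrightarrow> a = b" if "a \<noteq> x" "a \<noteq> y" "b \<noteq> x" "b \<noteq> y"
      using g ab that unfolding bij_betw_def inj_on_def by blast
    show "a = b" using ab gi gl[of a] gl[of b] c unfolding f_def by (auto split: if_splits)
  qed
  moreover have "f z < card Q" if "z \<in> Q" for z using gl[of z] that c by (auto simp: f_def)
  ultimately show ?thesis using that[of f] assms(4) by (auto simp: f_def)
qed

text \<open>The number of steps is chosen before the continuation \<open>k\<close>. With a uniform
  number, runs can be composed under any stack.\<close>

definition exec :: "cmd \<Rightarrow> tapes \<Rightarrow> nat \<Rightarrow> tapes \<Rightarrow> bool" where
  "exec c s B s' \<longleftrightarrow> (\<exists>t \<le> B. \<forall>k. (cstep ^^ t) (c # k, s) = (k, s'))"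

lemma poly_time_cmd:
  fixes p :: "nat poly"
  assumes ok: "okc n G c" "2 \<le> n" "3 \<le> G"
    and ex: "\<And>w. \<exists>s'. exec c (content (init_config w), head (init_config w)) (poly p (length w)) s' \<and>
        fst s' 1 = word_tape (f w)"
  shows "poly_time f"
proof -
  define Q where "Q = insert [] (conts c [])"
  have Q: "finite Q" "[c] \<in> Q" "[] \<in> Q" using finite_conts conts_self by (auto simp: Q_def)
  obtain ix :: "cmd list \<Rightarrow> nat" where ix: "inj_on ix Q" "ix [c] = 0" "ix [] = card Q - 1"
    "\<And>z. z \<in> Q \<Longrightarrow> ix z < card Q"
    using index_exists[OF Q(1,2,3)] by (metis list.distinct(1))
  define xi where "xi = the_inv_into Q ix"
  have xi: "xi (ix k) = k" if "k \<in> Q" for k unfolding xi_def by (rule the_inv_into_f_f[OF ix(1) that])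
  \<comment> \<open>The value 0 for a stack outside \<open>Q\<close> only keeps the transition
    function within the state range. On actual tapes \<open>cl\<close> shows that it is never
    taken.\<close>
  define M where "M = \<lparr>ntapes = n, nstates = card Q - 1, nsymbols = G,
     trans = (\<lambda>q ss. let (k, as) = tstep (xi q) ss in (if k \<in> Q then ix k else 0, as))\<rparr>"
  have cl: "fst (cstep (k, s)) \<in> Q" if "k \<in> Q" for k s
    using that conts_step[of k c "[]" s] by (auto simp: Q_def)
  have okk: "k \<noteq> [] \<Longrightarrow> okc n G (hd k)" if "k \<in> Q" for k
    using that conts_ok[of k c "[]" n G] ok(1) by (auto simp: Q_def)
  have surj: "\<exists>k \<in> Q. ix k = q" if "q < card Q" for q
  proof -
    have "ix ` Q = {..<card Q}"
      by (rule card_subset_eq) (use ix(4) card_image[OF ix(1)] in auto)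
    then show ?thesis using that by (metis image_iff lessThan_iff)
  qed
  have wf: "wf_tm M" unfolding wf_tm_def
  proof (intro conjI allI impI; (elim conjE)?)
    show "2 \<le> ntapes M" "3 \<le> nsymbols M" using ok by (auto simp: M_def)
    fix q ss assume q: "q < nstates M" and ss: "length ss = ntapes M" "set ss \<subseteq> {..<nsymbols M}"
    have "q < card Q" using q by (simp add: M_def)
    then obtain k where k: "k \<in> Q" "ix k = q" using surj by blast
    have lt: "ix z \<le> card Q - 1" if "z \<in> Q" for z using ix(4)[OF that] by linarith
    have "length (snd (tstep k ss)) = n" "fst ` set (snd (tstep k ss)) \<subseteq> {..<G}"
      using tstep_wf[of k n G ss] okk[OF k(1)] ss by (auto simp: M_def)
    then show "fst (trans M q ss) \<le> nstates M" "length (snd (trans M q ss)) = ntapes M"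
      "fst ` set (snd (trans M q ss)) \<subseteq> {..<nsymbols M}"
      using lt xi[OF k(1)] k(2) by (simp_all add: M_def Let_def case_prod_beta)
  qed
  define cfg where "cfg x = \<lparr>state = ix (fst x), content = fst (snd x), head = snd (snd x)\<rparr>" for x :: "cmd list \<times> tapes"
  have step: "step M (cfg (k, s)) = cfg (cstep (k, s))" if k: "k \<in> Q" for k s
  proof (cases "k = []")
    case True
    then show ?thesis by (simp add: step_def cfg_def M_def ix(3))
  next
    case False
    then have "ix k \<noteq> card Q - 1" using ix(1,3) k Q(3) by (metis inj_on_def)
    moreover note tc = tstep_cstep[of k n G s, OF okk[OF k]]
    ultimately show ?thesis
      using tc cl[OF k, of s] xi[OF k]
      by (simp add: step_def cfg_def M_def Let_def case_prod_beta cong: if_cong)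
  qed
  have steps: "fst ((cstep ^^ t) (k, s)) \<in> Q \<and> (step M ^^ t) (cfg (k, s)) = cfg ((cstep ^^ t) (k, s))" if "k \<in> Q" for t k s
  proof (induction t)
    case (Suc t)
    obtain k' s' where ks: "(cstep ^^ t) (k, s) = (k', s')" by (cases "(cstep ^^ t) (k, s)")
    then show ?case using Suc cl[of k' s'] step[of k' s'] by simp
  qed (use that in simp)
  have "outputs_within M w (poly p (length w)) (f w)" for w
  proof -
    let ?s = "(content (init_config w), head (init_config w))"
    obtain s' t where s': "t \<le> poly p (length w)" "\<forall>k. (cstep ^^ t) (c # k, ?s) = (k, s')" "fst s' 1 = word_tape (f w)"
      using ex[of w] unfolding exec_def by blast
    have fx: "(cstep ^^ r) ([], s') = ([], s')" for r by (induction r) auto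
    obtain r where r: "poly p (length w) = r + t" using s'(1) by (metis le_add_diff_inverse2)
    have "(cstep ^^ poly p (length w)) ([c], ?s) = ([], s')"
      unfolding r funpow_add using s'(2)[rule_format, of "[]"] fx by simp
    moreover have "init_config w = cfg ([c], ?s)" by (simp add: cfg_def ix(2) init_config_def)
    ultimately have "(step M ^^ poly p (length w)) (init_config w) = cfg ([], s')"
      using steps[OF Q(2), of "poly p (length w)" ?s] by simp
    then show ?thesis using s'(3) by (simp add: outputs_within_def cfg_def M_def ix(3) Let_def)
  qed
  then show ?thesis unfolding poly_time_def using wf by blast
qed


text \<open>A tape is described by a finite word from cell 0 on, surrounded by blanks. Words that
  avoid the symbol 0 have detectable ends, and all loops over tapes rely on this.\<close>

definition wtape :: "nat list \<Rightarrow> int \<Rightarrow> nat" where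
  "wtape ws z = (if 0 \<le> z \<and> z < int (length ws) then ws ! nat z else 0)"

type_synonym store = "nat \<Rightarrow> nat list \<times> int"

definition conc :: "store \<Rightarrow> tapes" where
  "conc st = (\<lambda>i. wtape (fst (st i)), \<lambda>i. snd (st i))"

definition ex :: "cmd \<Rightarrow> store \<Rightarrow> nat \<Rightarrow> store \<Rightarrow> bool" where
  "ex c st B st' \<longleftrightarrow> exec c (conc st) B (conc st')"

lemma exec1: "(\<And>k. cstep (c # k, s) = (k, s')) \<Longrightarrow> exec c s 1 s'"
  unfolding exec_def by (intro exI[of _ 1]) auto

lemma exec_seq_gen:
  assumes "exec c s B s1" "exec d s1 B' s2" "\<And>k. cstep (e # k, s) = (c # d # k, s)"
  shows "exec e s (B + B' + 1) s2"
proof -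
  obtain t t' where t: "t \<le> B" "\<forall>k. (cstep ^^ t) (c # k, s) = (k, s1)" "t' \<le> B'" "\<forall>k. (cstep ^^ t') (d # k, s1) = (k, s2)"
    using assms(1,2) unfolding exec_def by blast
  have "(cstep ^^ (t' + t + 1)) (e # k, s) = (k, s2)" for k
    unfolding funpow_add using t(2,4) assms(3)[of k] by simp
  then show ?thesis unfolding exec_def using t(1,3) by (intro exI[of _ "t' + t + 1"]) auto
qed

lemma exec_one_gen:
  assumes "exec c s B s1" "\<And>k. cstep (e # k, s) = (c # k, s)"
  shows "exec e s (B + 1) s1"
proof -
  obtain t where t: "t \<le> B" "\<forall>k. (cstep ^^ t) (c # k, s) = (k, s1)" using assms(1) unfolding exec_def by blast
  have "(cstep ^^ (t + 1)) (e # k, s) = (k, s1)" for k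
    unfolding funpow_add using t(2) assms(2)[of k] by simp
  then show ?thesis unfolding exec_def using t(1) by (intro exI[of _ "t + 1"]) auto
qed

lemma ex_weaken: "ex c st B st' \<Longrightarrow> B \<le> B' \<Longrightarrow> ex c st B' st'"
  unfolding ex_def exec_def using order_trans by blast

lemma ex_skip: "ex CSkip st 1 st"
  unfolding ex_def by (rule exec1) simp

lemma ex_mv: "st i = (ws, j) \<Longrightarrow> ex (CMv i m) st 1 (st(i := (ws, j + shift m)))"
  unfolding ex_def by (rule exec1) (auto simp: conc_def fun_eq_iff)

lemma ex_upd:
  assumes "st i = (ws, j)" "0 \<le> j" "j < int (length ws)"
  shows "ex (CWr i a m) st 1 (st(i := (ws[nat j := a], j + shift m)))"
  unfolding ex_def by (rule exec1) (use assms in \<open>auto simp: conc_def fun_eq_iff wtape_def nth_list_update\<close>)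

lemma ex_push:
  assumes "st i = (ws, int (length ws))"
  shows "ex (CWr i a Move_Right) st 1 (st(i := (ws @ [a], int (length (ws @ [a])))))"
  unfolding ex_def by (rule exec1) (use assms in \<open>auto simp: conc_def fun_eq_iff wtape_def nth_append nat_less_iff\<close>)

lemma ex_seq: "ex c st B st1 \<Longrightarrow> ex d st1 B' st2 \<Longrightarrow> ex (CSeq c d) st (B + B' + 1) st2"
  unfolding ex_def by (rule exec_seq_gen) auto

lemma ex_if: "ex (if wtape (fst (st i)) (snd (st i)) \<in> A then c else d) st B st' \<Longrightarrow> ex (CIf i A c d) st (B + 1) st'"
  unfolding ex_def by (rule exec_one_gen) (auto simp: conc_def)

lemma ex_wh_stop: "wtape (fst (st i)) (snd (st i)) \<notin> A \<Longrightarrow> ex (CWh i A c) st 1 st"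
  unfolding ex_def by (rule exec1) (auto simp: conc_def)

lemma ex_wh_go:
  assumes "wtape (fst (st i)) (snd (st i)) \<in> A" "ex c st B st1" "ex (CWh i A c) st1 B' st2"
  shows "ex (CWh i A c) st (B + B' + 1) st2"
  using assms(2,3) unfolding ex_def by (rule exec_seq_gen) (use assms(1) in \<open>auto simp: conc_def\<close>)

lemma wtape_nz: "0 \<notin> set ws \<Longrightarrow> wtape ws j \<in> - {0} \<longleftrightarrow> 0 \<le> j \<and> j < int (length ws)"
  by (auto simp: wtape_def in_set_conv_nth)

definition goleft :: "nat \<Rightarrow> cmd" where "goleft i = CWh i (- {0}) (CMv i Move_Left)"
definition goright :: "nat \<Rightarrow> cmd" where "goright i = CWh i (- {0}) (CMv i Move_Right)"
definition rewind :: "nat \<Rightarrow> cmd" where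
  "rewind i = CSeq (CMv i Move_Left) (CSeq (goleft i) (CMv i Move_Right))"

lemma ex_goleft:
  assumes nz: "0 \<notin> set ws"
  shows "st i = (ws, int j - 1) \<Longrightarrow> j \<le> length ws \<Longrightarrow> ex (goleft i) st (2 * j + 1) (st(i := (ws, - 1)))"
proof (induction j arbitrary: st)
  case 0
  then have "st(i := (ws, - 1)) = st" by auto
  then show ?case using 0 ex_wh_stop[of st i "- {0}" "CMv i Move_Left"] by (simp add: goleft_def wtape_def)
next
  case (Suc j)
  let ?st = "st(i := (ws, int j - 1))"
  have "ex (goleft i) ?st (2 * j + 1) (?st(i := (ws, - 1)))" by (rule Suc.IH) (use Suc.prems in auto)
  moreover have "ex (CMv i Move_Left) st 1 ?st" using ex_mv[of st i ws "int j" Move_Left] Suc.prems by simp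
  moreover have "wtape (fst (st i)) (snd (st i)) \<in> - {0}" using Suc.prems by (simp only: fst_conv snd_conv wtape_nz[OF nz]) simp
  ultimately have "ex (goleft i) st (1 + (2 * j + 1) + 1) (?st(i := (ws, - 1)))"
    unfolding goleft_def using ex_wh_go by blast
  then show ?case unfolding fun_upd_upd by (rule ex_weaken) simp
qed

lemma ex_goright:
  assumes nz: "0 \<notin> set ws"
  shows "st i = (ws, int j) \<Longrightarrow> j \<le> length ws \<Longrightarrow>
    ex (goright i) st (2 * (length ws - j) + 1) (st(i := (ws, int (length ws))))"
proof (induction "length ws - j" arbitrary: j st)
  case 0
  then have "st(i := (ws, int (length ws))) = st" by auto
  then show ?case using 0 ex_wh_stop[of st i "- {0}" "CMv i Move_Right"] by (simp add: goright_def wtape_def)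
next
  case (Suc l)
  let ?st = "st(i := (ws, int (Suc j)))"
  have "ex (goright i) ?st (2 * (length ws - Suc j) + 1) (?st(i := (ws, int (length ws))))"
    by (rule Suc.hyps(1)) (use Suc in auto)
  moreover have "ex (CMv i Move_Right) st 1 ?st" using ex_mv[of st i ws "int j" Move_Right] Suc.prems by (simp add: add.commute)
  moreover have "wtape (fst (st i)) (snd (st i)) \<in> - {0}" using Suc by (simp only: fst_conv snd_conv wtape_nz[OF nz]) simp
  ultimately have "ex (goright i) st (1 + (2 * (length ws - Suc j) + 1) + 1) (?st(i := (ws, int (length ws))))"
    unfolding goright_def using ex_wh_go by blast
  then show ?case unfolding fun_upd_upd by (rule ex_weaken) (use Suc in simp)
qed

lemma ex_rewind:
  assumes nz: "0 \<notin> set ws" and st: "st i = (ws, int j)" "j \<le> length ws"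
  shows "ex (rewind i) st (2 * j + 5) (st(i := (ws, 0)))"
proof -
  let ?s1 = "st(i := (ws, int j - 1))" and ?s2 = "st(i := (ws, - 1))"
  have 1: "ex (CMv i Move_Left) st 1 ?s1" using ex_mv[of st i ws "int j" Move_Left] st by simp
  have 2: "ex (goleft i) ?s1 (2 * j + 1) ?s2" using ex_goleft[OF nz, of ?s1 i j] st by simp
  have 3: "ex (CMv i Move_Right) ?s2 1 (st(i := (ws, 0)))" using ex_mv[of ?s2 i ws "- 1" Move_Right] by simp
  show ?thesis unfolding rewind_def
    by (rule ex_weaken[OF ex_seq[OF 1 ex_seq[OF 2 3]]]) simp
qed

definition cfor :: "nat \<Rightarrow> cmd \<Rightarrow> cmd" where
  "cfor i body = CSeq (CWh i (- {0}) (CSeq body (CMv i Move_Right))) (rewind i)"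

text \<open>\<open>S j\<close> is the store before iteration \<open>j\<close>. The update of tape
  \<open>i\<close> in the premise on \<open>body\<close> says that the body leaves that head on cell
  \<open>j\<close>; advancing it is the task of the loop.\<close>

lemma ex_cfor:
  assumes nz: "0 \<notin> set ws" and S: "\<And>j. j \<le> length ws \<Longrightarrow> S j i = (ws, int j)"
    and body: "\<And>j. j < length ws \<Longrightarrow> ex body (S j) B ((S (Suc j))(i := (ws, int j)))"
  shows "ex (cfor i body) (S 0) (length ws * (B + 5) + 7) ((S (length ws))(i := (ws, 0)))"
proof -
  let ?w = "CWh i (- {0}) (CSeq body (CMv i Move_Right))"
  have "ex ?w (S j) ((length ws - j) * (B + 3) + 1) (S (length ws))" if "j \<le> length ws" for j
    using that
  proof (induction "length ws - j" arbitrary: j)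
    case 0
    then show ?case using ex_wh_stop[of "S j" i "- {0}"] S[of j] by (simp add: wtape_def)
  next
    case (Suc l)
    have j: "j < length ws" using Suc by simp
    have eq: "((S (Suc j))(i := (ws, int j)))(i := (ws, int j + shift Move_Right)) = S (Suc j)"
      using S[of "Suc j"] j by (auto simp: fun_eq_iff)
    have "ex (CMv i Move_Right) ((S (Suc j))(i := (ws, int j))) 1 (S (Suc j))"
      using ex_mv[of "(S (Suc j))(i := (ws, int j))" i ws "int j" Move_Right] unfolding eq by simp
    note b = ex_seq[OF body[OF j] this]
    have w: "wtape (fst (S j i)) (snd (S j i)) \<in> - {0}" using S[of j] j by (simp only: fst_conv snd_conv wtape_nz[OF nz]) simp
    have "ex ?w (S (Suc j)) ((length ws - Suc j) * (B + 3) + 1) (S (length ws))" by (rule Suc.hyps(1)) (use Suc j in auto)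
    note g = ex_wh_go[OF w b this]
    have "length ws - j = Suc (length ws - Suc j)" using j by simp
    then show ?case by (intro ex_weaken[OF g]) simp
  qed
  from this[of 0] have 1: "ex ?w (S 0) (length ws * (B + 3) + 1) (S (length ws))" by simp
  have 2: "ex (rewind i) (S (length ws)) (2 * length ws + 5) ((S (length ws))(i := (ws, 0)))"
    using ex_rewind[OF nz, of "S (length ws)" i "length ws"] S[of "length ws"] by simp
  show ?thesis unfolding cfor_def by (rule ex_weaken[OF ex_seq[OF 1 2]]) (simp add: algebra_simps)
qed

definition cforb :: "nat \<Rightarrow> cmd \<Rightarrow> cmd" where
  "cforb i body = CSeq (goright i) (CSeq (CMv i Move_Left)
     (CSeq (CWh i (- {0}) (CSeq body (CMv i Move_Left))) (CMv i Move_Right)))"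

lemma ex_cforb:
  assumes nz: "0 \<notin> set ws" and st: "st i = (ws, 0)" "S 0 = st(i := (ws, int (length ws) - 1))"
    and S: "\<And>j. j \<le> length ws \<Longrightarrow> S j i = (ws, int (length ws) - 1 - int j)"
    and body: "\<And>j. j < length ws \<Longrightarrow> ex body (S j) B ((S (Suc j))(i := (ws, int (length ws) - 1 - int j)))"
  shows "ex (cforb i body) st (length ws * (B + 5) + 7) ((S (length ws))(i := (ws, 0)))"
proof -
  let ?w = "CWh i (- {0}) (CSeq body (CMv i Move_Left))"
  have "ex ?w (S j) ((length ws - j) * (B + 3) + 1) (S (length ws))" if "j \<le> length ws" for j
    using that
  proof (induction "length ws - j" arbitrary: j)
    case 0
    then show ?case using ex_wh_stop[of "S j" i "- {0}"] S[of j] by (simp add: wtape_def)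
  next
    case (Suc l)
    have j: "j < length ws" using Suc by simp
    let ?h = "int (length ws) - 1 - int j"
    have eq: "((S (Suc j))(i := (ws, ?h)))(i := (ws, ?h + shift Move_Left)) = S (Suc j)"
      using S[of "Suc j"] j by (auto simp: fun_eq_iff)
    have "ex (CMv i Move_Left) ((S (Suc j))(i := (ws, ?h))) 1 (S (Suc j))"
      using ex_mv[of "(S (Suc j))(i := (ws, ?h))" i ws ?h Move_Left] unfolding eq by simp
    note b = ex_seq[OF body[OF j] this]
    have w: "wtape (fst (S j i)) (snd (S j i)) \<in> - {0}" using S[of j] j by (simp only: fst_conv snd_conv wtape_nz[OF nz]) simp
    have "ex ?w (S (Suc j)) ((length ws - Suc j) * (B + 3) + 1) (S (length ws))" by (rule Suc.hyps(1)) (use Suc j in auto)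
    note g = ex_wh_go[OF w b this]
    have "length ws - j = Suc (length ws - Suc j)" using j by simp
    then show ?case by (intro ex_weaken[OF g]) simp
  qed
  from this[of 0] have 3: "ex ?w (S 0) (length ws * (B + 3) + 1) (S (length ws))" by simp
  have 1: "ex (goright i) st (2 * length ws + 1) (st(i := (ws, int (length ws))))"
    using ex_goright[OF nz, of st i 0] st by simp
  have 2: "ex (CMv i Move_Left) (st(i := (ws, int (length ws)))) 1 (S 0)"
    using ex_mv[of "st(i := (ws, int (length ws)))" i ws "int (length ws)" Move_Left] st(2) by simp
  have 4: "ex (CMv i Move_Right) (S (length ws)) 1 ((S (length ws))(i := (ws, 0)))"
    using ex_mv[of "S (length ws)" i ws "- 1" Move_Right] S[of "length ws"] by simp
  show ?thesis unfolding cforb_def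
    by (rule ex_weaken[OF ex_seq[OF 1 ex_seq[OF 2 ex_seq[OF 3 4]]]]) (simp add: algebra_simps)
qed

fun csel :: "nat \<Rightarrow> (nat \<times> cmd) list \<Rightarrow> cmd" where
  "csel i [] = CSkip"
| "csel i ((a, c) # xs) = CIf i {a} c (csel i xs)"

lemma ex_csel:
  assumes "map_of xs (wtape (fst (st i)) (snd (st i))) = Some c" "ex c st B st'"
  shows "ex (csel i xs) st (B + length xs) st'"
  using assms(1)
proof (induction xs)
  case (Cons x xs)
  obtain a d where x: "x = (a, d)" by (cases x)
  show ?case
  proof (cases "wtape (fst (st i)) (snd (st i)) = a")
    case True
    then have "d = c" using Cons.prems x by simp
    then have "ex (csel i (x # xs)) st (B + 1) st'" unfolding x csel.simps by (intro ex_if) (use True assms(2) in simp)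
    then show ?thesis by (rule ex_weaken) simp
  next
    case False
    then have "ex (csel i xs) st (B + length xs) st'" using Cons x by simp
    then have "ex (csel i (x # xs)) st (B + length xs + 1) st'" unfolding x csel.simps by (intro ex_if) (use False in simp)
    then show ?thesis by simp
  qed
qed simp

definition bsy :: "bool \<Rightarrow> nat" where "bsy b = (if b then 2 else 1)"

definition app :: "nat \<Rightarrow> nat list \<Rightarrow> store \<Rightarrow> store" where
  "app i ys st = st(i := (fst (st i) @ ys, int (length (fst (st i) @ ys))))"

definition at_end :: "store \<Rightarrow> nat \<Rightarrow> bool" where
  "at_end st i \<longleftrightarrow> snd (st i) = int (length (fst (st i)))"

lemma at_end_app: "at_end (app i ys st) i" "j \<noteq> i \<Longrightarrow> app i ys st j = st j"
  by (auto simp: at_end_def app_def)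

lemma app_app: "app i zs (app i ys st) = app i (ys @ zs) st"
  by (auto simp: app_def fun_eq_iff)

lemma app_Nil: "at_end st i \<Longrightarrow> app i [] st = st"
  by (auto simp: app_def at_end_def fun_eq_iff prod_eq_iff)

fun cpush :: "nat \<Rightarrow> nat list \<Rightarrow> cmd" where
  "cpush i [] = CSkip"
| "cpush i (a # as) = CSeq (CWr i a Move_Right) (cpush i as)"

lemma ex_cpush: "at_end st i \<Longrightarrow> ex (cpush i as) st (2 * length as + 1) (app i as st)"
proof (induction as arbitrary: st)
  case Nil
  then show ?case using ex_skip app_Nil by simp
next
  case (Cons a as)
  have "ex (CWr i a Move_Right) st 1 (app i [a] st)"
    using ex_push[of st i "fst (st i)" a] Cons.prems by (simp add: app_def at_end_def prod_eq_iff)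
  from ex_seq[OF this Cons.IH[OF at_end_app(1)]] show ?case by (simp add: app_app)
qed


section \<open>Emitting the code of an interval\<close>

definition dbl :: "bool list \<Rightarrow> bool list" where
  "dbl bs = concat (map (\<lambda>b. [True, b]) bs)"

definition oh :: "nat \<Rightarrow> nat \<Rightarrow> bool list" where
  "oh n m = map (\<lambda>i. i = m) [0..<n]"

lemma length_oh [simp]: "length (oh n m) = n"
  by (simp add: oh_def)

lemma bsy_nz: "0 \<notin> set (map bsy bs)" by (auto simp: bsy_def)

text \<open>\<open>EG \<delta> fwd\<close> emits the one-hot field of the column \<open>p + \<delta> - 1\<close>, where \<open>p\<close> is the current column;
  \<open>n\<close> stands for a column outside the range.\<close>

datatype em = EStr "bool list" | EG nat bool | ET

text \<open>Adding \<open>n\<close> modulo \<open>Suc n\<close> subtracts 1 cyclically, over the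
  \<open>n\<close> columns and one additional all-False field. In this cycle one uniform step leads
  from the fields of a column to those of the next.\<close>

fun den :: "nat \<Rightarrow> nat \<Rightarrow> nat \<Rightarrow> em \<Rightarrow> bool list" where
  "den n p t (EStr bs) = bs"
| "den n p t (EG \<delta> fwd) = dbl ((if fwd then id else rev) (oh n ((p + n + \<delta>) mod Suc n)))"
| "den n p t ET = dbl (replicate t False)"

definition cbit :: "nat \<Rightarrow> cmd" where
  "cbit i = CIf i {2} (cpush 1 [2, 2]) (cpush 1 [2, 1])"

fun cem :: "em \<Rightarrow> cmd" where
  "cem (EStr bs) = cpush 1 (map bsy bs)"
| "cem (EG \<delta> fwd) = (if fwd then cfor (3 + \<delta>) (cbit (3 + \<delta>)) else cforb (3 + \<delta>) (cbit (3 + \<delta>)))"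
| "cem ET = cfor 6 (cbit 6)"

lemma ex_cbit:
  assumes "at_end st 1" "i \<noteq> 1" "st i = (map bsy bs, int j)" "j < length bs"
  shows "ex (cbit i) st 6 (app 1 (map bsy [True, bs ! j]) st)"
proof -
  have s: "wtape (fst (st i)) (snd (st i)) = bsy (bs ! j)" using assms by (simp add: wtape_def)
  have "ex (cpush 1 (map bsy [True, bs ! j])) st 5 (app 1 (map bsy [True, bs ! j]) st)"
    using ex_cpush[OF assms(1), of "map bsy [True, bs ! j]"] by simp
  moreover have "(if wtape (fst (st i)) (snd (st i)) \<in> {2} then cpush 1 [2, 2] else cpush 1 [2, 1]) =
      cpush 1 (map bsy [True, bs ! j])" unfolding s by (simp add: bsy_def)
  ultimately have "ex (cbit i) st (5 + 1) (app 1 (map bsy [True, bs ! j]) st)"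
    unfolding cbit_def by (intro ex_if) simp
  then show ?thesis by simp
qed

lemma dbl_take_Suc: "j < length bs \<Longrightarrow> dbl (take (Suc j) bs) = dbl (take j bs) @ [True, bs ! j]"
  by (simp add: dbl_def take_Suc_conv_app_nth)

lemma ex_emit_fwd:
  assumes e: "at_end st 1" and i: "i \<noteq> 1" "st i = (map bsy bs, 0)"
  shows "ex (cfor i (cbit i)) st (length bs * 11 + 7) (app 1 (map bsy (dbl bs)) st)"
proof -
  define S where "S j = (app 1 (map bsy (dbl (take j bs))) st)(i := (map bsy bs, int j))" for j
  have "ex (cfor i (cbit i)) (S 0) (length (map bsy bs) * (6 + 5) + 7) ((S (length (map bsy bs)))(i := (map bsy bs, 0)))"
  proof (rule ex_cfor[OF bsy_nz])
    fix j assume j: "j < length (map bsy bs)"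
    have "ex (cbit i) (S j) 6 (app 1 (map bsy [True, bs ! j]) (S j))"
      using ex_cbit[of "S j" i bs j] i j by (auto simp: S_def at_end_def app_def)
    moreover have "app 1 (map bsy [True, bs ! j]) (S j) = (S (Suc j))(i := (map bsy bs, int j))"
      using i j by (auto simp: S_def app_def fun_eq_iff dbl_take_Suc)
    ultimately show "ex (cbit i) (S j) 6 ((S (Suc j))(i := (map bsy bs, int j)))" by simp
  qed (simp add: S_def)
  moreover have "S 0 = st" using i e by (auto simp: S_def app_def at_end_def dbl_def fun_eq_iff prod_eq_iff)
  moreover have "(S (length (map bsy bs)))(i := (map bsy bs, 0)) = app 1 (map bsy (dbl bs)) st"
    using i by (auto simp: S_def app_def fun_eq_iff)
  ultimately show ?thesis by simp
qed

lemma ex_emit_bwd: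
  assumes e: "at_end st 1" and i: "i \<noteq> 1" "st i = (map bsy bs, 0)"
  shows "ex (cforb i (cbit i)) st (length bs * 11 + 7) (app 1 (map bsy (dbl (rev bs))) st)"
proof -
  let ?h = "\<lambda>j. int (length bs) - 1 - int j"
  define S where "S j = (app 1 (map bsy (dbl (take j (rev bs)))) st)(i := (map bsy bs, ?h j))" for j
  have "ex (cforb i (cbit i)) st (length (map bsy bs) * (6 + 5) + 7) ((S (length (map bsy bs)))(i := (map bsy bs, 0)))"
  proof (rule ex_cforb[OF bsy_nz])
    fix j assume j: "j < length (map bsy bs)"
    have nth: "rev bs ! j = bs ! (length bs - 1 - j)" using j by (simp add: rev_nth)
    have hj: "?h j = int (length bs - 1 - j)" using j by simp
    have "ex (cbit i) (S j) 6 (app 1 (map bsy [True, bs ! (length bs - 1 - j)]) (S j))"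
      using ex_cbit[of "S j" i bs "length bs - 1 - j"] i j by (auto simp: S_def at_end_def app_def hj)
    moreover have "app 1 (map bsy [True, bs ! (length bs - 1 - j)]) (S j) = (S (Suc j))(i := (map bsy bs, ?h j))"
      using i j nth by (auto simp: S_def app_def fun_eq_iff dbl_take_Suc)
    ultimately show "ex (cbit i) (S j) 6 ((S (Suc j))(i := (map bsy bs, int (length (map bsy bs)) - 1 - int j)))" by simp
  next
    show "S 0 = st(i := (map bsy bs, int (length (map bsy bs)) - 1))"
      using i e by (auto simp: S_def app_def at_end_def dbl_def fun_eq_iff prod_eq_iff)
  qed (use i in \<open>simp_all add: S_def\<close>)
  moreover have "(S (length (map bsy bs)))(i := (map bsy bs, 0)) = app 1 (map bsy (dbl (rev bs))) st"
    using i by (auto simp: S_def app_def fun_eq_iff)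
  ultimately show ?thesis by simp
qed

text \<open>The tape layout of the generator: 0 holds the input, 1 the output, 2 the column classes,
  3 to 5 the one-hot fields of the preceding, the current and the next column, 6 the block number in
  unary and 7 a binary counter. From tape 8 on there are values of polynomials in unary.\<close>

definition emit_ready :: "nat \<Rightarrow> nat \<Rightarrow> nat \<Rightarrow> store \<Rightarrow> bool" where
  "emit_ready n p t st \<longleftrightarrow> at_end st 1 \<and> (\<forall>\<delta><3. st (3 + \<delta>) = (map bsy (oh n ((p + n + \<delta>) mod Suc n)), 0)) \<and>
     st 6 = (map bsy (replicate t False), 0)"

fun ecost :: "nat \<Rightarrow> em \<Rightarrow> nat" where
  "ecost L (EStr bs) = 2 * length bs + 2"
| "ecost L (EG \<delta> fwd) = L * 11 + 8"
| "ecost L ET = L * 11 + 8"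

fun em_ok :: "em \<Rightarrow> bool" where
  "em_ok (EG \<delta> fwd) \<longleftrightarrow> \<delta> < 3"
| "em_ok _ \<longleftrightarrow> True"

lemma ex_cem:
  assumes "emit_ready n p t st" "em_ok e" "n \<le> L" "t \<le> L"
  shows "ex (cem e) st (ecost L e - 1) (app 1 (map bsy (den n p t e)) st)"
proof (cases e)
  case (EStr bs)
  then show ?thesis using ex_cpush[of st 1 "map bsy bs"] assms by (simp add: emit_ready_def)
next
  case (EG \<delta> fwd)
  let ?bs = "oh n ((p + n + \<delta>) mod Suc n)"
  have st: "at_end st 1" "st (3 + \<delta>) = (map bsy ?bs, 0)" "3 + \<delta> \<noteq> 1" using assms EG by (auto simp: emit_ready_def)
  show ?thesis
  proof (cases fwd)
    case True
    have "ex (cem e) st (n * 11 + 7) (app 1 (map bsy (den n p t e)) st)"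
      using ex_emit_fwd[OF st(1,3,2)] EG True by simp
    then show ?thesis by (rule ex_weaken) (use assms EG in simp)
  next
    case False
    have "ex (cem e) st (n * 11 + 7) (app 1 (map bsy (den n p t e)) st)"
      using ex_emit_bwd[OF st(1,3,2)] EG False by simp
    then show ?thesis by (rule ex_weaken) (use assms EG in simp)
  qed
next
  case ET
  have "ex (cem e) st (t * 11 + 7) (app 1 (map bsy (den n p t e)) st)"
    using ex_emit_fwd[of st 6 "replicate t False"] assms ET by (simp add: emit_ready_def)
  then show ?thesis by (rule ex_weaken) (use assms ET in simp)
qed

definition cems :: "em list \<Rightarrow> cmd" where
  "cems es = foldr (\<lambda>e. CSeq (cem e)) es CSkip"

lemma ex_cems:
  assumes "emit_ready n p t st" "\<forall>e \<in> set es. em_ok e" "n \<le> L" "t \<le> L"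
  shows "ex (cems es) st (sum_list (map (ecost L) es) + 1) (app 1 (map bsy (concat (map (den n p t) es))) st)"
  using assms
proof (induction es arbitrary: st)
  case Nil
  then show ?case using ex_skip app_Nil by (simp add: cems_def emit_ready_def)
next
  case (Cons e es)
  let ?st = "app 1 (map bsy (den n p t e)) st"
  have r: "emit_ready n p t ?st" using Cons.prems(1) unfolding emit_ready_def by (simp add: at_end_app)
  have 1: "ex (cem e) st (ecost L e - 1) ?st" by (rule ex_cem) (use Cons.prems in auto)
  have 2: "ex (cems es) ?st (sum_list (map (ecost L) es) + 1) (app 1 (map bsy (concat (map (den n p t) es))) ?st)"
    by (rule Cons.IH) (use Cons.prems r in auto)
  have pos: "1 \<le> ecost L e" by (cases e) auto
  have "ex (cems (e # es)) st (ecost L e - 1 + (sum_list (map (ecost L) es) + 1) + 1)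
      (app 1 (map bsy (concat (map (den n p t) es))) ?st)"
    unfolding cems_def foldr.simps comp_def using ex_seq[OF 1 2[unfolded cems_def]] by simp
  then show ?case using pos by (simp add: app_app)
qed

lemma ecost_bound: "\<exists>K. \<forall>L. sum_list (map (ecost L) es) \<le> K * Suc L"
proof (induction es)
  case (Cons e es)
  then obtain K where K: "\<And>L. sum_list (map (ecost L) es) \<le> K * Suc L" by blast
  have "ecost L e \<le> (ecost 1 e) * Suc L" for L by (cases e) auto
  then have "sum_list (map (ecost L) (e # es)) \<le> (ecost 1 e + K) * Suc L" for L
    using add_mono[OF _ K[of L], of "ecost L e" "ecost 1 e * Suc L"] by (simp add: algebra_simps)
  then show ?case by blast
qed simp

text \<open>Advances a one-hot field cyclically through \<open>n + 1\<close> states. From the last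
  cell the mark drops off, which leaves the all-False state \<open>n\<close>, and from there it
  reappears in cell 0.\<close>

definition cadv :: "nat \<Rightarrow> cmd" where
  "cadv g = CSeq (CWh g {1} (CMv g Move_Right))
    (CIf g {2} (CSeq (CWr g 1 Move_Right) (CSeq (CIf g {1} (CWr g 2 Stay) CSkip) (rewind g)))
       (CSeq (rewind g) (CWr g 2 Stay)))"

lemma ex_skip_false:
  assumes "st g = (map bsy bs, int j)" "j \<le> m" "m \<le> length bs" "\<forall>i<m. \<not> bs ! i" "m < length bs \<longrightarrow> bs ! m"
  shows "ex (CWh g {1} (CMv g Move_Right)) st (2 * (m - j) + 1) (st(g := (map bsy bs, int m)))"
  using assms(1,2)
proof (induction "m - j" arbitrary: j st)
  case 0
  then have j: "j = m" by simp
  then have "st(g := (map bsy bs, int m)) = st" using 0 by auto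
  moreover have "wtape (fst (st g)) (snd (st g)) \<notin> {1}"
    using 0 j assms(3,5) by (auto simp: wtape_def bsy_def)
  ultimately show ?case using ex_wh_stop[of st g "{1}"] j by simp
next
  case (Suc l)
  let ?st = "st(g := (map bsy bs, int (Suc j)))"
  have "wtape (fst (st g)) (snd (st g)) \<in> {1}"
    using Suc assms(3,4) by (auto simp: wtape_def bsy_def)
  moreover have "ex (CMv g Move_Right) st 1 ?st" using ex_mv[of st g "map bsy bs" "int j" Move_Right] Suc by (simp add: add.commute)
  moreover have "ex (CWh g {1} (CMv g Move_Right)) ?st (2 * (m - Suc j) + 1) (?st(g := (map bsy bs, int m)))"
    by (rule Suc.hyps(1)) (use Suc in auto)
  ultimately have "ex (CWh g {1} (CMv g Move_Right)) st (1 + (2 * (m - Suc j) + 1) + 1) (?st(g := (map bsy bs, int m)))"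
    by (rule ex_wh_go)
  then show ?case unfolding fun_upd_upd by (rule ex_weaken) (use Suc in simp)
qed

lemma oh_update: "m < n \<Longrightarrow> (map bsy (oh n m))[m := 1] = map bsy (oh n n)"
  "m < n \<Longrightarrow> (map bsy (oh n n))[m := 2] = map bsy (oh n m)"
  by (auto intro!: nth_equalityI simp: oh_def nth_list_update bsy_def)

lemma ex_cadv:
  assumes st: "st g = (map bsy (oh n m), 0)" and m: "m \<le> n" "0 < n"
  shows "ex (cadv g) st (4 * n + 20) (st(g := (map bsy (oh n (Suc m mod Suc n)), 0)))"
proof -
  let ?w = "\<lambda>m. map bsy (oh n m)"
  have nz: "0 \<notin> set (?w m)" for m by (rule bsy_nz)
  have 1: "ex (CWh g {1} (CMv g Move_Right)) st (2 * m + 1) (st(g := (?w m, int m)))"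
    using ex_skip_false[of st g "oh n m" 0 m] st m by (auto simp: oh_def)
  show ?thesis
  proof (cases "m < n")
    case True
    let ?s1 = "st(g := (?w m, int m))" and ?s2 = "st(g := (?w n, int m + 1))"
    have 2: "ex (CWr g 1 Move_Right) ?s1 1 ?s2"
      using ex_upd[of ?s1 g "?w m" "int m" 1 Move_Right] True oh_update(1)[OF True] by simp
    have 3: "ex (CIf g {1} (CWr g 2 Stay) CSkip) ?s2 2 (st(g := (?w (Suc m mod Suc n), int m + 1)))"
    proof (cases "Suc m < n")
      case T: True
      have "ex (CWr g 2 Stay) ?s2 1 (st(g := ((?w n)[Suc m := 2], int m + 1)))"
        using ex_upd[of ?s2 g "?w n" "int m + 1" 2 Stay] T by (simp add: nat_add_distrib)
      moreover have "wtape (?w n) (int m + 1) = 1" using T by (auto simp: wtape_def oh_def bsy_def nat_add_distrib)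
      moreover have "(?w n)[Suc m := 2] = ?w (Suc m mod Suc n)" using T oh_update(2)[of "Suc m" n] by simp
      ultimately have "ex (CIf g {1} (CWr g 2 Stay) CSkip) ?s2 (1 + 1) (st(g := (?w (Suc m mod Suc n), int m + 1)))"
        by (intro ex_if) simp
      then show ?thesis by (simp add: numeral_2_eq_2)
    next
      case False
      then have "Suc m = n" using True by simp
      then have "wtape (?w n) (int m + 1) = 0" "Suc m mod Suc n = n" by (auto simp: wtape_def)
      then have "ex (CIf g {1} (CWr g 2 Stay) CSkip) ?s2 (1 + 1) (st(g := (?w (Suc m mod Suc n), int m + 1)))"
        by (intro ex_if) (simp add: ex_skip[simplified])
      then show ?thesis by (simp add: numeral_2_eq_2)
    qed
    have 4: "ex (rewind g) (st(g := (?w (Suc m mod Suc n), int m + 1))) (2 * Suc m + 5) (st(g := (?w (Suc m mod Suc n), 0)))"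
      using ex_rewind[OF nz, of "st(g := (?w (Suc m mod Suc n), int m + 1))" g "Suc m mod Suc n" "Suc m"] True by (simp add: add.commute)
    note 5 = ex_seq[OF 2 ex_seq[OF 3 4]]
    have "wtape (?w m) (int m) = 2" using True by (simp add: wtape_def oh_def bsy_def)
    then have 6: "ex (CIf g {2} (CSeq (CWr g 1 Move_Right) (CSeq (CIf g {1} (CWr g 2 Stay) CSkip) (rewind g)))
       (CSeq (rewind g) (CWr g 2 Stay))) ?s1 (1 + (2 + (2 * Suc m + 5) + 1) + 1 + 1) (st(g := (?w (Suc m mod Suc n), 0)))"
      by (intro ex_if) (use 5 in simp)
    show ?thesis unfolding cadv_def by (rule ex_weaken[OF ex_seq[OF 1 6]]) (use True in simp)
  next
    case False
    then have mn: "m = n" using m by simp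
    let ?s1 = "st(g := (?w m, int m))"
    have 2: "ex (rewind g) ?s1 (2 * m + 5) (st(g := (?w n, 0)))"
      using ex_rewind[OF nz, of ?s1 g m m] mn by simp
    have 3: "ex (CWr g 2 Stay) (st(g := (?w n, 0))) 1 (st(g := (?w 0, 0)))"
      using ex_upd[of "st(g := (?w n, 0))" g "?w n" 0 2 Stay] oh_update(2)[of 0 n] m(2) by simp
    have "wtape (?w m) (int m) = 0" using mn by (simp add: wtape_def)
    then have 6: "ex (CIf g {2} (CSeq (CWr g 1 Move_Right) (CSeq (CIf g {1} (CWr g 2 Stay) CSkip) (rewind g)))
       (CSeq (rewind g) (CWr g 2 Stay))) ?s1 (2 * m + 5 + 1 + 1 + 1) (st(g := (?w 0, 0)))"
      by (intro ex_if) (use ex_seq[OF 2 3] in simp)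
    have "Suc m mod Suc n = 0" using mn by simp
    then show ?thesis unfolding cadv_def using ex_weaken[OF ex_seq[OF 1 6], of "4 * n + 20"] mn by simp
  qed
qed

section \<open>Incrementing a binary counter\<close>

fun binc :: "bool list \<Rightarrow> bool list" where
  "binc [] = [True]"
| "binc (False # bs) = True # bs"
| "binc (True # bs) = False # binc bs"

lemma bits_Suc: "bits_of_nat (Suc v) = binc (bits_of_nat v)"
proof (induction v rule: less_induct)
  case (less v)
  show ?case
  proof (cases "v = 0")
    case True
    then show ?thesis by (simp add: bits_of_nat.simps[of "Suc 0"] bits_of_nat.simps[of 0])
  next
    case False
    show ?thesis
    proof (cases "odd v")
      case True
      then have "Suc v div 2 = Suc (v div 2)" by presburger
      then have "bits_of_nat (Suc v) = False # binc (bits_of_nat (v div 2))"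
        using less[of "v div 2"] True False by (subst bits_of_nat.simps) simp
      then show ?thesis using True False by (subst (2) bits_of_nat.simps) simp
    next
      case F: False
      then have "Suc v div 2 = v div 2" by presburger
      then show ?thesis using F False by (subst (1 2) bits_of_nat.simps) simp
    qed
  qed
qed

text \<open>This crude bound is enough, since the counter only reaches a value polynomial in the
  input length.\<close>

lemma length_bits: "length (bits_of_nat v) \<le> v"
proof (induction v rule: less_induct)
  case (less v)
  show ?case
  proof (cases "v = 0")
    case False
    then have "length (bits_of_nat (v div 2)) \<le> v div 2" using less by simp
    then show ?thesis using False by (simp add: bits_of_nat.simps[of v])
  qed (simp add: bits_of_nat.simps)
qed

definition cinc :: "nat \<Rightarrow> cmd" where
  "cinc g = CSeq (CWh g {2} (CWr g 1 Move_Right)) (CSeq (CWr g 2 Move_Right) (rewind g))"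

lemma binc_eq: "binc (replicate j True @ bs) = replicate j False @ binc bs"
  by (induction j) auto

lemma ex_carry:
  "st g = (map bsy (replicate j False @ replicate l True @ bs), int j) \<Longrightarrow> (bs = [] \<or> \<not> hd bs) \<Longrightarrow>
    ex (CWh g {2} (CWr g 1 Move_Right)) st (2 * l + 1) (st(g := (map bsy (replicate (j + l) False @ bs), int (j + l))))"
proof (induction l arbitrary: j st)
  case 0
  then have "st(g := (map bsy (replicate (j + 0) False @ bs), int (j + 0))) = st" by auto
  moreover have "wtape (fst (st g)) (snd (st g)) \<notin> {2}"
    using 0 by (cases bs) (auto simp: wtape_def nth_append bsy_def)
  ultimately show ?case using ex_wh_stop[of st g "{2}"] by simp
next
  case (Suc l)
  let ?w = "map bsy (replicate j False @ replicate (Suc l) True @ bs)"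
  let ?w' = "map bsy (replicate (Suc j) False @ replicate l True @ bs)"
  let ?st = "st(g := (?w', int (Suc j)))"
  have "wtape (fst (st g)) (snd (st g)) \<in> {2}" using Suc by (auto simp: wtape_def nth_append bsy_def)
  moreover have "?w[j := 1] = ?w'"
    by (simp add: list_update_append bsy_def replicate_app_Cons_same)
  then have "ex (CWr g 1 Move_Right) st 1 ?st"
    using ex_upd[of st g ?w "int j" 1 Move_Right] Suc.prems by (simp add: add.commute)
  moreover have "ex (CWh g {2} (CWr g 1 Move_Right)) ?st (2 * l + 1)
      (?st(g := (map bsy (replicate (Suc j + l) False @ bs), int (Suc j + l))))"
    by (rule Suc.IH) (use Suc.prems in auto)
  ultimately have "ex (CWh g {2} (CWr g 1 Move_Right)) st (1 + (2 * l + 1) + 1)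
      (?st(g := (map bsy (replicate (Suc j + l) False @ bs), int (Suc j + l))))" by (rule ex_wh_go)
  moreover have e: "j + Suc l = Suc j + l" by simp
  ultimately show ?case unfolding fun_upd_upd e by (elim ex_weaken) simp
qed

lemma split_carry: "\<exists>l bs'. bs = replicate l True @ bs' \<and> (bs' = [] \<or> \<not> hd bs')"
proof (induction bs)
  case (Cons b bs)
  then obtain l bs' where *: "bs = replicate l True @ bs'" "bs' = [] \<or> \<not> hd bs'" by blast
  show ?case
  proof (cases b)
    case True
    then show ?thesis using * by (intro exI[of _ "Suc l"] exI[of _ bs']) simp
  next
    case False
    then show ?thesis by (intro exI[of _ 0] exI[of _ "b # bs"]) simp
  qed
qed simp

lemma ex_cinc:
  assumes st: "st g = (map bsy bs, 0)"
  shows "ex (cinc g) st (4 * length bs + 12) (st(g := (map bsy (binc bs), 0)))"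
proof -
  obtain l bs' where bs: "bs = replicate l True @ bs'" "bs' = [] \<or> \<not> hd bs'" using split_carry by blast
  let ?w = "map bsy (replicate l False @ bs')"
  let ?s1 = "st(g := (?w, int l))" and ?s2 = "st(g := (map bsy (binc bs), int (Suc l)))"
  have 1: "ex (CWh g {2} (CWr g 1 Move_Right)) st (2 * l + 1) ?s1"
    using ex_carry[of st g 0 l bs'] st bs by simp
  have 2: "ex (CWr g 2 Move_Right) ?s1 1 ?s2"
  proof (cases bs')
    case Nil
    then show ?thesis using ex_push[of ?s1 g ?w 2] bs(1) binc_eq[of l "[]"] by (simp add: bsy_def add.commute)
  next
    case (Cons b bs'')
    then have "\<not> b" using bs(2) by simp
    then have "binc bs = replicate l False @ True # bs''" using bs(1) Cons by (simp add: binc_eq)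
    moreover have "?w[l := 2] = map bsy (replicate l False @ True # bs'')"
      using Cons by (simp add: list_update_append bsy_def)
    ultimately show ?thesis using ex_upd[of ?s1 g ?w "int l" 2 Move_Right] Cons by (simp add: add.commute)
  qed
  have len: "Suc l \<le> length (binc bs)" "l \<le> length bs"
    unfolding bs(1) binc_eq by (cases "bs'" rule: binc.cases; simp)+
  have 3: "ex (rewind g) ?s2 (2 * Suc l + 5) (st(g := (map bsy (binc bs), 0)))"
    using ex_rewind[OF bsy_nz, of ?s2 g "binc bs" "Suc l"] len by simp
  show ?thesis unfolding cinc_def by (rule ex_weaken[OF ex_seq[OF 1 ex_seq[OF 2 3]]]) (use len in simp)
qed


section \<open>The generator\<close>

text \<open>Running times need only be dominated by a polynomial. Closure under sums and products
  spares writing that polynomial down.\<close>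

definition pb :: "(nat \<Rightarrow> nat) \<Rightarrow> bool" where
  "pb f \<longleftrightarrow> (\<exists>p :: nat poly. \<forall>x. f x \<le> poly p x)"

lemma pb_const [intro, simp]: "pb (\<lambda>x. c)"
  unfolding pb_def by (rule exI[of _ "[:c:]"]) simp

lemma pb_id [intro, simp]: "pb (\<lambda>x. x)"
  unfolding pb_def by (rule exI[of _ "[:0, 1:]"]) simp

lemma pb_poly [intro, simp]: "pb (poly p)"
  unfolding pb_def by (rule exI[of _ p]) simp

lemma pb_add [intro]: "pb f \<Longrightarrow> pb g \<Longrightarrow> pb (\<lambda>x. f x + g x)"
  unfolding pb_def using add_mono by (metis poly_add)

lemma pb_mult [intro]: "pb f \<Longrightarrow> pb g \<Longrightarrow> pb (\<lambda>x. f x * g x)"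
  unfolding pb_def using mult_le_mono by (metis poly_mult)

lemma pb_Suc [intro]: "pb f \<Longrightarrow> pb (\<lambda>x. Suc (f x))"
  using pb_add[of f "\<lambda>_. 1"] by simp

lemma cfor_app:
  assumes nz: "0 \<notin> set ws" and ik: "i \<noteq> k" and st: "st i = (ws, 0)" "at_end st k"
    and body: "\<And>s j. j < length ws \<Longrightarrow> s i = (ws, int j) \<Longrightarrow> at_end s k \<Longrightarrow> (\<And>l. l \<noteq> i \<Longrightarrow> l \<noteq> k \<Longrightarrow> s l = st l) \<Longrightarrow>
       ex body s B (app k (f j) s)"
  shows "ex (cfor i body) st (length ws * (B + 5) + 7) (app k (concat (map f [0..<length ws])) st)"
proof -
  define S where "S j = (app k (concat (map f [0..<j])) st)(i := (ws, int j))" for j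
  have "ex (cfor i body) (S 0) (length ws * (B + 5) + 7) ((S (length ws))(i := (ws, 0)))"
  proof (rule ex_cfor[OF nz])
    fix j assume j: "j < length ws"
    have "ex body (S j) B (app k (f j) (S j))"
      by (rule body[OF j]) (use ik in \<open>auto simp: S_def at_end_def app_def\<close>)
    moreover have "app k (f j) (S j) = (S (Suc j))(i := (ws, int j))"
      using ik by (auto simp: S_def app_def fun_eq_iff)
    ultimately show "ex body (S j) B ((S (Suc j))(i := (ws, int j)))" by simp
  qed (simp add: S_def)
  moreover have "S 0 = st" using ik st by (auto simp: S_def app_def at_end_def fun_eq_iff prod_eq_iff)
  moreover have "(S (length ws))(i := (ws, 0)) = app k (concat (map f [0..<length ws])) st"
    using ik st by (auto simp: S_def app_def fun_eq_iff)
  ultimately show ?thesis by simp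
qed

lemma cfor_push:
  assumes "0 \<notin> set ws" "i \<noteq> k" "st i = (ws, 0)" "at_end st k"
  shows "ex (cfor i (cpush k [a])) st (length ws * 8 + 7) (app k (replicate (length ws) a) st)"
proof -
  have "ex (cfor i (cpush k [a])) st (length ws * (3 + 5) + 7) (app k (concat (map (\<lambda>_. [a]) [0..<length ws])) st)"
    by (rule cfor_app[OF assms]) (use ex_cpush[of _ k "[a]"] in simp)
  moreover have "concat (map (\<lambda>_. [a]) [0..<m]) = replicate m a" for m
    by (induction m) (auto simp: replicate_append_same)
  ultimately show ?thesis by simp
qed

text \<open>Horner's scheme in unary on the length \<open>X\<close> of the input, with a fresh tape
  per coefficient: nested loops over the tapes \<open>i\<close> and 0 append \<open>a * X\<close>
  marks, and \<open>b\<close> further marks add the coefficient. Leading coefficients come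
  first.\<close>

fun chor :: "nat \<Rightarrow> nat list \<Rightarrow> cmd" where
  "chor i [] = CSkip"
| "chor i (b # bs) = CSeq (cfor i (cfor 0 (cpush (Suc i) [1]))) (CSeq (cpush (Suc i) (replicate b 1))
     (CSeq (rewind (Suc i)) (chor (Suc i) bs)))"

fun hval :: "nat \<Rightarrow> nat \<Rightarrow> nat list \<Rightarrow> nat" where
  "hval X a [] = a"
| "hval X a (b # bs) = hval X (a * X + b) bs"

fun hcost :: "nat \<Rightarrow> nat \<Rightarrow> nat list \<Rightarrow> nat" where
  "hcost X a [] = 1"
| "hcost X a (b # bs) = (a * (X * 8 + 7 + 5) + 7) + ((2 * b + 1) + ((2 * (a * X + b) + 5) + hcost X (a * X + b) bs + 1) + 1) + 1"

lemma pb_hcost: "pb a \<Longrightarrow> pb (\<lambda>X. hcost X (a X) bs)"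
proof (induction bs arbitrary: a)
  case (Cons b bs)
  have "pb (\<lambda>X. a X * X + b)" using Cons.prems by (intro pb_add pb_mult pb_id pb_const)
  from Cons.IH[OF this] show ?case
    unfolding hcost.simps using Cons.prems by (intro pb_add pb_mult pb_id pb_const)
qed simp

lemma concat_replicate_one: "concat (map (\<lambda>_. replicate X a) [0..<m]) = replicate (m * X) a"
  by (induction m) (auto simp: replicate_add[symmetric] add.commute)

lemma ex_chor:
  assumes "st 0 = (w0, 0)" "0 \<notin> set w0" "0 < i" "st i = (replicate a 1, 0)"
    "\<And>j. i < j \<Longrightarrow> j \<le> i + length bs \<Longrightarrow> st j = ([], 0)"
  shows "\<exists>st'. ex (chor i bs) st (hcost (length w0) a bs) st' \<and> st' (i + length bs) = (replicate (hval (length w0) a bs) 1, 0) \<and>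
    (\<forall>j. j < i \<or> i + length bs < j \<longrightarrow> st' j = st j)"
  using assms
proof (induction bs arbitrary: st i a)
  case Nil
  then show ?case using ex_skip by (intro exI[of _ st]) auto
next
  case (Cons b bs)
  let ?X = "length w0"
  have st1: "st (Suc i) = ([], 0)" using Cons.prems(5)[of "Suc i"] by simp
  have nz: "0 \<notin> set (replicate n 1 :: nat list)" for n by auto
  have 1: "ex (cfor i (cfor 0 (cpush (Suc i) [1]))) st (a * (?X * 8 + 7 + 5) + 7) (app (Suc i) (replicate (a * ?X) 1) st)"
  proof -
    have "ex (cfor i (cfor 0 (cpush (Suc i) [1]))) st (length (replicate a (1::nat)) * (?X * 8 + 7 + 5) + 7)
       (app (Suc i) (concat (map (\<lambda>_. replicate ?X 1) [0..<length (replicate a (1::nat))])) st)"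
    proof (rule cfor_app[where st = st and i = i, OF nz[of a] _ Cons.prems(4)])
      show "at_end st (Suc i)" using st1 by (simp add: at_end_def)
      fix s j assume "\<And>l. l \<noteq> i \<Longrightarrow> l \<noteq> Suc i \<Longrightarrow> s l = st l" "at_end s (Suc i)"
      then show "ex (cfor 0 (cpush (Suc i) [1])) s (?X * 8 + 7) (app (Suc i) (replicate ?X 1) s)"
        using Cons.prems(1,2,3) by (intro cfor_push) auto
    qed simp
    then show ?thesis by (simp add: concat_replicate_one)
  qed
  let ?s1 = "app (Suc i) (replicate (a * ?X) 1) st"
  have 2: "ex (cpush (Suc i) (replicate b 1)) ?s1 (2 * b + 1) (app (Suc i) (replicate b 1) ?s1)"
    using ex_cpush[OF at_end_app(1), of "Suc i" "replicate b 1"] by simp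
  let ?v = "a * ?X + b"
  have s2: "app (Suc i) (replicate b 1) ?s1 = st(Suc i := (replicate ?v 1, int ?v))"
    using st1 by (auto simp: app_def fun_eq_iff replicate_add)
  let ?s3 = "st(Suc i := (replicate ?v 1, 0))"
  have 3: "ex (rewind (Suc i)) (st(Suc i := (replicate ?v 1, int ?v))) (2 * ?v + 5) ?s3"
    using ex_rewind[OF nz, of "st(Suc i := (replicate ?v 1, int ?v))" "Suc i" ?v ?v] by simp
  have "\<exists>st'. ex (chor (Suc i) bs) ?s3 (hcost ?X ?v bs) st' \<and>
      st' (Suc i + length bs) = (replicate (hval ?X ?v bs) 1, 0) \<and>
      (\<forall>j. j < Suc i \<or> Suc i + length bs < j \<longrightarrow> st' j = ?s3 j)"
    by (rule Cons.IH) (use Cons.prems in auto)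
  then obtain st' where st': "ex (chor (Suc i) bs) ?s3 (hcost ?X ?v bs) st'"
      "st' (Suc i + length bs) = (replicate (hval ?X ?v bs) 1, 0)"
      "\<forall>j. j < Suc i \<or> Suc i + length bs < j \<longrightarrow> st' j = ?s3 j"
    by (elim exE conjE)
  have "ex (chor i (b # bs)) st (hcost ?X a (b # bs)) st'"
    unfolding chor.simps hcost.simps by (rule ex_seq[OF 1 ex_seq[OF 2[unfolded s2] ex_seq[OF 3 st'(1)]]])
  then show ?case using st' by (intro exI[of _ st']) auto
qed

lemma hval_append: "hval X a (bs @ cs) = hval X (hval X a bs) cs"
  by (induction bs arbitrary: a) auto

lemma hval_poly: "hval X 0 (rev (coeffs p)) = poly p X"
proof -
  have "hval X 0 (rev cs) = poly (Poly cs) X" for cs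
    by (induction cs) (auto simp: hval_append algebra_simps)
  from this[of "coeffs p"] show ?thesis by simp
qed

definition setG :: "nat \<Rightarrow> nat \<Rightarrow> store \<Rightarrow> store" where
  "setG n p st = st(3 := (map bsy (oh n ((p + n + 0) mod Suc n)), 0), 4 := (map bsy (oh n ((p + n + 1) mod Suc n)), 0),
     5 := (map bsy (oh n ((p + n + 2) mod Suc n)), 0))"

lemma less_3: "(\<forall>\<delta><3. P \<delta>) \<longleftrightarrow> P 0 \<and> P 1 \<and> P (2::nat)"
  by (auto simp: less_Suc_eq numeral_3_eq_3 numeral_2_eq_2)

lemma setG_ready: "emit_ready n p t st \<Longrightarrow> setG n p st = st"
  by (auto simp: emit_ready_def less_3 setG_def fun_eq_iff)

lemma ready_setG: "emit_ready n p t st \<Longrightarrow> emit_ready n q t (setG n q st)"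
  by (auto simp: emit_ready_def less_3 setG_def at_end_def)

definition cadv3 :: cmd where "cadv3 = CSeq (cadv 3) (CSeq (cadv 4) (cadv 5))"

lemma ex_cadv3:
  assumes r: "emit_ready n p t st" and n: "0 < n"
  shows "ex cadv3 st (12 * n + 62) (setG n (Suc p) st)"
proof -
  let ?w = "\<lambda>p \<delta>. (map bsy (oh n ((p + n + \<delta>) mod Suc n)), 0 :: int)"
  have s: "Suc ((p + n + \<delta>) mod Suc n) mod Suc n = (Suc p + n + \<delta>) mod Suc n" for \<delta> by (simp add: mod_Suc_eq)
  have st: "st 3 = ?w p 0" "st 4 = ?w p 1" "st 5 = ?w p 2" using r by (auto simp: emit_ready_def less_3)
  have le: "(p + n + \<delta>) mod Suc n \<le> n" for \<delta> using mod_less_divisor[of "Suc n"] by (simp add: less_Suc_eq_le)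
  let ?s1 = "st(3 := ?w (Suc p) 0)" let ?s2 = "?s1(4 := ?w (Suc p) 1)"
  have 1: "ex (cadv 3) st (4 * n + 20) ?s1" using ex_cadv[where st = st and g = 3, OF st(1) le[of 0] n] unfolding s .
  have "?s1 4 = ?w p 1" using st by simp
  from ex_cadv[where st = ?s1 and g = 4, OF this le[of 1] n] have 2: "ex (cadv 4) ?s1 (4 * n + 20) ?s2" unfolding s .
  have "?s2 5 = ?w p 2" using st by simp
  from ex_cadv[where st = ?s2 and g = 5, OF this le[of 2] n] have 3: "ex (cadv 5) ?s2 (4 * n + 20) (?s2(5 := ?w (Suc p) 2))" unfolding s .
  have e: "?s2(5 := ?w (Suc p) 2) = setG n (Suc p) st" by (simp add: setG_def)
  show ?thesis unfolding cadv3_def e[symmetric] by (rule ex_weaken[OF ex_seq[OF 1 ex_seq[OF 2 3]]]) simp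
qed

text \<open>The class of a column, read from tape 2, selects the items to be emitted. The additional
  advance after the loop completes a cycle of \<open>n + 1\<close> advances, so the field tapes are
  back at column 0 for the next block.\<close>

definition cbody :: "(nat \<Rightarrow> em list) \<Rightarrow> cmd" where
  "cbody es = CSeq (cfor 2 (CSeq (csel 2 (map (\<lambda>a. (a, cems (es a))) [1..<8])) cadv3)) cadv3"

definition colstr :: "nat list \<Rightarrow> (nat \<Rightarrow> em list) \<Rightarrow> nat \<Rightarrow> bool list" where
  "colstr \<kappa> es t = concat (map (\<lambda>p. concat (map (den (length \<kappa>) p t) (es (\<kappa> ! p)))) [0..<length \<kappa>])"

definition bcost :: "(nat \<Rightarrow> em list) \<Rightarrow> nat \<Rightarrow> nat" where
  "bcost es L = (\<Sum>a\<in>{1..<8}. sum_list (map (ecost L) (es a)))"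

lemma ex_cbody:
  assumes r: "emit_ready (length \<kappa>) 0 t st" and k: "st 2 = (\<kappa>, 0)" "set \<kappa> \<subseteq> {1..<8}" "\<kappa> \<noteq> []"
    and ok: "\<And>a. \<forall>e \<in> set (es a). em_ok e" and L: "length \<kappa> \<le> L" "t \<le> L"
  shows "ex (cbody es) st (length \<kappa> * (bcost es L + (12 * L + 62) + 14) + 12 * L + 70) (app 1 (map bsy (colstr \<kappa> es t)) st)"
proof -
  let ?n = "length \<kappa>"
  have n: "0 < ?n" using k(3) by simp
  have nz: "0 \<notin> set \<kappa>" using k(2) by auto
  define out where "out m = map bsy (concat (map (\<lambda>p. concat (map (den ?n p t) (es (\<kappa> ! p)))) [0..<m]))" for m
  define S where "S p = (setG ?n p (app 1 (out p) st))(2 := (\<kappa>, int p))" for p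
  have rS: "emit_ready ?n p t (S p)" for p
  proof -
    have "emit_ready ?n 0 t (app 1 (out p) st)" using r by (auto simp: emit_ready_def at_end_app)
    from ready_setG[OF this, of p] show ?thesis by (auto simp: S_def emit_ready_def at_end_def less_3)
  qed
  let ?body = "CSeq (csel 2 (map (\<lambda>a. (a, cems (es a))) [1..<8])) cadv3"
  have "ex (cfor 2 ?body) (S 0) (?n * ((bcost es L + 1 + 7 + (12 * L + 62) + 1) + 5) + 7) ((S ?n)(2 := (\<kappa>, 0)))"
  proof (rule ex_cfor[OF nz])
    fix p assume p: "p < ?n"
    let ?a = "\<kappa> ! p"
    have a: "?a \<in> {1..<8}" using k(2) p nth_mem by blast
    let ?o = "map bsy (concat (map (den ?n p t) (es ?a)))"
    have 1: "ex (cems (es ?a)) (S p) (sum_list (map (ecost L) (es ?a)) + 1) (app 1 ?o (S p))"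
      by (rule ex_cems[OF rS ok L])
    have "sum_list (map (ecost L) (es ?a)) \<le> bcost es L"
      unfolding bcost_def by (rule member_le_sum[where f = "\<lambda>a. sum_list (map (ecost L) (es a))"]) (use a in auto)
    then have 1: "ex (cems (es ?a)) (S p) (bcost es L + 1) (app 1 ?o (S p))" by (intro ex_weaken[OF 1]) simp
    have m: "map_of (map (\<lambda>a. (a, c a)) xs) x = Some (c x)" if "x \<in> set xs" for x xs and c :: "nat \<Rightarrow> cmd"
      using that by (induction xs) auto
    have "wtape (fst (S p 2)) (snd (S p 2)) = ?a" using p by (simp add: S_def wtape_def)
    then have mo: "map_of (map (\<lambda>a. (a, cems (es a))) [1..<8]) (wtape (fst (S p 2)) (snd (S p 2))) = Some (cems (es ?a))"
      using m[of ?a "[1..<8]" "\<lambda>a. cems (es a)"] a by simp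
    have 2: "ex (csel 2 (map (\<lambda>a. (a, cems (es a))) [1..<8])) (S p) (bcost es L + 1 + 7) (app 1 ?o (S p))"
      using ex_csel[where xs = "map (\<lambda>a. (a, cems (es a))) [1..<8]", OF mo 1] by simp
    have rr: "emit_ready ?n p t (app 1 ?o (S p))" using rS[of p] by (auto simp: emit_ready_def at_end_app)
    have 3: "ex cadv3 (app 1 ?o (S p)) (12 * L + 62) (setG ?n (Suc p) (app 1 ?o (S p)))"
      by (rule ex_weaken[OF ex_cadv3[OF rr n]]) (use L in simp)
    have "setG ?n (Suc p) (app 1 ?o (S p)) = (S (Suc p))(2 := (\<kappa>, int p))"
      by (auto simp: S_def setG_def app_def out_def fun_eq_iff)
    then show "ex ?body (S p) (bcost es L + 1 + 7 + (12 * L + 62) + 1) ((S (Suc p))(2 := (\<kappa>, int p)))"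
      using ex_seq[OF 2 3] by simp
  qed (simp add: S_def)
  moreover have "S 0 = st"
  proof -
    have "app 1 (out 0) st = st" using r by (simp add: out_def app_Nil emit_ready_def)
    then show ?thesis unfolding S_def using setG_ready[OF r] k(1) by (metis fun_upd_triv of_nat_0)
  qed
  ultimately have 1: "ex (cfor 2 ?body) st (?n * ((bcost es L + 1 + 7 + (12 * L + 62) + 1) + 5) + 7) ((S ?n)(2 := (\<kappa>, 0)))" by simp
  have rr: "emit_ready ?n ?n t ((S ?n)(2 := (\<kappa>, 0)))" using rS[of ?n] by (auto simp: emit_ready_def at_end_def less_3)
  have 2: "ex cadv3 ((S ?n)(2 := (\<kappa>, 0))) (12 * L + 62) (setG ?n (Suc ?n) ((S ?n)(2 := (\<kappa>, 0))))"
    by (rule ex_weaken[OF ex_cadv3[OF rr n]]) (use L in simp)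
  have "setG ?n (Suc ?n) ((S ?n)(2 := (\<kappa>, 0))) = app 1 (map bsy (colstr \<kappa> es t)) st"
  proof -
    have "emit_ready ?n 0 t (app 1 (out ?n) st)" using r by (auto simp: emit_ready_def at_end_app)
    note e = setG_ready[OF this]
    have m: "(Suc ?n + ?n + \<delta>) mod Suc ?n = (0 + ?n + \<delta>) mod Suc ?n" for \<delta>
      by (metis add.assoc add_0 mod_add_self1)
    have "setG ?n (Suc ?n) ((S ?n)(2 := (\<kappa>, 0))) = (setG ?n 0 (app 1 (out ?n) st))(2 := (\<kappa>, 0))"
      unfolding setG_def S_def m by (auto simp: fun_eq_iff)
    also have "\<dots> = app 1 (out ?n) st" unfolding e using k(1) by (auto simp: app_def fun_eq_iff)
    finally show ?thesis by (simp add: out_def colstr_def)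
  qed
  then have "ex (cbody es) st (?n * ((bcost es L + 1 + 7 + (12 * L + 62) + 1) + 5) + 7 + (12 * L + 62) + 1) (app 1 (map bsy (colstr \<kappa> es t)) st)"
    unfolding cbody_def using ex_seq[OF 1 2] by simp
  then show ?thesis by (rule ex_weaken) (simp add: algebra_simps)
qed


section \<open>Preparing the work tapes and writing the header\<close>

definition cls :: "bool \<Rightarrow> nat" where "cls b = (if b then 5 else 4)"

text \<open>The column classes: 1 first column, 2 blank, 3 initial position of the heads, 4 and 5 input bits,
  6 witness bit or blank, 7 last column.\<close>

definition classes :: "nat \<Rightarrow> nat \<Rightarrow> bool list \<Rightarrow> nat list" where
  "classes T P x = [1] @ replicate T 2 @ [3] @ map cls (dbl x @ [False]) @ replicate P 6 @ replicate T 2 @ [7]"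

lemma classes_range: "set (classes T P x) \<subseteq> {1..<8}" "0 \<notin> set (classes T P x)" "classes T P x \<noteq> []"
  by (auto simp: classes_def cls_def)

lemma length_dbl: "length (dbl bs) = 2 * length bs"
  by (induction bs) (auto simp: dbl_def)

lemma length_classes: "length (classes T P x) = 2 * T + P + 2 * length x + 4"
  by (simp add: classes_def length_dbl)

text \<open>Each input bit contributes class 5 followed by its own class, and a final class 4 closes
  the list. These columns spell \<open>enc_word x\<close>, the fixed part of the input of the
  verifier.\<close>

definition ck :: "nat \<Rightarrow> nat \<Rightarrow> cmd" where
  "ck iT iP = CSeq (cpush 2 [1]) (CSeq (cfor iT (cpush 2 [2])) (CSeq (cpush 2 [3])
     (CSeq (cfor 0 (CIf 0 {2} (cpush 2 [5, 5]) (cpush 2 [5, 4]))) (CSeq (cpush 2 [4])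
     (CSeq (cfor iP (cpush 2 [6])) (CSeq (cfor iT (cpush 2 [2])) (CSeq (cpush 2 [7]) (rewind 2))))))))"

lemma ex_ck:
  assumes "st 0 = (map bsy x, 0)" "st iT = (replicate T 1, 0)" "st iP = (replicate P 1, 0)" "st 2 = ([], 0)"
    "iT \<noteq> 2" "iP \<noteq> 2"
  shows "ex (ck iT iP) st (20 * (T + P + length x) + 100) (st(2 := (classes T P x, 0)))"
proof -
  have nz: "0 \<notin> set (replicate n 1 :: nat list)" for n by auto
  have e: "at_end st 2" using assms by (simp add: at_end_def)
  have sT: "(app 2 ys st) iT = (replicate T 1, 0)" and sP: "(app 2 ys st) iP = (replicate P 1, 0)"
    and s0: "(app 2 ys st) 0 = (map bsy x, 0)" for ys using assms by (auto simp: at_end_app)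
  note push = ex_cpush[OF at_end_app(1)[of 2 _ st], unfolded app_app]
  note forT = cfor_push[OF nz[of T] assms(5) sT at_end_app(1), unfolded app_app]
  note forP = cfor_push[OF nz[of P] assms(6) sP at_end_app(1), unfolded app_app]
  let ?c0 = "[1] @ replicate T 2 @ [3]"
  let ?c1 = "?c0 @ map cls (dbl x)"
  have 1: "ex (cpush 2 [1]) st 3 (app 2 [1] st)" using ex_cpush[OF e, of "[1]"] by simp
  have 2: "ex (cfor iT (cpush 2 [2])) (app 2 [1] st) (T * 8 + 7) (app 2 ([1] @ replicate T 2) st)"
    using forT[of 2 "[1]"] by simp
  have 3: "ex (cpush 2 [3]) (app 2 ([1] @ replicate T 2) st) 3 (app 2 ?c0 st)"
    using push[of "[3]" "[1] @ replicate T 2"] by simp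
  have 4: "ex (cfor 0 (CIf 0 {2} (cpush 2 [5, 5]) (cpush 2 [5, 4]))) (app 2 ?c0 st) (length x * 11 + 7) (app 2 ?c1 st)"
  proof -
    have "ex (cfor 0 (CIf 0 {2} (cpush 2 [5, 5]) (cpush 2 [5, 4]))) (app 2 ?c0 st) (length (map bsy x) * (6 + 5) + 7)
       (app 2 (concat (map (\<lambda>j. [5, cls (x ! j)]) [0..<length (map bsy x)])) (app 2 ?c0 st))"
    proof (rule cfor_app[OF bsy_nz _ s0 at_end_app(1)])
      fix s j assume j: "j < length (map bsy x)" "s 0 = (map bsy x, int j)" "at_end s 2"
      have w: "wtape (fst (s 0)) (snd (s 0)) = bsy (x ! j)" using j by (simp add: wtape_def)
      have "ex (cpush 2 [5, cls (x ! j)]) s 5 (app 2 [5, cls (x ! j)] s)" using ex_cpush[OF j(3), of "[5, cls (x ! j)]"] by simp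
      moreover have "(if wtape (fst (s 0)) (snd (s 0)) \<in> {2} then cpush 2 [5, 5] else cpush 2 [5, 4]) = cpush 2 [5, cls (x ! j)]"
        unfolding w by (simp add: bsy_def cls_def)
      ultimately have "ex (CIf 0 {2} (cpush 2 [5, 5]) (cpush 2 [5, 4])) s (5 + 1) (app 2 [5, cls (x ! j)] s)"
        by (intro ex_if) simp
      then show "ex (CIf 0 {2} (cpush 2 [5, 5]) (cpush 2 [5, 4])) s 6 (app 2 [5, cls (x ! j)] s)" by simp
    qed simp
    moreover have "concat (map (\<lambda>j. [5, cls (x ! j)]) [0..<length x]) = map cls (dbl x)"
    proof -
      have "concat (map (\<lambda>b. [5, cls b]) x) = map cls (dbl x)" by (induction x) (auto simp: dbl_def cls_def)
      moreover have "map (\<lambda>j. [5, cls (x ! j)]) [0..<length x] = map (\<lambda>b. [5, cls b]) x"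
        by (rule nth_equalityI) auto
      ultimately show ?thesis by simp
    qed
    ultimately show ?thesis by (simp add: app_app)
  qed
  let ?c2 = "?c1 @ [4]" let ?c3 = "?c2 @ replicate P 6" let ?c4 = "?c3 @ replicate T 2"
  have 5: "ex (cpush 2 [4]) (app 2 ?c1 st) 3 (app 2 ?c2 st)" using push[of "[4]" ?c1] by simp
  have 6: "ex (cfor iP (cpush 2 [6])) (app 2 ?c2 st) (P * 8 + 7) (app 2 ?c3 st)" using forP[of 6 ?c2] by simp
  have 7: "ex (cfor iT (cpush 2 [2])) (app 2 ?c3 st) (T * 8 + 7) (app 2 ?c4 st)" using forT[of 2 ?c3] by simp
  have c: "?c4 @ [7] = classes T P x" by (simp add: classes_def cls_def)
  have 8: "ex (cpush 2 [7]) (app 2 ?c4 st) 3 (app 2 (classes T P x) st)" using push[of "[7]" ?c4] unfolding c by simp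
  let ?L = "length (classes T P x)"
  have ap: "app 2 (classes T P x) st 2 = (classes T P x, int ?L)" using assms by (simp add: app_def)
  have "(app 2 (classes T P x) st)(2 := (classes T P x, 0)) = st(2 := (classes T P x, 0))" by (simp add: app_def)
  then have 9: "ex (rewind 2) (app 2 (classes T P x) st) (2 * ?L + 5) (st(2 := (classes T P x, 0)))"
    using ex_rewind[where st = "app 2 (classes T P x) st" and i = 2, OF classes_range(2) ap] by simp
  show ?thesis unfolding ck_def
    by (rule ex_weaken[OF ex_seq[OF 1 ex_seq[OF 2 ex_seq[OF 3 ex_seq[OF 4 ex_seq[OF 5 ex_seq[OF 6 ex_seq[OF 7 ex_seq[OF 8 9]]]]]]]]])
      (simp add: length_classes)
qed

text \<open>All three field tapes start in the all-False state, which stands for the column before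
  the first one. Tape 4 is advanced once and tape 5 twice, which gives the fields around column
  0.\<close>

definition cg :: cmd where
  "cg = CSeq (CSeq (cfor 2 (cpush 3 [1])) (rewind 3)) (CSeq (CSeq (cfor 2 (cpush 4 [1])) (rewind 4))
    (CSeq (CSeq (cfor 2 (cpush 5 [1])) (rewind 5)) (CSeq (cadv 4) (CSeq (cadv 5) (cadv 5)))))"

lemma ex_fill:
  assumes "st 2 = (\<kappa>, 0)" "0 \<notin> set \<kappa>" "st g = ([], 0)" "g \<noteq> 2"
  shows "ex (CSeq (cfor 2 (cpush g [1])) (rewind g)) st (10 * length \<kappa> + 13) (st(g := (map bsy (oh (length \<kappa>) (length \<kappa>)), 0)))"
proof -
  let ?n = "length \<kappa>"
  have r: "map bsy (oh ?n ?n) = replicate ?n 1" by (rule nth_equalityI) (auto simp: oh_def bsy_def)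
  have 1: "ex (cfor 2 (cpush g [1])) st (?n * 8 + 7) (app g (replicate ?n 1) st)"
    using assms by (intro cfor_push) (auto simp: at_end_def)
  have a: "app g (replicate ?n 1) st g = (replicate ?n 1, int ?n)" using assms by (simp add: app_def)
  have "(app g (replicate ?n 1) st)(g := (replicate ?n 1, 0)) = st(g := (replicate ?n 1, 0))" by (simp add: app_def)
  then have 2: "ex (rewind g) (app g (replicate ?n 1) st) (2 * ?n + 5) (st(g := (replicate ?n 1, 0)))"
    using ex_rewind[where st = "app g (replicate ?n 1) st" and i = g, OF _ a] by simp
  show ?thesis unfolding r by (rule ex_weaken[OF ex_seq[OF 1 2]]) simp
qed

lemma ex_cg:
  assumes "st 2 = (\<kappa>, 0)" "0 \<notin> set \<kappa>" "st 3 = ([], 0)" "st 4 = ([], 0)" "st 5 = ([], 0)" "\<kappa> \<noteq> []"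
  shows "ex cg st (42 * length \<kappa> + 110) (setG (length \<kappa>) 0 st)"
proof -
  let ?n = "length \<kappa>" let ?w = "\<lambda>m. (map bsy (oh ?n m), 0 :: int)"
  have n: "0 < ?n" using assms by simp
  let ?s1 = "st(3 := ?w ?n)" let ?s2 = "?s1(4 := ?w ?n)" let ?s3 = "?s2(5 := ?w ?n)"
  let ?s4 = "?s3(4 := ?w (Suc ?n mod Suc ?n))" let ?s5 = "?s4(5 := ?w (Suc ?n mod Suc ?n))"
  let ?s6 = "?s5(5 := ?w (Suc (Suc ?n mod Suc ?n) mod Suc ?n))"
  have 1: "ex (CSeq (cfor 2 (cpush 3 [1])) (rewind 3)) st (10 * ?n + 13) ?s1" by (rule ex_fill) (use assms in auto)
  have 2: "ex (CSeq (cfor 2 (cpush 4 [1])) (rewind 4)) ?s1 (10 * ?n + 13) ?s2" by (rule ex_fill) (use assms in auto)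
  have 3: "ex (CSeq (cfor 2 (cpush 5 [1])) (rewind 5)) ?s2 (10 * ?n + 13) ?s3" by (rule ex_fill) (use assms in auto)
  have 4: "ex (cadv 4) ?s3 (4 * ?n + 20) ?s4" by (rule ex_cadv) (use n in auto)
  have 5: "ex (cadv 5) ?s4 (4 * ?n + 20) ?s5" by (rule ex_cadv) (use n in auto)
  have 6: "ex (cadv 5) ?s5 (4 * ?n + 20) ?s6" by (rule ex_cadv) (use n in auto)
  have "?s6 = setG ?n 0 st"
  proof -
    have "Suc (Suc ?n mod Suc ?n) mod Suc ?n = (0 + ?n + 2) mod Suc ?n"
      using mod_Suc_eq[of "Suc ?n" "Suc ?n"] by (simp only: add_0 add_2_eq_Suc')
    then show ?thesis by (auto simp: setG_def fun_eq_iff)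
  qed
  then show ?thesis unfolding cg_def
    using ex_weaken[OF ex_seq[OF 1 ex_seq[OF 2 ex_seq[OF 3 ex_seq[OF 4 ex_seq[OF 5 6]]]]], of "42 * ?n + 110"] by simp
qed

text \<open>The number of colours is the number of columns times the constant \<open>J\<close>; it
  is obtained by \<open>J\<close> binary increments per column.\<close>

definition ccnt :: "nat \<Rightarrow> cmd" where
  "ccnt J = CSeq (cfor 2 ((CSeq (cinc 7) ^^ J) CSkip)) (CSeq (cfor 7 (cbit 7)) (cpush 1 [1]))"

lemma ex_cincs:
  assumes "st 7 = (map bsy (bits_of_nat v), 0)" "v + j \<le> L"
  shows "ex ((CSeq (cinc 7) ^^ j) CSkip) st (j * (4 * L + 13) + 1) (st(7 := (map bsy (bits_of_nat (v + j)), 0)))"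
  using assms
proof (induction j arbitrary: v st)
  case 0
  then have "st(7 := (map bsy (bits_of_nat (v + 0)), 0)) = st" by auto
  then show ?case using ex_skip[of st] by simp
next
  case (Suc j)
  let ?s = "st(7 := (map bsy (bits_of_nat (Suc v)), 0))"
  have 1: "ex (cinc 7) st (4 * L + 12) ?s"
    using ex_weaken[OF ex_cinc[where st = st and g = 7, OF Suc.prems(1)], of "4 * L + 12"] length_bits[of v] Suc.prems(2) by (simp add: bits_Suc)
  have 2: "ex ((CSeq (cinc 7) ^^ j) CSkip) ?s (j * (4 * L + 13) + 1) (?s(7 := (map bsy (bits_of_nat (Suc v + j)), 0)))"
    by (rule Suc.IH) (use Suc.prems in auto)
  have e: "?s(7 := (map bsy (bits_of_nat (Suc v + j)), 0)) = st(7 := (map bsy (bits_of_nat (v + Suc j)), 0))" by simp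
  have f: "(CSeq (cinc 7) ^^ Suc j) CSkip = CSeq (cinc 7) ((CSeq (cinc 7) ^^ j) CSkip)" by simp
  show ?case unfolding f by (rule ex_weaken[OF ex_seq[OF 1 2[unfolded e]]]) simp
qed

lemma ex_ccnt:
  assumes "st 2 = (\<kappa>, 0)" "0 \<notin> set \<kappa>" "st 7 = ([], 0)" "at_end st 1"
  shows "ex (ccnt J) st (length \<kappa> * (J * (4 * (length \<kappa> * J) + 13) + 6) + 11 * (length \<kappa> * J) + 30)
     (app 1 (map bsy (enc_nat (length \<kappa> * J))) (st(7 := (map bsy (bits_of_nat (length \<kappa> * J)), 0))))"
proof -
  let ?n = "length \<kappa>" let ?L = "length \<kappa> * J"
  define S where "S p = st(7 := (map bsy (bits_of_nat (p * J)), 0), 2 := (\<kappa>, int p))" for p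
  have "ex (cfor 2 ((CSeq (cinc 7) ^^ J) CSkip)) (S 0) (?n * ((J * (4 * ?L + 13) + 1) + 5) + 7) ((S ?n)(2 := (\<kappa>, 0)))"
  proof (rule ex_cfor[OF assms(2)])
    fix p assume p: "p < ?n"
    have "Suc p * J \<le> ?n * J" using p by (intro mult_le_mono1) simp
    then have "p * J + J \<le> ?L" by simp
    moreover have "S p 7 = (map bsy (bits_of_nat (p * J)), 0)" by (simp add: S_def)
    ultimately have "ex ((CSeq (cinc 7) ^^ J) CSkip) (S p) (J * (4 * ?L + 13) + 1) ((S p)(7 := (map bsy (bits_of_nat (p * J + J)), 0)))"
      by (intro ex_cincs)
    moreover have "(S p)(7 := (map bsy (bits_of_nat (p * J + J)), 0)) = (S (Suc p))(2 := (\<kappa>, int p))"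
      by (auto simp: S_def fun_eq_iff add.commute)
    ultimately show "ex ((CSeq (cinc 7) ^^ J) CSkip) (S p) (J * (4 * ?L + 13) + 1) ((S (Suc p))(2 := (\<kappa>, int p)))" by simp
  qed (simp add: S_def)
  moreover have "S 0 = st" using assms by (auto simp: S_def fun_eq_iff bits_of_nat.simps)
  moreover let ?s1 = "st(7 := (map bsy (bits_of_nat ?L), 0))"
  have "(S ?n)(2 := (\<kappa>, 0)) = ?s1" using assms by (auto simp: S_def fun_eq_iff)
  ultimately have 1: "ex (cfor 2 ((CSeq (cinc 7) ^^ J) CSkip)) st (?n * ((J * (4 * ?L + 13) + 1) + 5) + 7) ?s1" by simp
  have e: "at_end ?s1 1" using assms by (simp add: at_end_def)
  have 2: "ex (cfor 7 (cbit 7)) ?s1 (11 * ?L + 7) (app 1 (map bsy (dbl (bits_of_nat ?L))) ?s1)"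
    using ex_weaken[OF ex_emit_fwd[where st = ?s1, OF e, of 7 "bits_of_nat ?L"], of "11 * ?L + 7"] length_bits[of ?L] by simp
  have 3: "ex (cpush 1 [1]) (app 1 (map bsy (dbl (bits_of_nat ?L))) ?s1) 3 (app 1 [1] (app 1 (map bsy (dbl (bits_of_nat ?L))) ?s1))"
    using ex_cpush[OF at_end_app(1), of 1 "[1]"] by simp
  have "app 1 [1] (app 1 (map bsy (dbl (bits_of_nat ?L))) ?s1) = app 1 (map bsy (enc_nat ?L)) ?s1"
    by (simp add: app_app enc_nat_def enc_word_def dbl_def bsy_def)
  then show ?thesis unfolding ccnt_def using ex_weaken[OF ex_seq[OF 1 ex_seq[OF 2 3]]] by (simp add: algebra_simps)
qed

definition cinct :: cmd where "cinct = CSeq (goright 6) (CSeq (CWr 6 1 Move_Right) (rewind 6))"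

lemma ex_cinct:
  assumes "st 6 = (map bsy (replicate t False), 0)" "t \<le> L"
  shows "ex cinct st (4 * L + 13) (st(6 := (map bsy (replicate (Suc t) False), 0)))"
proof -
  let ?w = "\<lambda>t. map bsy (replicate t False)"
  have 1: "ex (goright 6) st (2 * t + 1) (st(6 := (?w t, int t)))"
    using ex_goright[OF bsy_nz, of st 6 "replicate t False" 0] assms by simp
  have w: "?w t @ [1] = ?w (Suc t)" by (simp add: bsy_def replicate_append_same)
  have 2: "ex (CWr 6 1 Move_Right) (st(6 := (?w t, int t))) 1 (st(6 := (?w (Suc t), int (Suc t))))"
    using ex_push[of "st(6 := (?w t, int t))" 6 "?w t" 1] unfolding w by simp
  have 3: "ex (rewind 6) (st(6 := (?w (Suc t), int (Suc t)))) (2 * Suc t + 5) (st(6 := (?w (Suc t), 0)))"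
    using ex_rewind[OF bsy_nz, of "st(6 := (?w (Suc t), int (Suc t)))" 6 "replicate (Suc t) False" "Suc t"] by simp
  show ?thesis unfolding cinct_def by (rule ex_weaken[OF ex_seq[OF 1 ex_seq[OF 2 3]]]) (use assms in simp)
qed


definition cmain :: "nat \<Rightarrow> (nat \<Rightarrow> nat \<Rightarrow> em list) \<Rightarrow> cmd" where
  "cmain iT es = CSeq (cbody (es 0)) (CSeq cinct (CSeq (cfor iT (CSeq (cbody (es 1)) cinct))
     (CSeq (cbody (es 2)) (cpush 1 [1]))))"

definition phase :: "nat \<Rightarrow> nat \<Rightarrow> nat" where
  "phase N t = (if t = 0 then 0 else if t \<le> N then 1 else 2)"

definition mcost :: "(nat \<Rightarrow> nat \<Rightarrow> em list) \<Rightarrow> nat \<Rightarrow> nat" where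
  "mcost es L = L * (bcost (es 0) L + bcost (es 1) L + bcost (es 2) L + (12 * L + 62) + 14) + 12 * L + 70"

lemma ex_cmain:
  assumes r: "emit_ready (length \<kappa>) 0 0 st" and k: "st 2 = (\<kappa>, 0)" "set \<kappa> \<subseteq> {1..<8}" "\<kappa> \<noteq> []"
    and ok: "\<And>i a. \<forall>e \<in> set (es i a). em_ok e" and iT: "st iT = (replicate N 1, 0)" "8 \<le> iT"
  defines "L \<equiv> length \<kappa> + N + 2"
  shows "\<exists>st'. ex (cmain iT es) st (N * (mcost es L + 4 * L + 19) + 2 * mcost es L + 4 * L + 40) st' \<and>
     fst (st' 1) = fst (st 1) @ map bsy (concat (map (\<lambda>t. colstr \<kappa> (es (phase N t)) t) [0..<N + 2]) @ [False])"
proof -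
  let ?n = "length \<kappa>" and ?w = "replicate N (1::nat)"
  define out where "out m = concat (map (\<lambda>t. colstr \<kappa> (es (phase N t)) t) [0..<m])" for m
  define U where "U j t ys = (app 1 (map bsy ys) st)(6 := (map bsy (replicate t False), 0), iT := (?w, int j))" for j t ys
  have rU: "emit_ready ?n 0 t (U j t ys)" for j t ys
    using r iT(2) by (auto simp: U_def emit_ready_def at_end_def app_def less_3)
  have kU: "(U j t ys) 2 = (\<kappa>, 0)" for j t ys using k iT(2) by (simp add: U_def app_def)
  have body: "ex (cbody (es i)) (U j t ys) (mcost es L) (U j t (ys @ colstr \<kappa> (es i) t))" if "t \<le> L" "i < 3" for i j t ys
  proof -
    have "ex (cbody (es i)) (U j t ys) (?n * (bcost (es i) L + (12 * L + 62) + 14) + 12 * L + 70)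
        (app 1 (map bsy (colstr \<kappa> (es i) t)) (U j t ys))"
      by (rule ex_cbody[OF rU kU k(2,3) ok _ that(1)]) (simp add: L_def)
    moreover have "app 1 (map bsy (colstr \<kappa> (es i) t)) (U j t ys) = U j t (ys @ colstr \<kappa> (es i) t)"
      using iT(2) by (auto simp: U_def app_def fun_eq_iff)
    moreover have "bcost (es i) L \<le> bcost (es 0) L + bcost (es 1) L + bcost (es 2) L"
      using that(2) by (auto simp: less_Suc_eq numeral_3_eq_3 numeral_2_eq_2)
    then have "?n * (bcost (es i) L + (12 * L + 62) + 14) + 12 * L + 70 \<le> mcost es L"
      unfolding mcost_def by (intro add_mono mult_le_mono) (auto simp: L_def)
    ultimately show ?thesis using ex_weaken by metis
  qed
  have inct: "ex cinct (U j t ys) (4 * L + 13) (U j (Suc t) ys)" if "t \<le> L" for j t ys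
  proof -
    have "ex cinct (U j t ys) (4 * L + 13) ((U j t ys)(6 := (map bsy (replicate (Suc t) False), 0)))"
      by (rule ex_cinct[OF _ that]) (use iT(2) in \<open>simp add: U_def\<close>)
    moreover have "(U j t ys)(6 := (map bsy (replicate (Suc t) False), 0)) = U j (Suc t) ys"
      using iT(2) by (auto simp: U_def fun_eq_iff)
    ultimately show ?thesis by simp
  qed
  have outS: "out t @ colstr \<kappa> (es (phase N t)) t = out (Suc t)" for t by (simp add: out_def)
  have U0: "U 0 0 [] = st" using r iT by (auto simp: U_def app_def emit_ready_def at_end_def fun_eq_iff prod_eq_iff)
  have o1: "[] @ colstr \<kappa> (es 0) 0 = out 1" by (simp add: out_def phase_def)
  have 1: "ex (cbody (es 0)) st (mcost es L) (U 0 0 (out 1))" using body[of 0 0 0 "[]"] unfolding U0 o1 by simp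
  have 2: "ex cinct (U 0 0 (out 1)) (4 * L + 13) (U 0 1 (out 1))" using inct[of 0 0 "out 1"] by simp
  have 3: "ex (cfor iT (CSeq (cbody (es 1)) cinct)) (U 0 1 (out 1)) (N * ((mcost es L + (4 * L + 13) + 1) + 5) + 7)
      (U 0 (Suc N) (out (Suc N)))"
  proof -
    define S where "S j = U j (Suc j) (out (Suc j))" for j
    have "ex (cfor iT (CSeq (cbody (es 1)) cinct)) (S 0) (length ?w * ((mcost es L + (4 * L + 13) + 1) + 5) + 7) ((S (length ?w))(iT := (?w, 0)))"
    proof (rule ex_cfor)
      fix j assume "j < length ?w"
      then have j: "Suc j \<le> L" "phase N (Suc j) = 1" by (auto simp: L_def phase_def)
      have "ex (CSeq (cbody (es 1)) cinct) (S j) (mcost es L + (4 * L + 13) + 1) (U j (Suc (Suc j)) (out (Suc j) @ colstr \<kappa> (es 1) (Suc j)))"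
        unfolding S_def by (rule ex_seq[OF body inct]) (use j in auto)
      moreover have "U j (Suc (Suc j)) (out (Suc j) @ colstr \<kappa> (es 1) (Suc j)) = (S (Suc j))(iT := (?w, int j))"
        using outS[of "Suc j"] unfolding j(2) by (simp add: S_def U_def)
      ultimately show "ex (CSeq (cbody (es 1)) cinct) (S j) (mcost es L + (4 * L + 13) + 1) ((S (Suc j))(iT := (?w, int j)))" by simp
    qed (auto simp: S_def U_def)
    moreover have "(S N)(iT := (?w, 0)) = U 0 (Suc N) (out (Suc N))" by (simp add: S_def U_def)
    ultimately show ?thesis by (simp add: S_def)
  qed
  have 4: "ex (cbody (es 2)) (U 0 (Suc N) (out (Suc N))) (mcost es L) (U 0 (Suc N) (out (N + 2)))"
    using body[of "Suc N" 2 0 "out (Suc N)"] outS[of "Suc N"] by (simp add: L_def phase_def)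
  have e: "at_end (U 0 (Suc N) (out (N + 2))) 1" using rU unfolding emit_ready_def by blast
  have 5: "ex (cpush 1 [1]) (U 0 (Suc N) (out (N + 2))) 3 (app 1 [1] (U 0 (Suc N) (out (N + 2))))"
    using ex_cpush[OF e, of "[1]"] by simp
  have "fst ((app 1 [1] (U 0 (Suc N) (out (N + 2)))) 1) = fst (st 1) @ map bsy (out (N + 2) @ [False])"
    using iT(2) by (simp add: app_def U_def bsy_def)
  moreover have "ex (cmain iT es) st (N * (mcost es L + 4 * L + 19) + 2 * mcost es L + 4 * L + 40) (app 1 [1] (U 0 (Suc N) (out (N + 2))))"
    unfolding cmain_def by (rule ex_weaken[OF ex_seq[OF 1 ex_seq[OF 2 ex_seq[OF 3 ex_seq[OF 4 5]]]]]) (simp add: algebra_simps)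
  ultimately show ?thesis unfolding out_def by blast
qed

lemma pb_le: "pb g \<Longrightarrow> (\<And>x. f x \<le> g x) \<Longrightarrow> pb f"
  unfolding pb_def using order_trans by blast

lemma pb_bcost:
  assumes "pb L" shows "pb (\<lambda>X. bcost es (L X))"
proof -
  have "\<exists>K. \<forall>L. (\<Sum>a\<in>A. sum_list (map (ecost L) (es a))) \<le> K * Suc L" if "finite A" for A :: "nat set"
    using that
  proof (induction A)
    case (insert a A)
    then obtain K where K: "\<And>L. (\<Sum>a\<in>A. sum_list (map (ecost L) (es a))) \<le> K * Suc L" by blast
    obtain K' where K': "\<And>L. sum_list (map (ecost L) (es a)) \<le> K' * Suc L" using ecost_bound by blast
    have "(\<Sum>a\<in>insert a A. sum_list (map (ecost L) (es a))) \<le> (K' + K) * Suc L" for L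
      using add_mono[OF K'[of L] K[of L]] insert by (simp add: algebra_simps)
    then show ?case by blast
  qed simp
  from this[OF finite_atLeastLessThan[of 1 8]] obtain K where K: "\<forall>L. bcost es L \<le> K * Suc L"
    unfolding bcost_def by (elim exE)
  have "pb (\<lambda>X. K * Suc (L X))" by (rule pb_mult[OF pb_const pb_Suc[OF assms]])
  then show ?thesis by (rule pb_le) (rule K[rule_format])
qed

lemma pb_mcost: "pb L \<Longrightarrow> pb (\<lambda>X. mcost es (L X))"
  unfolding mcost_def by (intro pb_add pb_mult pb_bcost pb_const)

definition gen :: "nat list \<Rightarrow> nat list \<Rightarrow> nat \<Rightarrow> (nat \<Rightarrow> nat \<Rightarrow> em list) \<Rightarrow> cmd" where
  "gen cT cP J es = (let iT = 8 + length cT; jP = Suc iT; iP = jP + length cP in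
     CSeq (chor 8 cT) (CSeq (chor jP cP) (CSeq (ck iT iP) (CSeq cg (CSeq (ccnt J) (cmain iT es))))))"

lemma okc_cpush: "i < n \<Longrightarrow> set as \<subseteq> {..<G} \<Longrightarrow> okc n G (cpush i as)"
  by (induction as) auto

lemma okc_loops: "i < n \<Longrightarrow> okc n G c \<Longrightarrow> okc n G (cfor i c)" "i < n \<Longrightarrow> okc n G c \<Longrightarrow> okc n G (cforb i c)"
  "i < n \<Longrightarrow> okc n G (rewind i)" "i < n \<Longrightarrow> okc n G (goright i)"
  by (auto simp: cfor_def cforb_def rewind_def goleft_def goright_def)

lemma okc_csel: "i < n \<Longrightarrow> (\<And>x. x \<in> set xs \<Longrightarrow> okc n G (snd x)) \<Longrightarrow> okc n G (csel i xs)"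
  by (induction i xs rule: csel.induct) fastforce+

lemma okc_cbit: "i < n \<Longrightarrow> 8 \<le> n \<Longrightarrow> okc n 8 (cbit i)"
  by (auto simp: cbit_def)

lemma okc_cem: "em_ok e \<Longrightarrow> 8 \<le> n \<Longrightarrow> okc n 8 (cem e)"
  by (cases e) (auto intro!: okc_loops okc_cbit okc_cpush simp: bsy_def)

lemma okc_cems: "\<forall>e \<in> set es. em_ok e \<Longrightarrow> 8 \<le> n \<Longrightarrow> okc n 8 (cems es)"
  by (induction es) (auto simp: cems_def okc_cem)

lemma okc_cadv3: "8 \<le> n \<Longrightarrow> okc n 8 cadv3" "8 \<le> n \<Longrightarrow> g < n \<Longrightarrow> okc n 8 (cadv g)"
  by (auto simp: cadv3_def cadv_def intro!: okc_loops)

lemma okc_cbody: "\<forall>a. \<forall>e \<in> set (es a). em_ok e \<Longrightarrow> 8 \<le> n \<Longrightarrow> okc n 8 (cbody es)"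
  by (auto simp: cbody_def okc_cadv3 okc_cems intro!: okc_loops okc_csel)

lemma okc_chor: "i + length bs < n \<Longrightarrow> 8 \<le> n \<Longrightarrow> okc n 8 (chor i bs)"
  by (induction bs arbitrary: i) (auto intro!: okc_loops okc_cpush)

lemma okc_incs: "8 \<le> n \<Longrightarrow> okc n 8 ((CSeq (cinc 7) ^^ J) CSkip)"
  by (induction J) (auto simp: cinc_def intro!: okc_loops)

lemma okc_gen:
  assumes "\<forall>i a. \<forall>e \<in> set (es i a). em_ok e"
  shows "okc (10 + length cT + length cP) 8 (gen cT cP J es)"
  using assms
  by (auto simp: gen_def Let_def ck_def cg_def ccnt_def cmain_def cinct_def okc_cbit
      intro!: okc_chor okc_loops okc_cadv3 okc_incs okc_cbody)

text \<open>Everything that depends on the machine sits in the constant lists \<open>es i a\<close>,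
  one for each kind of block and class of column. The output is then a double loop over blocks and
  columns, whose lengths are polynomial.\<close>

theorem poly_time_gen:
  fixes pT pP :: "nat poly"
  assumes ok: "\<And>i a. \<forall>e \<in> set (es i a). em_ok e"
  defines "\<kappa> \<equiv> \<lambda>x. classes (poly pT (length x)) (poly pP (length x)) x"
  shows "poly_time (\<lambda>x. enc_nat (length (\<kappa> x) * J) @
     concat (map (\<lambda>t. colstr (\<kappa> x) (es (phase (poly pT (length x)) t)) t) [0..<poly pT (length x) + 2]) @ [False])"
proof -
  let ?cT = "rev (coeffs pT)" and ?cP = "rev (coeffs pP)"
  let ?iT = "8 + length ?cT" let ?jP = "Suc ?iT" let ?iP = "?jP + length ?cP"
  define n where "n X = 2 * poly pT X + poly pP X + 2 * X + 4" for X
  define L where "L X = n X + poly pT X + 2" for X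
  define B where "B X = hcost X 0 ?cT + (hcost X 0 ?cP + ((20 * (poly pT X + poly pP X + X) + 100) +
     ((42 * n X + 110) + ((n X * (J * (4 * (n X * J) + 13) + 6) + 11 * (n X * J) + 30) +
     (poly pT X * (mcost es (L X) + 4 * L X + 19) + 2 * mcost es (L X) + 4 * L X + 40) + 1) + 1) + 1) + 1) + 1" for X
  have pn: "pb n" unfolding n_def by (intro pb_add pb_mult pb_id pb_const pb_poly)
  have pL: "pb L" unfolding L_def by (intro pb_add pb_const pb_poly pn)
  have "pb B" unfolding B_def
    by (intro pb_add pb_mult pb_hcost pb_id pb_const pb_poly pn pL pb_mcost)
  then obtain p :: "nat poly" where p: "\<And>X. B X \<le> poly p X" unfolding pb_def by blast
  show ?thesis
  proof (rule poly_time_cmd[where n = "10 + length ?cT + length ?cP" and G = 8 and c = "gen ?cT ?cP J es" and p = p])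
    show "okc (10 + length ?cT + length ?cP) 8 (gen ?cT ?cP J es)" using okc_gen ok by blast
    fix x :: "bool list"
    let ?X = "length x" let ?T = "poly pT ?X" and ?P = "poly pP ?X"
    define s0 :: store where "s0 i = (if i = 0 then (map bsy x, 0) else ([], 0))" for i
    have wt: "word_tape w = wtape (map bsy w)" for w
      by (auto simp: word_tape_def wtape_def bsy_def fun_eq_iff nat_less_iff)
    have init: "(content (init_config x), head (init_config x)) = conc s0"
      by (auto simp: init_config_def conc_def s0_def wt fun_eq_iff)
    have "\<exists>s1. ex (chor 8 ?cT) s0 (hcost (length (map bsy x)) 0 ?cT) s1 \<and>
       s1 ?iT = (replicate (hval (length (map bsy x)) 0 ?cT) 1, 0) \<and> (\<forall>j. j < 8 \<or> ?iT < j \<longrightarrow> s1 j = s0 j)"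
      by (rule ex_chor) (auto simp: s0_def bsy_def)
    then obtain s1 where s1: "ex (chor 8 ?cT) s0 (hcost ?X 0 ?cT) s1" "s1 ?iT = (replicate ?T 1, 0)"
       "\<forall>j. j < 8 \<or> ?iT < j \<longrightarrow> s1 j = s0 j" unfolding hval_poly length_map by (elim exE conjE)
    have "\<exists>s2. ex (chor ?jP ?cP) s1 (hcost (length (map bsy x)) 0 ?cP) s2 \<and>
       s2 ?iP = (replicate (hval (length (map bsy x)) 0 ?cP) 1, 0) \<and> (\<forall>j. j < ?jP \<or> ?iP < j \<longrightarrow> s2 j = s1 j)"
      by (rule ex_chor) (use s1(3) in \<open>auto simp: s0_def bsy_def\<close>)
    then obtain s2 where s2: "ex (chor ?jP ?cP) s1 (hcost ?X 0 ?cP) s2" "s2 ?iP = (replicate ?P 1, 0)"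
       "\<forall>j. j < ?jP \<or> ?iP < j \<longrightarrow> s2 j = s1 j" unfolding hval_poly length_map by (elim exE conjE)
    have low: "s2 j = s0 j" if "j < 8" for j using s1(3) s2(3) that by simp
    have sT: "s2 ?iT = (replicate ?T 1, 0)" using s1(2) s2(3) by simp
    let ?k = "\<kappa> x"
    have 3: "ex (ck ?iT ?iP) s2 (20 * (?T + ?P + ?X) + 100) (s2(2 := (?k, 0)))"
      unfolding \<kappa>_def by (rule ex_ck) (use low sT s2(2) in \<open>auto simp: s0_def\<close>)
    let ?s3 = "s2(2 := (?k, 0))"
    have nl: "length ?k = n ?X" by (simp add: \<kappa>_def n_def length_classes)
    have kz: "set ?k \<subseteq> {1..<8}" "0 \<notin> set ?k" "?k \<noteq> []" using classes_range unfolding \<kappa>_def by blast+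
    have 4: "ex cg ?s3 (42 * n ?X + 110) (setG (n ?X) 0 ?s3)"
      unfolding nl[symmetric] by (rule ex_cg) (use low kz in \<open>auto simp: s0_def\<close>)
    let ?s4 = "setG (n ?X) 0 ?s3"
    have 5: "ex (ccnt J) ?s4 (n ?X * (J * (4 * (n ?X * J) + 13) + 6) + 11 * (n ?X * J) + 30)
        (app 1 (map bsy (enc_nat (n ?X * J))) (?s4(7 := (map bsy (bits_of_nat (n ?X * J)), 0))))"
      unfolding nl[symmetric] by (rule ex_ccnt) (use low kz in \<open>auto simp: s0_def setG_def at_end_def\<close>)
    let ?s5 = "app 1 (map bsy (enc_nat (n ?X * J))) (?s4(7 := (map bsy (bits_of_nat (n ?X * J)), 0)))"
    have r: "emit_ready (length ?k) 0 0 ?s5"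
      unfolding emit_ready_def nl less_3 using low by (auto simp: at_end_def app_def setG_def s0_def)
    have "\<exists>s6. ex (cmain ?iT es) ?s5 (?T * (mcost es (length ?k + ?T + 2) + 4 * (length ?k + ?T + 2) + 19) +
        2 * mcost es (length ?k + ?T + 2) + 4 * (length ?k + ?T + 2) + 40) s6 \<and>
        fst (s6 1) = fst (?s5 1) @ map bsy (concat (map (\<lambda>t. colstr ?k (es (phase ?T t)) t) [0..<?T + 2]) @ [False])"
      by (rule ex_cmain[OF r _ kz(1,3) ok]) (use sT in \<open>auto simp: app_def setG_def\<close>)
    then obtain s6 where s6: "ex (cmain ?iT es) ?s5 (?T * (mcost es (L ?X) + 4 * L ?X + 19) + 2 * mcost es (L ?X) + 4 * L ?X + 40) s6"
        "fst (s6 1) = fst (?s5 1) @ map bsy (concat (map (\<lambda>t. colstr ?k (es (phase ?T t)) t) [0..<?T + 2]) @ [False])"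
      unfolding nl L_def by (elim exE conjE)
    have "ex (gen ?cT ?cP J es) s0 (B ?X) s6"
      unfolding gen_def Let_def B_def
      by (rule ex_seq[OF s1(1) ex_seq[OF s2(1) ex_seq[OF 3 ex_seq[OF 4 ex_seq[OF 5 s6(1)]]]]])
    then have "ex (gen ?cT ?cP J es) s0 (poly p ?X) s6" using ex_weaken p by blast
    moreover have "fst (?s5 1) = map bsy (enc_nat (n ?X * J))" using low by (simp add: app_def setG_def s0_def)
    ultimately show "\<exists>s'. exec (gen ?cT ?cP J es) (content (init_config x), head (init_config x)) (poly p ?X) s' \<and>
      fst s' 1 = word_tape (enc_nat (length ?k * J) @
       concat (map (\<lambda>t. colstr ?k (es (phase ?T t)) t) [0..<?T + 2]) @ [False])"
      unfolding init ex_def using s6(2) nl by (intro exI[of _ "conc s6"]) (simp add: conc_def wt)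
  qed auto
qed


section \<open>Computations as tilings\<close>

text \<open>A tile records, for one cell at one time, the state and the scanned symbols of the whole configuration, the
  symbols of the cell, which heads are at the cell, which heads move in from the left and from the right, and a kind:
  1 first column, 2 last column, 3 witness bit, 4 blank behind the witness, 0 otherwise.\<close>

datatype tile = Tile (tq: nat) (tss: "nat list") (tcs: "nat list") (ths: "bool list") (thl: "bool list")
  (thr: "bool list") (tk: nat)

text \<open>An additional initial state, in which the heads are at position \<open>- 1\<close>, makes the first step move all heads
  to the right.\<close>

definition xtrans :: "tm \<Rightarrow> nat \<Rightarrow> nat list \<Rightarrow> nat \<times> (nat \<times> move) list" where
  "xtrans M q ss = (if q = Suc (nstates M) then (0, map (\<lambda>s. (s, Move_Right)) ss)
     else if q = nstates M then (q, map (\<lambda>s. (s, Stay)) ss) else trans M q ss)"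

definition scanned :: "tm \<Rightarrow> config \<Rightarrow> nat list" where
  "scanned M c = map (\<lambda>i. content c i (head c i)) [0..<ntapes M]"

definition act :: "tm \<Rightarrow> config \<Rightarrow> nat \<Rightarrow> nat \<times> move" where
  "act M c i = snd (xtrans M (state c) (scanned M c)) ! i"

definition xstep :: "tm \<Rightarrow> config \<Rightarrow> config" where
  "xstep M c = \<lparr>state = fst (xtrans M (state c) (scanned M c)),
     content = (\<lambda>i. if i < ntapes M then (content c i)(head c i := fst (act M c i)) else content c i),
     head = (\<lambda>i. if i < ntapes M then head c i + shift (snd (act M c i)) else head c i)\<rparr>"

text \<open>An initial tile must know from the class of its column alone whether the heads are
  there. Starting the heads in the only column of class 3, outside the input, spares a separate
  class for a first input bit that also carries the heads.\<close>

definition pre_config :: "tm \<Rightarrow> bool list \<Rightarrow> config" where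
  "pre_config M w = \<lparr>state = Suc (nstates M), content = content (init_config w), head = (\<lambda>_. - 1)\<rparr>"

definition okcfg :: "tm \<Rightarrow> config \<Rightarrow> bool" where
  "okcfg M c \<longleftrightarrow> state c \<le> nstates M \<and> (\<forall>i<ntapes M. \<forall>z. content c i z < nsymbols M)"

definition agree :: "tm \<Rightarrow> config \<Rightarrow> config \<Rightarrow> bool" where
  "agree M c c' \<longleftrightarrow> state c = state c' \<and> (\<forall>i<ntapes M. content c i = content c' i \<and> head c i = head c' i)"

lemma scanned_wf: "\<forall>i<ntapes M. \<forall>z. content c i z < nsymbols M \<Longrightarrow> length (scanned M c) = ntapes M \<and> set (scanned M c) \<subseteq> {..<nsymbols M}"
  by (auto simp: scanned_def)

lemma xstep_ok:
  assumes wf: "wf_tm M" and c: "state c \<le> Suc (nstates M)" "\<forall>i<ntapes M. \<forall>z. content c i z < nsymbols M"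
  shows "okcfg M (xstep M c)"
proof -
  note sc = scanned_wf[OF c(2)]
  have "fst (xtrans M (state c) (scanned M c)) \<le> nstates M \<and> (\<forall>i<ntapes M. fst (act M c i) < nsymbols M)"
  proof (cases "state c < nstates M")
    case True
    then have "fst (trans M (state c) (scanned M c)) \<le> nstates M \<and> length (snd (trans M (state c) (scanned M c))) = ntapes M \<and>
        fst ` set (snd (trans M (state c) (scanned M c))) \<subseteq> {..<nsymbols M}"
      using wf sc unfolding wf_tm_def by blast
    moreover from this have "fst (snd (trans M (state c) (scanned M c)) ! i) < nsymbols M" if "i < ntapes M" for i
      using that nth_mem[of i "snd (tm.trans M (state c) (scanned M c))"] unfolding image_subset_iff by simp
    ultimately show ?thesis using True by (simp add: xtrans_def act_def)
  next
    case False
    then have "state c = nstates M \<or> state c = Suc (nstates M)" using c(1) by auto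
    then show ?thesis using sc c(2) by (auto simp: xtrans_def act_def scanned_def)
  qed
  then show ?thesis using c(2) by (auto simp: okcfg_def xstep_def)
qed

lemma agree_step:
  assumes "agree M c c'" "okcfg M c" shows "agree M (xstep M c) (step M c')"
proof -
  have eq: "content c i = content c' i" "head c i = head c' i" if "i < ntapes M" for i
    using assms(1) that by (simp_all add: agree_def)
  have sc: "scanned M c = map (\<lambda>i. content c' i (head c' i)) [0..<ntapes M]"
    unfolding scanned_def by (rule map_cong) (simp_all add: eq)
  have st: "state c = state c'" using assms(1) by (simp add: agree_def)
  show ?thesis
  proof (cases "state c' = nstates M")
    case True
    then have "act M c i = (content c' i (head c' i), Stay)" if "i < ntapes M" for i
      using that by (simp add: act_def xtrans_def sc st)
    then show ?thesis using True unfolding agree_def xstep_def step_def by (simp add: eq st xtrans_def)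
  next
    case False
    then have x: "xtrans M (state c') ss = trans M (state c') ss" for ss
      using assms(2) st by (simp add: xtrans_def okcfg_def)
    show ?thesis using False unfolding agree_def xstep_def step_def act_def sc
      by (simp add: eq st x Let_def case_prod_beta)
  qed
qed

lemma run_agree:
  fixes w :: "bool list"
  assumes wf: "wf_tm M"
  defines "c \<equiv> \<lambda>t. (xstep M ^^ t) (pre_config M w)"
  shows "okcfg M (c (Suc t)) \<and> agree M (c (Suc t)) ((step M ^^ t) (init_config w))"
proof (induction t)
  case 0
  have sy: "\<forall>i<ntapes M. \<forall>z. content (pre_config M w) i z < nsymbols M"
    using wf by (auto simp: pre_config_def init_config_def word_tape_def wf_tm_def)
  have "okcfg M (xstep M (pre_config M w))" by (rule xstep_ok[OF wf _ sy]) (simp add: pre_config_def)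
  moreover have "act M (pre_config M w) i = (content (init_config w) i (- 1), Move_Right)" if "i < ntapes M" for i
    using that by (simp add: act_def xtrans_def pre_config_def scanned_def)
  then have "agree M (xstep M (pre_config M w)) (init_config w)"
    by (simp add: agree_def xstep_def xtrans_def pre_config_def init_config_def)
  ultimately show ?case by (simp add: c_def)
next
  case (Suc t)
  have "c (Suc (Suc t)) = xstep M (c (Suc t))" by (simp add: c_def)
  moreover have "okcfg M (xstep M (c (Suc t)))"
    by (rule xstep_ok[OF wf]) (use Suc in \<open>simp_all add: okcfg_def\<close>)
  moreover have "agree M (xstep M (c (Suc t))) (step M ((step M ^^ t) (init_config w)))"
    using Suc by (intro agree_step) blast+
  ultimately show ?case by simp
qed

text \<open>The heads start in cell \<open>- 1\<close> and move by at most one cell per step. Hence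
  \<open>T\<close> blank columns on either side suffice for \<open>T\<close> steps.\<close>

lemma head_bound: "i < ntapes M \<Longrightarrow> \<bar>head ((xstep M ^^ t) (pre_config M w)) i + 1\<bar> \<le> int t"
proof (induction t)
  case (Suc t)
  have "\<bar>shift m\<bar> \<le> 1" for m by (cases m) auto
  from this[of "snd (act M ((xstep M ^^ t) (pre_config M w)) i)"] show ?case
    using Suc by (simp add: xstep_def[of M "(xstep M ^^ t) (pre_config M w)"])
qed (simp add: pre_config_def)

section \<open>Tiles and their local constraints\<close>

context
  fixes M :: tm
begin

text \<open>The scanned symbols in a tile are a guess about the whole configuration. The guess for a
  tape is verified in the one cell where its head stands, and equality along the row passes the
  result to all other cells. Kinds 1 and 2 forbid heads to enter across the outer borders.\<close>

definition tiles :: "tile set" where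
  "tiles = {\<tau>. tq \<tau> \<le> Suc (nstates M) \<and> length (tss \<tau>) = ntapes M \<and> set (tss \<tau>) \<subseteq> {..<nsymbols M} \<and>
     length (tcs \<tau>) = ntapes M \<and> set (tcs \<tau>) \<subseteq> {..<nsymbols M} \<and>
     length (ths \<tau>) = ntapes M \<and> length (thl \<tau>) = ntapes M \<and> length (thr \<tau>) = ntapes M \<and> tk \<tau> < 5 \<and>
     (\<forall>i<ntapes M. ths \<tau> ! i \<longrightarrow> tcs \<tau> ! i = tss \<tau> ! i) \<and>
     (tk \<tau> = 1 \<longrightarrow> (\<forall>i<ntapes M. \<not> thl \<tau> ! i)) \<and> (tk \<tau> = 2 \<longrightarrow> (\<forall>i<ntapes M. \<not> thr \<tau> ! i))}"

lemma finite_tiles: "finite tiles"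
proof -
  let ?A = "{xs :: nat list. set xs \<subseteq> {..<nsymbols M} \<and> length xs = ntapes M}"
  let ?B = "{xs :: bool list. set xs \<subseteq> UNIV \<and> length xs = ntapes M}"
  have f: "finite ?A" "finite ?B" by (intro finite_lists_length_eq, simp)+
  have "tiles \<subseteq> (\<lambda>(q, s, c, h, l, r, k). Tile q s c h l r k) ` ({..Suc (nstates M)} \<times> ?A \<times> ?A \<times> ?B \<times> ?B \<times> ?B \<times> {..<5})"
  proof
    fix \<tau> assume "\<tau> \<in> tiles"
    then show "\<tau> \<in> (\<lambda>(q, s, c, h, l, r, k). Tile q s c h l r k) ` ({..Suc (nstates M)} \<times> ?A \<times> ?A \<times> ?B \<times> ?B \<times> ?B \<times> {..<5})"
      by (intro image_eqI[of _ _ "(tq \<tau>, tss \<tau>, tcs \<tau>, ths \<tau>, thl \<tau>, thr \<tau>, tk \<tau>)"]) (simp_all add: tiles_def)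
  qed
  then show ?thesis by (rule finite_subset) (intro finite_imageI finite_cartesian_product f finite_atMost finite_lessThan)
qed

definition tact :: "tile \<Rightarrow> nat \<Rightarrow> nat \<times> move" where
  "tact \<tau> i = snd (xtrans M (tq \<tau>) (tss \<tau>)) ! i"

text \<open>Besides handing moving heads over to the neighbouring cell, the relation forbids a
  witness bit directly behind a blank. Therefore the guessed cells spell a word followed by
  blanks.\<close>

definition tH :: "tile \<Rightarrow> tile \<Rightarrow> bool" where
  "tH \<tau> \<tau>' \<longleftrightarrow> tss \<tau>' = tss \<tau> \<and> (\<forall>i<ntapes M. (thl \<tau>' ! i \<longleftrightarrow> ths \<tau> ! i \<and> snd (tact \<tau> i) = Move_Right) \<and>
      (thr \<tau> ! i \<longleftrightarrow> ths \<tau>' ! i \<and> snd (tact \<tau>' i) = Move_Left)) \<and> \<not> (tk \<tau> = 4 \<and> tk \<tau>' = 3)"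

definition tV :: "tile \<Rightarrow> tile \<Rightarrow> bool" where
  "tV \<tau> \<tau>' \<longleftrightarrow> tq \<tau>' = fst (xtrans M (tq \<tau>) (tss \<tau>)) \<and> tk \<tau>' = tk \<tau> \<and>
     (\<forall>i<ntapes M. tcs \<tau>' ! i = (if ths \<tau> ! i then fst (tact \<tau> i) else tcs \<tau> ! i) \<and>
       (ths \<tau>' ! i \<longleftrightarrow> thl \<tau> ! i \<or> thr \<tau> ! i \<or> ths \<tau> ! i \<and> snd (tact \<tau> i) = Stay))"

definition tIni :: "nat \<Rightarrow> tile \<Rightarrow> bool" where
  "tIni a \<tau> \<longleftrightarrow> tq \<tau> = Suc (nstates M) \<and> (\<forall>i<ntapes M. ths \<tau> ! i \<longleftrightarrow> a = 3) \<and>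
     (\<forall>i<ntapes M. 0 < i \<longrightarrow> tcs \<tau> ! i = 0) \<and>
     (if a = 6 then tk \<tau> = 3 \<and> tcs \<tau> ! 0 \<in> {1, 2} \<or> tk \<tau> = 4 \<and> tcs \<tau> ! 0 = 0
      else tk \<tau> = (if a = 1 then 1 else if a = 7 then 2 else 0) \<and>
        tcs \<tau> ! 0 = (if a = 4 then 1 else if a = 5 then 2 else 0))"

text \<open>The verifier outputs \<open>[True]\<close> or \<open>[False]\<close>, so acceptance
  amounts to the absence of the symbol 1 on the output tape. Every cell can check this on its
  own.\<close>

definition tAcc :: "tile \<Rightarrow> bool" where
  "tAcc \<tau> \<longleftrightarrow> tq \<tau> = nstates M \<and> tcs \<tau> ! 1 \<noteq> 1"

definition tiled :: "nat list \<Rightarrow> nat \<Rightarrow> (nat \<Rightarrow> nat \<Rightarrow> tile) \<Rightarrow> bool" where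
  "tiled \<kappa> N \<tau> \<longleftrightarrow> (\<forall>t\<le>N. \<forall>p<length \<kappa>. \<tau> t p \<in> tiles) \<and> (\<forall>p<length \<kappa>. tIni (\<kappa> ! p) (\<tau> 0 p)) \<and>
     (\<forall>t<N. \<forall>p. Suc p < length \<kappa> \<longrightarrow> tH (\<tau> t p) (\<tau> t (Suc p))) \<and>
     (\<forall>t<N. \<forall>p<length \<kappa>. tV (\<tau> t p) (\<tau> (Suc t) p)) \<and> (\<forall>p<length \<kappa>. tAcc (\<tau> N p))"

end

section \<open>Tilings versus accepting runs of the verifier\<close>

definition clas :: "nat \<Rightarrow> nat \<Rightarrow> bool list \<Rightarrow> nat list" where
  "clas T P y = [1] @ replicate T 2 @ [3] @ map (\<lambda>b. if b then 5 else 4) y @ replicate P 6 @ replicate T 2 @ [7]"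

lemma clas_nth:
  assumes "p < 2 * T + P + length y + 3"
  shows "clas T P y ! p = (if p = 0 then 1 else if p \<le> T then 2 else if p = T + 1 then 3
    else if p < T + 2 + length y then (if y ! (p - (T + 2)) then 5 else 4)
    else if p < T + 2 + length y + P then 6 else if p < 2 * T + 2 + length y + P then 2 else 7)"
proof -
  consider "p = 0" | "0 < p" "p \<le> T" | "p = T + 1" | "T + 2 \<le> p" "p < T + 2 + length y"
    | "T + 2 + length y \<le> p" "p < T + 2 + length y + P"
    | "T + 2 + length y + P \<le> p" "p < 2 * T + 2 + length y + P" | "p = 2 * T + 2 + length y + P"
    using assms by atomize_elim arith
  then show ?thesis
  proof cases
    case 2
    then have "p = Suc (p - 1)" by simp
    then show ?thesis using 2 by (simp add: clas_def nth_append nth_Cons')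
  next
    case 4
    then obtain j where "p = T + 2 + j" using le_Suc_ex by blast
    then show ?thesis using 4 by (simp add: clas_def nth_append)
  next
    case 5
    then obtain j where "p = T + 2 + length y + j" using le_Suc_ex by blast
    then show ?thesis using 5 by (simp add: clas_def nth_append)
  next
    case 6
    then obtain j where "p = T + 2 + length y + P + j" using le_Suc_ex by blast
    then show ?thesis using 6 by (simp add: clas_def nth_append)
  qed (simp_all add: clas_def nth_append)
qed

lemma length_clas: "length (clas T P y) = 2 * T + P + length y + 3"
  by (simp add: clas_def)

text \<open>The tiling is read off the run. Its first step is the additional one that brings the
  heads to cell 0, which leaves \<open>T - 1\<close> steps for the machine.\<close>

lemma tiled_complete:
  assumes wf: "wf_tm M" and w: "length w \<le> P" and T: "0 < T"
    and acc: "state ((step M ^^ (T - 1)) (init_config (y @ w))) = nstates M"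
      "\<forall>z. content ((step M ^^ (T - 1)) (init_config (y @ w))) 1 z \<noteq> 1"
  shows "\<exists>\<tau>. tiled M (clas T P y) T \<tau>"
proof -
  define c where "c t = (xstep M ^^ t) (pre_config M (y @ w))" for t
  \<comment> \<open>Column \<open>p\<close> stands for cell \<open>p - off\<close>: the column of
    class 3 has index \<open>T + 1\<close> and is cell \<open>- 1\<close>, so the input starts in
    cell 0.\<close>
  define off where "off = int T + 2"
  let ?n = "ntapes M"
  let ?N = "length (clas T P y)"
  define kd where "kd p = (if p = 0 then 1 else if Suc p = ?N then 2
      else if T + 2 + length y \<le> p \<and> p < T + 2 + length y + P then (if p < T + 2 + length y + length w then 3 else 4) else 0 :: nat)" for p
  define \<tau> where "\<tau> t p = Tile (state (c t)) (scanned M (c t)) (map (\<lambda>i. content (c t) i (int p - off)) [0..<?n])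
     (map (\<lambda>i. head (c t) i = int p - off) [0..<?n])
     (map (\<lambda>i. head (c t) i = int p - off - 1 \<and> snd (act M (c t) i) = Move_Right) [0..<?n])
     (map (\<lambda>i. head (c t) i = int p - off + 1 \<and> snd (act M (c t) i) = Move_Left) [0..<?n]) (kd p)" for t p
  have ta: "tact M (\<tau> t p) i = act M (c t) i" for t p i by (simp add: tact_def \<tau>_def act_def)
  have hb: "\<bar>head (c t) i + 1\<bar> \<le> int t" if "i < ?n" for t i using head_bound[OF that] by (simp add: c_def)
  have ok: "okcfg M (c (Suc t))" "agree M (c (Suc t)) ((step M ^^ t) (init_config (y @ w)))" for t
    using run_agree[OF wf, where w = "y @ w"] by (auto simp: c_def)
  have "(\<forall>i<?n. \<forall>z. content (c t) i z < nsymbols M) \<and> state (c t) \<le> Suc (nstates M)" for t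
  proof (cases t)
    case 0
    then show ?thesis using wf by (auto simp: c_def pre_config_def init_config_def word_tape_def wf_tm_def)
  next
    case (Suc s)
    then show ?thesis using ok(1)[of s] by (auto simp: okcfg_def)
  qed
  then have sy: "\<forall>i<?n. \<forall>z. content (c t) i z < nsymbols M" "state (c t) \<le> Suc (nstates M)" for t by blast+
  have len: "?N = 2 * T + P + length y + 3" by (rule length_clas)
  have kd5: "kd p < 5" "kd p = 1 \<longleftrightarrow> p = 0" for p by (auto simp: kd_def len)
  have kd2: "kd p = 2 \<Longrightarrow> Suc p = ?N" for p by (auto simp: kd_def split: if_splits)
  have "\<tau> t p \<in> tiles M" if "t \<le> T" "p < ?N" for t p
  proof -
    have "\<not> head (c t) i = int p - off - 1" if "p = 0" "i < ?n" for i
      using hb[OF that(2), of t] that(1) \<open>t \<le> T\<close> by (auto simp: off_def)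
    moreover have "\<not> head (c t) i = int p - off + 1" if "Suc p = ?N" "i < ?n" for i
      using hb[OF that(2), of t] that(1) \<open>t \<le> T\<close> by (auto simp: off_def len)
    ultimately show ?thesis
      using sy(2)[of t] sy(1)[of t, rule_format] kd5[of p] kd2[of p]
      by (simp add: tiles_def \<tau>_def scanned_def image_subset_iff)
  qed
  moreover have "tIni M (clas T P y ! p) (\<tau> 0 p)" if p: "p < ?N" for p
  proof -
    have c0: "state (c 0) = Suc (nstates M)" "head (c 0) i = - 1"
      "content (c 0) i = word_tape (if i = 0 then y @ w else [])" for i
      by (auto simp: c_def pre_config_def init_config_def)
    have n0: "0 < ?n" using wf by (auto simp: wf_tm_def)
    note nth = clas_nth[OF p[unfolded len]]
    have hd: "(- 1 = int p - off) \<longleftrightarrow> clas T P y ! p = 3" unfolding nth using p len by (auto simp: off_def)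
    have w0: "word_tape [] z = 0" for z by (simp add: word_tape_def)
    have cell: "word_tape (y @ w) (int p - off) = (if T + 2 \<le> p \<and> p < T + 2 + length y + length w
        then if (y @ w) ! (p - (T + 2)) then 2 else 1 else 0)"
      unfolding word_tape_def off_def by (auto simp: nat_diff_distrib' of_nat_diff nat_add_distrib)
    have "if clas T P y ! p = 6 then kd p = 3 \<and> word_tape (y @ w) (int p - off) \<in> {1, 2} \<or> kd p = 4 \<and> word_tape (y @ w) (int p - off) = 0
      else kd p = (if clas T P y ! p = 1 then 1 else if clas T P y ! p = 7 then 2 else 0) \<and>
        word_tape (y @ w) (int p - off) = (if clas T P y ! p = 4 then 1 else if clas T P y ! p = 5 then 2 else 0)"
      unfolding nth cell kd_def using p w unfolding len by (auto simp: nth_append)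
    then show ?thesis using c0 n0 hd w0 by (auto simp: tIni_def \<tau>_def)
  qed
  moreover have "tH M (\<tau> t p) (\<tau> t (Suc p))" if "t < T" "Suc p < ?N" for t p
  proof -
    have "\<not> (kd p = 4 \<and> kd (Suc p) = 3)" by (auto simp: kd_def split: if_splits)
    then show ?thesis unfolding tH_def ta by (auto simp: \<tau>_def off_def)
  qed
  moreover have "tV M (\<tau> t p) (\<tau> (Suc t) p)" if "t < T" "p < ?N" for t p
  proof -
    have cS: "c (Suc t) = xstep M (c t)" by (simp add: c_def)
    have hd: "(head (c t) i + shift m = z) \<longleftrightarrow> (head (c t) i = z - 1 \<and> m = Move_Right) \<or> (head (c t) i = z + 1 \<and> m = Move_Left)
        \<or> (head (c t) i = z \<and> m = Stay)" for i m z by (cases m) auto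
    show ?thesis unfolding tV_def ta
      by (auto simp: \<tau>_def cS xstep_def hd scanned_def)
  qed
  moreover have "tAcc M (\<tau> T p)" for p
  proof -
    have "1 < ?n" using wf by (auto simp: wf_tm_def)
    moreover have "c T = c (Suc (T - 1))" using T by simp
    ultimately show ?thesis using ok(2)[of "T - 1"] acc by (auto simp: tAcc_def \<tau>_def agree_def)
  qed
  ultimately show ?thesis unfolding tiled_def by blast
qed

text \<open>The witness is read off the first row; afterwards the rows are forced to follow the
  configurations, as only the guessed scanned symbols leave a choice and these are verified under
  the heads.\<close>

lemma tiled_sound:
  assumes wf: "wf_tm M" and T: "0 < T" and \<tau>: "tiled M (clas T P y) T \<tau>"
  shows "\<exists>w. length w \<le> P \<and> state ((step M ^^ (T - 1)) (init_config (y @ w))) = nstates M \<and>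
     (\<forall>z. 0 \<le> z \<and> z \<le> int (length y) \<longrightarrow> content ((step M ^^ (T - 1)) (init_config (y @ w))) 1 z \<noteq> 1)"
proof -
  let ?n = "ntapes M" and ?N = "length (clas T P y)"
  have n: "0 < ?n" "1 < ?n" using wf by (auto simp: wf_tm_def)
  have len: "?N = 2 * T + P + length y + 3" by (rule length_clas)
  define off where "off = int T + 2"
  have til: "\<And>t p. t \<le> T \<Longrightarrow> p < ?N \<Longrightarrow> \<tau> t p \<in> tiles M" and ini: "\<And>p. p < ?N \<Longrightarrow> tIni M (clas T P y ! p) (\<tau> 0 p)"
    and H: "\<And>t p. t < T \<Longrightarrow> Suc p < ?N \<Longrightarrow> tH M (\<tau> t p) (\<tau> t (Suc p))"
    and V: "\<And>t p. t < T \<Longrightarrow> p < ?N \<Longrightarrow> tV M (\<tau> t p) (\<tau> (Suc t) p)" and A: "\<And>p. p < ?N \<Longrightarrow> tAcc M (\<tau> T p)"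
    using \<tau> unfolding tiled_def by blast+
  let ?b = "T + 2 + length y"
  have free: "tk (\<tau> 0 (?b + f)) = 3 \<and> tcs (\<tau> 0 (?b + f)) ! 0 \<in> {1, 2} \<or> tk (\<tau> 0 (?b + f)) = 4 \<and> tcs (\<tau> 0 (?b + f)) ! 0 = 0" if "f < P" for f
  proof -
    have p: "?b + f < ?N" using that len by simp
    have "clas T P y ! (?b + f) = 6" using clas_nth[of "?b + f" T P y] that by simp
    then show ?thesis using ini[OF p] by (simp add: tIni_def)
  qed
  \<comment> \<open>The length of the witness is the number of guessed cells before the first blank.
    The alternative \<open>f = P\<close> covers a witness without blanks behind it.\<close>
  define l where "l = (LEAST f. f = P \<or> tk (\<tau> 0 (?b + f)) = 4)"
  have l: "l = P \<or> tk (\<tau> 0 (?b + l)) = 4" unfolding l_def by (rule LeastI[of _ P]) simp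
  have lP: "l \<le> P" unfolding l_def by (rule Least_le) simp
  have l3: "tk (\<tau> 0 (?b + f)) = 3" if "f < l" for f
    using not_less_Least[of f "\<lambda>f. f = P \<or> tk (\<tau> 0 (?b + f)) = 4"] that free[of f] lP unfolding l_def[symmetric] by auto
  have l4: "tk (\<tau> 0 (?b + (l + f))) = 4" if "l + f < P" for f
    using that
  proof (induction f)
    case 0
    then show ?case using l by auto
  next
    case (Suc f)
    have "tH M (\<tau> 0 (?b + (l + f))) (\<tau> 0 (Suc (?b + (l + f))))" by (rule H) (use T Suc.prems len in auto)
    then have "tk (\<tau> 0 (?b + (l + Suc f))) \<noteq> 3" using Suc by (auto simp: tH_def)
    then show ?case using free[OF Suc.prems] by blast
  qed
  define w where "w = map (\<lambda>f. tcs (\<tau> 0 (?b + f)) ! 0 = 2) [0..<l]"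
  have lw: "length w = l" by (simp add: w_def)
  define c where "c t = (xstep M ^^ t) (pre_config M (y @ w))" for t
  have hb: "\<bar>head (c t) i + 1\<bar> \<le> int t" if "i < ?n" for t i using head_bound[OF that] by (simp add: c_def)
  define mat where "mat t \<longleftrightarrow> (\<forall>p<?N. tq (\<tau> t p) = state (c t) \<and> (\<forall>i<?n. tcs (\<tau> t p) ! i = content (c t) i (int p - off) \<and>
      (ths (\<tau> t p) ! i \<longleftrightarrow> head (c t) i = int p - off)))" for t
  have kind: "tk (\<tau> t p) = tk (\<tau> 0 p)" if "t \<le> T" "p < ?N" for t p
    using that
  proof (induction t)
    case (Suc t)
    then show ?case using V[of t p] by (simp add: tV_def)
  qed simp
  have "mat 0" unfolding mat_def
  proof (intro allI impI)
    fix p assume p: "p < ?N"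
    have c0: "state (c 0) = Suc (nstates M)" "head (c 0) i = - 1"
      "content (c 0) i = word_tape (if i = 0 then y @ w else [])" for i
      by (auto simp: c_def pre_config_def init_config_def)
    note I = ini[OF p, unfolded tIni_def] and nth = clas_nth[OF p[unfolded len]]
    have hd: "(- 1 = int p - off) \<longleftrightarrow> clas T P y ! p = 3" unfolding nth using p len by (auto simp: off_def)
    have w0: "word_tape [] z = 0" for z by (simp add: word_tape_def)
    have cell: "word_tape (y @ w) (int p - off) = (if T + 2 \<le> p \<and> p < T + 2 + length y + length w
        then if (y @ w) ! (p - (T + 2)) then 2 else 1 else 0)"
      unfolding word_tape_def off_def by (auto simp: nat_diff_distrib' of_nat_diff nat_add_distrib)
    have "tcs (\<tau> 0 p) ! 0 = word_tape (y @ w) (int p - off)"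
    proof (cases "?b \<le> p \<and> p < ?b + P")
      case False
      then have "clas T P y ! p \<noteq> 6" unfolding nth by simp
      then have tc: "tcs (\<tau> 0 p) ! 0 = (if clas T P y ! p = 4 then 1 else if clas T P y ! p = 5 then 2 else 0)"
        using I by simp
      consider "p < T + 2" | "T + 2 \<le> p" "p < T + 2 + length y" | "T + 2 + length y + P \<le> p"
        using False by linarith
      then show ?thesis
      proof cases
        case 1
        then show ?thesis unfolding tc cell nth by simp
      next
        case 2
        then show ?thesis unfolding tc cell nth by (simp add: nth_append) linarith
      next
        case 3
        then show ?thesis unfolding tc cell nth lw using lP by simp
      qed
    next
      case True
      define f where "f = p - ?b"
      have f: "p = ?b + f" "f < P" using True by (auto simp: f_def)
      show ?thesis
      proof (cases "f < l")
        case True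
        then have "tk (\<tau> 0 p) = 3" using l3 f by simp
        then have "tcs (\<tau> 0 p) ! 0 \<in> {1, 2}" using free[OF f(2)] f(1) by auto
        moreover have "(y @ w) ! (p - (T + 2)) \<longleftrightarrow> tcs (\<tau> 0 p) ! 0 = 2" using True f by (simp add: nth_append w_def)
        ultimately show ?thesis unfolding cell lw using True f by auto
      next
        case False
        then have "tk (\<tau> 0 p) = 4" using l4[of "f - l"] f by simp
        then have "tcs (\<tau> 0 p) ! 0 = 0" using free[OF f(2)] f(1) by auto
        then show ?thesis unfolding cell lw using False f by auto
      qed
    qed
    then show "tq (\<tau> 0 p) = state (c 0) \<and> (\<forall>i<?n. tcs (\<tau> 0 p) ! i = content (c 0) i (int p - off) \<and>
      (ths (\<tau> 0 p) ! i \<longleftrightarrow> head (c 0) i = int p - off))"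
      using I hd w0 unfolding c0 by auto
  qed
  moreover have "mat (Suc t)" if m: "mat t" and t: "t < T" for t
  proof -
    have ss0: "tss (\<tau> t p) = tss (\<tau> t 0)" if "p < ?N" for p
      using that
    proof (induction p)
      case (Suc p)
      then show ?case using H[OF t, of p] by (simp add: tH_def)
    qed simp
    have ss: "tss (\<tau> t 0) = scanned M (c t)"
    proof (rule nth_equalityI)
      have "\<tau> t 0 \<in> tiles M" using til[of t 0] t len by simp
      then show l: "length (tss (\<tau> t 0)) = length (scanned M (c t))" by (simp add: tiles_def scanned_def)
      fix i assume "i < length (tss (\<tau> t 0))"
      then have i: "i < ?n" using l by (simp add: scanned_def)
      \<comment> \<open>This is the column under head \<open>i\<close>, which lies in the grid by
        \<open>head_bound\<close>. Its tile must carry the true scanned symbol, and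
        \<open>ss0\<close> transports that symbol to column 0.\<close>
      define p where "p = nat (head (c t) i + off)"
      have p: "int p - off = head (c t) i" "p < ?N" using hb[OF i, of t] t by (auto simp: p_def off_def len)
      then have "ths (\<tau> t p) ! i" "tcs (\<tau> t p) ! i = content (c t) i (head (c t) i)" using m i unfolding mat_def by auto
      moreover have "\<tau> t p \<in> tiles M" using til t p by simp
      ultimately have "tss (\<tau> t p) ! i = content (c t) i (head (c t) i)" using i by (auto simp: tiles_def)
      then show "tss (\<tau> t 0) ! i = scanned M (c t) ! i" using ss0[OF p(2)] i by (simp add: scanned_def)
    qed
    have ta: "tact M (\<tau> t p) i = act M (c t) i" "tq (\<tau> t p) = state (c t)" if "p < ?N" for p i
      using m ss ss0 that unfolding mat_def tact_def act_def by auto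
    have cS: "c (Suc t) = xstep M (c t)" by (simp add: c_def)
    show ?thesis unfolding mat_def
    proof (intro allI impI conjI)
      fix p assume p: "p < ?N"
      note Vp = V[OF t p, unfolded tV_def]
      show "tq (\<tau> (Suc t) p) = state (c (Suc t))" using Vp ta(2)[OF p] ss ss0[OF p] by (simp add: cS xstep_def)
      fix i assume i: "i < ?n"
      have mp: "tcs (\<tau> t p) ! i = content (c t) i (int p - off)" "ths (\<tau> t p) ! i \<longleftrightarrow> head (c t) i = int p - off"
        using m p i unfolding mat_def by auto
      show "tcs (\<tau> (Suc t) p) ! i = content (c (Suc t)) i (int p - off)"
        using Vp mp i ta(1)[OF p] by (auto simp: cS xstep_def)
      have hl: "thl (\<tau> t p) ! i \<longleftrightarrow> head (c t) i = int p - off - 1 \<and> snd (act M (c t) i) = Move_Right"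
      proof (cases p)
        case 0
        then have "tk (\<tau> 0 p) = 1" using ini[OF p] clas_nth[of 0 T P y] by (simp add: tIni_def)
        then have "\<not> thl (\<tau> t p) ! i" using til[of t p] kind[of t p] t p i by (simp add: tiles_def)
        moreover have "head (c t) i \<noteq> int p - off - 1" using hb[OF i, of t] t 0 by (auto simp: off_def)
        ultimately show ?thesis by simp
      next
        case (Suc q)
        then have "thl (\<tau> t p) ! i \<longleftrightarrow> ths (\<tau> t q) ! i \<and> snd (tact M (\<tau> t q) i) = Move_Right"
          using H[OF t, of q] p i by (simp add: tH_def)
        moreover have "ths (\<tau> t q) ! i \<longleftrightarrow> head (c t) i = int q - off" using m i p Suc unfolding mat_def by auto
        ultimately show ?thesis using ta(1)[of q i] p Suc by auto
      qed
      have hr: "thr (\<tau> t p) ! i \<longleftrightarrow> head (c t) i = int p - off + 1 \<and> snd (act M (c t) i) = Move_Left"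
      proof (cases "Suc p = ?N")
        case True
        then have "tk (\<tau> 0 p) = 2" using ini[OF p] clas_nth[of p T P y] len by (simp add: tIni_def split: if_splits)
        then have "\<not> thr (\<tau> t p) ! i" using til[of t p] kind[of t p] t p i by (simp add: tiles_def)
        moreover have "head (c t) i \<noteq> int p - off + 1" using hb[OF i, of t] t True len by (auto simp: off_def)
        ultimately show ?thesis by simp
      next
        case False
        then have q: "Suc p < ?N" using p by simp
        then have "thr (\<tau> t p) ! i \<longleftrightarrow> ths (\<tau> t (Suc p)) ! i \<and> snd (tact M (\<tau> t (Suc p)) i) = Move_Left"
          using H[OF t q] i by (simp add: tH_def)
        moreover have "ths (\<tau> t (Suc p)) ! i \<longleftrightarrow> head (c t) i = int (Suc p) - off" using m i q unfolding mat_def by auto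
        ultimately show ?thesis using ta(1)[OF q, of i] by auto
      qed
      have hd: "(head (c t) i + shift mm = z) \<longleftrightarrow> (head (c t) i = z - 1 \<and> mm = Move_Right) \<or> (head (c t) i = z + 1 \<and> mm = Move_Left)
        \<or> (head (c t) i = z \<and> mm = Stay)" for mm z by (cases mm) auto
      show "ths (\<tau> (Suc t) p) ! i \<longleftrightarrow> head (c (Suc t)) i = int p - off"
        using Vp i hl hr mp(2) ta(1)[OF p] by (simp add: cS xstep_def hd)
    qed
  qed
  ultimately have "mat t" if "t \<le> T" for t using that by (induction t) auto
  from this[of T] have mT: "mat T" by simp
  have ag: "agree M (c T) ((step M ^^ (T - 1)) (init_config (y @ w)))"
    using run_agree[OF wf, where w = "y @ w" and t = "T - 1"] T by (simp add: c_def)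
  have "state (c T) = nstates M" using mT A[of 0] len unfolding mat_def by (auto simp: tAcc_def)
  moreover have "content (c T) 1 z \<noteq> 1" if "0 \<le> z" "z \<le> int (length y)" for z
  proof -
    define p where "p = nat (z + off)"
    have p: "int p - off = z" "p < ?N" using that T by (auto simp: p_def off_def len)
    then show ?thesis using mT A[of p] n unfolding mat_def tAcc_def by force
  qed
  ultimately show ?thesis using ag n lw lP by (intro exI[of _ w]) (auto simp: agree_def)
qed


section \<open>The reduction\<close>

lemma bits_double: "0 < m \<Longrightarrow> bits_of_nat (2 * m + of_bool b) = b # bits_of_nat m"
  by (subst bits_of_nat.simps) (cases b; simp)

lemma bits_shift: "0 < m \<Longrightarrow> bits_of_nat (2 ^ t * m) = replicate t False @ bits_of_nat m"
proof (induction t)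
  case (Suc t)
  then show ?case using bits_double[of "2 ^ t * m" False] by (simp add: mult.assoc)
qed simp

lemma oh_Suc: "oh (Suc L) (Suc j) = False # oh L j" "oh (Suc L) 0 = True # replicate L False"
  by (auto simp: oh_def upt_conv_Cons map_Suc_upt[symmetric] comp_def map_replicate_const simp del: upt_Suc)

text \<open>Words have the least significant bit first, so a power of two below \<open>2 ^ L\<close>
  appears as a one-hot field of width \<open>L\<close> in front of the bits of
  \<open>m\<close>.\<close>

lemma bits_oh: "0 < m \<Longrightarrow> j < L \<Longrightarrow> bits_of_nat (2 ^ j + 2 ^ L * m) = oh L j @ bits_of_nat m"
proof (induction L arbitrary: j)
  case (Suc L)
  show ?case
  proof (cases j)
    case 0
    have "(2::nat) ^ j + 2 ^ Suc L * m = 2 * (2 ^ L * m) + of_bool True" using 0 by simp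
    then show ?thesis using 0 Suc.prems bits_double[of "2 ^ L * m" True] by (simp only: oh_Suc bits_shift) simp
  next
    case (Suc i)
    have "(2::nat) ^ j + 2 ^ Suc L * m = 2 * (2 ^ i + 2 ^ L * m) + of_bool False" using Suc by simp
    then show ?thesis using Suc Suc.prems Suc.IH[of i] bits_double[of "2 ^ i + 2 ^ L * m" False]
      by (simp only: oh_Suc) simp
  qed
qed simp

lemma rev_oh: "j < L \<Longrightarrow> rev (oh L j) = oh L (L - 1 - j)"
  by (rule nth_equalityI) (auto simp: oh_def rev_nth)

text \<open>The constant tail consists of the terminator of the numerator, the sign of the
  denominator 1, its only bit with its marker, and its terminator.\<close>

lemma enc_rat_of_nat: "enc_rat (of_nat m) = False # dbl (bits_of_nat m) @ [False, False, True, True, False]"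
proof -
  have "quotient_of (of_nat m) = (int m, 1)" using quotient_of_int[of "int m"] by (simp add: of_rat_of_nat_eq)
  moreover have "bits_of_nat 1 = [True]" by (simp add: bits_of_nat.simps)
  ultimately show ?thesis by (simp add: enc_rat_def enc_int_def enc_nat_def enc_word_def dbl_def)
qed

lemma concat_map_concat: "concat (map f (concat xss)) = concat (map (\<lambda>xs. concat (map f xs)) xss)"
  by (induction xss) auto

lemma concat_map_product: "concat (map f (List.product xs ys)) = concat (map (\<lambda>x. concat (map (\<lambda>y. f (x, y)) ys)) xs)"
  by (induction xs) (auto simp: comp_def)

text \<open>The low field stays below \<open>2 ^ L\<close>, so the high part decides first: one-hot
  fields are compared lexicographically, the most significant field first.\<close>

lemma pow_lex_less: "x < L \<Longrightarrow> u < u' \<or> u = u' \<and> x < x' \<Longrightarrow> (2::nat) ^ x + 2 ^ L * u < 2 ^ x' + 2 ^ L * u'"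
proof -
  assume x: "x < L" and *: "u < u' \<or> u = u' \<and> x < x'"
  from * show ?thesis
  proof
    assume "u < u'"
    then have "(2::nat) ^ L * Suc u \<le> 2 ^ L * u'" by (intro mult_le_mono2) simp
    moreover have "(2::nat) ^ x < 2 ^ L" using x by simp
    ultimately show ?thesis unfolding mult_Suc_right by linarith
  qed simp
qed

lemma div_mod_less: "(i::nat) < i' \<Longrightarrow> i div J < i' div J \<or> i div J = i' div J \<and> i mod J < i' mod J"
proof -
  assume "i < i'"
  then have "i div J \<le> i' div J" by (simp add: div_le_mono)
  moreover have "i mod J < i' mod J" if "i div J = i' div J"
    using \<open>i < i'\<close> that div_mult_mod_eq[of i J] div_mult_mod_eq[of i' J] by (metis nat_add_left_cancel_less)
  ultimately show ?thesis by linarith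
qed

lemma col_div_mod: "(j::nat) < J \<Longrightarrow> (p * J + j) div J = p" "j < J \<Longrightarrow> (p * J + j) mod J = j"
  by simp_all

text \<open>Only the data fixed by the verifier enter here, not the input. This makes the emitted
  lists constants of the generator.\<close>

locale op_programs =
  fixes d C :: nat and wI :: "nat \<Rightarrow> (opk \<times> nat) list" and wH wV wF :: "(opk \<times> nat) list"
begin

definition J :: nat where "J = 8 * d + 4"

definition col_op :: "nat \<Rightarrow> nat \<Rightarrow> nat \<Rightarrow> nat \<Rightarrow> opk" where
  "col_op ph a c j = op_table d C (wI a) wH wV wF ph (a = 1) (a = 7) c j"

text \<open>The operation at the preceding position; only the horizontal windows reach across the border of a column.\<close>

definition prev_op :: "nat \<Rightarrow> nat \<Rightarrow> nat \<Rightarrow> nat \<Rightarrow> opk" where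
  "prev_op ph a c j = (if 0 < j then col_op ph a c (j - 1)
     else if ph = 1 \<and> c < length wH \<and> a \<noteq> 1 then lookup_op wH c (4 * d + 1) else Nop)"

text \<open>\<open>endpos\<close> in coordinates local to a column: the first component is 0, 1 or 2
  for the preceding, the same or the next column, the second is the position in that column. Parity
  of the round appears as parity of \<open>c\<close>, because the block length \<open>C\<close> will
  be even.\<close>

definition target :: "nat \<Rightarrow> nat \<Rightarrow> nat \<Rightarrow> nat \<Rightarrow> nat \<times> nat" where
  "target ph a c j =
    (if col_op ph a c j = Test \<or> col_op ph a c j = Free \<and> even c then if Suc j < J then (1, Suc j) else (2, 0)
     else if col_op ph a c j = Nop \<and> (prev_op ph a c j = Test \<or> prev_op ph a c j = Free \<and> odd c)
       then if 0 < j then (1, j - 1) else (0, J - 1)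
     else (1, j))"

text \<open>If the next round is odd, that is if \<open>c\<close> is even, slots run backwards; then
  the column field is reversed and the position is reflected. In round 0 the reversal in
  \<open>endpos\<close> and the one in \<open>slot\<close> cancel.\<close>

definition end_slot :: "nat \<Rightarrow> nat \<Rightarrow> nat \<Rightarrow> nat \<Rightarrow> nat \<times> bool \<times> nat" where
  "end_slot ph a c j = (if ph = 0 \<and> c = 0 then (1, True, j)
     else (fst (target ph a c j), odd c, if odd c then snd (target ph a c j) else J - 1 - snd (target ph a c j)))"

text \<open>The code of one endpoint, field by field in the order of its bits. The additional zeros
  \<open>dt\<close> serve ends that fall into the next block, whose number is one larger.\<close>

definition coord :: "nat \<Rightarrow> nat \<Rightarrow> nat \<Rightarrow> bool \<Rightarrow> nat \<Rightarrow> bool \<Rightarrow> em list" where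
  "coord dt c \<delta> fwd j s = [EStr (False # dbl (s # oh J j)), EG \<delta> fwd, EStr (dbl (oh C c @ replicate dt False)), ET,
     EStr (dbl [True] @ [False, False, True, True, False])]"

definition piece_ems :: "nat \<Rightarrow> nat \<Rightarrow> nat \<Rightarrow> nat \<Rightarrow> em list" where
  "piece_ems ph a c j = EStr [True] # coord 0 c 1 (even c) (if even c then j else J - 1 - j) True @
     (case end_slot ph a c j of (\<delta>, fwd, j') \<Rightarrow>
       coord (if Suc c < C then 0 else 1) (if Suc c < C then Suc c else 0) \<delta> fwd j' False) @ [EStr [odd c]]"

definition ems :: "nat \<Rightarrow> nat \<Rightarrow> em list" where
  "ems ph a = concat (map (\<lambda>c. concat (map (piece_ems ph a c) [0..<J])) [0..<C])"

lemma ems_ok: "\<forall>e \<in> set (ems ph a). em_ok e"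
proof -
  have "fst (end_slot ph a c j) < 3" for c j by (simp add: end_slot_def target_def)
  then have "\<forall>e \<in> set (piece_ems ph a c j). em_ok e" for c j
    by (simp add: piece_ems_def coord_def case_prod_beta)
  then show ?thesis unfolding ems_def by simp
qed

end

locale tiling_instance = op_programs d C wI wH wV wF
  for d C :: nat and wI :: "nat \<Rightarrow> (opk \<times> nat) list" and wH wV wF :: "(opk \<times> nat) list" +
  fixes N :: nat and \<kappa> :: "nat list" and H V :: "nat \<Rightarrow> nat \<Rightarrow> bool" and Ini :: "nat \<Rightarrow> nat \<Rightarrow> bool" and Acc :: "nat \<Rightarrow> bool"
  assumes d: "0 < d" and n: "2 \<le> length \<kappa>" and C: "2 \<le> C" "even C"
    and first: "\<And>p. p < length \<kappa> \<Longrightarrow> \<kappa> ! p = 1 \<longleftrightarrow> p = 0"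
    and last: "\<And>p. p < length \<kappa> \<Longrightarrow> \<kappa> ! p = 7 \<longleftrightarrow> p = length \<kappa> - 1"
    and wI: "\<And>a. init_ok d (Ini a) (wI a) \<and> length (wI a) = C - 1"
    and wH: "window_ok d (\<lambda>a b x y. x = a \<and> y = b \<and> H a b) wH"
    and wV: "window_ok d (\<lambda>a b x y. a = b \<and> x = y \<and> V a x) wV" "length wH + length wV = C"
    and wF: "final_ok d Acc wF" "length wF = C - 1"
begin

abbreviation n :: nat where "n \<equiv> length \<kappa>"

sublocale til: tiling d n N C H V "\<lambda>p. Ini (\<kappa> ! p)" Acc "\<lambda>p. wI (\<kappa> ! p)" wH wV wF
  by unfold_locales (use d n C wI wH wV wF in auto)

lemma til_J: "til.J = J" by (simp add: til.J_def J_def)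

lemma J_pos: "0 < J" by (simp add: J_def)

lemma ops_eq:
  assumes "c < C" "p < n" "j < J"
  shows "til.ops (t * C + c) (p * J + j) = col_op (phase N t) (\<kappa> ! p) c j"
  using assms first[of p] last[of p] by (simp add: til.ops_def til_J col_op_def phase_def)

lemma lookup_range:
  "\<forall>x \<in> set \<Omega>. Suc (snd x) < 8 * d + 4 \<Longrightarrow> lookup_op \<Omega> c j \<noteq> Nop \<Longrightarrow> Suc j < J \<and> lookup_op \<Omega> c (Suc j) = Nop"
  using nth_mem[of c \<Omega>] by (auto simp: lookup_op_def J_def split: if_splits)

lemma ranges: "\<forall>x \<in> set (wI a). Suc (snd x) < 8 * d + 4" "\<forall>x \<in> set wH. Suc (snd x) < 8 * d + 4"
  "\<forall>x \<in> set wV. Suc (snd x) < 8 * d + 4" "\<forall>x \<in> set wF. Suc (snd x) < 8 * d + 4"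
  by (rule wI[of a, THEN conjunct1, unfolded init_ok_def, THEN conjunct1]
      wH[unfolded window_ok_def, THEN conjunct1] wV(1)[unfolded window_ok_def, THEN conjunct1]
      wF(1)[unfolded final_ok_def, THEN conjunct1])+

lemma lookup_Suc: "lookup_op \<Omega> c j \<noteq> Nop \<Longrightarrow> j' \<noteq> j \<Longrightarrow> lookup_op \<Omega> c j' = Nop"
  by (auto simp: lookup_op_def split: if_splits)

text \<open>A horizontal window covers \<open>4 * d + 2\<close> positions of its left column. Only
  its operation at relative position \<open>4 * d + 1\<close> acts across the border, while all
  other operations stay within a column.\<close>

lemma col_op_Suc:
  assumes "col_op ph a c j \<noteq> Nop" "j < J"
  shows "Suc j < J \<and> col_op ph a c (Suc j) = Nop \<or> Suc j = J \<and> a \<noteq> 7 \<and> ph = 1 \<and> c < length wH \<and> lookup_op wH c (4 * d + 1) \<noteq> Nop"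
proof (cases "ph = 1 \<and> c < length wH")
  case False
  then show ?thesis using assms lookup_range[OF ranges(1), of a "c - 1" j] lookup_range[OF ranges(3), of "c - length wH" j]
      lookup_range[OF ranges(4), of c j]
    by (auto simp: col_op_def op_table_def split: if_splits)
next
  case True
  show ?thesis
  proof (cases "4 * d + 2 \<le> j")
    case H: True
    then have a: "a \<noteq> 7" "lookup_op wH c (j - (4 * d + 2)) \<noteq> Nop" using assms True by (auto simp: col_op_def op_table_def split: if_splits)
    show ?thesis
    proof (cases "Suc j < J")
      case True': True
      have "lookup_op wH c (Suc j - (4 * d + 2)) = Nop" by (rule lookup_Suc[OF a(2)]) (use H in simp)
      then show ?thesis using True True' H a by (simp add: col_op_def op_table_def)
    next
      case False
      then have "j - (4 * d + 2) = 4 * d + 1" "Suc j = J" using assms(2) by (auto simp: J_def)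
      then show ?thesis using a True by simp
    qed
  next
    case H: False
    then have a: "a \<noteq> 1" "lookup_op wH c (j + (4 * d + 2)) \<noteq> Nop" using assms True by (auto simp: col_op_def op_table_def split: if_splits)
    have "Suc (j + (4 * d + 2)) < J" "lookup_op wH c (Suc (j + (4 * d + 2))) = Nop" using lookup_range[OF ranges(2) a(2)] by auto
    then show ?thesis using True H a by (simp add: col_op_def op_table_def J_def)
  qed
qed

lemma prev_op_eq:
  assumes "c < C" "p < n" "j < J" "0 < p * J + j"
  shows "til.ops (t * C + c) (p * J + j - 1) = prev_op (phase N t) (\<kappa> ! p) c j"
proof (cases j)
  case (Suc i)
  then show ?thesis using ops_eq[of c p i t] assms by (simp add: prev_op_def)
next
  case 0
  then obtain p' where p': "p = Suc p'" using assms by (cases p) auto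
  have q: "p * J + j - 1 = p' * J + (J - 1)" using p' 0 J_pos by simp
  have "til.ops (t * C + c) (p * J + j - 1) = col_op (phase N t) (\<kappa> ! p') c (J - 1)"
    unfolding q using assms p' J_pos by (intro ops_eq) auto
  moreover have "\<kappa> ! p \<noteq> 1" "\<kappa> ! p' \<noteq> 7" using first[of p] last[of p'] assms p' by auto
  moreover have "J - 1 - (4 * d + 2) = 4 * d + 1" "4 * d + 2 \<le> J - 1" by (auto simp: J_def)
  moreover have "lookup_op \<Omega> c' (J - 1) = Nop" if "\<forall>x \<in> set \<Omega>. Suc (snd x) < 8 * d + 4" for \<Omega> c'
    using lookup_range[OF that, of c' "J - 1"] J_pos by auto
  ultimately show ?thesis using 0 ranges(1)[of "\<kappa> ! p'"] ranges(2-4)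
    by (simp add: prev_op_def col_op_def op_table_def phase_def)
qed

lemma pos_less: "p < n \<Longrightarrow> j < J \<Longrightarrow> p * J + j < n * J"
proof -
  assume "p < n" "j < J"
  then have "Suc p * J \<le> n * J" by (intro mult_le_mono1) simp
  then show ?thesis using \<open>j < J\<close> by simp
qed

text \<open>From the least significant end: the start flag, the position in the column, the column,
  the round in the block, and the block. The first field is a bit and the next three are one-hot;
  the block number is a power of two, that is, a run of zeros and a final one. The numbers are
  exponentially large, but their codes have length linear in \<open>n\<close> and in the number of
  blocks.\<close>

definition time :: "nat \<Rightarrow> nat \<Rightarrow> nat \<Rightarrow> nat" where
  "time r i s = s + 2 * (2 ^ (i mod J) + 2 ^ J * (2 ^ (i div J) + 2 ^ n * (2 ^ (r mod C) + 2 ^ C * 2 ^ (r div C))))"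

definition rounds :: nat where "rounds = (N + 2) * C - 1"

sublocale rnd: interval_rounds "n * J" "rounds" til.ops time
proof
  show "0 < n * J" using n J_pos by (cases \<kappa>) auto
  show "0 < rounds" using C by (simp add: rounds_def)
next
  fix r q assume o: "til.ops r q \<noteq> Nop"
  define p j t c where pq: "p = q div J" "j = q mod J" "t = r div C" "c = r mod C"
  have q: "q = p * J + j" "r = t * C + c" "j < J" "c < C" using J_pos C by (auto simp: pq)
  have p: "p < n" using o by (auto simp: til.ops_def til_J pq split: if_splits)
  have "col_op (phase N t) (\<kappa> ! p) c j \<noteq> Nop" using o ops_eq[of c p j t] q p by simp
  from col_op_Suc[OF this q(3)] show "Suc q < n * J \<and> til.ops r (Suc q) = Nop"
  proof
    assume *: "Suc j < J \<and> col_op (phase N t) (\<kappa> ! p) c (Suc j) = Nop"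
    then show ?thesis using ops_eq[of c p "Suc j" t] pos_less[of p "Suc j"] q p by simp
  next
    assume *: "Suc j = J \<and> \<kappa> ! p \<noteq> 7 \<and> phase N t = 1 \<and> c < length wH \<and> lookup_op wH c (4 * d + 1) \<noteq> Nop"
    then have p': "Suc p < n" using last[OF p] p by auto
    have Sq: "Suc q = Suc p * J + 0" using q(1) * by simp
    have "til.ops r (Suc q) = col_op (phase N t) (\<kappa> ! Suc p) c 0"
      unfolding Sq q(2) using p' q J_pos by (intro ops_eq) auto
    also have "\<dots> = Nop" using * lookup_Suc[of wH c "4 * d + 1" "4 * d + 2"] by (simp add: col_op_def op_table_def)
    finally show ?thesis using Sq pos_less[OF p' J_pos] by simp
  qed
next
  fix q
  \<comment> \<open>The last round is the last one of block \<open>N + 1\<close>, beyond the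
    \<open>C - 1\<close> rounds of the final program, so it is idle.\<close>
  have M: "rounds = (N + 1) * C + (C - 1)" using C by (simp add: rounds_def)
  have "(rounds) div C = N + 1" "(rounds) mod C = C - 1" unfolding M using C by (simp_all only: col_div_mod diff_less pos2 zero_less_one less_le_trans)
  then show "til.ops (rounds) q = Nop" using wF(2) by (simp add: til.ops_def op_table_def lookup_op_def)
next
  fix r i s r' i' s' :: nat
  assume *: "r < r' \<or> r = r' \<and> (i < i' \<or> i = i' \<and> s < s')" and i: "i < n * J" "i' < n * J" "s \<le> 1" "s' \<le> 1"
  define A where "A r = 2 ^ (r mod C) + 2 ^ C * (2::nat) ^ (r div C)" for r
  define B where "B i u = (2::nat) ^ (i mod J) + 2 ^ J * (2 ^ (i div J) + 2 ^ n * u)" for i u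
  have A: "A r < A r'" if "r < r'"
    unfolding A_def by (rule pow_lex_less) (use C div_mod_less[OF that, of C] in auto)
  have dv: "i div J < n" using i J_pos by (simp add: less_mult_imp_div_less)
  have B: "B i u < B i' u'" if "u < u' \<or> u = u' \<and> i < i'" for u u'
    unfolding B_def
  proof (rule pow_lex_less)
    show "i mod J < J" using J_pos by simp
    have "2 ^ (i div J) + 2 ^ n * u < 2 ^ (i' div J) + 2 ^ n * u'" if "u < u' \<or> u = u' \<and> i div J < i' div J"
      by (rule pow_lex_less[OF dv that])
    then show "2 ^ (i div J) + 2 ^ n * u < 2 ^ (i' div J) + 2 ^ n * u' \<or>
      2 ^ (i div J) + 2 ^ n * u = 2 ^ (i' div J) + 2 ^ n * u' \<and> i mod J < i' mod J"
      using \<open>u < u' \<or> u = u' \<and> i < i'\<close> div_mod_less[of i i' J] by auto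
  qed
  have "B i (A r) < B i' (A r') \<or> B i (A r) = B i' (A r') \<and> s < s'"
    using * A B[of "A r" "A r'"] by auto
  then show "time r i s < time r' i' s'" using i unfolding time_def A_def[symmetric] B_def[symmetric] by auto
qed

lemma time_bits:
  assumes "i < n * J"
  shows "bits_of_nat (time r i (of_bool s)) =
    s # oh J (i mod J) @ oh n (i div J) @ oh C (r mod C) @ replicate (r div C) False @ [True]"
proof -
  have dv: "i div J < n" using assms J_pos by (simp add: less_mult_imp_div_less)
  have b1: "bits_of_nat 1 = [True]" by (simp add: bits_of_nat.simps)
  have m: "i mod J < J" "r mod C < C" using J_pos C by simp_all
  have "time r i (of_bool s) = 2 * (2 ^ (i mod J) + 2 ^ J * (2 ^ (i div J) + 2 ^ n * (2 ^ (r mod C) + 2 ^ C * (2 ^ (r div C) * 1)))) + of_bool s"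
    by (simp add: time_def)
  also have "bits_of_nat \<dots> = s # oh J (i mod J) @ oh n (i div J) @ oh C (r mod C) @ replicate (r div C) False @ bits_of_nat 1"
    by (subst bits_double, simp, subst bits_oh[OF _ m(1)], simp, subst bits_oh[OF _ dv], simp, subst bits_oh[OF _ m(2)], simp,
        subst bits_shift, simp, rule refl)
  finally show ?thesis unfolding b1 .
qed

lemma den_coord:
  assumes "p + \<delta> = Suc p'" "p' < n" "i < n * J" "i mod J = j" "i div J = (if fwd then p' else n - 1 - p')"
    "r div C = t + dt" "r mod C = c"
  shows "concat (map (den n p t) (coord dt c \<delta> fwd j s)) = enc_rat (of_nat (time r i (of_bool s)))"
proof -
  have m: "(p + n + \<delta>) mod Suc n = p'"
  proof -
    have "p + n + \<delta> = Suc n + p'" using assms(1) by simp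
    then show ?thesis using assms(2) by (simp only: mod_add_self1) simp
  qed
  have o: "(if fwd then id else rev) (oh n p') = oh n (i div J)" using assms(2,5) by (simp add: rev_oh)
  have dbl: "dbl (a @ b) = dbl a @ dbl b" "dbl (x # b) = True # x # dbl b" "dbl [] = []" for a b x by (auto simp: dbl_def)
  show ?thesis unfolding enc_rat_of_nat time_bits[OF assms(3)]
    using assms(4,6,7) by (simp add: coord_def m o dbl replicate_add add.commute[of t])
qed

lemma slot_rev: "p < n \<Longrightarrow> j < J \<Longrightarrow> n * J - 1 - (p * J + j) = (n - 1 - p) * J + (J - 1 - j)"
proof -
  assume p: "p < n" and j: "j < J"
  then obtain l where l: "n = Suc p + l" using less_iff_Suc_add by auto
  then show ?thesis using j by (simp add: algebra_simps)
qed

text \<open>Connects local and global coordinates of ends. Since \<open>C\<close> is even, the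
  parity of the round is that of \<open>c\<close>, and a target never lies farther away than in a
  neighbouring column.\<close>

lemma end_slot_eq:
  assumes t: "t < N + 2" "c < C" "p < n" "j < J" and e: "end_slot (phase N t) (\<kappa> ! p) c j = (\<delta>, fwd, j')"
  defines "i \<equiv> rnd.slot (Suc (t * C + c)) (rnd.endpos (t * C + c) (p * J + j))"
  shows "\<exists>p'. p + \<delta> = Suc p' \<and> p' < n \<and> i mod J = j' \<and> i div J = (if fwd then p' else n - 1 - p')"
proof (cases "t = 0 \<and> c = 0")
  case True
  then have "i = p * J + j" using pos_less[OF t(3,4)] by (simp add: i_def rnd.slot_def rnd.endpos_def)
  then show ?thesis using e True t by (intro exI[of _ p]) (auto simp: end_slot_def phase_def)
next
  case False
  let ?r = "t * C + c" and ?q = "p * J + j"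
  let ?a = "col_op (phase N t) (\<kappa> ! p) c j" and ?b = "prev_op (phase N t) (\<kappa> ! p) c j"
  have r: "?r \<noteq> 0" "odd ?r \<longleftrightarrow> odd c" using False C by auto
  have ph: "\<not> (phase N t = 0 \<and> c = 0)" using False by (auto simp: phase_def)
  define q' where "q' = rnd.endpos ?r ?q"
  have q'k: "q' < n * J" unfolding q'_def using pos_less[OF t(3,4)] by (rule rnd.endpos_less)
  define p' where "p' = q' div J"
  have p': "p' < n" using q'k J_pos by (simp add: p'_def less_mult_imp_div_less)
  have oa: "til.ops ?r ?q = ?a" using ops_eq t by simp
  have ob: "til.ops ?r (?q - 1) = ?b" if "0 < ?q" using prev_op_eq[OF t(2-4) that] .
  have b0: "?b = Nop" if "?q = 0" using that first[OF t(3)] J_pos by (simp add: prev_op_def)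
  have qe: "q' = (if ?a = Test \<or> ?a = Free \<and> even c then Suc ?q
      else if ?a = Nop \<and> (?b = Test \<or> ?b = Free \<and> odd c) then ?q - 1 else ?q)"
  proof (cases "?q = 0")
    case True
    show ?thesis unfolding q'_def rnd.endpos_def using r oa b0[OF True] True by (cases ?a) auto
  next
    case False
    then have "0 < ?q" by simp
    then show ?thesis unfolding q'_def rnd.endpos_def using r oa ob by (cases ?a; cases ?b) auto
  qed
  have tg: "p + fst (target (phase N t) (\<kappa> ! p) c j) = Suc p' \<and> snd (target (phase N t) (\<kappa> ! p) c j) = q' mod J"
  proof (cases "?a = Test \<or> ?a = Free \<and> even c")
    case True
    then have q: "q' = Suc ?q" using qe by simp
    show ?thesis
    proof (cases "Suc j < J")
      case True': True
      have "q' = p * J + Suc j" using q by simp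
      then show ?thesis using True True' unfolding p'_def by (simp only: col_div_mod) (simp add: target_def)
    next
      case False
      then have "q' = Suc p * J" using q t(4) by simp
      then show ?thesis using True False J_pos by (simp add: p'_def target_def)
    qed
  next
    case nT: False
    show ?thesis
    proof (cases "?a = Nop \<and> (?b = Test \<or> ?b = Free \<and> odd c)")
      case True
      then have q: "q' = ?q - 1" using qe by simp
      show ?thesis
      proof (cases "0 < j")
        case True': True
        then have "q' = p * J + (j - 1)" using q by simp
        moreover have "j - 1 < J" using t(4) by simp
        ultimately show ?thesis using True nT True' unfolding p'_def by (simp only: col_div_mod) (simp add: target_def)
      next
        case F: False
        moreover have "?q \<noteq> 0" using b0 True by (elim conjE disjE; metis opk.distinct)
        ultimately obtain p2 where p2: "p = Suc p2" by (cases p) auto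
        then have "q' = p2 * J + (J - 1)" using q F J_pos by simp
        moreover have "J - 1 < J" using J_pos by simp
        ultimately show ?thesis using True nT F p2 unfolding p'_def by (simp only: col_div_mod) (simp add: target_def)
      qed
    next
      case False
      have "q' = ?q" unfolding qe if_not_P[OF nT] if_not_P[OF False] ..
      moreover have "target (phase N t) (\<kappa> ! p) c j = (1, j)"
        unfolding target_def if_not_P[OF nT] if_not_P[OF False] ..
      ultimately show ?thesis using t(4) by (simp add: p'_def)
    qed
  qed
  have q': "q' = p' * J + q' mod J" by (simp add: p'_def)
  have jl: "q' mod J < J" using J_pos by simp
  have "i = (if odd c then q' else (n - 1 - p') * J + (J - 1 - q' mod J))"
    using slot_rev[OF p' jl] q' r(2) unfolding i_def q'_def[symmetric] rnd.slot_def by simp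
  moreover have "\<delta> = fst (target (phase N t) (\<kappa> ! p) c j)" "fwd = odd c" "j' = (if odd c then q' mod J else J - 1 - q' mod J)"
    using e ph tg by (auto simp: end_slot_def)
  moreover have "J - 1 - q' mod J < J" using J_pos by simp
  ultimately show ?thesis using tg p' unfolding p'_def[symmetric]
    by (intro exI[of _ p']) (simp add: col_div_mod p'_def[symmetric] del: add_diff_assoc)
qed

text \<open>The enumeration follows the loops of the generator: block, column, round in the block,
  position. Hence the code of the instance is literally the generated word.\<close>

definition pieces :: "(rat \<times> rat) list" where
  "pieces = map (\<lambda>(t, p, c, j). rnd.piece (t * C + c) (p * J + j))
     (List.product [0..<N + 2] (List.product [0..<n] (List.product [0..<C] [0..<J])))"

lemma round_le: "t < N + 2 \<Longrightarrow> c < C \<Longrightarrow> t * C + c \<le> rounds"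
proof -
  assume "t < N + 2" "c < C"
  then have "Suc t * C \<le> (N + 2) * C" by (intro mult_le_mono1) simp
  then show ?thesis using \<open>c < C\<close> by (simp add: rounds_def)
qed

lemma den_piece:
  assumes t: "t < N + 2" "c < C" "p < n" "j < J"
  shows "concat (map (den n p t) (piece_ems (phase N t) (\<kappa> ! p) c j)) =
    True # (case rnd.piece (t * C + c) (p * J + j) of (l, r) \<Rightarrow>
      enc_rat l @ enc_rat r @ [rnd.ori (interval_of (l, r)) = Right_going])"
proof -
  let ?r = "t * C + c" and ?q = "p * J + j"
  have q: "?q < n * J" using pos_less t by simp
  have ev: "even ?r \<longleftrightarrow> even c" using C by simp
  obtain \<delta> fwd j' where e: "end_slot (phase N t) (\<kappa> ! p) c j = (\<delta>, fwd, j')" by (metis prod_cases3)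
  let ?i = "rnd.slot (Suc ?r) (rnd.endpos ?r ?q)"
  have i: "?i < n * J" using q by (intro rnd.slot_less rnd.endpos_less)
  obtain p' where p': "p + \<delta> = Suc p'" "p' < n" "?i mod J = j'" "?i div J = (if fwd then p' else n - 1 - p')"
    using end_slot_eq[OF t e] by blast
  have s: "concat (map (den n p t) (coord 0 c 1 (even c) (if even c then j else J - 1 - j) True)) =
      enc_rat (of_nat (time ?r (rnd.slot ?r ?q) (of_bool True)))"
  proof (rule den_coord[where p' = p])
    show "rnd.slot ?r ?q < n * J" using q by (rule rnd.slot_less)
    show "rnd.slot ?r ?q mod J = (if even c then j else J - 1 - j)" "rnd.slot ?r ?q div J = (if even c then p else n - 1 - p)"
      unfolding rnd.slot_def ev slot_rev[OF t(3,4)] using t(4) J_pos by (simp_all add: col_div_mod del: add_diff_assoc)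
  qed (use t in auto)
  have n: "concat (map (den n p t) (coord (if Suc c < C then 0 else 1) (if Suc c < C then Suc c else 0) \<delta> fwd j' False)) =
      enc_rat (of_nat (time (Suc ?r) ?i (of_bool False)))"
  proof (rule den_coord[OF p'(1,2) i p'(3,4)])
    have *: "Suc ?r = (if Suc c < C then t * C + Suc c else Suc t * C + 0)" using t(2) by auto
    show "Suc ?r div C = t + (if Suc c < C then 0 else 1)" "Suc ?r mod C = (if Suc c < C then Suc c else 0)"
      unfolding * using C t(2) col_div_mod[of "Suc c" C t] col_div_mod[of 0 C "Suc t"] by simp_all
  qed
  have "rnd.ori (interval_of (rnd.piece ?r ?q)) = (if even c then Left_going else Right_going)"
    using rnd.ori_ivl[OF round_le[OF t(1,2)] q] ev by (simp add: rnd.ivl_def)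
  then have "(rnd.ori (interval_of (rnd.piece ?r ?q)) = Right_going) = odd c" by simp
  then show ?thesis using s n by (simp add: piece_ems_def e rnd.piece_def rnd.st_def rnd.en_def)
qed

lemma enc_pieces:
  "enc_instance pieces rnd.ori (n * J) =
     enc_nat (n * J) @ concat (map (\<lambda>t. colstr \<kappa> (ems (phase N t)) t) [0..<N + 2]) @ [False]"
proof -
  let ?e = "\<lambda>(l, r). enc_rat l @ enc_rat r @ [rnd.ori (interval_of (l, r)) = Right_going]"
  have "concat (map (\<lambda>x. True # ?e x) pieces) = concat (map (\<lambda>t. colstr \<kappa> (ems (phase N t)) t) [0..<N + 2])"
    unfolding pieces_def map_map comp_def concat_map_product prod.case
      colstr_def ems_def concat_map_concat
    by (intro arg_cong[of _ _ concat] map_cong refl) (simp only: set_upt atLeastLessThan_iff den_piece)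
  then show ?thesis by (simp add: enc_instance_def enc_list_def)
qed

lemma set_pieces: "set pieces = {rnd.piece r q | r q. r \<le> rounds \<and> q < n * J}"
proof
  show "set pieces \<subseteq> {rnd.piece r q | r q. r \<le> rounds \<and> q < n * J}"
  proof
    fix x assume "x \<in> set pieces"
    then obtain t p c j where x: "x = rnd.piece (t * C + c) (p * J + j)" and "t < N + 2" "p < n" "c < C" "j < J"
      unfolding pieces_def by (auto simp del: upt_Suc)
    then have "t * C + c \<le> rounds" "p * J + j < n * J" using round_le pos_less by simp_all
    then show "x \<in> {rnd.piece r q | r q. r \<le> rounds \<and> q < n * J}" unfolding x by blast
  qed
  show "{rnd.piece r q | r q. r \<le> rounds \<and> q < n * J} \<subseteq> set pieces"
  proof
    fix x assume "x \<in> {rnd.piece r q | r q. r \<le> rounds \<and> q < n * J}"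
    then obtain r q where x: "x = rnd.piece r q" and r: "r \<le> rounds" and q: "q < n * J" by blast
    have "r < (N + 2) * C" using r C by (simp add: rounds_def)
    then have "r div C < N + 2" by (simp add: less_mult_imp_div_less)
    moreover have "q div J < n" using q by (simp add: less_mult_imp_div_less)
    ultimately show "x \<in> set pieces" unfolding x pieces_def set_map
      using C J_pos by (intro image_eqI[of _ _ "(r div C, q div J, r mod C, q mod J)"]) auto
  qed
qed

lemma valid_pieces: "valid_intervals pieces"
proof -
  have "t = t' \<and> c = c' \<and> p = p' \<and> j = j'"
    if e: "rnd.piece (t * C + c) (p * J + j) = rnd.piece (t' * C + c') (p' * J + j')"
      and b: "t < N + 2" "c < C" "p < n" "j < J" "t' < N + 2" "c' < C" "p' < n" "j' < J" for t c p j t' c' p' j'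
  proof -
    have "rnd.ivl (t * C + c) (p * J + j) = rnd.ivl (t' * C + c') (p' * J + j')" using e by (simp add: rnd.ivl_def)
    then have *: "t * C + c = t' * C + c'" "p * J + j = p' * J + j'"
      using rnd.ivl_inj[OF round_le[OF b(1,2)] pos_less[OF b(3,4)] round_le[OF b(5,6)] pos_less[OF b(7,8)]] by auto
    have "t = t'" "c = c'" using arg_cong[OF *(1), of "\<lambda>x. x div C"] arg_cong[OF *(1), of "\<lambda>x. x mod C"] b by auto
    moreover have "p = p'" "j = j'" using arg_cong[OF *(2), of "\<lambda>x. x div J"] arg_cong[OF *(2), of "\<lambda>x. x mod J"] b by auto
    ultimately show ?thesis by simp
  qed
  then have "distinct pieces" unfolding pieces_def distinct_map
    by (intro conjI distinct_product distinct_upt inj_onI) (auto simp del: upt_Suc)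
  moreover have "l < r" if lr: "(l, r) \<in> set pieces" for l r
  proof -
    obtain s q where "(l, r) = rnd.piece s q" "s \<le> rounds" "q < n * J" using lr unfolding set_pieces by blast
    then show ?thesis using rnd.st_less_en[of s q] by (simp add: rnd.piece_def)
  qed
  ultimately show ?thesis by (auto simp: valid_intervals_def)
qed

theorem chromatic_iff_tiling:
  "chromatic_number (bidirectional_interval_graph (interval_of ` set pieces) rnd.ori) \<le> enat (n * J) \<longleftrightarrow>
    (\<exists>\<tau>. til.is_tiling N \<tau> \<and> (\<forall>p<n. Acc (\<tau> N p)))"
proof -
  have "interval_of ` set pieces = rnd.ivls" unfolding set_pieces rnd.ivls_def rnd.ivl_def image_Collect by blast
  then show ?thesis using rnd.chromatic_iff_rows til.rows_iff_tiling by (simp only: rounds_def diff_diff_eq one_add_one)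
qed

end


section \<open>Problems in NP as tilings, and the final assembly\<close>

lemma poly_nat_mono: "m \<le> n \<Longrightarrow> poly (p :: nat poly) m \<le> poly p n"
  by (induction p) (auto intro!: add_mono mult_mono)

lemma halted_steps:
  assumes "state ((step M ^^ s) c) = nstates M" "s \<le> t"
  shows "(step M ^^ t) c = (step M ^^ s) c"
proof -
  have "step M ((step M ^^ s) c) = (step M ^^ s) c" using assms(1) by (simp add: step_def[of M "(step M ^^ s) c"])
  with assms(2) show ?thesis by (induction t rule: dec_induct) simp_all
qed

lemma classes_clas: "classes T P x = clas T P (enc_word x)"
  by (simp add: classes_def clas_def cls_def[abs_def] enc_word_def dbl_def)

lemma NP_tiled:
  assumes "A \<in> class_NP"
  shows "\<exists>M pT pP. wf_tm M \<and> (\<forall>x. x \<in> A \<longleftrightarrow>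
    (\<exists>\<tau>. tiled M (classes (poly pT (length x)) (poly pP (length x)) x) (poly pT (length x)) \<tau>))"
proof -
  obtain V pP where V: "V \<in> class_P" and A: "\<And>x. x \<in> A \<longleftrightarrow> (\<exists>w. length w \<le> poly pP (length x) \<and> enc_word x @ w \<in> V)"
    using assms unfolding class_NP_def by blast
  obtain M pv where wf: "wf_tm M" and out: "\<And>w. outputs_within M w (poly pv (length w)) [w \<in> V]"
    using V unfolding class_P_def poly_time_def by blast
  \<comment> \<open>The running time of the verifier on words of length
    \<open>2 * length x + 1\<close> plus the maximal witness length; the summand 1 pays for the
    additional initial step.\<close>
  define pT where "pT = pcompose pv ([:1, 2:] + pP) + 1"
  have "x \<in> A \<longleftrightarrow> (\<exists>\<tau>. tiled M (classes (poly pT (length x)) (poly pP (length x)) x) (poly pT (length x)) \<tau>)" for x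
  proof -
    let ?T = "poly pT (length x)" and ?P = "poly pP (length x)" and ?y = "enc_word x"
    have T: "?T = Suc (poly pv (2 * length x + 1 + ?P))" by (simp add: pT_def poly_pcompose mult.commute)
    have ly: "length ?y = 2 * length x + 1" by (simp add: enc_word_def length_dbl[unfolded dbl_def])
    have run: "state ((step M ^^ (?T - 1)) (init_config (?y @ w))) = nstates M"
        "content ((step M ^^ (?T - 1)) (init_config (?y @ w))) 1 = word_tape [?y @ w \<in> V]" if w: "length w \<le> ?P" for w
    proof -
      let ?s = "poly pv (length (?y @ w))"
      have "?s \<le> ?T - 1" unfolding T diff_Suc_1 by (rule poly_nat_mono) (use w ly in simp)
      moreover have o: "state ((step M ^^ ?s) (init_config (?y @ w))) = nstates M"
        "content ((step M ^^ ?s) (init_config (?y @ w))) 1 = word_tape [?y @ w \<in> V]"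
        using out[of "?y @ w"] unfolding outputs_within_def Let_def by blast+
      ultimately have eq: "(step M ^^ (?T - 1)) (init_config (?y @ w)) = (step M ^^ ?s) (init_config (?y @ w))"
        by (intro halted_steps)
      show "state ((step M ^^ (?T - 1)) (init_config (?y @ w))) = nstates M"
        "content ((step M ^^ (?T - 1)) (init_config (?y @ w))) 1 = word_tape [?y @ w \<in> V]"
        unfolding eq by (rule o)+
    qed
    have T0: "0 < ?T" by (simp add: T)
    show ?thesis unfolding classes_clas
    proof
      assume "x \<in> A"
      then obtain w where w: "length w \<le> ?P" "?y @ w \<in> V" using A by blast
      show "\<exists>\<tau>. tiled M (clas ?T ?P ?y) ?T \<tau>"
      proof (rule tiled_complete[OF wf w(1) T0 run(1)[OF w(1)]])
        show "\<forall>z. content ((step M ^^ (?T - 1)) (init_config (?y @ w))) 1 z \<noteq> 1"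
          unfolding run(2)[OF w(1)] using w(2) by (simp add: word_tape_def)
      qed
    next
      assume "\<exists>\<tau>. tiled M (clas ?T ?P ?y) ?T \<tau>"
      then obtain \<tau> where "tiled M (clas ?T ?P ?y) ?T \<tau>" ..
      from tiled_sound[OF wf T0 this] obtain w where w: "length w \<le> ?P"
        "\<forall>z. 0 \<le> z \<and> z \<le> int (length ?y) \<longrightarrow> content ((step M ^^ (?T - 1)) (init_config (?y @ w))) 1 z \<noteq> 1" by blast
      \<comment> \<open>Cell 0 holds the single answer bit, and its symbol is known not to be
        1.\<close>
      have "word_tape [?y @ w \<in> V] 0 \<noteq> 1" using w(2)[rule_format, of 0] unfolding run(2)[OF w(1)] by simp
      then have "?y @ w \<in> V" by (auto simp: word_tape_def split: if_splits)
      then show "x \<in> A" using A w(1) by blast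
    qed
  qed
  then show ?thesis using wf by blast
qed

lemma pad_ok:
  "window_ok d \<phi> \<Omega> \<Longrightarrow> window_ok d \<phi> (\<Omega> @ replicate l (Nop, 0))"
  "init_ok d P \<Omega> \<Longrightarrow> init_ok d P (\<Omega> @ replicate l (Nop, 0))"
  "final_ok d P \<Omega> \<Longrightarrow> final_ok d P (\<Omega> @ replicate l (Nop, 0))"
  unfolding window_ok_def init_ok_def final_ok_def run_Nops by (simp_all add: ball_Un)

text \<open>The initial predicate depends on \<open>a\<close> only through \<open>min a b\<close>,
  so finitely many initial programs represent all classes and their lengths have a common bound.
  Idle operations pad all programs to the required lengths, and the block length is made even for
  the sake of the orientations.\<close>

lemma programs_exist:
  fixes Ini :: "nat \<Rightarrow> nat \<Rightarrow> bool"
  assumes d: "0 < d" and Ini: "\<And>a. Ini (min a b) = Ini a"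
  shows "\<exists>C wI wH wV wF. 2 \<le> C \<and> even C \<and> (\<forall>a. init_ok d (Ini a) (wI a) \<and> length (wI a) = C - 1) \<and>
    window_ok d (\<lambda>a b x y. x = a \<and> y = b \<and> H a b) wH \<and> window_ok d (\<lambda>a b x y. a = b \<and> x = y \<and> V a x) wV \<and>
    length wH + length wV = C \<and> final_ok d Acc wF \<and> length wF = C - 1"
proof -
  obtain uI where uI: "\<And>a. init_ok d (Ini a) (uI a)" 
    using choice[of "\<lambda>a \<Omega>. init_ok d (Ini a) \<Omega>"] init_ok_exists[OF d] by blast
  obtain uH where uH: "window_ok d (\<lambda>a b x y. x = a \<and> y = b \<and> H a b) uH" using window_ok_exists by blast
  obtain uV where uV: "window_ok d (\<lambda>a b x y. a = b \<and> x = y \<and> V a x) uV" using window_ok_exists by blast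
  obtain uF where uF: "final_ok d Acc uF" using final_ok_exists[OF d] by blast
  define L where "L = (\<Sum>a\<le>b. length (uI a)) + length uH + length uV + length uF"
  define C where "C = 2 * Suc L"
  have l: "length (uI (min a b)) \<le> L" for a
  proof -
    have "length (uI (min a b)) \<le> (\<Sum>a\<le>b. length (uI a))" by (rule member_le_sum) auto
    then show ?thesis by (simp add: L_def)
  qed
  define wI where "wI a = uI (min a b) @ replicate (C - 1 - length (uI (min a b))) (Nop, 0)" for a
  define wV where "wV = uV @ replicate (C - length uH - length uV) (Nop, 0)"
  define wF where "wF = uF @ replicate (C - 1 - length uF) (Nop, 0)"
  have "init_ok d (Ini a) (wI a) \<and> length (wI a) = C - 1" for a
  proof
    show "init_ok d (Ini a) (wI a)" using pad_ok(2)[OF uI[of "min a b"]] unfolding wI_def Ini .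
    show "length (wI a) = C - 1" using l[of a] by (simp add: wI_def C_def)
  qed
  moreover have "window_ok d (\<lambda>a b x y. a = b \<and> x = y \<and> V a x) wV" unfolding wV_def by (rule pad_ok(1)[OF uV])
  moreover have "final_ok d Acc wF" unfolding wF_def by (rule pad_ok(3)[OF uF])
  moreover have "length uH + length wV = C" "length wF = C - 1" "2 \<le> C" "even C"
    by (simp_all add: wV_def wF_def C_def L_def)
  ultimately show ?thesis using uH by (intro exI[of _ C] exI[of _ wI] exI[of _ uH] exI[of _ wV] exI[of _ wF]) blast
qed

lemma bidirectional_interval_graph_cong:
  "(\<And>u. u \<in> I \<Longrightarrow> ori u = ori' u) \<Longrightarrow> bidirectional_interval_graph I ori = bidirectional_interval_graph I ori'"
  unfolding bidirectional_interval_graph_def by (simp cong: conj_cong) 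

theorem theorem6:
  shows "NP_hard {enc_instance xs ori k | xs ori k.
           valid_intervals xs \<and> 0 < k \<and>
           chromatic_number (bidirectional_interval_graph (interval_of ` set xs) ori) \<le> enat k}"
    (is "NP_hard ?L")
  unfolding NP_hard_def
proof
  fix A assume "A \<in> class_NP"
  from NP_tiled[OF this] obtain M pT pP where
    A: "\<And>x. x \<in> A \<longleftrightarrow> (\<exists>\<tau>. tiled M (classes (poly pT (length x)) (poly pP (length x)) x) (poly pT (length x)) \<tau>)"
    by blast
  obtain ts where ts: "set ts = tiles M" using finite_list[OF finite_tiles] by blast
  \<comment> \<open>One index more than there are tiles, so that \<open>d\<close> is positive in any
    case. The tile at the additional index is unspecified; \<open>Ini\<close> for the first row and
    \<open>V\<close> for the later rows therefore demand members of \<open>tiles M\<close>.\<close>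
  define d where "d = Suc (length ts)"
  define H where "H i j \<longleftrightarrow> tH M (ts ! i) (ts ! j)" for i j
  define V where "V i j \<longleftrightarrow> ts ! j \<in> tiles M \<and> tV M (ts ! i) (ts ! j)" for i j
  define Ini where "Ini a i \<longleftrightarrow> ts ! i \<in> tiles M \<and> tIni M a (ts ! i)" for a i
  define Acc where "Acc i \<longleftrightarrow> tAcc M (ts ! i)" for i
  have d: "0 < d" by (simp add: d_def)
  have Ini8: "Ini (min a 8) = Ini a" for a by (rule ext) (auto simp: Ini_def tIni_def min_def)
  from programs_exist[where Ini = Ini and b = 8 and H = H and V = V and Acc = Acc, OF d Ini8] obtain C wI wH wV wF where
    prog: "2 \<le> C" "even C" "\<And>a. init_ok d (Ini a) (wI a) \<and> length (wI a) = C - 1"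
    "window_ok d (\<lambda>a b x y. x = a \<and> y = b \<and> H a b) wH" "window_ok d (\<lambda>a b x y. a = b \<and> x = y \<and> V a x) wV"
    "length wH + length wV = C" "final_ok d Acc wF" "length wF = C - 1"
    by (elim exE conjE) blast
  interpret op_programs d C wI wH wV wF .
  define \<kappa> where "\<kappa> x = classes (poly pT (length x)) (poly pP (length x)) x" for x
  define f where "f x = enc_nat (length (\<kappa> x) * J) @
     concat (map (\<lambda>t. colstr (\<kappa> x) (ems (phase (poly pT (length x)) t)) t) [0..<poly pT (length x) + 2]) @ [False]" for x
  have "poly_time f" unfolding f_def[abs_def] \<kappa>_def by (rule poly_time_gen) (rule ems_ok)
  moreover have "x \<in> A \<longleftrightarrow> f x \<in> ?L" for x
  proof -
    let ?N = "poly pT (length x)" and ?n = "length (\<kappa> x)"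
    have len: "?n = 2 * ?N + poly pP (length x) + length (enc_word x) + 3" by (simp add: \<kappa>_def classes_clas length_clas)
    interpret tiling_instance d C wI wH wV wF ?N "\<kappa> x" H V Ini Acc
    proof (unfold_locales)
      fix p assume p: "p < ?n"
      note nth = clas_nth[OF p[unfolded len]]
      show "\<kappa> x ! p = 1 \<longleftrightarrow> p = 0" "\<kappa> x ! p = 7 \<longleftrightarrow> p = ?n - 1"
        unfolding len unfolding \<kappa>_def classes_clas nth using p len by simp_all
    qed (use d prog len in simp_all)
    have fx: "f x = enc_instance pieces rnd.ori (?n * J)" unfolding f_def enc_pieces ..
    have "(\<exists>\<tau>. til.is_tiling ?N \<tau> \<and> (\<forall>p<?n. Acc (\<tau> ?N p))) \<longleftrightarrow> (\<exists>\<tau>. tiled M (\<kappa> x) ?N \<tau>)"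
    proof
      assume "\<exists>\<tau>. til.is_tiling ?N \<tau> \<and> (\<forall>p<?n. Acc (\<tau> ?N p))"
      then obtain \<tau> where \<tau>: "til.is_tiling ?N \<tau>" and acc: "\<And>p. p < ?n \<Longrightarrow> Acc (\<tau> ?N p)" by blast
      have "ts ! \<tau> t p \<in> tiles M" if "t \<le> ?N" "p < ?n" for t p
        using that \<tau> unfolding til.is_tiling_def by (cases t) (simp_all add: Ini_def V_def)
      then have "tiled M (\<kappa> x) ?N (\<lambda>t p. ts ! \<tau> t p)"
        using \<tau> acc unfolding til.is_tiling_def tiled_def by (simp add: Ini_def V_def H_def Acc_def)
      then show "\<exists>\<tau>. tiled M (\<kappa> x) ?N \<tau>" by blast
    next
      assume "\<exists>\<tau>. tiled M (\<kappa> x) ?N \<tau>"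
      then obtain \<tau> where \<tau>: "tiled M (\<kappa> x) ?N \<tau>" ..
      \<comment> \<open>Tiles are turned back into indices; a list may contain a tile repeatedly, so
        some index is chosen.\<close>
      define g where "g \<theta> = (SOME i. i < length ts \<and> ts ! i = \<theta>)" for \<theta>
      have "g \<theta> < length ts \<and> ts ! g \<theta> = \<theta>" if "\<theta> \<in> tiles M" for \<theta>
        unfolding g_def by (rule someI_ex) (use that ts in_set_conv_nth[of \<theta> ts] in blast)
      then have g: "ts ! g (\<tau> t p) = \<tau> t p" "g (\<tau> t p) < d" if "t \<le> ?N" "p < ?n" for t p
        using that \<tau> unfolding tiled_def d_def by (simp_all add: less_Suc_eq)
      have "til.is_tiling ?N (\<lambda>t p. g (\<tau> t p))" "\<forall>p<?n. Acc (g (\<tau> ?N p))"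
        using \<tau> unfolding til.is_tiling_def tiled_def by (simp_all add: g Ini_def V_def H_def Acc_def)
      then show "\<exists>\<tau>. til.is_tiling ?N \<tau> \<and> (\<forall>p<?n. Acc (\<tau> ?N p))" by blast
    qed
    then have xA: "x \<in> A \<longleftrightarrow> chromatic_number (bidirectional_interval_graph (interval_of ` set pieces) rnd.ori) \<le> enat (?n * J)"
      unfolding A \<kappa>_def[symmetric] chromatic_iff_tiling by simp
    show ?thesis
    proof
      assume "x \<in> A"
      then show "f x \<in> ?L" using xA fx valid_pieces rnd.k by blast
    next
      assume "f x \<in> ?L"
      then obtain xs ori k where e: "enc_instance pieces rnd.ori (?n * J) = enc_instance xs ori k"
        and chr: "chromatic_number (bidirectional_interval_graph (interval_of ` set xs) ori) \<le> enat k" unfolding fx by blast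
      \<comment> \<open>A code word determines the orientation only on the listed intervals, which
        is all that the graph depends on.\<close>
      from e have "?n * J = k" "pieces = xs" "\<forall>p \<in> set pieces. rnd.ori (interval_of p) = ori (interval_of p)"
        unfolding enc_instance_inject by blast+
      moreover from this have "bidirectional_interval_graph (interval_of ` set pieces) rnd.ori =
          bidirectional_interval_graph (interval_of ` set pieces) ori"
        by (intro bidirectional_interval_graph_cong) blast
      ultimately show "x \<in> A" using xA chr by simp
    qed
  qed
  ultimately show "poly_reducible A ?L" unfolding poly_reducible_def by blast
qed

end
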